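(* For all $r,d,\Delta\in\mathbb{N}$ there exists $C$ such that if $p\ge C\big(\tfrac{\log n}{n}\big)^{1/(2d)}$, then asymptotically almost surely the random graph $G(Cn,p)$ is $r$-partition universal for $\mathcal{H}(n,d,\Delta)$.
   Context: $G(N,p)$ is the binomial random graph on $N$ vertices with edge probability $p=p(n)$; asymptotically almost surely means with probability tending to $1$ as $n\to\infty$. Logarithms are to base $2$. The degeneracy of a graph is the least $\ell$ such that every induced subgraph has minimum degree at most $\ell$. $\mathcal{H}(n,d,\Delta)$ is the class of $n$-vertex graphs with maximum degree at most $\Delta$ and degeneracy at most $d$. A graph $G$ is $r$-partition universal for a class $\mathcal{H}$ if for every colouring of $E(G)$ with $r$ colours there is a colour class whose graph contains a copy of every $H\in\mathcal{H}$ as a subgraph. *)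

theory Defs
  imports "HOL-Probability.Probability" "HOL-Library.Ramsey"
begin

datatype 'a ugraph = UGraph (verts: "'a set") (edges: "'a set set")

definition simple_graph :: "'a ugraph \<Rightarrow> bool" where
  "simple_graph G \<longleftrightarrow> finite (verts G) \<and> edges G \<subseteq> nsets (verts G) 2"

definition degree :: "'a ugraph \<Rightarrow> 'a \<Rightarrow> nat" where
  "degree G v = card {e \<in> edges G. v \<in> e}"

text \<open>
  \<open>max_degree\<close> and \<open>min_degree\<close> are meaningful for finite nonempty vertex sets only.
\<close>

definition max_degree :: "'a ugraph \<Rightarrow> nat" where
  "max_degree G = Max (degree G ` verts G)"

definition min_degree :: "'a ugraph \<Rightarrow> nat" where
  "min_degree G = Min (degree G ` verts G)"

definition induced_subgraph :: "'a ugraph \<Rightarrow> 'a set \<Rightarrow> 'a ugraph" where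
  "induced_subgraph G U = UGraph U {e \<in> edges G. e \<subseteq> U}"

definition degeneracy :: "'a ugraph \<Rightarrow> nat" where
  "degeneracy G =
     (LEAST l. \<forall>U. U \<subseteq> verts G \<and> U \<noteq> {} \<longrightarrow> min_degree (induced_subgraph G U) \<le> l)"

text \<open>
  The class \<open>\<H>(n, d, \<Delta>)\<close>. Vertices are natural numbers, so every isomorphism type of
  finite graphs is represented.
\<close>

definition degenerate_class :: "nat \<Rightarrow> nat \<Rightarrow> nat \<Rightarrow> nat ugraph set" where
  "degenerate_class n d \<Delta> =
     {H. simple_graph H \<and> card (verts H) = n \<and> max_degree H \<le> \<Delta> \<and> degeneracy H \<le> d}"

text \<open>A copy is a not necessarily induced subgraph isomorphic to \<open>H\<close>.\<close>

definition contains_copy :: "'a ugraph \<Rightarrow> 'b ugraph \<Rightarrow> bool" where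
  "contains_copy G H \<longleftrightarrow>
     (\<exists>f. inj_on f (verts H) \<and> f ` verts H \<subseteq> verts G \<and> (\<forall>e\<in>edges H. f ` e \<in> edges G))"

definition partition_universal :: "nat \<Rightarrow> 'a ugraph \<Rightarrow> 'b ugraph set \<Rightarrow> bool" where
  "partition_universal r G \<H> \<longleftrightarrow>
     (\<forall>c \<in> edges G \<rightarrow> {..<r}. \<exists>i<r. \<forall>H\<in>\<H>.
        contains_copy (UGraph (verts G) {e \<in> edges G. c e = i}) H)"

text \<open>
  The binomial random graph on the vertex set \<open>{..<N}\<close>: each pair is an edge independently with
  probability \<open>p\<close>, which has to lie in the unit interval.
\<close>

definition random_graph :: "nat \<Rightarrow> real \<Rightarrow> nat ugraph pmf" where
  "random_graph N p =
     map_pmf (\<lambda>\<omega>. UGraph {..<N} {e \<in> nsets {..<N} 2. \<omega> e})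
       (Pi_pmf (nsets {..<N} 2) False (\<lambda>_. bernoulli_pmf p))"

end

theory Submission
  imports Defs
begin

text \<open>
  A random graph is jumbled and all its codegrees are of the right order, by Chernoff and union
  bounds. In any \<open>r\<close>-colouring of such a graph a density increment argument and Ramsey's theorem give
  disjoint large vertex sets, as many as needed to colour the square of \<open>H\<close> properly, whose pairs are
  all regular in one common colour.

  A pair regular in the sparse sense is, up to few exceptions, as good as a random one: a second
  moment computation, in which edges are replaced by edges of the host graph one at a time, shows that
  almost all tuples of vertices with the adjacency pattern of the host have the expected number of
  common neighbours in the colour class. Codegrees of sets of size \<open>2 d\<close> enter here, whence the exponent.

  Finally the vertices of \<open>H\<close> are embedded along a \<open>d\<close>-degenerate order. By averaging, the next vertex
  can be chosen so that the proportion of bad completions of each partially embedded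
  back-neighbourhood stays small, while an exponential potential keeps the used vertices spread out
  over all common neighbourhoods.
\<close>

section \<open>Jumbled graphs\<close>

text \<open>Regularity in the sparse sense says nothing about sets as small as common
  neighbourhoods, which have size about \<open>p ^ k * M\<close>, and there the embedding takes
  place. So regularity is never inherited by neighbourhoods. It serves to show that the tuples with
  too few common neighbours are a small proportion \<open>\<eta>\<close> of the tuples with the same
  host adjacencies; afterwards only this proportion is followed, by upper bounds in the host. These
  rest on jumbledness, which is effective for sets of size at least \<open>b\<close>, of order
  \<open>log N / p\<close> in the random graph. A new vertex may be adjacent to up to
  \<open>d\<close> members of a back-neighbourhood, one of which has up to \<open>d - 1\<close>
  other constraints; hence \<open>b\<close> must be small against
  \<open>p ^ (2 * d - 1) * N\<close>, that is, \<open>p ^ (2 * d) * N\<close> large against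
  \<open>log N\<close>. The same exponent appears in the joint neighbourhood of a test set and a
  back-neighbourhood, of size \<open>d\<close> each. Every proportion is affected by at most
  \<open>d + d * d\<close> steps, so \<open>\<eta>\<close> can be fixed in advance in terms of
  \<open>r\<close>, \<open>d\<close> and \<open>\<Delta>\<close>.\<close>

definition edge_count :: "('a \<Rightarrow> 'b \<Rightarrow> bool) \<Rightarrow> 'a set \<Rightarrow> 'b set \<Rightarrow> real" where
  "edge_count R A B = (\<Sum>a\<in>A. \<Sum>b\<in>B. of_bool (R a b))"

lemma sum_of_bool_card:
  "finite B \<Longrightarrow> (\<Sum>b\<in>B. of_bool (P b) :: real) = card {b\<in>B. P b}"
  by (simp add: Int_def)

lemma edge_count_card:
  "finite B \<Longrightarrow> edge_count R A B = (\<Sum>a\<in>A. real (card {b\<in>B. R a b}))"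
  by (simp add: edge_count_def Int_def)

lemma edge_count_nonneg [simp]: "0 \<le> edge_count R A B"
  by (simp add: edge_count_def sum_nonneg)

lemma edge_count_mono:
  assumes "finite A'" "finite B'" "A \<subseteq> A'" "B \<subseteq> B'" "\<And>a b. a \<in> A \<Longrightarrow> b \<in> B \<Longrightarrow> R a b \<Longrightarrow> S a b"
  shows "edge_count R A B \<le> edge_count S A' B'"
proof -
  have "edge_count R A B \<le> (\<Sum>a\<in>A. \<Sum>b\<in>B. of_bool (S a b))"
    unfolding edge_count_def using assms(5) by (intro sum_mono) auto
  also have "\<dots> \<le> (\<Sum>a\<in>A. \<Sum>b\<in>B'. of_bool (S a b))"
    using assms by (intro sum_mono sum_mono2) auto
  also have "\<dots> \<le> (\<Sum>a\<in>A'. \<Sum>b\<in>B'. of_bool (S a b))"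
    using assms by (intro sum_mono2) (auto intro!: sum_nonneg)
  finally show ?thesis by (simp add: edge_count_def)
qed

lemma edge_count_Diff_left:
  assumes "finite X" "A \<subseteq> X"
  shows "edge_count R (X - A) B = edge_count R X B - edge_count R A B"
  using assms by (simp add: edge_count_def sum_diff)

lemma edge_count_Diff_right:
  assumes "finite Y" "B \<subseteq> Y"
  shows "edge_count R A (Y - B) = edge_count R A Y - edge_count R A B"
  using assms by (simp add: edge_count_def sum_diff sum_subtractf del: sum_of_bool_eq)

lemma edge_count_swap: "edge_count R A B = edge_count (\<lambda>x y. R y x) B A"
  unfolding edge_count_def by (rule sum.swap)

lemma sum_sum_minus_const:
  fixes c :: real
  shows "finite A \<Longrightarrow> finite B \<Longrightarrow> (\<Sum>a\<in>A. \<Sum>b\<in>B. of_bool (R a b) - c) = edge_count R A B - c * card A * card B"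
  by (simp add: edge_count_def sum_subtractf algebra_simps)

text \<open>The maximum with \<open>b\<close> gives one inequality for all pairs: edges between
  smaller sets of a random graph are not concentrated well enough for a union bound, and such sets
  are charged as if they had size \<open>b\<close>. Codegree bounds are a separate assumption
  because common neighbourhoods of up to \<open>2 * d\<close> vertices may be smaller than
  \<open>b\<close>.\<close>

locale jumbled_graph =
  fixes E :: "nat \<Rightarrow> nat \<Rightarrow> bool" and N d :: nat and p b \<gamma> :: real
  assumes E_sym: "E x y \<Longrightarrow> E y x"
    and p_pos: "0 < p" and p_le1: "p \<le> 1"
    and \<gamma>_nonneg: "0 \<le> \<gamma>" and \<gamma>_le1: "\<gamma> \<le> 1" and b_ge1: "1 \<le> b"
    and jumbled: "A \<subseteq> {..<N} \<Longrightarrow> B \<subseteq> {..<N} \<Longrightarrow> A \<inter> B = {} \<Longrightarrow>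
       \<bar>edge_count E A B - p * card A * card B\<bar> \<le> \<gamma> * p * max (card A) b * max (card B) b"
    and common_nbrs: "T \<subseteq> {..<N} \<Longrightarrow> card T \<le> 2 * d \<Longrightarrow>
       real (card {y\<in>{..<N}. \<forall>t\<in>T. E t y}) \<le> 8 * p ^ card T * N"
begin

lemma finite_sub: "A \<subseteq> {..<N} \<Longrightarrow> finite A"
  using finite_subset by blast

lemma common_nbrs_sub:
  assumes "Y \<subseteq> {..<N}" "T \<subseteq> {..<N}" "card T \<le> 2 * d"
  shows "real (card {y\<in>Y. \<forall>t\<in>T. E t y}) \<le> 8 * p ^ card T * N"
proof -
  have "card {y\<in>Y. \<forall>t\<in>T. E t y} \<le> card {y\<in>{..<N}. \<forall>t\<in>T. E t y}"
    using assms by (intro card_mono) auto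
  then show ?thesis using common_nbrs[OF assms(2,3)] by linarith
qed

text \<open>The signs split \<open>B\<close> into two sets, and jumbledness applies to each; hence
  the factor 2. Signs arise when sums of absolute values are rewritten as signed sums.\<close>

lemma jumbled_signed:
  assumes "A \<subseteq> {..<N}" "B \<subseteq> {..<N}" "A \<inter> B = {}" "\<And>y. y \<in> B \<Longrightarrow> \<sigma> y = 1 \<or> \<sigma> y = (-1::real)"
  shows "\<bar>\<Sum>v\<in>A. \<Sum>y\<in>B. (of_bool (E v y) - p) * \<sigma> y\<bar> \<le> 2 * \<gamma> * p * max (card A) b * max (card B) b"
proof -
  define P where "P = {y\<in>B. \<sigma> y = 1}"
  have fin: "finite A" "finite B" using assms finite_sub by auto
  have PB: "P \<subseteq> B" by (auto simp: P_def)
  have *: "(\<Sum>y\<in>B. (of_bool (E v y) - p) * \<sigma> y) =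
      (\<Sum>y\<in>P. of_bool (E v y) - p) - (\<Sum>y\<in>B-P. of_bool (E v y) - p)" for v
  proof -
    have "(\<Sum>y\<in>B. (of_bool (E v y) - p) * \<sigma> y) = (\<Sum>y\<in>P. (of_bool (E v y) - p) * \<sigma> y) + (\<Sum>y\<in>B-P. (of_bool (E v y) - p) * \<sigma> y)"
      using sum.subset_diff[OF PB fin(2)] by (simp only: add.commute)
    also have "(\<Sum>y\<in>P. (of_bool (E v y) - p) * \<sigma> y) = (\<Sum>y\<in>P. of_bool (E v y) - p)"
      by (intro sum.cong) (auto simp: P_def)
    also have "(\<Sum>y\<in>B-P. (of_bool (E v y) - p) * \<sigma> y) = - (\<Sum>y\<in>B-P. of_bool (E v y) - p)"
    proof -
      have "(of_bool (E v y) - p) * \<sigma> y = - (of_bool (E v y) - p)" if "y \<in> B - P" for y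
      proof -
        have "\<sigma> y = -1" using assms(4)[of y] that by (auto simp: P_def)
        then show ?thesis by simp
      qed
      then show ?thesis unfolding sum_negf[symmetric] by (intro sum.cong) auto
    qed
    finally show ?thesis by simp
  qed
  have sub: "\<bar>\<Sum>v\<in>A. \<Sum>y\<in>Q. of_bool (E v y) - p\<bar> \<le> \<gamma> * p * max (card A) b * max (card B) b" if "Q \<subseteq> B" for Q
  proof -
    have "\<bar>\<Sum>v\<in>A. \<Sum>y\<in>Q. of_bool (E v y) - p\<bar> \<le> \<gamma> * p * max (card A) b * max (card Q) b"
    proof -
      have "Q \<subseteq> {..<N}" "A \<inter> Q = {}" using assms(2,3) that by auto
      from jumbled[OF assms(1) this] show ?thesis
        using fin(1) finite_subset[OF that fin(2)] by (simp only: sum_sum_minus_const)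
    qed
    also have "\<dots> \<le> \<gamma> * p * max (card A) b * max (card B) b"
      using p_pos \<gamma>_nonneg b_ge1 card_mono[OF fin(2) that]
      by (intro mult_left_mono) auto
    finally show ?thesis .
  qed
  show ?thesis
    unfolding * sum_subtractf[where A = A]
    using sub[OF PB] sub[of "B - P"] by (simp del: sum_of_bool_eq sum_subtractf)
qed

text \<open>More than \<open>b\<close> such vertices would form a set large enough for jumbledness
  to be effective, which allows at most \<open>(1 + \<gamma>) * p * card U * max (card D) b\<close>
  edges between it and \<open>D\<close>. The exceptional set is bounded by \<open>b\<close> even if
  \<open>D\<close> itself is smaller than \<open>b\<close>.\<close>

lemma card_large_nbrs_le:
  assumes "X \<subseteq> {..<N}" "D \<subseteq> {..<N}" "X \<inter> D = {}"
  shows "real (card {x\<in>X. real (card {y\<in>D. E x y}) > 2 * p * max (card D) b}) \<le> b"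
proof (rule ccontr)
  define U where "U = {x\<in>X. real (card {y\<in>D. E x y}) > 2 * p * max (card D) b}"
  assume "\<not> ?thesis"
  then have gt: "real (card U) > b" by (simp add: U_def)
  then have ne: "U \<noteq> {}" using b_ge1 by auto
  have UX: "U \<subseteq> X" by (auto simp: U_def)
  have finD: "finite D" using assms finite_sub by auto
  have finU: "finite U" using finite_subset[OF UX] assms finite_sub by auto
  define m where "m = max (real (card D)) b"
  have "(\<Sum>u\<in>U. 2 * p * m) < (\<Sum>u\<in>U. real (card {y\<in>D. E u y}))"
    using ne finU by (intro sum_strict_mono) (simp_all add: U_def m_def)
  then have 1: "real (card U) * (2 * p * m) < edge_count E U D"
    using finD by (simp add: edge_count_card)
  have m: "real (card D) \<le> m" "0 \<le> m" using b_ge1 by (auto simp: m_def)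
  have 2: "edge_count E U D \<le> p * card U * card D + \<gamma> * p * card U * m"
  proof -
    have "max (real (card U)) b = card U" using gt by simp
    moreover have "U \<subseteq> {..<N}" "U \<inter> D = {}" using UX assms by auto
    ultimately have "\<bar>edge_count E U D - p * card U * card D\<bar> \<le> \<gamma> * p * card U * m"
      using jumbled[of U D] assms(2) by (simp only: m_def)
    then show ?thesis by linarith
  qed
  have 3: "p * card U * card D \<le> p * card U * m"
    using p_pos m by (intro mult_left_mono) auto
  have 4: "\<gamma> * p * card U * m \<le> 1 * p * card U * m"
    using p_pos \<gamma>_le1 m by (intro mult_right_mono) auto
  show False using 1 2 3 4 by (simp add: algebra_simps)
qed

end

section \<open>Regular pairs\<close>

lemma sum_of_bool_mult:
  fixes f :: "'a \<Rightarrow> real"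
  shows "finite A \<Longrightarrow> (\<Sum>x\<in>A. of_bool (P x) * f x) = (\<Sum>x\<in>{x\<in>A. P x}. f x)"
  by (simp add: of_bool_def if_distrib[of "\<lambda>c. c * _"] sum.inter_filter cong: if_cong)

lemma sum_abs_split:
  fixes f :: "'a \<Rightarrow> real"
  assumes "finite A"
  shows "(\<Sum>x\<in>A. \<bar>f x\<bar>) = (\<Sum>x\<in>{x\<in>A. f x \<ge> 0}. f x) - (\<Sum>x\<in>{x\<in>A. \<not> f x \<ge> 0}. f x)"
proof -
  have "(\<Sum>x\<in>A. \<bar>f x\<bar>) = (\<Sum>x\<in>A. (if f x \<ge> 0 then f x else 0)) - (\<Sum>x\<in>A. (if \<not> f x \<ge> 0 then f x else 0))"
    unfolding sum_subtractf[symmetric] by (intro sum.cong) auto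
  then show ?thesis using assms by (simp only: sum.inter_filter)
qed

lemma Cauchy_Schwarz_weighted:
  fixes w h :: "'a \<Rightarrow> real"
  assumes "finite A" "\<And>x. x \<in> A \<Longrightarrow> 0 \<le> w x"
  shows "(\<Sum>x\<in>A. w x * \<bar>h x\<bar>)\<^sup>2 \<le> (\<Sum>x\<in>A. w x) * (\<Sum>x\<in>A. w x * (h x)\<^sup>2)"
proof -
  have "(\<Sum>x\<in>A. w x * \<bar>h x\<bar>) = (\<Sum>x\<in>A. sqrt (w x) * (sqrt (w x) * \<bar>h x\<bar>))"
    using assms by (intro sum.cong) (auto simp flip: mult.assoc)
  then have "(\<Sum>x\<in>A. w x * \<bar>h x\<bar>)\<^sup>2 \<le> (\<Sum>x\<in>A. (sqrt (w x))\<^sup>2) * (\<Sum>x\<in>A. (sqrt (w x) * \<bar>h x\<bar>)\<^sup>2)"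
    using Cauchy_Schwarz_ineq_sum by metis
  also have "\<dots> = (\<Sum>x\<in>A. w x) * (\<Sum>x\<in>A. w x * (h x)\<^sup>2)"
    using assms by (simp add: power_mult_distrib)
  finally show ?thesis .
qed

text \<open>\<open>\<alpha> * p\<close> approximates the density of the pair. The error is measured
  against the full pair, so almost nothing is claimed about small \<open>A\<close> and
  \<open>B\<close>. The ratio of \<open>N\<close> to the part size is controlled by
  \<open>z\<close>, and \<open>\<omega>\<close> puts typical degrees well above the cutoff
  \<open>b\<close>.\<close>

locale regular_pair = jumbled_graph +
  fixes G :: "nat \<Rightarrow> nat \<Rightarrow> bool" and X Y :: "nat set" and M :: nat and \<alpha> \<epsilon> z \<omega> :: real
  assumes X_sub: "X \<subseteq> {..<N}" and Y_sub: "Y \<subseteq> {..<N}" and XY: "X \<inter> Y = {}"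
    and card_X: "card X = M" and card_Y: "card Y = M"
    and G_sub: "v \<in> X \<Longrightarrow> y \<in> Y \<Longrightarrow> G v y \<Longrightarrow> E v y"
    and regular: "A \<subseteq> X \<Longrightarrow> B \<subseteq> Y \<Longrightarrow>
       \<bar>edge_count G A B - \<alpha> * p * card A * card B\<bar> \<le> \<epsilon> * p * real M ^ 2"
    and \<alpha>_nonneg: "0 \<le> \<alpha>" and \<alpha>_le2: "\<alpha> \<le> 2"
    and N_le: "real N \<le> z * M" and z_ge1: "1 \<le> z" and d_ge1: "1 \<le> d"
    and \<epsilon>_nonneg: "0 \<le> \<epsilon>"
    and \<omega>_nonneg: "0 \<le> \<omega>" and \<omega>_le1: "\<omega> \<le> 1" and b_le: "b \<le> \<omega> * p * M"
begin

definition F :: "nat \<Rightarrow> nat \<Rightarrow> real" where "F v y = of_bool (G v y) - \<alpha> * p"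

lemma fin: "finite X" "finite Y" using X_sub Y_sub finite_sub by auto

lemma pM_ge1: "1 \<le> p * M"
proof -
  have "\<omega> * (p * M) \<le> 1 * (p * M)" using \<omega>_le1 p_pos by (intro mult_right_mono) auto
  then show ?thesis using b_ge1 b_le by (simp add: mult.assoc)
qed

lemma b_le_M: "b \<le> \<omega> * M" "b \<le> M"
proof -
  have "\<omega> * M * p \<le> \<omega> * M * 1" using \<omega>_nonneg p_le1 by (intro mult_left_mono) auto
  then show 1: "b \<le> \<omega> * M" using b_le by (simp add: algebra_simps)
  have "\<omega> * real M \<le> 1 * real M" using \<omega>_le1 by (intro mult_right_mono) auto
  with 1 show "b \<le> M" by simp
qed

lemma M_ge1: "1 \<le> real M" using b_le_M b_ge1 by linarith

lemma deg_le:
  assumes "W \<subseteq> {..<N}" "y < N" shows "real (card {v\<in>W. E y v}) \<le> 8 * z * p * M"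
proof -
  have "real (card {v\<in>W. \<forall>t\<in>{y}. E t v}) \<le> 8 * p ^ card {y} * N"
    using assms d_ge1 by (intro common_nbrs_sub) auto
  then have "real (card {v\<in>W. E y v}) \<le> 8 * p * N" by simp
  also have "\<dots> \<le> 8 * p * (z * M)" using N_le p_pos by (intro mult_left_mono) auto
  finally show ?thesis by (simp add: algebra_simps)
qed

lemma codeg_le:
  assumes "W \<subseteq> {..<N}" "y < N" "y' < N" "y \<noteq> y'"
  shows "real (card {v\<in>W. E y v \<and> E y' v}) \<le> 8 * z * p^2 * M"
proof -
  have "real (card {v\<in>W. \<forall>t\<in>{y,y'}. E t v}) \<le> 8 * p ^ card {y,y'} * N"
    using assms d_ge1 by (intro common_nbrs_sub) auto
  then have "real (card {v\<in>W. E y v \<and> E y' v}) \<le> 8 * p^2 * N" using assms by (simp add: power2_eq_square)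
  also have "\<dots> \<le> 8 * p^2 * (z * M)" using N_le p_pos by (intro mult_left_mono) auto
  finally show ?thesis by (simp add: algebra_simps)
qed

lemma abs_F_le: "v \<in> X \<Longrightarrow> y \<in> Y \<Longrightarrow> \<bar>F v y\<bar> \<le> of_bool (E v y) + 2 * p"
proof -
  assume "v \<in> X" "y \<in> Y"
  then have "G v y \<Longrightarrow> E v y" using G_sub by blast
  moreover have "0 \<le> \<alpha> * p" "\<alpha> * p \<le> 2 * p" using \<alpha>_nonneg \<alpha>_le2 p_pos by auto
  ultimately show ?thesis by (cases "G v y"; cases "E v y") (auto simp: F_def)
qed

lemma sum_F: "A \<subseteq> X \<Longrightarrow> B \<subseteq> Y \<Longrightarrow> \<bar>\<Sum>v\<in>A. \<Sum>y\<in>B. F v y\<bar> \<le> \<epsilon> * p * real M ^ 2"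
  using regular[of A B] fin unfolding F_def
  by (subst sum_sum_minus_const) (auto intro: finite_subset)

text \<open>Regularity is applied to the set of all rows with nonnegative sum and to the set of all
  rows with negative sum.\<close>

lemma sum_abs_F:
  assumes "B \<subseteq> Y" shows "(\<Sum>v\<in>X. \<bar>\<Sum>y\<in>B. F v y\<bar>) \<le> 2 * \<epsilon> * p * real M ^ 2"
proof -
  define P where "P = {v\<in>X. (\<Sum>y\<in>B. F v y) \<ge> 0}"
  define Q where "Q = {v\<in>X. \<not> (\<Sum>y\<in>B. F v y) \<ge> 0}"
  have "(\<Sum>v\<in>X. \<bar>\<Sum>y\<in>B. F v y\<bar>) = (\<Sum>v\<in>P. \<Sum>y\<in>B. F v y) - (\<Sum>v\<in>Q. \<Sum>y\<in>B. F v y)"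
    unfolding P_def Q_def by (rule sum_abs_split[OF fin(1)])
  moreover have "P \<subseteq> X" "Q \<subseteq> X" by (auto simp: P_def Q_def)
  ultimately show ?thesis using sum_F[of P B] sum_F[of Q B] assms by linarith
qed

lemma sum_abs_F_signed:
  assumes "\<And>y. y \<in> Y \<Longrightarrow> \<sigma> y = 1 \<or> \<sigma> y = (-1::real)"
  shows "(\<Sum>v\<in>X. \<bar>\<Sum>y\<in>Y. F v y * \<sigma> y\<bar>) \<le> 4 * \<epsilon> * p * real M ^ 2"
proof -
  define P where "P = {y\<in>Y. \<sigma> y = 1}"
  have P: "P \<subseteq> Y" by (auto simp: P_def)
  have eq: "(\<Sum>y\<in>Y. F v y * \<sigma> y) = (\<Sum>y\<in>P. F v y) - (\<Sum>y\<in>Y-P. F v y)" for v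
  proof -
    have "(\<Sum>y\<in>Y. F v y * \<sigma> y) = (\<Sum>y\<in>Y-P. F v y * \<sigma> y) + (\<Sum>y\<in>P. F v y * \<sigma> y)"
      using sum.subset_diff[OF P fin(2)] .
    moreover have "(\<Sum>y\<in>P. F v y * \<sigma> y) = (\<Sum>y\<in>P. F v y)" by (intro sum.cong) (auto simp: P_def)
    moreover have "(\<Sum>y\<in>Y-P. F v y * \<sigma> y) = (\<Sum>y\<in>Y-P. - F v y)"
    proof (intro sum.cong refl)
      fix y assume "y \<in> Y - P"
      then have "\<sigma> y = -1" using assms[of y] by (auto simp: P_def)
      then show "F v y * \<sigma> y = - F v y" by simp
    qed
    ultimately show ?thesis by (simp add: sum_negf)
  qed
  have "(\<Sum>v\<in>X. \<bar>\<Sum>y\<in>Y. F v y * \<sigma> y\<bar>) \<le> (\<Sum>v\<in>X. \<bar>\<Sum>y\<in>P. F v y\<bar> + \<bar>\<Sum>y\<in>Y-P. F v y\<bar>)"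
    unfolding eq by (intro sum_mono) linarith
  also have "\<dots> \<le> 2 * \<epsilon> * p * real M ^ 2 + 2 * \<epsilon> * p * real M ^ 2"
    unfolding sum.distrib using sum_abs_F[OF P] sum_abs_F[of "Y - P"] by (intro add_mono) auto
  finally show ?thesis by simp
qed

text \<open>Outside the at most \<open>b\<close> rows of exceptional degree a row sum is at most
  \<open>4 * p * M\<close> in absolute value, so its square is at most \<open>4 * p * M\<close>
  times its absolute value and the first moment suffices. For the exceptional rows the crude bound
  \<open>deg_le\<close> is enough, since \<open>b \<le> \<omega> * M\<close>.\<close>

lemma sum_sq_F_signed:
  assumes \<sigma>: "\<And>y. y \<in> Y \<Longrightarrow> \<sigma> y = 1 \<or> \<sigma> y = (-1::real)"
  shows "(\<Sum>v\<in>X. (\<Sum>y\<in>Y. F v y * \<sigma> y)\<^sup>2) \<le> (16 * \<epsilon> + 100 * z\<^sup>2 * \<omega>) * p\<^sup>2 * real M ^ 3"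
proof -
  define t where "t v = \<bar>\<Sum>y\<in>Y. F v y * \<sigma> y\<bar>" for v
  define U where "U = {v\<in>X. real (card {y\<in>Y. E v y}) > 2 * p * max (card Y) b}"
  have U: "real (card U) \<le> b" unfolding U_def using card_large_nbrs_le[OF X_sub Y_sub XY] .
  have UX: "U \<subseteq> X" by (auto simp: U_def)
  have mx: "max (real (card Y)) b = M" using b_le_M card_Y by simp
  have t_le: "t v \<le> real (card {y\<in>Y. E v y}) + 2 * p * M" if "v \<in> X" for v
  proof -
    have "t v \<le> (\<Sum>y\<in>Y. \<bar>F v y * \<sigma> y\<bar>)" unfolding t_def by (rule sum_abs)
    also have "\<dots> \<le> (\<Sum>y\<in>Y. of_bool (E v y) + 2 * p)"
    proof (intro sum_mono)
      fix y assume y: "y \<in> Y"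
      have "\<bar>F v y * \<sigma> y\<bar> = \<bar>F v y\<bar>" using \<sigma>[OF y] by (auto simp: abs_mult)
      then show "\<bar>F v y * \<sigma> y\<bar> \<le> of_bool (E v y) + 2 * p" using abs_F_le[OF that y] by simp
    qed
    also have "\<dots> = real (card {y\<in>Y. E v y}) + 2 * p * M"
      using fin card_Y by (simp only: sum.distrib sum_of_bool_card sum_constant) (simp add: algebra_simps)
    finally show ?thesis .
  qed
  have t0: "0 \<le> t v" for v by (simp add: t_def)
  have sq: "(t v)\<^sup>2 \<le> 4 * p * M * t v + of_bool (v \<in> U) * (100 * z\<^sup>2 * p\<^sup>2 * real M ^ 2)" if v: "v \<in> X" for v
  proof (cases "v \<in> U")
    case True
    have "t v \<le> 8 * z * p * M + 2 * p * M" using t_le[OF v] deg_le[of Y v] Y_sub X_sub v by auto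
    moreover have "1 * (p * M) \<le> z * (p * M)" using z_ge1 p_pos by (intro mult_right_mono) auto
    ultimately have "t v \<le> 10 * z * p * M" by (simp add: algebra_simps)
    then have "(t v)\<^sup>2 \<le> (10 * z * p * M)\<^sup>2" using t0 by (intro power_mono) auto
    also have "\<dots> = 100 * z\<^sup>2 * p\<^sup>2 * real M ^ 2" by (simp add: power_mult_distrib)
    finally have "(t v)\<^sup>2 \<le> 100 * z\<^sup>2 * p\<^sup>2 * real M ^ 2" .
    moreover have "0 \<le> 4 * p * M * t v" using t0 p_pos by simp
    ultimately show ?thesis using True by simp
  next
    case False
    then have "real (card {y\<in>Y. E v y}) \<le> 2 * p * M" using v mx by (auto simp: U_def)
    then have "t v \<le> 4 * p * M" using t_le[OF v] by simp
    then have "t v * t v \<le> 4 * p * M * t v" using t0 by (intro mult_right_mono) auto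
    then show ?thesis using False by (simp add: power2_eq_square)
  qed
  have "(\<Sum>v\<in>X. (\<Sum>y\<in>Y. F v y * \<sigma> y)\<^sup>2) = (\<Sum>v\<in>X. (t v)\<^sup>2)" by (simp add: t_def)
  also have "\<dots> \<le> (\<Sum>v\<in>X. 4 * p * M * t v + of_bool (v \<in> U) * (100 * z\<^sup>2 * p\<^sup>2 * real M ^ 2))"
    using sq by (rule sum_mono)
  also have "\<dots> = 4 * p * M * (\<Sum>v\<in>X. t v) + real (card {v\<in>X. v \<in> U}) * (100 * z\<^sup>2 * p\<^sup>2 * real M ^ 2)"
    using fin by (simp only: sum.distrib sum_distrib_left[symmetric] sum_distrib_right[symmetric] sum_of_bool_card)
  also have "{v\<in>X. v \<in> U} = U" using UX by auto
  also have "4 * p * M * (\<Sum>v\<in>X. t v) + real (card U) * (100 * z\<^sup>2 * p\<^sup>2 * real M ^ 2)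
     \<le> 4 * p * M * (4 * \<epsilon> * p * real M ^ 2) + (\<omega> * M) * (100 * z\<^sup>2 * p\<^sup>2 * real M ^ 2)"
    using sum_abs_F_signed[OF \<sigma>] U b_le_M p_pos unfolding t_def
    by (intro add_mono mult_left_mono mult_right_mono) auto
  also have "\<dots> = (16 * \<epsilon> + 100 * z\<^sup>2 * \<omega>) * p\<^sup>2 * real M ^ 3"
    by (simp add: algebra_simps power2_eq_square power3_eq_cube)
  finally show ?thesis .
qed

end

section \<open>Signed codegrees of a regular pair\<close>

context regular_pair
begin

text \<open>Expanding \<open>F v y1 * F v y2\<close> leaves sums of the host deviation over four
  subsets of \<open>X\<close>: the common \<open>G\<close>-neighbourhood of \<open>y1\<close> and
  \<open>y2\<close>, the two single neighbourhoods and \<open>X\<close> itself. Jumbledness bounds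
  each, and \<open>b2\<close> keeps the cutoff below the size bound for the common neighbourhood.
  For \<open>y1 = y2\<close> the latter is a whole neighbourhood, larger by a factor
  \<open>1 / p\<close>; this is the second term.\<close>

lemma sum_E_FF:
  assumes b2: "b \<le> p\<^sup>2 * M" and y: "y1 \<in> Y" "y2 \<in> Y"
    and \<sigma>: "\<And>y. y \<in> Y \<Longrightarrow> \<sigma> y = 1 \<or> \<sigma> y = (-1::real)"
  shows "\<bar>\<Sum>v\<in>X. F v y1 * F v y2 * (\<Sum>y\<in>Y. (of_bool (E v y) - p) * \<sigma> y)\<bar>
    \<le> 88 * \<gamma> * z * p^3 * real M ^ 2 + of_bool (y1 = y2) * (88 * \<gamma> * z * p\<^sup>2 * real M ^ 2)"
proof -
  define Q where "Q v = (\<Sum>y\<in>Y. (of_bool (E v y) - p) * \<sigma> y)" for v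
  define c where "c = 2 * \<gamma> * p * M"
  define c2 where "c2 = (if y1 = y2 then 8 * z * p * M else 8 * z * p\<^sup>2 * M)"
  define A1 where "A1 = {v\<in>X. G v y1}"
  define A2 where "A2 = {v\<in>X. G v y2}"
  define A12 where "A12 = {v\<in>X. G v y1 \<and> G v y2}"
  have c0: "0 \<le> c" using \<gamma>_nonneg p_pos by (simp add: c_def)
  have mx: "max (real (card Y)) b = M" using b_le_M card_Y by simp
  have Q: "\<bar>\<Sum>v\<in>A. Q v\<bar> \<le> c * m" if "A \<subseteq> X" "real (card A) \<le> m" "b \<le> m" for A m
  proof -
    have "\<bar>\<Sum>v\<in>A. Q v\<bar> \<le> 2 * \<gamma> * p * max (card A) b * max (card Y) b"
      unfolding Q_def using that X_sub Y_sub XY \<sigma> by (intro jumbled_signed) auto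
    also have "\<dots> = c * max (card A) b" unfolding mx c_def by simp
    also have "\<dots> \<le> c * m" using that c0 by (intro mult_left_mono) auto
    finally show ?thesis .
  qed
  have yN: "y1 < N" "y2 < N" using y Y_sub by auto
  have z_M: "w \<le> z * w" if "0 \<le> w" for w using z_ge1 mult_right_mono[of 1 z w] that by simp
  have pM0: "0 \<le> p * M" "0 \<le> p\<^sup>2 * M" using p_pos by auto
  have z_pM: "p * M \<le> z * (p * M)" "p\<^sup>2 * M \<le> z * (p\<^sup>2 * M)" using z_M pM0 by blast+
  have "\<omega> * (p * M) \<le> 1 * (p * M)" using \<omega>_le1 pM0 by (intro mult_right_mono) auto
  then have b_le_pM: "b \<le> 8 * z * p * M" using b_le z_pM pM0 by (simp only: mult.assoc)
  have cG: "real (card {v\<in>X. G v y}) \<le> 8 * z * p * M" if "y \<in> Y" for y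
  proof -
    have "card {v\<in>X. G v y} \<le> card {v\<in>X. E y v}"
      using fin G_sub E_sym that by (intro card_mono) auto
    then show ?thesis using deg_le[of X y] X_sub Y_sub that by auto
  qed
  have cA1: "real (card A1) \<le> 8 * z * p * M" "real (card A2) \<le> 8 * z * p * M"
    using cG y by (auto simp: A1_def A2_def)
  have p2: "p\<^sup>2 * M \<le> p * M" using p_pos p_le1 by (simp add: power2_eq_square mult_left_le_one_le)
  have cA12: "real (card A12) \<le> c2" "b \<le> c2"
  proof -
    show "real (card A12) \<le> c2"
    proof (cases "y1 = y2")
      case True
      then have "A12 = A1" by (auto simp: A12_def A1_def)
      then show ?thesis using cA1 True by (simp add: c2_def)
    next
      case False
      have "card A12 \<le> card {v\<in>X. E y1 v \<and> E y2 v}"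
        unfolding A12_def using fin G_sub E_sym y by (intro card_mono) auto
      then show ?thesis using codeg_le[OF X_sub yN False] False by (simp add: c2_def)
    qed
    show "b \<le> c2"
    proof (cases "y1 = y2")
      case False
      then show ?thesis using b2 z_pM pM0 by (simp only: c2_def mult.assoc if_False)
    qed (use b_le_pM in \<open>simp add: c2_def\<close>)
  qed
  have FF: "F v y1 * F v y2 * Q v = of_bool (G v y1 \<and> G v y2) * Q v - \<alpha> * p * (of_bool (G v y1) * Q v)
      - \<alpha> * p * (of_bool (G v y2) * Q v) + (\<alpha> * p)\<^sup>2 * Q v" for v
    by (simp add: F_def algebra_simps power2_eq_square of_bool_conj)
  have eq: "(\<Sum>v\<in>X. F v y1 * F v y2 * Q v) =
     (\<Sum>v\<in>A12. Q v) - \<alpha> * p * (\<Sum>v\<in>A1. Q v) - \<alpha> * p * (\<Sum>v\<in>A2. Q v) + (\<alpha> * p)\<^sup>2 * (\<Sum>v\<in>X. Q v)"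
    using fin unfolding FF A12_def A1_def A2_def
    by (simp only: sum.distrib sum_subtractf sum_distrib_left[symmetric] sum_of_bool_mult)
  have sub: "A1 \<subseteq> X" "A2 \<subseteq> X" "A12 \<subseteq> X" by (auto simp: A1_def A2_def A12_def)
  have ap: "0 \<le> \<alpha> * p" "\<alpha> * p \<le> 2 * p" using \<alpha>_nonneg \<alpha>_le2 p_pos by auto
  have ap2: "(\<alpha> * p)\<^sup>2 \<le> 4 * p\<^sup>2" using power_mono[OF ap(2) ap(1), of 2] by (simp add: power_mult_distrib)
  have t1: "\<bar>\<alpha> * p * s\<bar> \<le> 2 * p * m" if "\<bar>s\<bar> \<le> m" for s m :: real
    using that ap by (simp add: abs_mult mult_mono)
  have t2: "\<bar>(\<alpha> * p)\<^sup>2 * s\<bar> \<le> 4 * p\<^sup>2 * m" if "\<bar>s\<bar> \<le> m" for s m :: real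
    using that ap2 by (simp add: abs_mult mult_mono)
  have "\<bar>\<Sum>v\<in>X. F v y1 * F v y2 * Q v\<bar> \<le>
      c * c2 + 2 * p * (c * (8 * z * p * M)) + 2 * p * (c * (8 * z * p * M)) + 4 * p\<^sup>2 * (c * M)"
    unfolding eq
    using Q[OF sub(3) cA12] t1[OF Q[OF sub(1) cA1(1) b_le_pM]] t1[OF Q[OF sub(2) cA1(2) b_le_pM]]
      t2[OF Q[OF subset_refl, of M]] b_le_M card_X by linarith
  also have "\<dots> = c * (c2 + 32 * z * (p\<^sup>2 * M) + 4 * (p\<^sup>2 * M))"
    by (simp add: algebra_simps power2_eq_square)
  also have "\<dots> \<le> c * (44 * z * (p\<^sup>2 * M) + of_bool (y1 = y2) * (44 * z * (p * M)))"
  proof (intro mult_left_mono c0)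
    show "c2 + 32 * z * (p\<^sup>2 * M) + 4 * (p\<^sup>2 * M) \<le> 44 * z * (p\<^sup>2 * M) + of_bool (y1 = y2) * (44 * z * (p * M))"
    proof (cases "y1 = y2")
      case True
      have "c2 + 32 * z * (p\<^sup>2 * M) + 4 * (p\<^sup>2 * M) \<le> 44 * (z * (p\<^sup>2 * M)) + 44 * (z * (p * M))"
        using z_pM pM0 True by (simp only: c2_def mult.assoc if_True simp_thms)
      then show ?thesis using True by (simp add: mult.assoc)
    next
      case False
      have "c2 + 32 * z * (p\<^sup>2 * M) + 4 * (p\<^sup>2 * M) \<le> 44 * (z * (p\<^sup>2 * M))"
        using z_pM pM0 False by (simp only: c2_def mult.assoc if_False)
      then show ?thesis using False by (simp add: mult.assoc)
    qed
  qed
  also have "\<dots> = 88 * \<gamma> * z * p^3 * real M ^ 2 + of_bool (y1 = y2) * (88 * \<gamma> * z * p\<^sup>2 * real M ^ 2)"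
    by (simp add: c_def algebra_simps power2_eq_square power3_eq_cube)
  finally show ?thesis by (simp add: Q_def)
qed

text \<open>The sum equals \<open>F\<close> paired with its signed transform \<open>H\<close>. Plain
  Cauchy-Schwarz would lose a factor of order \<open>p powr (- 1 / 2)\<close>, because
  \<open>F\<close> is large only on the sparse host while \<open>H\<close> would be summed over all
  pairs. So the majorant \<open>w\<close> of \<open>F\<close> is kept as a weight in both factors.
  In the second one \<open>w\<close> is the host deviation plus \<open>3 * p\<close>;
  \<open>sum_E_FF\<close> controls the former and \<open>sum_sq_F_signed\<close> the latter.\<close>

lemma sum_abs_codeg:
  assumes b2: "b \<le> p\<^sup>2 * M" and \<zeta>: "0 \<le> \<zeta>" "704 * \<gamma> * z + 192 * \<epsilon> + 1200 * z\<^sup>2 * \<omega> \<le> \<zeta>\<^sup>2"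
  shows "(\<Sum>y\<in>Y. \<Sum>y'\<in>Y. \<bar>\<Sum>v\<in>X. F v y * F v y'\<bar>) \<le> \<zeta> * p\<^sup>2 * real M ^ 3"
proof -
  define s where "s y y' = (if (\<Sum>v\<in>X. F v y * F v y') \<ge> 0 then 1 else -1 :: real)" for y y'
  define H where "H v y' = (\<Sum>y\<in>Y. F v y * s y y')" for v y'
  have s: "s y y' = 1 \<or> s y y' = -1" for y y' by (simp add: s_def)
  let ?S = "\<Sum>y\<in>Y. \<Sum>y'\<in>Y. \<bar>\<Sum>v\<in>X. F v y * F v y'\<bar>"
  have "?S = (\<Sum>y\<in>Y. \<Sum>y'\<in>Y. s y y' * (\<Sum>v\<in>X. F v y * F v y'))"
    by (intro sum.cong refl) (simp add: s_def)
  also have "\<dots> = (\<Sum>y\<in>Y. \<Sum>y'\<in>Y. \<Sum>v\<in>X. F v y' * (F v y * s y y'))"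
    unfolding sum_distrib_left by (intro sum.cong refl) simp
  also have "\<dots> = (\<Sum>y'\<in>Y. \<Sum>y\<in>Y. \<Sum>v\<in>X. F v y' * (F v y * s y y'))"
    by (rule sum.swap)
  also have "\<dots> = (\<Sum>y'\<in>Y. \<Sum>v\<in>X. \<Sum>y\<in>Y. F v y' * (F v y * s y y'))"
    by (rule sum.cong[OF refl], rule sum.swap)
  also have "\<dots> = (\<Sum>y'\<in>Y. \<Sum>v\<in>X. F v y' * H v y')"
    by (simp add: H_def sum_distrib_left)
  also have "\<dots> = (\<Sum>v\<in>X. \<Sum>y'\<in>Y. F v y' * H v y')" by (rule sum.swap)
  finally have S_eq: "?S = (\<Sum>v\<in>X. \<Sum>y'\<in>Y. F v y' * H v y')" .
  define w where "w vy = of_bool (E (fst vy) (snd vy)) + 2 * p" for vy :: "nat \<times> nat"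
  have w0: "0 \<le> w vy" for vy using p_pos by (simp add: w_def)
  have "?S \<le> (\<Sum>v\<in>X. \<Sum>y'\<in>Y. w (v, y') * \<bar>H v y'\<bar>)"
    unfolding S_eq
  proof (intro sum_mono)
    fix v y assume "v \<in> X" "y \<in> Y"
    then have "\<bar>F v y * H v y\<bar> \<le> w (v, y) * \<bar>H v y\<bar>"
      using abs_F_le[of v y] unfolding w_def fst_conv snd_conv abs_mult by (intro mult_right_mono) auto
    then show "F v y * H v y \<le> w (v, y) * \<bar>H v y\<bar>" by linarith
  qed
  also have "\<dots> = (\<Sum>vy\<in>X\<times>Y. w vy * \<bar>case_prod H vy\<bar>)"
    by (simp add: sum.cartesian_product split_def)
  finally have S_le: "?S \<le> (\<Sum>vy\<in>X\<times>Y. w vy * \<bar>case_prod H vy\<bar>)" .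
  have S0: "0 \<le> ?S" by (intro sum_nonneg) auto
  have "?S\<^sup>2 \<le> (\<Sum>vy\<in>X\<times>Y. w vy * \<bar>case_prod H vy\<bar>)\<^sup>2"
    using S_le S0 by (rule power_mono)
  also have "\<dots> \<le> (\<Sum>vy\<in>X\<times>Y. w vy) * (\<Sum>vy\<in>X\<times>Y. w vy * (case_prod H vy)\<^sup>2)"
    using fin w0 by (intro Cauchy_Schwarz_weighted) auto
  finally have S_sq: "?S\<^sup>2 \<le> (\<Sum>vy\<in>X\<times>Y. w vy) * (\<Sum>vy\<in>X\<times>Y. w vy * (case_prod H vy)\<^sup>2)" .
  have W1: "(\<Sum>vy\<in>X\<times>Y. w vy) \<le> 4 * p * real M ^ 2"
  proof -
    have "(\<Sum>vy\<in>X\<times>Y. w vy) = edge_count E X Y + 2 * p * M * M"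
      using card_X card_Y fin
      by (simp add: w_def sum.cartesian_product[symmetric, of "\<lambda>v y. of_bool (E v y) + 2 * p" for E, simplified] split_def
          sum.distrib edge_count_def sum.cartesian_product del: sum_of_bool_eq)
    also have "edge_count E X Y \<le> p * M * M + \<gamma> * p * M * M"
    proof -
      have "max (real M) b = M" using b_le_M by simp
      then have "\<bar>edge_count E X Y - p * M * M\<bar> \<le> \<gamma> * p * M * M"
        using jumbled[OF X_sub Y_sub XY] by (simp only: card_X card_Y)
      then show ?thesis by linarith
    qed
    also have "\<gamma> * p * M * M \<le> 1 * p * M * M" using \<gamma>_le1 p_pos by (intro mult_right_mono) auto
    finally show ?thesis by (simp add: algebra_simps power2_eq_square)
  qed
  have sq_H: "(\<Sum>v\<in>X. \<Sum>y'\<in>Y. (H v y')\<^sup>2) \<le> (16 * \<epsilon> + 100 * z\<^sup>2 * \<omega>) * p\<^sup>2 * real M ^ 4"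
  proof -
    have "(\<Sum>v\<in>X. \<Sum>y'\<in>Y. (H v y')\<^sup>2) = (\<Sum>y'\<in>Y. \<Sum>v\<in>X. (H v y')\<^sup>2)" by (rule sum.swap)
    also have "\<dots> \<le> (\<Sum>y'\<in>Y. (16 * \<epsilon> + 100 * z\<^sup>2 * \<omega>) * p\<^sup>2 * real M ^ 3)"
      unfolding H_def using s by (intro sum_mono sum_sq_F_signed) auto
    also have "\<dots> = (16 * \<epsilon> + 100 * z\<^sup>2 * \<omega>) * p\<^sup>2 * real M ^ 4"
      using card_Y by (simp add: power4_eq_xxxx power3_eq_cube)
    finally show ?thesis .
  qed
  \<comment> \<open>After squaring \<open>H\<close> and moving the sum over \<open>y'\<close>
    innermost, the coefficients are products of two signs, hence signs again, as
    \<open>sum_E_FF\<close> requires.\<close>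
  have E_H: "(\<Sum>v\<in>X. \<Sum>y'\<in>Y. (of_bool (E v y') - p) * (H v y')\<^sup>2) \<le> 176 * \<gamma> * z * p^3 * real M ^ 4"
  proof -
    have "(\<Sum>v\<in>X. \<Sum>y'\<in>Y. (of_bool (E v y') - p) * (H v y')\<^sup>2)
       = (\<Sum>v\<in>X. \<Sum>y'\<in>Y. \<Sum>y1\<in>Y. \<Sum>y2\<in>Y. F v y1 * F v y2 * ((of_bool (E v y') - p) * (s y1 y' * s y2 y')))"
      unfolding H_def power2_eq_square sum_product unfolding sum_distrib_left
      by (intro sum.cong refl) (simp only: mult_ac)
    also have "\<dots> = (\<Sum>v\<in>X. \<Sum>y1\<in>Y. \<Sum>y'\<in>Y. \<Sum>y2\<in>Y. F v y1 * F v y2 * ((of_bool (E v y') - p) * (s y1 y' * s y2 y')))"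
      by (rule sum.cong[OF refl], rule sum.swap)
    also have "\<dots> = (\<Sum>y1\<in>Y. \<Sum>v\<in>X. \<Sum>y2\<in>Y. \<Sum>y'\<in>Y. F v y1 * F v y2 * ((of_bool (E v y') - p) * (s y1 y' * s y2 y')))"
      by (subst sum.swap[of _ X Y], rule sum.cong[OF refl], rule sum.cong[OF refl], rule sum.swap)
    also have "\<dots> = (\<Sum>y1\<in>Y. \<Sum>y2\<in>Y. \<Sum>v\<in>X. \<Sum>y'\<in>Y. F v y1 * F v y2 * ((of_bool (E v y') - p) * (s y1 y' * s y2 y')))"
      by (rule sum.cong[OF refl], rule sum.swap)
    also have "\<dots> = (\<Sum>y1\<in>Y. \<Sum>y2\<in>Y. \<Sum>v\<in>X. F v y1 * F v y2 * (\<Sum>y'\<in>Y. (of_bool (E v y') - p) * (s y1 y' * s y2 y')))"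
      by (simp only: sum_distrib_left)
    also have "\<dots> \<le> (\<Sum>y1\<in>Y. \<Sum>y2\<in>Y. 88 * \<gamma> * z * p^3 * real M ^ 2 + of_bool (y1 = y2) * (88 * \<gamma> * z * p\<^sup>2 * real M ^ 2))"
    proof (intro sum_mono)
      fix y1 y2 assume y: "y1 \<in> Y" "y2 \<in> Y"
      have "s y1 y * s y2 y = 1 \<or> s y1 y * s y2 y = -1" for y by (simp add: s_def)
      from sum_E_FF[OF b2 y, of "\<lambda>y. s y1 y * s y2 y", OF this]
      show "(\<Sum>v\<in>X. F v y1 * F v y2 * (\<Sum>y'\<in>Y. (of_bool (E v y') - p) * (s y1 y' * s y2 y')))
        \<le> 88 * \<gamma> * z * p^3 * real M ^ 2 + of_bool (y1 = y2) * (88 * \<gamma> * z * p\<^sup>2 * real M ^ 2)" by linarith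
    qed
    also have "\<dots> = M * (M * (88 * \<gamma> * z * p^3 * real M ^ 2)) + M * (88 * \<gamma> * z * p\<^sup>2 * real M ^ 2)"
      using fin card_Y by (simp add: sum.distrib sum_distrib_right[symmetric] of_bool_def distrib_left del: sum_of_bool_eq)
    also have "\<dots> = 88 * \<gamma> * z * p^3 * real M ^ 4 + 88 * \<gamma> * z * p\<^sup>2 * real M ^ 3 * 1"
      by (simp add: power4_eq_xxxx power3_eq_cube power2_eq_square)
    \<comment> \<open>The diagonal lacks a factor \<open>p * M\<close>, which is at least 1.\<close>
    also have "\<dots> \<le> 88 * \<gamma> * z * p^3 * real M ^ 4 + 88 * \<gamma> * z * p\<^sup>2 * real M ^ 3 * (p * M)"
      using pM_ge1 \<gamma>_nonneg z_ge1 p_pos by (intro add_left_mono mult_left_mono) auto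
    also have "\<dots> = 176 * \<gamma> * z * p^3 * real M ^ 4"
      by (simp add: power4_eq_xxxx power3_eq_cube power2_eq_square)
    finally show ?thesis .
  qed
  have W2: "(\<Sum>vy\<in>X\<times>Y. w vy * (case_prod H vy)\<^sup>2) \<le> (176 * \<gamma> * z + 48 * \<epsilon> + 300 * z\<^sup>2 * \<omega>) * p^3 * real M ^ 4"
  proof -
    have "(\<Sum>vy\<in>X\<times>Y. w vy * (case_prod H vy)\<^sup>2) = (\<Sum>v\<in>X. \<Sum>y\<in>Y. w (v, y) * (H v y)\<^sup>2)"
      by (simp add: sum.cartesian_product split_def)
    also have "\<dots> = (\<Sum>v\<in>X. \<Sum>y\<in>Y. (of_bool (E v y) - p) * (H v y)\<^sup>2 + 3 * p * (H v y)\<^sup>2)"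
      by (intro sum.cong refl) (simp add: w_def algebra_simps)
    also have "\<dots> = (\<Sum>v\<in>X. \<Sum>y\<in>Y. (of_bool (E v y) - p) * (H v y)\<^sup>2) + 3 * p * (\<Sum>v\<in>X. \<Sum>y\<in>Y. (H v y)\<^sup>2)"
      by (simp only: sum.distrib sum_distrib_left)
    also have "\<dots> \<le> 176 * \<gamma> * z * p^3 * real M ^ 4 + 3 * p * ((16 * \<epsilon> + 100 * z\<^sup>2 * \<omega>) * p\<^sup>2 * real M ^ 4)"
      using E_H sq_H p_pos by (intro add_mono mult_left_mono) auto
    also have "\<dots> = (176 * \<gamma> * z + 48 * \<epsilon> + 300 * z\<^sup>2 * \<omega>) * p^3 * real M ^ 4"
      by (simp add: algebra_simps power3_eq_cube power2_eq_square)
    finally show ?thesis .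
  qed
  have "?S\<^sup>2 \<le> (4 * p * real M ^ 2) * ((176 * \<gamma> * z + 48 * \<epsilon> + 300 * z\<^sup>2 * \<omega>) * p^3 * real M ^ 4)"
  proof (rule order_trans[OF S_sq], rule mult_mono[OF W1 W2])
    show "0 \<le> 4 * p * real M ^ 2" using p_pos by simp
    show "0 \<le> (\<Sum>vy\<in>X\<times>Y. w vy * (case_prod H vy)\<^sup>2)" by (intro sum_nonneg mult_nonneg_nonneg w0) auto
  qed
  also have "\<dots> = (704 * \<gamma> * z + 192 * \<epsilon> + 1200 * z\<^sup>2 * \<omega>) * (p\<^sup>2 * real M ^ 3)\<^sup>2"
    by (simp add: algebra_simps power_mult_distrib flip: power_add power_mult power_Suc)
       (simp add: power3_eq_cube power2_eq_square power4_eq_xxxx eval_nat_numeral algebra_simps)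
  also have "\<dots> \<le> \<zeta>\<^sup>2 * (p\<^sup>2 * real M ^ 3)\<^sup>2" by (intro mult_right_mono \<zeta>) auto
  also have "\<dots> = (\<zeta> * p\<^sup>2 * real M ^ 3)\<^sup>2" by (simp add: power_mult_distrib mult.assoc)
  finally show ?thesis
    using \<zeta> p_pos by (elim power2_le_imp_le) auto
qed

end

section \<open>Second moment of common neighbourhoods\<close>

lemma sum_PiE_insert:
  assumes "j \<notin> S"
  shows "(\<Sum>\<phi>\<in>PiE (insert j S) V. f \<phi>) = (\<Sum>\<psi>\<in>PiE S V. \<Sum>v\<in>V j. f (\<psi>(j := v)))"
proof -
  have "(\<Sum>\<phi>\<in>PiE (insert j S) V. f \<phi>) = (\<Sum>x\<in>V j \<times> PiE S V. f ((snd x)(j := fst x)))"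
    unfolding PiE_insert_eq using inj_combinator[OF assms, of V]
    by (subst sum.reindex) (auto simp: split_def)
  also have "\<dots> = (\<Sum>v\<in>V j. \<Sum>\<psi>\<in>PiE S V. f (\<psi>(j := v)))"
    by (simp add: sum.cartesian_product split_def)
  also have "\<dots> = (\<Sum>\<psi>\<in>PiE S V. \<Sum>v\<in>V j. f (\<psi>(j := v)))" by (rule sum.swap)
  finally show ?thesis .
qed

lemma of_bool_Ball_prod: "finite S \<Longrightarrow> (of_bool (\<forall>i\<in>S. P i) :: real) = (\<Prod>i\<in>S. of_bool (P i))"
  by (induction S rule: finite_induct) auto

lemma sum_square_diff_const:
  fixes a b :: "'a \<Rightarrow> real" and c :: real
  shows "(\<Sum>x\<in>A. (a x + c * b x)\<^sup>2) \<le> 2 * (\<Sum>x\<in>A. (a x)\<^sup>2) + 2 * c\<^sup>2 * (\<Sum>x\<in>A. (b x)\<^sup>2)"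
proof -
  have "(a x + c * b x)\<^sup>2 \<le> 2 * (a x)\<^sup>2 + 2 * c\<^sup>2 * (b x)\<^sup>2" for x
  proof -
    have "2 * (a x)\<^sup>2 + 2 * c\<^sup>2 * (b x)\<^sup>2 - (a x + c * b x)\<^sup>2 = (a x - c * b x)\<^sup>2"
      by (simp add: power2_eq_square algebra_simps)
    then show ?thesis using zero_le_power2[of "a x - c * b x"] by linarith
  qed
  then have "(\<Sum>x\<in>A. (a x + c * b x)\<^sup>2) \<le> (\<Sum>x\<in>A. 2 * (a x)\<^sup>2 + 2 * c\<^sup>2 * (b x)\<^sup>2)" by (rule sum_mono)
  then show ?thesis by (simp add: sum.distrib sum_distrib_left)
qed

context regular_pair
begin

definition K :: "nat \<Rightarrow> nat \<Rightarrow> real" where "K y y' = (\<Sum>v\<in>X. F v y * F v y')"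

text \<open>A pointwise bound for the pairs to which the average in \<open>sum_abs_codeg\<close> is
  not applied: the diagonal and the pairs of atypical codegree.\<close>

lemma abs_K_le:
  assumes y: "y \<in> Y" "y' \<in> Y"
  shows "\<bar>K y y'\<bar> \<le> (if y = y' then 44 * z * p * M else 44 * z * p\<^sup>2 * M)"
proof -
  define c2 where "c2 = (if y = y' then 8 * z * p * M else 8 * z * p\<^sup>2 * M)"
  have yN: "y < N" "y' < N" using y Y_sub by auto
  have "\<bar>K y y'\<bar> \<le> (\<Sum>v\<in>X. \<bar>F v y * F v y'\<bar>)" unfolding K_def by (rule sum_abs)
  also have "\<dots> \<le> (\<Sum>v\<in>X. (of_bool (E y v) + 2 * p) * (of_bool (E y' v) + 2 * p))"
  proof (intro sum_mono)
    fix v assume v: "v \<in> X"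
    have "E v y = E y v" "E v y' = E y' v" using E_sym by blast+
    then show "\<bar>F v y * F v y'\<bar> \<le> (of_bool (E y v) + 2 * p) * (of_bool (E y' v) + 2 * p)"
      unfolding abs_mult using abs_F_le[OF v y(1)] abs_F_le[OF v y(2)] p_pos by (intro mult_mono) auto
  qed
  also have "\<dots> = (\<Sum>v\<in>X. of_bool (E y v \<and> E y' v) + 2 * p * of_bool (E y v) + 2 * p * of_bool (E y' v) + 4 * p\<^sup>2)"
    by (intro sum.cong refl) (simp add: of_bool_conj algebra_simps power2_eq_square)
  also have "\<dots> = real (card {v\<in>X. E y v \<and> E y' v}) + 2 * p * real (card {v\<in>X. E y v})
       + 2 * p * real (card {v\<in>X. E y' v}) + 4 * p\<^sup>2 * M"
    using fin(1) card_X by (simp only: sum.distrib sum_distrib_left[symmetric] sum_of_bool_card sum_constant) (simp add: mult_ac)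
  also have "\<dots> \<le> c2 + 2 * p * (8 * z * p * M) + 2 * p * (8 * z * p * M) + 4 * p\<^sup>2 * M"
  proof (intro add_mono mult_left_mono order_refl)
    show "real (card {v\<in>X. E y v \<and> E y' v}) \<le> c2"
    proof (cases "y = y'")
      case True
      then have "{v\<in>X. E y v \<and> E y' v} = {v\<in>X. E y v}" by auto
      then show ?thesis using deg_le[OF X_sub yN(1)] True by (simp only: c2_def if_True simp_thms)
    next
      case False
      then show ?thesis using codeg_le[OF X_sub yN] by (simp add: c2_def)
    qed
  qed (use p_pos deg_le X_sub yN in auto)
  also have "\<dots> \<le> (if y = y' then 44 * z * p * M else 44 * z * p\<^sup>2 * M)"
  proof -
    have pM0: "0 \<le> p * M" "0 \<le> p\<^sup>2 * M" using p_pos by auto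
    have z_pM: "1 * (p\<^sup>2 * M) \<le> z * (p\<^sup>2 * M)" using z_ge1 pM0 by (intro mult_right_mono) auto
    have "p\<^sup>2 * M \<le> p * M" using p_pos p_le1 by (simp add: power2_eq_square mult_left_le_one_le)
    then have zp: "z * (p\<^sup>2 * M) \<le> z * (p * M)" using z_ge1 by (intro mult_left_mono) auto
    have e: "2 * p * (8 * z * p * M) = 16 * (z * (p\<^sup>2 * M))" by (simp add: power2_eq_square)
    show ?thesis
    proof (cases "y = y'")
      case True
      have "8 * (z * (p * M)) + 16 * (z * (p\<^sup>2 * M)) + 16 * (z * (p\<^sup>2 * M)) + 4 * (p\<^sup>2 * M) \<le> 44 * (z * (p * M))"
        using zp z_pM by linarith
      then show ?thesis using True unfolding e c2_def by (simp only: mult.assoc if_True simp_thms)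
    next
      case False
      have "8 * (z * (p\<^sup>2 * M)) + 16 * (z * (p\<^sup>2 * M)) + 16 * (z * (p\<^sup>2 * M)) + 4 * (p\<^sup>2 * M) \<le> 44 * (z * (p\<^sup>2 * M))"
        using zp z_pM by linarith
      then show ?thesis using False unfolding e c2_def by (simp only: mult.assoc if_False)
    qed
  qed
  finally show ?thesis .
qed

text \<open>\<open>card_large_nbrs_le\<close> is used twice. At most \<open>b\<close> vertices
  \<open>y\<close> have too many neighbours in \<open>X\<close>; for every other \<open>y\<close> at
  most \<open>b\<close> vertices \<open>y'\<close> have too many neighbours inside the neighbourhood
  of \<open>y\<close>. The two thresholds \<open>2 * p\<close> multiply to
  \<open>4 * p^2\<close>.\<close>

lemma atypical_pairs_le:
  "(\<Sum>y\<in>Y. \<Sum>y'\<in>Y. of_bool (real (card {v\<in>X. E y v \<and> E y' v}) > 4 * p\<^sup>2 * M)) \<le> 2 * b * M"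
proof -
  define U where "U = {y\<in>Y. real (card {v\<in>X. E y v}) > 2 * p * max (card X) b}"
  have U: "real (card U) \<le> b" unfolding U_def using card_large_nbrs_le[OF Y_sub X_sub] XY by auto
  have mx: "max (real (card X)) b = M" using b_le_M card_X by simp
  have b_pM: "b \<le> 2 * p * M"
  proof -
    have "\<omega> * (p * M) \<le> 1 * (p * M)" using \<omega>_le1 p_pos by (intro mult_right_mono) auto
    moreover have "0 \<le> p * M" using p_pos by simp
    ultimately show ?thesis using b_le by (simp only: mult.assoc)
  qed
  have row: "(\<Sum>y'\<in>Y. of_bool (real (card {v\<in>X. E y v \<and> E y' v}) > 4 * p\<^sup>2 * M)) \<le> of_bool (y \<in> U) * real M + b"
    if y: "y \<in> Y" for y
  proof (cases "y \<in> U")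
    case True
    have "(\<Sum>y'\<in>Y. of_bool (real (card {v\<in>X. E y v \<and> E y' v}) > 4 * p\<^sup>2 * M)) \<le> (\<Sum>y'\<in>Y. 1::real)"
      by (intro sum_mono) auto
    then show ?thesis using True card_Y b_ge1 by simp
  next
    case False
    define D where "D = {v\<in>X. E y v}"
    have DX: "D \<subseteq> X" by (auto simp: D_def)
    have D: "max (real (card D)) b \<le> 2 * p * M" using False y mx b_pM by (auto simp: U_def D_def)
    have "(\<Sum>y'\<in>Y. of_bool (real (card {v\<in>X. E y v \<and> E y' v}) > 4 * p\<^sup>2 * M))
       = real (card {y'\<in>Y. real (card {v\<in>X. E y v \<and> E y' v}) > 4 * p\<^sup>2 * M})"
      by (rule sum_of_bool_card[OF fin(2)])
    also have "\<dots> \<le> real (card {y'\<in>Y. real (card {v\<in>D. E y' v}) > 2 * p * max (card D) b})"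
    proof -
      have "2 * p * max (real (card D)) b \<le> 4 * p\<^sup>2 * M"
        using mult_left_mono[OF D, of "2 * p"] p_pos by (simp add: power2_eq_square mult_ac)
      moreover have "{v\<in>X. E y v \<and> E y' v} = {v\<in>D. E y' v}" for y' by (auto simp: D_def)
      ultimately have "{y'\<in>Y. real (card {v\<in>X. E y v \<and> E y' v}) > 4 * p\<^sup>2 * M}
         \<subseteq> {y'\<in>Y. real (card {v\<in>D. E y' v}) > 2 * p * max (card D) b}"
        by (simp only: Collect_mono_iff) (blast intro: le_less_trans)
      then show ?thesis using fin by (intro of_nat_mono card_mono) auto
    qed
    also have "\<dots> \<le> b" using card_large_nbrs_le[of Y D] Y_sub DX X_sub XY by blast
    finally show ?thesis using False by simp
  qed
  have "(\<Sum>y\<in>Y. \<Sum>y'\<in>Y. of_bool (real (card {v\<in>X. E y v \<and> E y' v}) > 4 * p\<^sup>2 * M))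
    \<le> (\<Sum>y\<in>Y. of_bool (y \<in> U) * real M + b)" using row by (rule sum_mono)
  also have "\<dots> = real (card {y\<in>Y. y \<in> U}) * M + M * b"
    using fin card_Y by (simp only: sum.distrib sum_distrib_right[symmetric] sum_of_bool_card sum_constant)
  also have "{y\<in>Y. y \<in> U} = U" by (auto simp: U_def)
  also have "real (card U) * M + M * b \<le> b * M + M * b" using U by (intro add_right_mono mult_right_mono) auto
  finally show ?thesis by simp
qed

end

text \<open>\<open>I\<close> stands for a back-neighbourhood, \<open>V i\<close> for the part of its
  member \<open>i\<close>, and \<open>Y\<close> for the part of the vertex whose candidates are
  counted. The last assumption ties \<open>\<zeta>\<close> to the other errors as
  \<open>sum_abs_codeg\<close> demands.\<close>

locale tuple_host = jumbled_graph +
  fixes G :: "nat \<Rightarrow> nat \<Rightarrow> bool" and I :: "nat set" and V :: "nat \<Rightarrow> nat set" and Y :: "nat set" and M :: nat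
    and \<alpha> :: "nat \<Rightarrow> real" and \<epsilon> z \<omega> \<zeta> :: real
  assumes finite_I: "finite I" and card_I: "card I \<le> d"
    and V_sub: "i \<in> I \<Longrightarrow> V i \<subseteq> {..<N}" and Y_sub: "Y \<subseteq> {..<N}"
    and VV: "i \<in> I \<Longrightarrow> j \<in> I \<Longrightarrow> i \<noteq> j \<Longrightarrow> V i \<inter> V j = {}" and VY: "i \<in> I \<Longrightarrow> V i \<inter> Y = {}"
    and card_V: "i \<in> I \<Longrightarrow> card (V i) = M" and card_Y: "card Y = M"
    and G_sub: "i \<in> I \<Longrightarrow> v \<in> V i \<Longrightarrow> y \<in> Y \<Longrightarrow> G v y \<Longrightarrow> E v y"
    and regular: "i \<in> I \<Longrightarrow> A \<subseteq> V i \<Longrightarrow> B \<subseteq> Y \<Longrightarrow>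
       \<bar>edge_count G A B - \<alpha> i * p * card A * card B\<bar> \<le> \<epsilon> * p * real M ^ 2"
    and \<alpha>_nonneg: "i \<in> I \<Longrightarrow> 0 \<le> \<alpha> i" and \<alpha>_le2: "i \<in> I \<Longrightarrow> \<alpha> i \<le> 2"
    and N_le: "real N \<le> z * M" and z_ge1: "1 \<le> z" and d_ge1: "1 \<le> d"
    and \<epsilon>_nonneg: "0 \<le> \<epsilon>"
    and \<omega>_nonneg: "0 \<le> \<omega>" and \<omega>_le1: "\<omega> \<le> 1" and b_le: "b \<le> \<omega> * p ^ (2 * d - 1) * M"
    and \<zeta>: "0 \<le> \<zeta>" "704 * \<gamma> * z + 192 * \<epsilon> + 1200 * z\<^sup>2 * \<omega> \<le> \<zeta>\<^sup>2"
begin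

lemma b_le_pow: "k \<le> 2 * d - 1 \<Longrightarrow> b \<le> \<omega> * (p ^ k * M)"
proof -
  assume "k \<le> 2 * d - 1"
  then have "p ^ (2 * d - 1) \<le> p ^ k" using p_pos p_le1 by (intro power_decreasing) auto
  then have "\<omega> * (p ^ (2 * d - 1) * M) \<le> \<omega> * (p ^ k * M)"
    using \<omega>_nonneg by (intro mult_left_mono mult_right_mono) auto
  then show ?thesis using b_le by (simp add: mult.assoc)
qed

lemma pair: "i \<in> I \<Longrightarrow> regular_pair E N d p b \<gamma> G (V i) Y M (\<alpha> i) \<epsilon> z \<omega>"
proof unfold_locales
  show "b \<le> \<omega> * p * M" using b_le_pow[of 1] d_ge1 by (simp add: mult.assoc)
qed (use V_sub Y_sub VY card_V card_Y G_sub regular \<alpha>_nonneg \<alpha>_le2 N_le z_ge1 d_ge1 \<epsilon>_nonneg \<omega>_nonneg \<omega>_le1 in auto)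

lemma finite_VY: "i \<in> I \<Longrightarrow> finite (V i)" "finite Y"
  using V_sub Y_sub finite_sub by blast+

definition joint :: "nat set \<Rightarrow> (nat \<Rightarrow> nat) \<Rightarrow> nat \<Rightarrow> real" where
  "joint S \<phi> y = of_bool (\<forall>i\<in>S. G (\<phi> i) y)"

definition F :: "nat \<Rightarrow> nat \<Rightarrow> nat \<Rightarrow> real" where "F j v y = of_bool (G v y) - \<alpha> j * p"

text \<open>The first two summands bound the case of empty \<open>S\<close>, the third the typical
  pairs; in the last one \<open>2 * d\<close> stands for the atypical pairs and 1 for the
  diagonal.\<close>

definition err :: real where
  "err = 16 * \<epsilon> + 100 * z\<^sup>2 * \<omega> + 4 ^ d * \<zeta> + (2 * d + 1) * \<omega> * (8 * z) ^ d * (44 * z)"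

lemma err_nonneg: "0 \<le> err"
  using \<epsilon>_nonneg \<omega>_nonneg z_ge1 \<zeta> by (simp add: err_def)

text \<open>After squaring, the sum over tuples factors into codegrees \<open>C y y'\<close>, and
  the sum over \<open>v\<close> is the signed codegree \<open>K y y'\<close>. Where all codegrees
  are typical, \<open>C\<close> is at most \<open>(4 * p^2 * M) ^ s\<close> and the smallness comes
  from \<open>sum_abs_codeg\<close>; the remaining pairs are few. As \<open>j\<close> is outside
  \<open>S\<close>, a nonempty \<open>S\<close> forces \<open>2 \<le> d\<close>, which yields the
  condition \<open>b \<le> p^2 * M\<close> of that lemma.\<close>

lemma sum_sq_joint_F_nonempty:
  assumes S: "S \<subseteq> I" and j: "j \<in> I" "j \<notin> S" and ne: "S \<noteq> {}"
  shows "(\<Sum>\<phi>\<in>PiE S V. \<Sum>v\<in>V j. (\<Sum>y\<in>Y. joint S \<phi> y * F j v y)\<^sup>2)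
     \<le> (4 ^ d * \<zeta> + (2 * d + 1) * \<omega> * (8 * z) ^ d * (44 * z)) * p ^ (2 * card S + 2) * real M ^ (card S + 3)"
proof -
  interpret j: regular_pair E N d p b \<gamma> G "V j" Y M "\<alpha> j" \<epsilon> z \<omega> using pair j by blast
  have finS: "finite S" using S finite_I finite_subset by blast
  define s where "s = card S"
  have s1: "s + 1 \<le> d"
  proof -
    have "card (insert j S) \<le> card I" using S j finite_I by (intro card_mono) auto
    then show ?thesis using card_I j finS by (simp add: s_def)
  qed
  have s0: "1 \<le> s" using ne finS by (simp add: s_def Suc_le_eq card_gt_0_iff)
  have Feq: "F j = j.F" by (intro ext) (simp add: F_def j.F_def)
  define C where "C y y' = (\<Prod>i\<in>S. real (card {v\<in>V i. G v y \<and> G v y'}))" for y y'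
  \<comment> \<open>The diagonal is kept apart because there each of the \<open>s + 1\<close>
    factors has order \<open>p * M\<close> instead of \<open>p^2 * M\<close>.\<close>
  define atyp where "atyp y y' \<longleftrightarrow> y \<noteq> y' \<and> (\<exists>i\<in>S. real (card {v\<in>V i. E y v \<and> E y' v}) > 4 * p\<^sup>2 * M)" for y y'
  have C_eq: "(\<Sum>\<phi>\<in>PiE S V. joint S \<phi> y * joint S \<phi> y') = C y y'" for y y'
  proof -
    have "joint S \<phi> y * joint S \<phi> y' = (\<Prod>i\<in>S. of_bool (G (\<phi> i) y \<and> G (\<phi> i) y'))" for \<phi>
      unfolding joint_def of_bool_Ball_prod[OF finS] of_bool_conj by (rule prod.distrib[symmetric])
    then have "(\<Sum>\<phi>\<in>PiE S V. joint S \<phi> y * joint S \<phi> y') = (\<Sum>\<phi>\<in>PiE S V. \<Prod>i\<in>S. of_bool (G (\<phi> i) y \<and> G (\<phi> i) y'))"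
      by (simp del: of_bool_eq_iff)
    also have "\<dots> = (\<Prod>i\<in>S. \<Sum>v\<in>V i. of_bool (G v y \<and> G v y'))"
      using finS S finite_VY by (intro prod_sum_PiE[symmetric]) auto
    also have "\<dots> = C y y'" unfolding C_def using S finite_VY by (intro prod.cong refl sum_of_bool_card) auto
    finally show ?thesis .
  qed
  have "(\<Sum>\<phi>\<in>PiE S V. \<Sum>v\<in>V j. (\<Sum>y\<in>Y. joint S \<phi> y * F j v y)\<^sup>2) =
     (\<Sum>\<phi>\<in>PiE S V. \<Sum>v\<in>V j. \<Sum>y\<in>Y. \<Sum>y'\<in>Y. (joint S \<phi> y * joint S \<phi> y') * (F j v y * F j v y'))"
    unfolding power2_eq_square sum_product by (intro sum.cong refl) (simp only: mult_ac)
  also have "\<dots> = (\<Sum>\<phi>\<in>PiE S V. \<Sum>y\<in>Y. \<Sum>v\<in>V j. \<Sum>y'\<in>Y. (joint S \<phi> y * joint S \<phi> y') * (F j v y * F j v y'))"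
    by (rule sum.cong[OF refl], rule sum.swap)
  also have "\<dots> = (\<Sum>\<phi>\<in>PiE S V. \<Sum>y\<in>Y. \<Sum>y'\<in>Y. \<Sum>v\<in>V j. (joint S \<phi> y * joint S \<phi> y') * (F j v y * F j v y'))"
    by (rule sum.cong[OF refl], rule sum.cong[OF refl], rule sum.swap)
  also have "\<dots> = (\<Sum>\<phi>\<in>PiE S V. \<Sum>y\<in>Y. \<Sum>y'\<in>Y. (joint S \<phi> y * joint S \<phi> y') * j.K y y')"
    by (simp only: sum_distrib_left j.K_def Feq)
  also have "\<dots> = (\<Sum>y\<in>Y. \<Sum>\<phi>\<in>PiE S V. \<Sum>y'\<in>Y. (joint S \<phi> y * joint S \<phi> y') * j.K y y')" by (rule sum.swap)
  also have "\<dots> = (\<Sum>y\<in>Y. \<Sum>y'\<in>Y. \<Sum>\<phi>\<in>PiE S V. (joint S \<phi> y * joint S \<phi> y') * j.K y y')"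
    by (rule sum.cong[OF refl], rule sum.swap)
  also have "\<dots> = (\<Sum>y\<in>Y. \<Sum>y'\<in>Y. C y y' * j.K y y')"
    by (simp only: C_eq[symmetric] sum_distrib_right)
  also have "\<dots> \<le> (\<Sum>y\<in>Y. \<Sum>y'\<in>Y. (4 * p\<^sup>2 * M) ^ s * \<bar>j.K y y'\<bar>
      + of_bool (atyp y y') * ((8 * z * p\<^sup>2 * M) ^ s * (44 * z * p\<^sup>2 * M))
      + of_bool (y = y') * ((8 * z * p * M) ^ s * (44 * z * p * M)))"
  proof (intro sum_mono)
    fix y y' assume y: "y \<in> Y" "y' \<in> Y"
    have C0: "0 \<le> C y y'" unfolding C_def by (intro prod_nonneg) auto
    have C_le: "C y y' \<le> m ^ s" if "\<And>i. i \<in> S \<Longrightarrow> real (card {v\<in>V i. E y v \<and> E y' v}) \<le> m" for m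
    proof -
      have "C y y' \<le> (\<Prod>i\<in>S. m)" unfolding C_def
      proof (intro prod_mono conjI)
        fix i assume i: "i \<in> S"
        have "card {v\<in>V i. G v y \<and> G v y'} \<le> card {v\<in>V i. E y v \<and> E y' v}"
        proof (intro card_mono)
          have iI: "i \<in> I" using i S by blast
          have "E y v" if "v \<in> V i" "G v y" for v using E_sym[OF G_sub[OF iI that(1) y(1) that(2)]] .
          moreover have "E y' v" if "v \<in> V i" "G v y'" for v using E_sym[OF G_sub[OF iI that(1) y(2) that(2)]] .
          ultimately show "{v\<in>V i. G v y \<and> G v y'} \<subseteq> {v\<in>V i. E y v \<and> E y' v}" by blast
          show "finite {v\<in>V i. E y v \<and> E y' v}" using finite_VY(1)[OF iI] by simp
        qed
        then show "real (card {v\<in>V i. G v y \<and> G v y'}) \<le> m" using that[OF i] by linarith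
        show "0 \<le> real (card {v\<in>V i. G v y \<and> G v y'})" by simp
      qed
      then show ?thesis by (simp add: s_def)
    qed
    have CK: "C y y' * j.K y y' \<le> m ^ s * k" if "C y y' \<le> m ^ s" "\<bar>j.K y y'\<bar> \<le> k" for m k
    proof -
      have "C y y' * j.K y y' \<le> C y y' * \<bar>j.K y y'\<bar>" using C0 by (intro mult_left_mono) auto
      also have "\<dots> \<le> m ^ s * k" using that C0 by (intro mult_mono) auto
      finally show ?thesis .
    qed
    have t0: "0 \<le> (4 * p\<^sup>2 * M) ^ s * \<bar>j.K y y'\<bar>" "0 \<le> (8 * z * p\<^sup>2 * M) ^ s * (44 * z * p\<^sup>2 * M)"
      using p_pos z_ge1 by auto
    have yN: "y < N" "y' < N" using y Y_sub by auto
    have Ki: "i \<in> S \<Longrightarrow> V i \<subseteq> {..<N}" for i using S V_sub by auto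
    consider "y = y'" | "atyp y y'" "y \<noteq> y'" | "\<not> atyp y y'" "y \<noteq> y'" by blast
    then show "C y y' * j.K y y' \<le> (4 * p\<^sup>2 * M) ^ s * \<bar>j.K y y'\<bar>
      + of_bool (atyp y y') * ((8 * z * p\<^sup>2 * M) ^ s * (44 * z * p\<^sup>2 * M))
      + of_bool (y = y') * ((8 * z * p * M) ^ s * (44 * z * p * M))"
    proof cases
      case 1
      have "C y y' * j.K y y' \<le> (8 * z * p * M) ^ s * (44 * z * p * M)"
        using 1 j.deg_le[OF Ki yN(1)] j.abs_K_le[OF y] by (intro CK C_le) auto
      moreover have "\<not> atyp y y'" using 1 by (simp add: atyp_def)
      ultimately show ?thesis using 1 t0(1) by (simp only: of_bool_eq simp_thms mult_1 mult_zero_left)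
    next
      case 2
      have "C y y' * j.K y y' \<le> (8 * z * p\<^sup>2 * M) ^ s * (44 * z * p\<^sup>2 * M)"
        using 2 j.codeg_le[OF Ki yN] j.abs_K_le[OF y] by (intro CK C_le) auto
      then show ?thesis using 2 t0(1) by (simp only: of_bool_eq simp_thms mult_1 mult_zero_left)
    next
      case 3
      have "C y y' * j.K y y' \<le> (4 * p\<^sup>2 * M) ^ s * \<bar>j.K y y'\<bar>"
        using 3 by (intro CK C_le) (auto simp: atyp_def not_less)
      then show ?thesis using 3 by simp
    qed
  qed
  also have "\<dots> = (4 * p\<^sup>2 * M) ^ s * (\<Sum>y\<in>Y. \<Sum>y'\<in>Y. \<bar>j.K y y'\<bar>)
      + (\<Sum>y\<in>Y. \<Sum>y'\<in>Y. of_bool (atyp y y')) * ((8 * z * p\<^sup>2 * M) ^ s * (44 * z * p\<^sup>2 * M))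
      + (\<Sum>y\<in>Y. \<Sum>y'\<in>Y. of_bool (y = y')) * ((8 * z * p * M) ^ s * (44 * z * p * M))"
    by (simp only: sum.distrib sum_distrib_left[symmetric] sum_distrib_right[symmetric])
  also have "\<dots> \<le> (4 * p\<^sup>2 * M) ^ s * (\<zeta> * p\<^sup>2 * real M ^ 3)
      + (2 * s * (\<omega> * M) * M) * ((8 * z * p\<^sup>2 * M) ^ s * (44 * z * p\<^sup>2 * M))
      + M * ((8 * z * p * M) ^ s * (44 * z * p * M))"
  proof (intro add_mono mult_left_mono mult_right_mono)
    show "(\<Sum>y\<in>Y. \<Sum>y'\<in>Y. \<bar>j.K y y'\<bar>) \<le> \<zeta> * p\<^sup>2 * real M ^ 3"
      unfolding j.K_def
    proof (rule j.sum_abs_codeg[OF _ \<zeta>])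
      have "b \<le> \<omega> * (p ^ 2 * M)" using s1 s0 by (intro b_le_pow) auto
      also have "\<dots> \<le> 1 * (p ^ 2 * M)" using \<omega>_le1 by (intro mult_right_mono) auto
      finally show "b \<le> p\<^sup>2 * M" by simp
    qed
    have "(\<Sum>y\<in>Y. \<Sum>y'\<in>Y. of_bool (atyp y y') :: real) \<le>
       (\<Sum>y\<in>Y. \<Sum>y'\<in>Y. \<Sum>i\<in>S. of_bool (real (card {v\<in>V i. E y v \<and> E y' v}) > 4 * p\<^sup>2 * M))"
    proof (intro sum_mono)
      fix y y' assume "y \<in> Y" "y' \<in> Y"
      show "(of_bool (atyp y y') :: real) \<le> (\<Sum>i\<in>S. of_bool (real (card {v\<in>V i. E y v \<and> E y' v}) > 4 * p\<^sup>2 * M))"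
      proof (cases "atyp y y'")
        case True
        then obtain i where i: "i \<in> S" "real (card {v\<in>V i. E y v \<and> E y' v}) > 4 * p\<^sup>2 * M" by (auto simp: atyp_def)
        have "(\<Sum>i\<in>S. of_bool (real (card {v\<in>V i. E y v \<and> E y' v}) > 4 * p\<^sup>2 * M)) \<ge>
           (of_bool (real (card {v\<in>V i. E y v \<and> E y' v}) > 4 * p\<^sup>2 * M) :: real)"
          using i finS by (intro member_le_sum) auto
        then show ?thesis using i True by simp
      qed (simp add: sum_nonneg del: sum_of_bool_eq)
    qed
    also have "\<dots> = (\<Sum>y\<in>Y. \<Sum>i\<in>S. \<Sum>y'\<in>Y. of_bool (real (card {v\<in>V i. E y v \<and> E y' v}) > 4 * p\<^sup>2 * M))"
      by (rule sum.cong[OF refl], rule sum.swap)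
    also have "\<dots> = (\<Sum>i\<in>S. \<Sum>y\<in>Y. \<Sum>y'\<in>Y. of_bool (real (card {v\<in>V i. E y v \<and> E y' v}) > 4 * p\<^sup>2 * M))"
      by (rule sum.swap)
    also have "\<dots> \<le> (\<Sum>i\<in>S. 2 * b * M)"
      using regular_pair.atypical_pairs_le[OF pair] S by (intro sum_mono) auto
    also have "\<dots> = s * (2 * b * M)" by (simp add: s_def)
    also have "\<dots> \<le> s * (2 * (\<omega> * M) * M)" using j.b_le_M by (intro mult_left_mono mult_right_mono) auto
    finally show "(\<Sum>y\<in>Y. \<Sum>y'\<in>Y. of_bool (atyp y y')) \<le> 2 * s * (\<omega> * M) * M" by (simp add: mult_ac)
    show "(\<Sum>y\<in>Y. \<Sum>y'\<in>Y. of_bool (y = y')) \<le> real M"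
      using finite_VY card_Y by (simp add: of_bool_def)
  qed (use p_pos z_ge1 in auto)
  also have "\<dots> \<le> (4 ^ d * \<zeta> + (2 * d + 1) * \<omega> * (8 * z) ^ d * (44 * z)) * (p ^ (2 * s + 2) * real M ^ (s + 3))"
  proof -
    define Q where "Q = p ^ (2 * s + 2) * real M ^ (s + 3)"
    have Q0: "0 \<le> Q" using p_pos by (simp add: Q_def)
    have pw: "(c * p\<^sup>2 * M) ^ s = c ^ s * p ^ (2 * s) * real M ^ s" for c
      by (simp add: power_mult_distrib power_mult)
    have pw': "(c * p * M) ^ s = c ^ s * p ^ s * real M ^ s" for c
      by (simp add: power_mult_distrib)
    have e1: "(4 * p\<^sup>2 * M) ^ s * (\<zeta> * p\<^sup>2 * real M ^ 3) = 4 ^ s * \<zeta> * Q"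
      unfolding pw Q_def power_add by (simp add: mult_ac)
    have e2: "(2 * s * (\<omega> * M) * M) * ((8 * z * p\<^sup>2 * M) ^ s * (44 * z * p\<^sup>2 * M)) = 2 * s * \<omega> * (8 * z) ^ s * (44 * z) * Q"
      unfolding pw Q_def power_add by (simp add: mult_ac power3_eq_cube)
    have e3: "M * ((8 * z * p * M) ^ s * (44 * z * p * M)) = (8 * z) ^ s * (44 * z) * (p ^ (s + 1) * real M ^ (s + 2))"
      unfolding pw' power_add by (simp add: mult_ac power2_eq_square)
    \<comment> \<open>The diagonal has only \<open>M\<close> entries, but each lacks
      \<open>s + 1\<close> factors \<open>p\<close>. The cutoff condition
      \<open>1 \<le> \<omega> * p ^ (s + 1) * M\<close> pays for them.\<close>
    have "s + 1 \<le> 2 * d - 1" using s1 by linarith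
    from b_le_pow[OF this] b_ge1 have "1 \<le> \<omega> * (p ^ (s + 1) * M)" by linarith
    then have "p ^ (s + 1) * real M ^ (s + 2) * 1 \<le> p ^ (s + 1) * real M ^ (s + 2) * (\<omega> * (p ^ (s + 1) * M))"
      using p_pos by (intro mult_left_mono) auto
    also have "\<dots> = \<omega> * Q"
    proof -
      have "2 * s + 2 = (s + 1) + (s + 1)" by simp
      then show ?thesis unfolding Q_def by (simp only: power_add) (simp add: mult_ac power2_eq_square power3_eq_cube)
    qed
    finally have e3': "M * ((8 * z * p * M) ^ s * (44 * z * p * M)) \<le> (8 * z) ^ s * (44 * z) * (\<omega> * Q)"
      unfolding e3 using z_ge1 by (intro mult_left_mono) auto
    have zs: "(8 * z) ^ s \<le> (8 * z) ^ d" using s1 z_ge1 by (intro power_increasing) auto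
    have "4 ^ s * \<zeta> * Q \<le> 4 ^ d * \<zeta> * Q" using s1 \<zeta> Q0 by (intro mult_right_mono power_increasing) auto
    moreover have "2 * s * \<omega> * (8 * z) ^ s * (44 * z) * Q \<le> 2 * d * \<omega> * (8 * z) ^ d * (44 * z) * Q"
      using s1 Q0 zs \<omega>_nonneg z_ge1 by (intro mult_right_mono mult_mono) auto
    moreover have "(8 * z) ^ s * (44 * z) * (\<omega> * Q) \<le> (8 * z) ^ d * (44 * z) * (\<omega> * Q)"
      using zs Q0 \<omega>_nonneg z_ge1 by (intro mult_right_mono) auto
    ultimately have "(4 * p\<^sup>2 * M) ^ s * (\<zeta> * p\<^sup>2 * real M ^ 3)
      + (2 * s * (\<omega> * M) * M) * ((8 * z * p\<^sup>2 * M) ^ s * (44 * z * p\<^sup>2 * M))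
      + M * ((8 * z * p * M) ^ s * (44 * z * p * M)) \<le>
      4 ^ d * \<zeta> * Q + 2 * d * \<omega> * (8 * z) ^ d * (44 * z) * Q + (8 * z) ^ d * (44 * z) * (\<omega> * Q)"
      unfolding e1 e2 using e3' by linarith
    also have "\<dots> = (4 ^ d * \<zeta> + (2 * d + 1) * \<omega> * (8 * z) ^ d * (44 * z)) * Q" by (simp add: algebra_simps)
    finally show ?thesis by (simp only: Q_def)
  qed
  finally show ?thesis by (simp add: s_def mult.assoc)
qed

text \<open>With \<open>S\<close> empty only \<open>1 \<le> d\<close> is available, too little for
  \<open>b \<le> p^2 * M\<close>; the plain second moment of row sums takes the place of the
  codegree bound.\<close>

lemma sum_sq_joint_F:
  assumes S: "S \<subseteq> I" and j: "j \<in> I" "j \<notin> S"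
  shows "(\<Sum>\<phi>\<in>PiE S V. \<Sum>v\<in>V j. (\<Sum>y\<in>Y. joint S \<phi> y * F j v y)\<^sup>2)
     \<le> err * p ^ (2 * card S + 2) * real M ^ (card S + 3)"
proof (cases "S = {}")
  case True
  interpret j: regular_pair E N d p b \<gamma> G "V j" Y M "\<alpha> j" \<epsilon> z \<omega> using pair j by blast
  have "(\<Sum>v\<in>V j. (\<Sum>y\<in>Y. F j v y)\<^sup>2) \<le> (16 * \<epsilon> + 100 * z\<^sup>2 * \<omega>) * p\<^sup>2 * real M ^ 3"
    using j.sum_sq_F_signed[of "\<lambda>_. 1"] by (simp add: F_def j.F_def)
  also have "\<dots> \<le> err * p\<^sup>2 * real M ^ 3"
    using z_ge1 \<omega>_nonneg \<zeta> p_pos by (intro mult_right_mono) (auto simp: err_def)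
  finally show ?thesis using True by (simp add: joint_def power2_eq_square)
next
  case False
  have "(4 ^ d * \<zeta> + (2 * d + 1) * \<omega> * (8 * z) ^ d * (44 * z)) \<le> err"
    using z_ge1 \<omega>_nonneg \<epsilon>_nonneg by (auto simp: err_def)
  then have "(4 ^ d * \<zeta> + (2 * d + 1) * \<omega> * (8 * z) ^ d * (44 * z)) * p ^ (2 * card S + 2) * real M ^ (card S + 3)
     \<le> err * p ^ (2 * card S + 2) * real M ^ (card S + 3)"
    using p_pos by (intro mult_right_mono) auto
  then show ?thesis using sum_sq_joint_F_nonempty[OF S j False] by linarith
qed

definition cnt :: "nat set \<Rightarrow> (nat \<Rightarrow> nat) \<Rightarrow> real" where
  "cnt S \<phi> = (\<Sum>y\<in>Y. joint S \<phi> y)"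

definition \<mu> :: "nat set \<Rightarrow> real" where "\<mu> S = (\<Prod>i\<in>S. \<alpha> i) * p ^ card S * M"

text \<open>A new index \<open>j\<close> turns the deviation into a term with the centred factor
  \<open>F j\<close> plus \<open>\<alpha> j * p\<close> times the old deviation. Squaring doubles
  both, and with \<open>\<alpha> j \<le> 2\<close> the constant \<open>10 ^ s\<close> becomes
  \<open>2 + 8 * 10 ^ s\<close>, at most \<open>10 ^ (s + 1)\<close>. All tuples are counted here,
  whatever their adjacencies.\<close>

lemma variance_le:
  assumes S: "S \<subseteq> I"
  shows "(\<Sum>\<phi>\<in>PiE S V. (cnt S \<phi> - \<mu> S)\<^sup>2) \<le> 10 ^ card S * err * p ^ (2 * card S) * real M ^ (card S + 2)"
proof -
  have "finite S" using S finite_I finite_subset by blast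
  then show ?thesis using S
  proof (induction S rule: finite_induct)
    case empty
    then show ?case using card_Y err_nonneg by (simp add: cnt_def joint_def \<mu>_def)
  next
    case (insert j S)
    let ?s = "card S"
    have j: "j \<in> I" "S \<subseteq> I" using insert.prems by auto
    have \<mu>: "\<mu> (insert j S) = \<alpha> j * p * \<mu> S" using insert.hyps by (simp add: \<mu>_def mult_ac)
    have eq: "cnt (insert j S) (\<psi>(j := v)) - \<mu> (insert j S) =
        (\<Sum>y\<in>Y. joint S \<psi> y * F j v y) + (\<alpha> j * p) * (cnt S \<psi> - \<mu> S)" for \<psi> v
    proof -
      have "joint (insert j S) (\<psi>(j := v)) y = joint S \<psi> y * F j v y + (\<alpha> j * p) * joint S \<psi> y" for y
      proof -
        have "(\<forall>i\<in>insert j S. G ((\<psi>(j := v)) i) y) = (G v y \<and> (\<forall>i\<in>S. G (\<psi> i) y))"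
          using insert.hyps(2) by auto
        then have "joint (insert j S) (\<psi>(j := v)) y = of_bool (G v y) * joint S \<psi> y"
          by (simp only: joint_def of_bool_conj)
        then show ?thesis by (simp add: F_def algebra_simps)
      qed
      then have "cnt (insert j S) (\<psi>(j := v)) = (\<Sum>y\<in>Y. joint S \<psi> y * F j v y) + (\<alpha> j * p) * cnt S \<psi>"
        by (simp only: cnt_def sum.distrib sum_distrib_left)
      then show ?thesis by (simp add: \<mu> right_diff_distrib)
    qed
    let ?A = "\<Sum>\<psi>\<in>PiE S V. \<Sum>v\<in>V j. (\<Sum>y\<in>Y. joint S \<psi> y * F j v y)\<^sup>2"
    let ?B = "\<Sum>\<psi>\<in>PiE S V. (cnt S \<psi> - \<mu> S)\<^sup>2"
    have "(\<Sum>\<phi>\<in>PiE (insert j S) V. (cnt (insert j S) \<phi> - \<mu> (insert j S))\<^sup>2) =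
       (\<Sum>\<psi>\<in>PiE S V. \<Sum>v\<in>V j. ((\<Sum>y\<in>Y. joint S \<psi> y * F j v y) + (\<alpha> j * p) * (cnt S \<psi> - \<mu> S))\<^sup>2)"
      by (simp only: sum_PiE_insert[OF insert.hyps(2)] eq)
    also have "\<dots> \<le> (\<Sum>\<psi>\<in>PiE S V. 2 * (\<Sum>v\<in>V j. (\<Sum>y\<in>Y. joint S \<psi> y * F j v y)\<^sup>2)
         + 2 * (\<alpha> j * p)\<^sup>2 * (\<Sum>v\<in>V j. (cnt S \<psi> - \<mu> S)\<^sup>2))"
      by (intro sum_mono sum_square_diff_const)
    also have "\<dots> = 2 * ?A + 2 * (\<alpha> j * p)\<^sup>2 * (M * ?B)"
      using card_V[OF j(1)] by (simp add: sum.distrib sum_distrib_left)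
    also have "\<dots> \<le> 2 * (err * p ^ (2 * ?s + 2) * real M ^ (?s + 3))
       + 2 * (2 * p)\<^sup>2 * (M * (10 ^ ?s * err * p ^ (2 * ?s) * real M ^ (?s + 2)))"
    proof (intro add_mono mult_left_mono mult_mono)
      show "?A \<le> err * p ^ (2 * ?s + 2) * real M ^ (?s + 3)"
        by (rule sum_sq_joint_F[OF j(2,1) insert.hyps(2)])
      show "?B \<le> 10 ^ ?s * err * p ^ (2 * ?s) * real M ^ (?s + 2)" by (rule insert.IH[OF j(2)])
      show "(\<alpha> j * p)\<^sup>2 \<le> (2 * p)\<^sup>2"
        using \<alpha>_nonneg[OF j(1)] \<alpha>_le2[OF j(1)] p_pos by (intro power_mono mult_right_mono) auto
      show "0 \<le> real M * ?B" by (intro mult_nonneg_nonneg sum_nonneg) auto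
    qed simp_all
    also have "\<dots> = (2 + 8 * 10 ^ ?s) * err * p ^ (2 * ?s + 2) * real M ^ (?s + 3)"
      by (simp add: distrib_left distrib_right power_add power2_eq_square power3_eq_cube mult_ac)
    also have "\<dots> \<le> 10 ^ (?s + 1) * err * p ^ (2 * ?s + 2) * real M ^ (?s + 3)"
      using err_nonneg p_pos by (intro mult_right_mono) auto
    finally have *: "(\<Sum>\<phi>\<in>PiE (insert j S) V. (cnt (insert j S) \<phi> - \<mu> (insert j S))\<^sup>2) \<le> \<dots>" .
    have "card (insert j S) = ?s + 1" "2 * (?s + 1) = 2 * ?s + 2" "?s + 1 + 2 = ?s + 3"
      using insert.hyps by auto
    then show ?case using * by (simp only:)
  qed
qed

end

section \<open>Replacing host edges one at a time\<close>

text \<open>The coordinates are chosen in increasing order, and \<open>c i\<close> bounds the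
  choices at \<open>i\<close> once the smaller coordinates agree with those of some member of
  \<open>S\<close>. The induction splits off the largest index.\<close>

lemma card_PiE_sequential:
  fixes S :: "(nat \<Rightarrow> 'b) set" and c :: "nat \<Rightarrow> real"
  assumes "finite J" "S \<subseteq> PiE J B" "\<And>i. i \<in> J \<Longrightarrow> finite (B i)" "\<And>i. i \<in> J \<Longrightarrow> 0 \<le> c i"
    and "\<And>i \<psi>. i \<in> J \<Longrightarrow> \<psi> \<in> S \<Longrightarrow> real (card {\<phi> i |\<phi>. \<phi> \<in> S \<and> (\<forall>j\<in>J. j < i \<longrightarrow> \<phi> j = \<psi> j)}) \<le> c i"
  shows "real (card S) \<le> (\<Prod>i\<in>J. c i)"
  using assms
proof (induction J arbitrary: S rule: finite_linorder_max_induct)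
  case empty
  then have "S \<subseteq> {\<lambda>_. undefined}" by simp
  then have "card S \<le> 1" using card_mono[of "{\<lambda>_. undefined}" S] by simp
  then show ?case by simp
next
  case (insert m J)
  define S' where "S' = (\<lambda>\<phi>. restrict \<phi> J) ` S"
  have m: "m \<notin> J" using insert.hyps by auto
  have finS: "finite S"
    using insert.prems(1,2) insert.hyps(1) finite_PiE[of "insert m J" B] by (meson finite.insertI finite_subset)
  have IH: "real (card S') \<le> (\<Prod>i\<in>J. c i)"
  proof (rule insert.IH)
    show "S' \<subseteq> PiE J B" unfolding S'_def using insert.prems(1) by (auto simp: PiE_def Pi_def extensional_def subset_iff)
    fix i \<psi> assume i: "i \<in> J" and "\<psi> \<in> S'"
    then obtain \<psi>0 where \<psi>0: "\<psi>0 \<in> S" "\<psi> = restrict \<psi>0 J" by (auto simp: S'_def)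
    have "{\<phi> i |\<phi>. \<phi> \<in> S' \<and> (\<forall>j\<in>J. j < i \<longrightarrow> \<phi> j = \<psi> j)} \<subseteq> {\<phi> i |\<phi>. \<phi> \<in> S \<and> (\<forall>j\<in>insert m J. j < i \<longrightarrow> \<phi> j = \<psi>0 j)}"
    proof
      fix x assume "x \<in> {\<phi> i |\<phi>. \<phi> \<in> S' \<and> (\<forall>j\<in>J. j < i \<longrightarrow> \<phi> j = \<psi> j)}"
      then obtain \<phi> where \<phi>: "x = restrict \<phi> J i" "\<phi> \<in> S" "\<forall>j\<in>J. j < i \<longrightarrow> restrict \<phi> J j = \<psi> j"
        by (auto simp: S'_def)
      have "\<not> m < i" using insert.hyps(2) i by force
      then have "\<forall>j\<in>insert m J. j < i \<longrightarrow> \<phi> j = \<psi>0 j" using \<phi>(3) \<psi>0(2) by auto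
      then show "x \<in> {\<phi> i |\<phi>. \<phi> \<in> S \<and> (\<forall>j\<in>insert m J. j < i \<longrightarrow> \<phi> j = \<psi>0 j)}" using \<phi>(1,2) i by auto
    qed
    then have "card {\<phi> i |\<phi>. \<phi> \<in> S' \<and> (\<forall>j\<in>J. j < i \<longrightarrow> \<phi> j = \<psi> j)} \<le> card {\<phi> i |\<phi>. \<phi> \<in> S \<and> (\<forall>j\<in>insert m J. j < i \<longrightarrow> \<phi> j = \<psi>0 j)}"
      using finS by (intro card_mono) auto
    also have "real \<dots> \<le> c i" using insert.prems(4)[of i \<psi>0] i \<psi>0 by simp
    finally show "real (card {\<phi> i |\<phi>. \<phi> \<in> S' \<and> (\<forall>j\<in>J. j < i \<longrightarrow> \<phi> j = \<psi> j)}) \<le> c i" by simp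
  qed (use insert.prems in auto)
  have "card S = (\<Sum>\<psi>\<in>S'. card {\<phi>\<in>S. restrict \<phi> J = \<psi>})"
    unfolding S'_def using sum.image_gen[OF finS, of "\<lambda>_. 1::nat" "\<lambda>\<phi>. restrict \<phi> J"] by simp
  then have "real (card S) = (\<Sum>\<psi>\<in>S'. real (card {\<phi>\<in>S. restrict \<phi> J = \<psi>}))" by simp
  also have "\<dots> \<le> (\<Sum>\<psi>\<in>S'. c m)"
  proof (intro sum_mono)
    fix \<psi> assume "\<psi> \<in> S'"
    then obtain \<psi>0 where \<psi>0: "\<psi>0 \<in> S" "\<psi> = restrict \<psi>0 J" by (auto simp: S'_def)
    let ?T = "{\<phi>\<in>S. restrict \<phi> J = \<psi>}"
    have inj: "inj_on (\<lambda>\<phi>. \<phi> m) ?T"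
    proof (rule inj_onI)
      fix \<phi> \<phi>' assume a: "\<phi> \<in> ?T" "\<phi>' \<in> ?T" "\<phi> m = \<phi>' m"
      have ext: "\<phi> \<in> PiE (insert m J) B" "\<phi>' \<in> PiE (insert m J) B" using a insert.prems(1) by auto
      have r: "restrict \<phi> J = restrict \<phi>' J" using a by simp
      show "\<phi> = \<phi>'"
      proof (rule PiE_ext[OF ext])
        fix j assume "j \<in> insert m J"
        then show "\<phi> j = \<phi>' j" using a(3) fun_cong[OF r, of j] by auto
      qed
    qed
    have "(\<lambda>\<phi>. \<phi> m) ` ?T \<subseteq> {\<phi> m |\<phi>. \<phi> \<in> S \<and> (\<forall>j\<in>insert m J. j < m \<longrightarrow> \<phi> j = \<psi>0 j)}"
    proof
      fix x assume "x \<in> (\<lambda>\<phi>. \<phi> m) ` ?T"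
      then obtain \<phi> where \<phi>: "x = \<phi> m" "\<phi> \<in> S" "restrict \<phi> J = restrict \<psi>0 J" using \<psi>0 by auto
      have "\<forall>j\<in>insert m J. j < m \<longrightarrow> \<phi> j = \<psi>0 j"
      proof (intro ballI impI)
        fix j assume "j \<in> insert m J" "j < m"
        then show "\<phi> j = \<psi>0 j" using fun_cong[OF \<phi>(3), of j] by auto
      qed
      then show "x \<in> {\<phi> m |\<phi>. \<phi> \<in> S \<and> (\<forall>j\<in>insert m J. j < m \<longrightarrow> \<phi> j = \<psi>0 j)}" using \<phi> by blast
    qed
    then have "card ?T \<le> card {\<phi> m |\<phi>. \<phi> \<in> S \<and> (\<forall>j\<in>insert m J. j < m \<longrightarrow> \<phi> j = \<psi>0 j)}"
      unfolding card_image[OF inj, symmetric] using finS by (intro card_mono) auto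
    also have "real \<dots> \<le> c m" using insert.prems(4)[of m \<psi>0] \<psi>0 by simp
    finally show "real (card ?T) \<le> c m" by simp
  qed
  also have "\<dots> = real (card S') * c m" by simp
  also have "\<dots> \<le> (\<Prod>i\<in>J. c i) * c m" using IH insert.prems(3) by (intro mult_right_mono) auto
  also have "\<dots> = (\<Prod>i\<in>insert m J. c i)" using m insert.hyps(1) by simp
  finally show ?case .
qed

context jumbled_graph
begin

text \<open>Coordinate \<open>i\<close> lies in the common neighbourhood of \<open>Ys i\<close> and
  the images of \<open>bck i\<close>. Disjointness of the parts makes these vertices distinct, so
  the codegree bound has its full exponent.\<close>

lemma card_homs_le:
  fixes J :: "nat set"
  assumes J: "finite J" and B: "\<And>i. i \<in> J \<Longrightarrow> B i \<subseteq> {..<N}"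
    and bck: "\<And>i. i \<in> J \<Longrightarrow> bck i \<subseteq> {j\<in>J. j < i}"
    and disj: "\<And>i j k. i \<in> J \<Longrightarrow> j \<in> bck i \<Longrightarrow> k \<in> bck i \<Longrightarrow> j \<noteq> k \<Longrightarrow> B j \<inter> B k = {}"
    and Ys: "\<And>i. i \<in> J \<Longrightarrow> Ys i \<subseteq> {..<N}" and disjY: "\<And>i j. i \<in> J \<Longrightarrow> j \<in> bck i \<Longrightarrow> Ys i \<inter> B j = {}"
    and card: "\<And>i. i \<in> J \<Longrightarrow> card (Ys i) + card (bck i) \<le> 2 * d"
  shows "real (card {\<phi>\<in>PiE J B. \<forall>i\<in>J. (\<forall>j\<in>bck i. E (\<phi> j) (\<phi> i)) \<and> (\<forall>y\<in>Ys i. E y (\<phi> i))})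
     \<le> (\<Prod>i\<in>J. 8 * p ^ (card (Ys i) + card (bck i)) * N)"
proof (rule card_PiE_sequential[OF J])
  let ?S = "{\<phi>\<in>PiE J B. \<forall>i\<in>J. (\<forall>j\<in>bck i. E (\<phi> j) (\<phi> i)) \<and> (\<forall>y\<in>Ys i. E y (\<phi> i))}"
  show "?S \<subseteq> PiE J B" by auto
  show "\<And>i. i \<in> J \<Longrightarrow> finite (B i)" using B finite_sub by blast
  show "\<And>i. i \<in> J \<Longrightarrow> 0 \<le> 8 * p ^ (card (Ys i) + card (bck i)) * N" using p_pos by simp
  fix i \<psi> assume i: "i \<in> J" and \<psi>: "\<psi> \<in> ?S"
  have finb: "finite (bck i)" using bck[OF i] J finite_subset by fastforce
  have \<psi>B: "\<psi> j \<in> B j" if "j \<in> bck i" for j using that bck[OF i] \<psi> by (auto simp: PiE_def Pi_def)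
  have inj: "inj_on \<psi> (bck i)"
    using disj[OF i] \<psi>B by (intro inj_onI) (metis disjoint_iff)
  have T: "Ys i \<union> \<psi> ` bck i \<subseteq> {..<N}" using Ys[OF i] \<psi>B B bck[OF i] by blast
  have cT: "card (Ys i \<union> \<psi> ` bck i) = card (Ys i) + card (bck i)"
    using disjY[OF i] \<psi>B finb finite_sub[OF Ys[OF i]] card_image[OF inj]
    by (subst card_Un_disjoint) auto
  have "{\<phi> i |\<phi>. \<phi> \<in> ?S \<and> (\<forall>j\<in>J. j < i \<longrightarrow> \<phi> j = \<psi> j)} \<subseteq> {y\<in>{..<N}. \<forall>t\<in>Ys i \<union> \<psi> ` bck i. E t y}"
  proof
    fix x assume "x \<in> {\<phi> i |\<phi>. \<phi> \<in> ?S \<and> (\<forall>j\<in>J. j < i \<longrightarrow> \<phi> j = \<psi> j)}"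
    then obtain \<phi> where \<phi>: "x = \<phi> i" "\<phi> \<in> ?S" "\<forall>j\<in>J. j < i \<longrightarrow> \<phi> j = \<psi> j" by blast
    have "x \<in> B i" using \<phi> i by (auto simp: PiE_def Pi_def)
    then have "x < N" using B[OF i] by auto
    moreover have "E t x" if t: "t \<in> Ys i \<union> \<psi> ` bck i" for t
    proof (cases "t \<in> Ys i")
      case True
      then show ?thesis using \<phi> i by auto
    next
      case False
      then obtain j where j: "j \<in> bck i" "t = \<psi> j" using t by blast
      then have "\<phi> j = \<psi> j" using \<phi>(3) bck[OF i] by auto
      moreover have "E (\<phi> j) (\<phi> i)" using \<phi>(2) i j by auto
      ultimately show ?thesis using j \<phi>(1) by simp
    qed
    ultimately show "x \<in> {y\<in>{..<N}. \<forall>t\<in>Ys i \<union> \<psi> ` bck i. E t y}" by auto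
  qed
  then have "card {\<phi> i |\<phi>. \<phi> \<in> ?S \<and> (\<forall>j\<in>J. j < i \<longrightarrow> \<phi> j = \<psi> j)} \<le> card {y\<in>{..<N}. \<forall>t\<in>Ys i \<union> \<psi> ` bck i. E t y}"
    by (intro card_mono) auto
  also have "real \<dots> \<le> 8 * p ^ card (Ys i \<union> \<psi> ` bck i) * N"
    using T cT card[OF i] by (intro common_nbrs) auto
  finally show "real (card {\<phi> i |\<phi>. \<phi> \<in> ?S \<and> (\<forall>j\<in>J. j < i \<longrightarrow> \<phi> j = \<psi> j)})
      \<le> 8 * p ^ (card (Ys i) + card (bck i)) * N" unfolding cT by simp
qed

end

section \<open>Tuples with a prescribed adjacency pattern\<close>

context tuple_host
begin

definition homs :: "(nat \<times> nat) set \<Rightarrow> (nat \<Rightarrow> nat) \<Rightarrow> bool" where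
  "homs R \<phi> \<longleftrightarrow> (\<forall>(j, i)\<in>R. E (\<phi> j) (\<phi> i))"

lemma N_ge_M: "i \<in> I \<Longrightarrow> M \<le> N"
  using card_mono[of "{..<N}" "V i"] V_sub card_V by fastforce

text \<open>Once the images of all indices except \<open>a\<close> and \<open>c\<close> are fixed,
  the admissible images of \<open>a\<close> and of \<open>c\<close> form two sets in disjoint parts,
  and jumbledness compares the edges between them with \<open>p\<close> times all pairs. Codegree
  bounds count the fixed images and the sizes of the two sets, with a factor \<open>p\<close> for
  every pair of \<open>R\<close>. The set \<open>Y0\<close> confines all images to the neighbourhood
  of at most two vertices, as the first and second moment of \<open>cnt\<close> require.\<close>

lemma hom_remove_edge:
  assumes R: "insert (a, c) R \<subseteq> {(j, i) \<in> I \<times> I. j < i}" and ac: "(a, c) \<notin> R"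
    and Y0: "Y0 \<subseteq> Y" "card Y0 \<le> 2"
    and B: "\<And>i. i \<in> I \<Longrightarrow> B i \<subseteq> {v\<in>V i. \<forall>y\<in>Y0. E y v}"
  shows "\<bar>(\<Sum>\<phi>\<in>PiE I B. of_bool (homs (insert (a, c) R) \<phi>)) - p * (\<Sum>\<phi>\<in>PiE I B. of_bool (homs R \<phi>))\<bar>
    \<le> \<gamma> * p ^ (card R + 1) * (8 * p ^ card Y0 * N) ^ card I"
proof -
  define t where "t = card Y0"
  define J where "J = I - {a, c}"
  have aI: "a \<in> I" "c \<in> I" "a < c" using R by auto
  have I_eq: "I = insert a (insert c J)" "a \<notin> insert c J" "c \<notin> J" using aI by (auto simp: J_def)
  have finJ: "finite J" using finite_I by (simp add: J_def)
  have cardJ: "card I = card J + 2" using finJ I_eq by (metis card_insert_disjoint finite_insert add_2_eq_Suc')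
  define nb where "nb x = {j\<in>J. (j, x) \<in> R \<or> (x, j) \<in> R}" for x
  define bck where "bck i = {j\<in>J. (j, i) \<in> R}" for i
  define P where "P x \<psi> = {v\<in>B x. \<forall>j\<in>nb x. E (\<psi> j) v}" for x \<psi>
  define RJ where "RJ = {(j, i) \<in> R. j \<in> J \<and> i \<in> J}"
  have bck_sub: "bck i \<subseteq> {j\<in>J. j < i}" for i using R by (auto simp: bck_def)
  have finR: "finite R" using R finite_I by (auto intro: finite_subset[of _ "I \<times> I"])
  have fin_nb: "finite (nb x)" for x using finJ by (simp add: nb_def)
  have B_V: "i \<in> I \<Longrightarrow> B i \<subseteq> V i" for i using B by blast
  have BN: "i \<in> I \<Longrightarrow> B i \<subseteq> {..<N}" for i using B_V V_sub by blast
  have finB: "i \<in> I \<Longrightarrow> finite (B i)" for i using BN finite_sub by blast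
  have JI: "J \<subseteq> I" by (auto simp: J_def)
  have Y0N: "Y0 \<subseteq> {..<N}" using Y0 Y_sub by blast
  \<comment> \<open>Since \<open>(a, c)\<close> is not in \<open>R\<close>, each pair of
    \<open>R\<close> lies within \<open>J\<close> or joins \<open>a\<close> or \<open>c\<close> to
    \<open>J\<close>. An inequality suffices because \<open>p \<le> 1\<close>.\<close>
  have exps: "card R \<le> (\<Sum>i\<in>J. card (bck i)) + card (nb a) + card (nb c)"
  proof -
    let ?f = "\<lambda>x j. if (j, x) \<in> R then (j, x) else (x, j)"
    have "R \<subseteq> (\<lambda>(i, j). (j, i)) ` (SIGMA i:J. bck i) \<union> ?f a ` nb a \<union> ?f c ` nb c"
    proof (rule subrelI)
      fix j i assume ji: "(j, i) \<in> R"
      then have jiI: "j \<in> I" "i \<in> I" "j < i" using R by auto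
      have "(j, i) \<noteq> (a, c)" using ji ac by auto
      then consider "j \<in> J" "i \<in> J" | "i = a" "j \<in> J" | "j = a" "i \<in> J" | "i = c" "j \<in> J" | "j = c" "i \<in> J"
        using jiI aI by (auto simp: J_def)
      then show "(j, i) \<in> (\<lambda>(i, j). (j, i)) ` (SIGMA i:J. bck i) \<union> ?f a ` nb a \<union> ?f c ` nb c"
      proof cases
        case 1
        then show ?thesis using ji by (auto simp: bck_def intro!: image_eqI[of _ _ "(i, j)"])
      next
        case 2
        then have "j \<in> nb a" "(j, i) = ?f a j" using ji by (auto simp: nb_def)
        then show ?thesis by blast
      next
        case 3
        then have "i \<in> nb a" using ji by (auto simp: nb_def)
        moreover have "(i, a) \<notin> R" using R 3 jiI by auto
        ultimately show ?thesis using 3 by auto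
      next
        case 4
        then have "j \<in> nb c" "(j, i) = ?f c j" using ji by (auto simp: nb_def)
        then show ?thesis by blast
      next
        case 5
        then have "i \<in> nb c" using ji by (auto simp: nb_def)
        moreover have "(i, c) \<notin> R" using R 5 jiI by auto
        ultimately show ?thesis using 5 by auto
      qed
    qed
    then have "card R \<le> card ((\<lambda>(i, j). (j, i)) ` (SIGMA i:J. bck i) \<union> ?f a ` nb a \<union> ?f c ` nb c)"
      using finJ fin_nb by (intro card_mono) (auto simp: bck_def)
    also have "\<dots> \<le> card ((\<lambda>(i, j). (j, i)) ` (SIGMA i:J. bck i)) + card (?f a ` nb a) + card (?f c ` nb c)"
      using card_Un_le[of "(\<lambda>(i, j). (j, i)) ` (SIGMA i:J. bck i)" "?f a ` nb a"]
        card_Un_le[of "(\<lambda>(i, j). (j, i)) ` (SIGMA i:J. bck i) \<union> ?f a ` nb a" "?f c ` nb c"] by linarith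
    also have "\<dots> \<le> card (SIGMA i:J. bck i) + card (nb a) + card (nb c)"
      using finJ fin_nb by (intro add_mono card_image_le) (auto simp: bck_def)
    also have "card (SIGMA i:J. bck i) = (\<Sum>i\<in>J. card (bck i))"
      using finJ by (subst card_SigmaI) (auto simp: bck_def)
    finally show ?thesis .
  qed
  define SJ where "SJ = {\<psi>\<in>PiE J B. \<forall>i\<in>J. (\<forall>j\<in>bck i. E (\<psi> j) (\<psi> i)) \<and> (\<forall>y\<in>Y0. E y (\<psi> i))}"
  have homJ: "homs RJ \<psi> \<longleftrightarrow> \<psi> \<in> SJ" if "\<psi> \<in> PiE J B" for \<psi>
  proof -
    have "E y (\<psi> i)" if "i \<in> J" "y \<in> Y0" for y i using that B[of i] JI \<open>\<psi> \<in> PiE J B\<close> by (auto simp: PiE_def Pi_def)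
    then show ?thesis using that unfolding homs_def SJ_def RJ_def bck_def by blast
  qed
  have SJ_card: "real (card SJ) \<le> (\<Prod>i\<in>J. 8 * p ^ (t + card (bck i)) * N)"
    unfolding SJ_def t_def
  proof (rule card_homs_le[OF finJ])
    fix i assume i: "i \<in> J"
    have "bck i \<subseteq> J - {i}" using bck_sub by blast
    then have "card (bck i) \<le> card J - 1" using finJ i by (metis card_Diff_singleton card_mono finite_Diff)
    then show "card Y0 + card (bck i) \<le> 2 * d" using Y0(2) cardJ card_I i finJ by linarith
  next
    fix i j assume "i \<in> J" "j \<in> bck i"
    then show "Y0 \<inter> B j = {}" using B_V[of j] VY[of j] Y0(1) JI by (auto simp: bck_def)
  next
    fix i j k assume "i \<in> J" "j \<in> bck i" "k \<in> bck i" "j \<noteq> k"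
    then have "j \<in> I" "k \<in> I" "V j \<inter> V k = {}" using VV[of j k] JI by (auto simp: bck_def)
    then show "B j \<inter> B k = {}" using B_V[of j] B_V[of k] by blast
  qed (use BN JI bck_sub Y0N in auto)
  have P_card: "max (real (card (P x \<psi>))) b \<le> 8 * p ^ (t + card (nb x)) * N"
    if x: "x = a \<or> x = c" and \<psi>: "\<psi> \<in> PiE J B" for x \<psi>
  proof -
    have xI: "x \<in> I" "x \<notin> J" using x aI by (auto simp: J_def)
    have nbJ: "card (nb x) \<le> card J" using finJ by (intro card_mono) (auto simp: nb_def)
    have \<psi>B: "\<psi> j \<in> V j" if "j \<in> nb x" for j using that \<psi> B_V[of j] JI by (auto simp: nb_def PiE_def Pi_def)
    have nbI: "nb x \<subseteq> I" using JI by (auto simp: nb_def)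
    have inj: "inj_on \<psi> (nb x)"
    proof (rule inj_onI, rule ccontr)
      fix j k assume jk: "j \<in> nb x" "k \<in> nb x" "\<psi> j = \<psi> k" "j \<noteq> k"
      then have "V j \<inter> V k = {}" using VV[of j k] nbI by blast
      then show False using \<psi>B[OF jk(1)] \<psi>B[OF jk(2)] jk(3) by auto
    qed
    have T: "Y0 \<union> \<psi> ` nb x \<subseteq> {..<N}" using Y0N \<psi>B V_sub nbI by blast
    have "Y0 \<inter> \<psi> ` nb x = {}"
    proof -
      have "\<psi> j \<notin> Y0" if "j \<in> nb x" for j using \<psi>B[OF that] VY[of j] nbI that Y0(1) by blast
      then show ?thesis by blast
    qed
    then have cT: "card (Y0 \<union> \<psi> ` nb x) = t + card (nb x)"
      using fin_nb finite_sub[OF Y0N] card_image[OF inj] by (subst card_Un_disjoint) (auto simp: t_def)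
    have le: "t + card (nb x) \<le> d" using nbJ cardJ card_I Y0(2) by (simp add: t_def)
    have "P x \<psi> \<subseteq> {v\<in>V x. \<forall>y\<in>Y0 \<union> \<psi> ` nb x. E y v}" using B[OF xI(1)] by (auto simp: P_def)
    then have "card (P x \<psi>) \<le> card {v\<in>V x. \<forall>y\<in>Y0 \<union> \<psi> ` nb x. E y v}"
      using finite_VY(1)[OF xI(1)] by (intro card_mono) auto
    also have "real \<dots> \<le> 8 * p ^ card (Y0 \<union> \<psi> ` nb x) * N"
      using V_sub[OF xI(1)] T cT le by (intro common_nbrs_sub) auto
    finally have 1: "real (card (P x \<psi>)) \<le> 8 * p ^ (t + card (nb x)) * N" unfolding cT by simp
    have "b \<le> \<omega> * (p ^ (t + card (nb x)) * M)" using le d_ge1 by (intro b_le_pow) linarith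
    also have "\<dots> \<le> 8 * (p ^ (t + card (nb x)) * N)"
      using \<omega>_le1 p_pos N_ge_M[OF xI(1)] by (intro mult_mono mult_left_mono) auto
    finally show ?thesis using 1 by simp
  qed
  have split: "(\<Sum>\<phi>\<in>PiE I B. f \<phi>) = (\<Sum>\<psi>\<in>PiE J B. \<Sum>w\<in>B c. \<Sum>v\<in>B a. f (\<psi>(c := w, a := v)))"
    for f :: "(nat \<Rightarrow> nat) \<Rightarrow> real"
    unfolding I_eq(1) by (simp only: sum_PiE_insert[OF I_eq(2)] sum_PiE_insert[OF I_eq(3)])
  have hom_upd: "homs R (\<psi>(c := w, a := v)) \<longleftrightarrow> homs RJ \<psi> \<and> v \<in> P a \<psi> \<and> w \<in> P c \<psi>"
    if "v \<in> B a" "w \<in> B c" for \<psi> v w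
  proof -
    let ?\<phi> = "\<psi>(c := w, a := v)"
    have \<phi>J: "j \<in> J \<Longrightarrow> ?\<phi> j = \<psi> j" for j by (auto simp: J_def)
    have \<phi>ac: "?\<phi> a = v" "?\<phi> c = w" using aI by auto
    show ?thesis
    proof
      assume h: "homs R ?\<phi>"
      have e: "E (?\<phi> j) (?\<phi> i)" if "(j, i) \<in> R" for j i using h that by (auto simp: homs_def)
      have "homs RJ \<psi>" unfolding homs_def RJ_def using e \<phi>J by fastforce
      moreover have nbE: "E (\<psi> j) (?\<phi> x)" if "j \<in> nb x" for j x
      proof -
        have j: "j \<in> J" "(j, x) \<in> R \<or> (x, j) \<in> R" using that by (auto simp: nb_def)
        from j(2) have "E (?\<phi> j) (?\<phi> x)"
        proof
          assume "(x, j) \<in> R"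
          from E_sym[OF e[OF this]] show ?thesis .
        qed (rule e)
        then show ?thesis using \<phi>J[OF j(1)] by simp
      qed
      moreover have "E (\<psi> j) v" if "j \<in> nb a" for j using nbE[OF that] \<phi>ac by simp
      moreover have "E (\<psi> j) w" if "j \<in> nb c" for j using nbE[OF that] \<phi>ac by simp
      ultimately show "homs RJ \<psi> \<and> v \<in> P a \<psi> \<and> w \<in> P c \<psi>" using that by (auto simp: P_def)
    next
      assume h: "homs RJ \<psi> \<and> v \<in> P a \<psi> \<and> w \<in> P c \<psi>"
      show "homs R ?\<phi>" unfolding homs_def
      proof (clarify)
        fix j i assume ji: "(j, i) \<in> R"
        then have jiI: "j \<in> I" "i \<in> I" "j < i" using R by auto
        have "(j, i) \<noteq> (a, c)" using ji ac by auto
        then consider "j \<in> J" "i \<in> J" | "i = a" "j \<in> J" | "j = a" "i \<in> J" | "i = c" "j \<in> J" | "j = c" "i \<in> J"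
          using jiI aI by (auto simp: J_def)
        then show "E (?\<phi> j) (?\<phi> i)"
        proof cases
          case 1
          then have "E (\<psi> j) (\<psi> i)" using h ji by (auto simp: homs_def RJ_def)
          then show ?thesis using \<phi>J 1 by simp
        next
          case 2
          then have "E (\<psi> j) v" using h ji by (auto simp: P_def nb_def)
          then show ?thesis using \<phi>J[OF 2(2)] \<phi>ac 2 by simp
        next
          case 3
          then have "E (\<psi> i) v" using h ji by (auto simp: P_def nb_def)
          then have "E v (\<psi> i)" by (rule E_sym)
          then show ?thesis using \<phi>J[OF 3(2)] \<phi>ac 3 by simp
        next
          case 4
          then have "E (\<psi> j) w" using h ji by (auto simp: P_def nb_def)
          then show ?thesis using \<phi>J[OF 4(2)] \<phi>ac 4 by simp
        next
          case 5
          then have "E (\<psi> i) w" using h ji by (auto simp: P_def nb_def)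
          then have "E w (\<psi> i)" by (rule E_sym)
          then show ?thesis using \<phi>J[OF 5(2)] \<phi>ac 5 by simp
        qed
      qed
    qed
  qed
  have hom_ins: "homs (insert (a, c) R) (\<psi>(c := w, a := v)) \<longleftrightarrow> E v w \<and> homs R (\<psi>(c := w, a := v))" for \<psi> v w
    using aI by (auto simp: homs_def)
  define D where "D \<psi> = (\<Sum>w\<in>P c \<psi>. \<Sum>v\<in>P a \<psi>. of_bool (E v w) - p)" for \<psi>
  have inner: "(\<Sum>w\<in>B c. \<Sum>v\<in>B a. of_bool (homs (insert (a, c) R) (\<psi>(c := w, a := v))) - p * of_bool (homs R (\<psi>(c := w, a := v))))
     = of_bool (homs RJ \<psi>) * D \<psi>" for \<psi>
  proof -
    have "(\<Sum>w\<in>B c. \<Sum>v\<in>B a. of_bool (homs (insert (a, c) R) (\<psi>(c := w, a := v))) - p * of_bool (homs R (\<psi>(c := w, a := v))))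
      = (\<Sum>w\<in>B c. \<Sum>v\<in>B a. of_bool (w \<in> P c \<psi>) * (of_bool (v \<in> P a \<psi>) * (of_bool (homs RJ \<psi>) * (of_bool (E v w) - p))))"
      by (intro sum.cong refl) (auto simp: hom_ins hom_upd)
    also have "\<dots> = (\<Sum>w\<in>{w\<in>B c. w \<in> P c \<psi>}. \<Sum>v\<in>{v\<in>B a. v \<in> P a \<psi>}. of_bool (homs RJ \<psi>) * (of_bool (E v w) - p))"
      using finB aI by (simp only: sum_distrib_left[symmetric] sum_of_bool_mult)
    also have "{w\<in>B c. w \<in> P c \<psi>} = P c \<psi>" by (auto simp: P_def)
    also have "{v\<in>B a. v \<in> P a \<psi>} = P a \<psi>" by (auto simp: P_def)
    finally show ?thesis by (simp only: D_def sum_distrib_left)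
  qed
  define q where "q = (8 * p ^ (t + card (nb a)) * N) * (8 * p ^ (t + card (nb c)) * N)"
  have D_le: "\<bar>D \<psi>\<bar> \<le> \<gamma> * p * q" if \<psi>: "\<psi> \<in> PiE J B" for \<psi>
  proof -
    have Psub: "P a \<psi> \<subseteq> V a" "P c \<psi> \<subseteq> V c" using B_V aI by (auto simp: P_def)
    have disj: "P a \<psi> \<inter> P c \<psi> = {}" using Psub VV[of a c] aI by blast
    have PN: "P a \<psi> \<subseteq> {..<N}" "P c \<psi> \<subseteq> {..<N}" using Psub V_sub aI by blast+
    have "D \<psi> = edge_count E (P a \<psi>) (P c \<psi>) - p * card (P a \<psi>) * card (P c \<psi>)"
      unfolding D_def by (subst sum.swap) (rule sum_sum_minus_const; use PN finite_sub in blast)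
    then have "\<bar>D \<psi>\<bar> \<le> \<gamma> * p * max (card (P a \<psi>)) b * max (card (P c \<psi>)) b"
      using jumbled[OF PN disj] by simp
    also have "\<dots> = \<gamma> * p * (max (card (P a \<psi>)) b * max (card (P c \<psi>)) b)" by (simp only: mult.assoc)
    also have "\<dots> \<le> \<gamma> * p * q" unfolding q_def
    proof (intro mult_left_mono mult_mono P_card \<psi>)
      show "0 \<le> max (real (card (P c \<psi>))) b" by (simp add: le_max_iff_disj)
    qed (use \<gamma>_nonneg p_pos in auto)
    finally show ?thesis .
  qed
  have "(\<Sum>\<phi>\<in>PiE I B. of_bool (homs (insert (a, c) R) \<phi>)) - p * (\<Sum>\<phi>\<in>PiE I B. of_bool (homs R \<phi>))
    = (\<Sum>\<phi>\<in>PiE I B. of_bool (homs (insert (a, c) R) \<phi>) - p * of_bool (homs R \<phi>))"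
    by (simp only: sum_subtractf sum_distrib_left)
  also have "\<dots> = (\<Sum>\<psi>\<in>PiE J B. of_bool (homs RJ \<psi>) * D \<psi>)"
    by (simp only: split inner)
  finally have eq: "(\<Sum>\<phi>\<in>PiE I B. of_bool (homs (insert (a, c) R) \<phi>)) - p * (\<Sum>\<phi>\<in>PiE I B. of_bool (homs R \<phi>))
    = (\<Sum>\<psi>\<in>PiE J B. of_bool (homs RJ \<psi>) * D \<psi>)" .
  have finPJ: "finite (PiE J B)" using finJ finB JI by (intro finite_PiE) auto
  have "\<bar>\<Sum>\<psi>\<in>PiE J B. of_bool (homs RJ \<psi>) * D \<psi>\<bar> \<le> (\<Sum>\<psi>\<in>PiE J B. of_bool (\<psi> \<in> SJ) * (\<gamma> * p * q))"
  proof (rule order_trans[OF sum_abs], intro sum_mono)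
    fix \<psi> assume \<psi>: "\<psi> \<in> PiE J B"
    show "\<bar>of_bool (homs RJ \<psi>) * D \<psi>\<bar> \<le> of_bool (\<psi> \<in> SJ) * (\<gamma> * p * q)"
      using D_le[OF \<psi>] homJ[OF \<psi>] by (cases "\<psi> \<in> SJ") auto
  qed
  also have "\<dots> = real (card {\<psi>\<in>PiE J B. \<psi> \<in> SJ}) * (\<gamma> * p * q)"
    by (simp only: sum_distrib_right[symmetric] sum_of_bool_card[OF finPJ])
  also have "{\<psi>\<in>PiE J B. \<psi> \<in> SJ} = SJ" by (auto simp: SJ_def)
  also have "real (card SJ) * (\<gamma> * p * q) \<le> (\<Prod>i\<in>J. 8 * p ^ (t + card (bck i)) * N) * (\<gamma> * p * q)"
    using SJ_card \<gamma>_nonneg p_pos by (intro mult_right_mono) (auto simp: q_def)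
  also have "(\<Prod>i\<in>J. 8 * p ^ (t + card (bck i)) * N) = (8 * p ^ t * N) ^ card J * p ^ (\<Sum>i\<in>J. card (bck i))"
  proof -
    have "(\<Prod>i\<in>J. 8 * p ^ (t + card (bck i)) * N) = (\<Prod>i\<in>J. (8 * p ^ t * N) * p ^ card (bck i))"
      by (intro prod.cong refl) (simp add: power_add)
    then show ?thesis by (simp add: prod.distrib power_mult_distrib power_sum)
  qed
  also have "(8 * p ^ t * N) ^ card J * p ^ (\<Sum>i\<in>J. card (bck i)) * (\<gamma> * p * q)
     = \<gamma> * p * p ^ ((\<Sum>i\<in>J. card (bck i)) + card (nb a) + card (nb c)) * (8 * p ^ t * N) ^ (card J + 2)"
    unfolding q_def by (simp add: power_add power2_eq_square mult_ac)
  also have "\<dots> \<le> \<gamma> * p * p ^ card R * (8 * p ^ t * N) ^ (card J + 2)"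
    using exps p_pos p_le1 \<gamma>_nonneg by (intro mult_right_mono mult_left_mono power_decreasing) auto
  finally show ?thesis unfolding eq cardJ t_def by (simp add: mult_ac)
qed

end

context tuple_host
begin

text \<open>The pairs of \<open>R\<close> are removed one at a time. The error of each removal,
  times the factors \<open>p\<close> collected before, is the same, so the errors add up to
  \<open>card R\<close> copies.\<close>

lemma hom_count:
  assumes R: "R \<subseteq> {(j, i) \<in> I \<times> I. j < i}"
    and Y0: "Y0 \<subseteq> Y" "card Y0 \<le> 2"
    and B: "\<And>i. i \<in> I \<Longrightarrow> B i \<subseteq> {v\<in>V i. \<forall>y\<in>Y0. E y v}"
  shows "\<bar>\<Sum>\<phi>\<in>PiE I B. of_bool (homs R \<phi>) - p ^ card R\<bar> \<le> card R * (\<gamma> * p ^ card R * (8 * p ^ card Y0 * N) ^ card I)"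
proof -
  have "finite R" using R finite_I by (auto intro: finite_subset[of _ "I \<times> I"])
  then show ?thesis using R
  proof (induction R rule: finite_induct)
    case empty
    then show ?case by (simp add: homs_def)
  next
    case (insert x R)
    obtain a c where x: "x = (a, c)" by (cases x)
    let ?h = "\<lambda>R. \<Sum>\<phi>\<in>PiE I B. of_bool (homs R \<phi>) :: real"
    let ?e = "\<gamma> * p ^ (card R + 1) * (8 * p ^ card Y0 * N) ^ card I"
    have c: "card (insert x R) = card R + 1" using insert.hyps by simp
    have RI: "R \<subseteq> {(j, i) \<in> I \<times> I. j < i}" using insert.prems by blast
    have IH: "\<bar>\<Sum>\<phi>\<in>PiE I B. of_bool (homs R \<phi>) - p ^ card R\<bar> \<le> card R * (\<gamma> * p ^ card R * (8 * p ^ card Y0 * N) ^ card I)"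
      by (rule insert.IH[OF RI])
    have 1: "\<bar>?h (insert x R) - p * ?h R\<bar> \<le> ?e"
      using hom_remove_edge[OF insert.prems[unfolded x] insert.hyps(2)[unfolded x] Y0 B] unfolding x by blast
    have eq: "(\<Sum>\<phi>\<in>PiE I B. of_bool (homs R \<phi>) - p ^ card R) = ?h R - card (PiE I B) * p ^ card R" for R
      by (simp only: sum_subtractf sum_constant)
    have "\<bar>p * (?h R - card (PiE I B) * p ^ card R)\<bar> \<le> card R * ?e"
    proof -
      have "\<bar>p * (?h R - card (PiE I B) * p ^ card R)\<bar> = p * \<bar>?h R - card (PiE I B) * p ^ card R\<bar>"
        using p_pos by (simp add: abs_mult)
      also have "\<dots> \<le> p * (card R * (\<gamma> * p ^ card R * (8 * p ^ card Y0 * N) ^ card I))"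
        using IH unfolding eq using p_pos by (intro mult_left_mono) auto
      finally show ?thesis by (simp add: mult_ac)
    qed
    then have 2: "\<bar>p * ?h R - card (PiE I B) * p ^ (card R + 1)\<bar> \<le> card R * ?e"
      by (simp add: right_diff_distrib mult_ac)
    have "\<bar>?h (insert x R) - card (PiE I B) * p ^ (card R + 1)\<bar> \<le> ?e + card R * ?e" using 1 2 by linarith
    then show ?case unfolding eq unfolding c by (simp add: algebra_simps)
  qed
qed

text \<open>Tuples with pattern \<open>R\<close> are only about a fraction \<open>p ^ card R\<close>
  of all tuples, so \<open>variance_le\<close> cannot simply be restricted to them. Instead the
  indicator of the pattern is replaced by \<open>p ^ card R\<close> at the cost of
  \<open>\<xi>\<close>. Expanding the square weighted with \<open>\<xi>\<close> gives counts of
  tuples inside the neighbourhoods of at most two vertices of \<open>Y\<close>, which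
  \<open>hom_count\<close> estimates.\<close>

lemma hom_variance_le:
  assumes R: "R \<subseteq> {(j, i) \<in> I \<times> I. j < i}"
  shows "(\<Sum>\<phi>\<in>PiE I V. of_bool (homs R \<phi>) * (cnt I \<phi> - \<mu> I)\<^sup>2)
     \<le> (10 ^ d * err + 5 * (real d)\<^sup>2 * \<gamma> * (32 * z) ^ d) * p ^ card R * p ^ (2 * card I) * real M ^ (card I + 2)"
proof -
  define k where "k = card I"
  define \<xi> where "\<xi> \<phi> = of_bool (homs R \<phi>) - p ^ card R" for \<phi>
  define D where "D = card R * \<gamma> * p ^ card R * (8 * z) ^ k"
  have kd: "k \<le> d" using card_I by (simp add: k_def)
  have pp: "p ^ (2 * k) = p ^ k * p ^ k" by (simp only: mult_2 power_add)
  have R_le: "real (card R) \<le> d\<^sup>2"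
  proof -
    have "card R \<le> card (I \<times> I)" using R finite_I by (intro card_mono) auto
    also have "\<dots> = k * k" using finite_I by (simp add: k_def)
    also have "\<dots> \<le> d * d" using kd by (intro mult_mono) auto
    finally have "real (card R) \<le> real (d * d)" by (rule of_nat_mono)
    then show ?thesis by (simp add: power2_eq_square)
  qed
  have D0: "0 \<le> D" using \<gamma>_nonneg p_pos z_ge1 by (simp add: D_def)
  \<comment> \<open>Pays for the diagonal \<open>y = y'\<close> in \<open>S2\<close>, where one
    factor \<open>p ^ k\<close> is missing.\<close>
  have pMk: "1 \<le> p ^ k * M"
  proof -
    have "b \<le> \<omega> * (p ^ k * M)" using kd d_ge1 by (intro b_le_pow) linarith
    also have "\<dots> \<le> 1 * (p ^ k * M)" using \<omega>_le1 p_pos by (intro mult_right_mono) auto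
    finally show ?thesis using b_ge1 by simp
  qed
  \<comment> \<open>\<open>Q i\<close> will be a neighbourhood in the colour class. The error bound
    of \<open>hom_count\<close> asks only that it lie inside the host neighbourhood of
    \<open>Y0\<close>.\<close>
  have \<xi>_sum: "\<bar>\<Sum>\<phi>\<in>PiE I V. \<xi> \<phi> * of_bool (\<forall>i\<in>I. \<phi> i \<in> Q i)\<bar> \<le> D * (p ^ card Y0) ^ k * real M ^ k"
    if Y0: "Y0 \<subseteq> Y" "card Y0 \<le> 2" and Q: "\<And>i v. i \<in> I \<Longrightarrow> v \<in> V i \<Longrightarrow> v \<in> Q i \<Longrightarrow> \<forall>y\<in>Y0. E y v" for Y0 Q
  proof -
    have finP: "finite (PiE I V)" using finite_I finite_VY by (intro finite_PiE) auto
    have "(\<Sum>\<phi>\<in>PiE I V. \<xi> \<phi> * of_bool (\<forall>i\<in>I. \<phi> i \<in> Q i)) = (\<Sum>\<phi>\<in>{\<phi>\<in>PiE I V. \<forall>i\<in>I. \<phi> i \<in> Q i}. \<xi> \<phi>)"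
      using sum_of_bool_mult[OF finP, of "\<lambda>\<phi>. \<forall>i\<in>I. \<phi> i \<in> Q i" \<xi>] by (simp only: mult.commute)
    also have "{\<phi>\<in>PiE I V. \<forall>i\<in>I. \<phi> i \<in> Q i} = PiE I (\<lambda>i. V i \<inter> Q i)" by (auto simp: PiE_def Pi_def)
    finally have eq: "(\<Sum>\<phi>\<in>PiE I V. \<xi> \<phi> * of_bool (\<forall>i\<in>I. \<phi> i \<in> Q i)) = (\<Sum>\<phi>\<in>PiE I (\<lambda>i. V i \<inter> Q i). \<xi> \<phi>)" .
    have "\<bar>\<Sum>\<phi>\<in>PiE I (\<lambda>i. V i \<inter> Q i). \<xi> \<phi>\<bar> \<le> card R * (\<gamma> * p ^ card R * (8 * p ^ card Y0 * N) ^ card I)"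
      unfolding \<xi>_def using Q by (intro hom_count[OF R Y0]) auto
    also have "\<dots> \<le> card R * (\<gamma> * p ^ card R * (8 * p ^ card Y0 * (z * M)) ^ card I)"
      using N_le p_pos \<gamma>_nonneg by (intro mult_left_mono power_mono) auto
    also have "\<dots> = D * (p ^ card Y0) ^ k * real M ^ k"
      by (simp add: D_def k_def power_mult_distrib mult_ac)
    finally show ?thesis unfolding eq .
  qed
  have J: "joint I \<phi> y * joint I \<phi> y' = of_bool (\<forall>i\<in>I. \<phi> i \<in> {v. G v y \<and> G v y'})" for \<phi> y y'
    unfolding joint_def of_bool_conj[symmetric] by (rule arg_cong[of _ _ of_bool]) auto
  have GE: "E y v" if "i \<in> I" "v \<in> V i" "y \<in> Y" "G v y" for i v y using E_sym[OF G_sub[OF that]] .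
  define S0 where "S0 = (\<Sum>\<phi>\<in>PiE I V. \<xi> \<phi>)"
  define S1 where "S1 = (\<Sum>\<phi>\<in>PiE I V. \<xi> \<phi> * cnt I \<phi>)"
  define S2 where "S2 = (\<Sum>\<phi>\<in>PiE I V. \<xi> \<phi> * (cnt I \<phi>)\<^sup>2)"
  have S0: "\<bar>S0\<bar> \<le> D * real M ^ k"
    using \<xi>_sum[of "{}" "\<lambda>_. UNIV"] by (simp add: S0_def)
  have S1: "\<bar>S1\<bar> \<le> M * (D * p ^ k * real M ^ k)"
  proof -
    have "S1 = (\<Sum>y\<in>Y. \<Sum>\<phi>\<in>PiE I V. \<xi> \<phi> * joint I \<phi> y)"
      unfolding S1_def cnt_def sum_distrib_left by (rule sum.swap)
    also have "\<bar>\<dots>\<bar> \<le> (\<Sum>y\<in>Y. D * p ^ k * real M ^ k)"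
    proof (rule order_trans[OF sum_abs], intro sum_mono)
      fix y assume y: "y \<in> Y"
      have "joint I \<phi> y = of_bool (\<forall>i\<in>I. \<phi> i \<in> {v. G v y})" for \<phi> by (simp add: joint_def)
      then show "\<bar>\<Sum>\<phi>\<in>PiE I V. \<xi> \<phi> * joint I \<phi> y\<bar> \<le> D * p ^ k * real M ^ k"
        using \<xi>_sum[of "{y}" "\<lambda>_. {v. G v y}"] y GE by simp
    qed
    finally show ?thesis using card_Y by simp
  qed
  have S2: "\<bar>S2\<bar> \<le> 2 * D * p ^ (2 * k) * real M ^ (k + 2)"
  proof -
    have "S2 = (\<Sum>\<phi>\<in>PiE I V. \<Sum>y\<in>Y. \<Sum>y'\<in>Y. \<xi> \<phi> * (joint I \<phi> y * joint I \<phi> y'))"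
      unfolding S2_def cnt_def power2_eq_square sum_product by (simp only: sum_distrib_left)
    also have "\<dots> = (\<Sum>y\<in>Y. \<Sum>\<phi>\<in>PiE I V. \<Sum>y'\<in>Y. \<xi> \<phi> * (joint I \<phi> y * joint I \<phi> y'))"
      by (rule sum.swap)
    also have "\<dots> = (\<Sum>y\<in>Y. \<Sum>y'\<in>Y. \<Sum>\<phi>\<in>PiE I V. \<xi> \<phi> * (joint I \<phi> y * joint I \<phi> y'))"
      by (rule sum.cong[OF refl], rule sum.swap)
    finally have "\<bar>S2\<bar> \<le> (\<Sum>y\<in>Y. \<Sum>y'\<in>Y. \<bar>\<Sum>\<phi>\<in>PiE I V. \<xi> \<phi> * (joint I \<phi> y * joint I \<phi> y')\<bar>)"
      by (auto intro!: order_trans[OF sum_abs] sum_mono)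
    also have "\<dots> \<le> (\<Sum>y\<in>Y. \<Sum>y'\<in>Y. D * p ^ (2 * k) * real M ^ k + of_bool (y = y') * (D * p ^ k * real M ^ k))"
    proof (intro sum_mono)
      fix y y' assume y: "y \<in> Y" "y' \<in> Y"
      have "\<bar>\<Sum>\<phi>\<in>PiE I V. \<xi> \<phi> * (joint I \<phi> y * joint I \<phi> y')\<bar> \<le> D * (p ^ card {y, y'}) ^ k * real M ^ k"
        unfolding J using y GE by (intro \<xi>_sum) (auto simp: card_insert_if)
      moreover have "0 \<le> D * p ^ (2 * k) * real M ^ k" using D0 p_pos by simp
      ultimately show "\<bar>\<Sum>\<phi>\<in>PiE I V. \<xi> \<phi> * (joint I \<phi> y * joint I \<phi> y')\<bar>
          \<le> D * p ^ (2 * k) * real M ^ k + of_bool (y = y') * (D * p ^ k * real M ^ k)"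
        by (cases "y = y'") (simp_all add: power_mult power2_eq_square)
    qed
    also have "\<dots> = M * (M * (D * p ^ (2 * k) * real M ^ k)) + M * (D * p ^ k * real M ^ k)"
      using finite_VY card_Y by (simp add: sum.distrib sum_distrib_right[symmetric] of_bool_def distrib_left del: sum_of_bool_eq)
    also have "\<dots> \<le> M * (M * (D * p ^ (2 * k) * real M ^ k)) + M * (D * p ^ k * real M ^ k) * (p ^ k * M)"
      using pMk D0 p_pos mult_left_mono[OF pMk, of "M * (D * p ^ k * real M ^ k)"] by simp
    also have "\<dots> = 2 * D * p ^ (2 * k) * real M ^ (k + 2)"
      unfolding pp power_add power2_eq_square by algebra
    finally show ?thesis .
  qed
  have \<mu>0: "0 \<le> \<mu> I" "\<mu> I \<le> 2 ^ k * p ^ k * M"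
  proof -
    have "0 \<le> (\<Prod>i\<in>I. \<alpha> i)" using \<alpha>_nonneg by (intro prod_nonneg) auto
    moreover have "(\<Prod>i\<in>I. \<alpha> i) \<le> (\<Prod>i\<in>I. 2)" using \<alpha>_nonneg \<alpha>_le2 by (intro prod_mono) auto
    ultimately show "0 \<le> \<mu> I" "\<mu> I \<le> 2 ^ k * p ^ k * M"
      using p_pos by (auto simp: \<mu>_def k_def intro!: mult_right_mono)
  qed
  define Q where "Q = p ^ (2 * k) * real M ^ (k + 2)"
  have Q0: "0 \<le> Q" using p_pos by (simp add: Q_def)
  have sq: "(\<mu> I)\<^sup>2 \<le> (2 ^ k * p ^ k * M)\<^sup>2" using \<mu>0 by (intro power_mono) auto
  have "(\<Sum>\<phi>\<in>PiE I V. \<xi> \<phi> * (cnt I \<phi> - \<mu> I)\<^sup>2) =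
     (\<Sum>\<phi>\<in>PiE I V. \<xi> \<phi> * (cnt I \<phi>)\<^sup>2 - (2 * \<mu> I) * (\<xi> \<phi> * cnt I \<phi>) + (\<mu> I)\<^sup>2 * \<xi> \<phi>)"
    by (intro sum.cong refl) (simp add: power2_eq_square algebra_simps)
  also have "\<dots> = S2 - (2 * \<mu> I) * S1 + (\<mu> I)\<^sup>2 * S0"
    unfolding S0_def S1_def S2_def by (simp only: sum.distrib sum_subtractf sum_distrib_left)
  also have "\<dots> \<le> \<bar>S2\<bar> + (2 * \<mu> I) * \<bar>S1\<bar> + (\<mu> I)\<^sup>2 * \<bar>S0\<bar>"
  proof -
    have "(2 * \<mu> I) * (- S1) \<le> (2 * \<mu> I) * \<bar>S1\<bar>" using \<mu>0 by (intro mult_left_mono) auto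
    moreover have "(\<mu> I)\<^sup>2 * S0 \<le> (\<mu> I)\<^sup>2 * \<bar>S0\<bar>" by (intro mult_left_mono) auto
    moreover have "S2 \<le> \<bar>S2\<bar>" by simp
    ultimately show ?thesis by (simp only: mult_minus_right)
  qed
  also have "\<dots> \<le> 2 * D * p ^ (2 * k) * real M ^ (k + 2)
      + (2 * (2 ^ k * p ^ k * M)) * (M * (D * p ^ k * real M ^ k)) + (2 ^ k * p ^ k * M)\<^sup>2 * (D * real M ^ k)"
    using \<mu>0 p_pos by (intro add_mono mult_mono S0 S1 S2 sq) auto
  also have "\<dots> = D * (2 + 2 * 2 ^ k + 2 ^ k * 2 ^ k) * Q"
    unfolding Q_def pp power_add power2_eq_square by algebra
  also have "\<dots> \<le> D * (5 * 4 ^ k) * Q"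
  proof -
    have "(1::real) \<le> 2 ^ k" by simp
    then have "(2::real) ^ k \<le> 2 ^ k * 2 ^ k" by simp
    moreover have "(2::real) ^ k * 2 ^ k = 4 ^ k" by (simp flip: power_mult_distrib)
    ultimately have "(2::real) + 2 * 2 ^ k + 2 ^ k * 2 ^ k \<le> 5 * 4 ^ k" using \<open>1 \<le> 2 ^ k\<close> by linarith
    then show ?thesis using D0 Q0 by (intro mult_right_mono mult_left_mono) auto
  qed
  also have "\<dots> \<le> 5 * (real d)\<^sup>2 * \<gamma> * (32 * z) ^ d * p ^ card R * Q"
  proof -
    have "D * (5 * 4 ^ k) = 5 * real (card R) * \<gamma> * (32 * z) ^ k * p ^ card R"
    proof -
      have "(32 * z) ^ k = (4 * (8 * z)) ^ k" by simp
      also have "\<dots> = 4 ^ k * (8 * z) ^ k" by (rule power_mult_distrib)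
      finally show ?thesis by (simp only: D_def mult_ac)
    qed
    also have "\<dots> \<le> 5 * (real d)\<^sup>2 * \<gamma> * (32 * z) ^ d * p ^ card R"
      using R_le \<gamma>_nonneg p_pos z_ge1 kd by (intro mult_right_mono mult_mono power_increasing) auto
    finally show ?thesis using Q0 by (intro mult_right_mono) auto
  qed
  finally have A: "(\<Sum>\<phi>\<in>PiE I V. \<xi> \<phi> * (cnt I \<phi> - \<mu> I)\<^sup>2) \<le> 5 * (real d)\<^sup>2 * \<gamma> * (32 * z) ^ d * p ^ card R * Q" .
  have "(\<Sum>\<phi>\<in>PiE I V. (cnt I \<phi> - \<mu> I)\<^sup>2) \<le> 10 ^ k * err * Q"
    using variance_le[OF subset_refl] by (simp add: k_def Q_def mult.assoc)
  also have "\<dots> \<le> 10 ^ d * err * Q"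
    using kd err_nonneg Q0 by (intro mult_right_mono power_increasing) auto
  finally have B: "p ^ card R * (\<Sum>\<phi>\<in>PiE I V. (cnt I \<phi> - \<mu> I)\<^sup>2) \<le> p ^ card R * (10 ^ d * err * Q)"
    using p_pos by (intro mult_left_mono) auto
  have "(\<Sum>\<phi>\<in>PiE I V. of_bool (homs R \<phi>) * (cnt I \<phi> - \<mu> I)\<^sup>2) =
      (\<Sum>\<phi>\<in>PiE I V. \<xi> \<phi> * (cnt I \<phi> - \<mu> I)\<^sup>2 + p ^ card R * (cnt I \<phi> - \<mu> I)\<^sup>2)"
    by (intro sum.cong refl) (simp add: \<xi>_def algebra_simps)
  also have "\<dots> \<le> 5 * (real d)\<^sup>2 * \<gamma> * (32 * z) ^ d * p ^ card R * Q + p ^ card R * (10 ^ d * err * Q)"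
    using A B by (simp only: sum.distrib sum_distrib_left[symmetric])
  also have "\<dots> = (10 ^ d * err + 5 * (real d)\<^sup>2 * \<gamma> * (32 * z) ^ d) * p ^ card R * Q" by (simp add: algebra_simps)
  finally show ?thesis by (simp add: Q_def k_def mult.assoc)
qed

text \<open>Chebyshev's inequality for the second moment in \<open>hom_variance_le\<close>.\<close>

lemma card_deviating_homs_le:
  assumes R: "R \<subseteq> {(j, i) \<in> I \<times> I. j < i}" and \<theta>: "0 < \<theta>"
    and \<eta>: "10 ^ d * err + 5 * (real d)\<^sup>2 * \<gamma> * (32 * z) ^ d \<le> \<eta> * \<theta>\<^sup>2"
    and M: "0 < M"
  shows "real (card {\<phi>\<in>PiE I V. homs R \<phi> \<and> \<theta> * p ^ card I * M \<le> \<bar>cnt I \<phi> - \<mu> I\<bar>}) \<le> \<eta> * p ^ card R * real M ^ card I"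
proof -
  let ?S = "{\<phi>\<in>PiE I V. homs R \<phi> \<and> \<theta> * p ^ card I * M \<le> \<bar>cnt I \<phi> - \<mu> I\<bar>}"
  define m where "m = (\<theta> * p ^ card I * M)\<^sup>2"
  have m0: "0 < m" using \<theta> p_pos M by (simp add: m_def)
  have finP: "finite (PiE I V)" using finite_I finite_VY by (intro finite_PiE) auto
  have "real (card ?S) * m = (\<Sum>\<phi>\<in>PiE I V. of_bool (homs R \<phi> \<and> \<theta> * p ^ card I * M \<le> \<bar>cnt I \<phi> - \<mu> I\<bar>) * m)"
    by (simp only: sum_distrib_right[symmetric] sum_of_bool_card[OF finP])
  also have "\<dots> \<le> (\<Sum>\<phi>\<in>PiE I V. of_bool (homs R \<phi>) * (cnt I \<phi> - \<mu> I)\<^sup>2)"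
  proof (intro sum_mono)
    fix \<phi>
    show "of_bool (homs R \<phi> \<and> \<theta> * p ^ card I * M \<le> \<bar>cnt I \<phi> - \<mu> I\<bar>) * m \<le> of_bool (homs R \<phi>) * (cnt I \<phi> - \<mu> I)\<^sup>2"
    proof (cases "homs R \<phi> \<and> \<theta> * p ^ card I * M \<le> \<bar>cnt I \<phi> - \<mu> I\<bar>")
      case True
      then have "m \<le> \<bar>cnt I \<phi> - \<mu> I\<bar>\<^sup>2" unfolding m_def using \<theta> p_pos by (intro power_mono) auto
      then show ?thesis using True by simp
    qed auto
  qed
  also have "\<dots> \<le> (10 ^ d * err + 5 * (real d)\<^sup>2 * \<gamma> * (32 * z) ^ d) * (p ^ card R * p ^ (2 * card I) * real M ^ (card I + 2))"
    using hom_variance_le[OF R] by (simp only: mult.assoc)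
  also have "\<dots> \<le> (\<eta> * \<theta>\<^sup>2) * (p ^ card R * p ^ (2 * card I) * real M ^ (card I + 2))"
    using \<eta> p_pos by (intro mult_right_mono) auto
  also have "\<dots> = (\<eta> * p ^ card R * real M ^ card I) * m"
    by (simp add: m_def power_mult_distrib power_add power_mult[symmetric] mult_ac power2_eq_square[of "real M"])
  finally show ?thesis using m0 by simp
qed

end

section \<open>Embedding along a degenerate order\<close>

text \<open>Each condition shrinks the set by the factor \<open>q\<close> while it is larger than
  \<open>b\<close>; below that size the claimed bound absorbs the maximum, because
  \<open>b \<le> q ^ k * \<beta>\<close> at every stage but the last.\<close>

lemma card_iterated_shrink:
  fixes A :: "nat set" and q b \<beta> :: real
  assumes "finite A" and D: "finite D" "real (card D) \<le> \<beta>" and q: "0 \<le> q"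
    and "\<And>k. k < card A \<Longrightarrow> b \<le> q ^ k * \<beta>"
    and "\<And>m. m \<in> A \<Longrightarrow> real (card {v\<in>D. (\<forall>i\<in>A. i < m \<longrightarrow> P i v) \<and> P m v})
       \<le> q * max (card {v\<in>D. \<forall>i\<in>A. i < m \<longrightarrow> P i v}) b"
  shows "real (card {v\<in>D. \<forall>i\<in>A. P i v}) \<le> q ^ card A * \<beta>"
  using assms(1,5,6)
proof (induction A rule: finite_linorder_max_induct)
  case empty
  then show ?case using D by simp
next
  case (insert m A)
  have m: "m \<notin> A" using insert.hyps by auto
  have c: "card (insert m A) = card A + 1" using m insert.hyps(1) by simp
  have IH: "real (card {v\<in>D. \<forall>i\<in>A. P i v}) \<le> q ^ card A * \<beta>"
  proof (rule insert.IH)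
    show "b \<le> q ^ k * \<beta>" if "k < card A" for k using insert.prems(1)[of k] that c by simp
    fix m' assume m': "m' \<in> A"
    have "(\<forall>i\<in>insert m A. i < m' \<longrightarrow> P i v) = (\<forall>i\<in>A. i < m' \<longrightarrow> P i v)" for v
      using insert.hyps(2) m' by force
    then show "real (card {v\<in>D. (\<forall>i\<in>A. i < m' \<longrightarrow> P i v) \<and> P m' v})
       \<le> q * max (card {v\<in>D. \<forall>i\<in>A. i < m' \<longrightarrow> P i v}) b"
      using insert.prems(2)[of m'] m' by simp
  qed
  have eq: "(\<forall>i\<in>insert m A. i < m \<longrightarrow> P i v) = (\<forall>i\<in>A. P i v)" for v
    using insert.hyps(2) by force
  have "b \<le> q ^ card A * \<beta>" using insert.prems(1)[of "card A"] c by simp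
  then have mx: "max (real (card {v\<in>D. \<forall>i\<in>A. P i v})) b \<le> q ^ card A * \<beta>" using IH by simp
  have "{v\<in>D. \<forall>i\<in>insert m A. P i v} = {v\<in>D. (\<forall>i\<in>A. P i v) \<and> P m v}" by auto
  then have "real (card {v\<in>D. \<forall>i\<in>insert m A. P i v}) \<le> q * max (card {v\<in>D. \<forall>i\<in>A. P i v}) b"
    using insert.prems(2)[of m] by (simp only: eq insertI1)
  also have "\<dots> \<le> q * (q ^ card A * \<beta>)" using mx q by (rule mult_left_mono)
  finally show ?case unfolding c by simp
qed

lemma card_markov:
  fixes w :: "'a \<Rightarrow> real"
  assumes "finite A" "\<And>v. v \<in> A \<Longrightarrow> 0 \<le> w v" "(\<Sum>v\<in>A. w v) \<le> s" "0 < t"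
  shows "real (card {v\<in>A. w v > t}) \<le> s / t"
proof -
  have "real (card {v\<in>A. w v > t}) * t = (\<Sum>v\<in>{v\<in>A. w v > t}. t)" by simp
  also have "\<dots> \<le> (\<Sum>v\<in>{v\<in>A. w v > t}. w v)" by (intro sum_mono) auto
  also have "\<dots> \<le> (\<Sum>v\<in>A. w v)" using assms by (intro sum_mono2) auto
  also have "\<dots> \<le> s" by (rule assms)
  finally show ?thesis using assms(4) by (simp add: field_simps)
qed

text \<open>A set of at most \<open>d\<close> elements is encoded by a list of length
  \<open>d\<close>, padded with the extra symbol \<open>N\<close>.\<close>

lemma card_small_subsets_le: "real (card {S. S \<subseteq> {..<N::nat} \<and> card S \<le> d}) \<le> (real N + 1) ^ d"
proof -
  let ?L = "{xs. set xs \<subseteq> {..N} \<and> length xs = d}"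
  have fin: "finite ?L" by (rule finite_lists_length_eq) simp
  have "{S. S \<subseteq> {..<N} \<and> card S \<le> d} \<subseteq> (\<lambda>xs. set xs - {N}) ` ?L"
  proof
    fix S assume "S \<in> {S. S \<subseteq> {..<N} \<and> card S \<le> d}"
    then have S: "S \<subseteq> {..<N}" "card S \<le> d" by auto
    then have "finite S" using finite_subset by blast
    then obtain ys where ys: "set ys = S" "distinct ys" using finite_distinct_list by blast
    let ?xs = "ys @ replicate (d - card S) N"
    have "length ?xs = d" using ys S distinct_card[OF ys(2)] by simp
    moreover have "set ?xs \<subseteq> {..N}" using S ys by (auto simp: set_replicate_conv_if)
    moreover have "set ?xs - {N} = S" using S ys by (auto simp: set_replicate_conv_if)
    ultimately show "S \<in> (\<lambda>xs. set xs - {N}) ` ?L" by (intro image_eqI[of _ _ ?xs]) auto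
  qed
  then have "card {S. S \<subseteq> {..<N} \<and> card S \<le> d} \<le> card ((\<lambda>xs. set xs - {N}) ` ?L)"
    using fin by (intro card_mono) auto
  also have "\<dots> \<le> card ?L" by (rule card_image_le[OF fin])
  also have "\<dots> = (N + 1) ^ d" by (subst card_lists_length_eq) auto
  finally have "real (card {S. S \<subseteq> {..<N} \<and> card S \<le> d}) \<le> real ((N + 1) ^ d)" by (rule of_nat_mono)
  then show ?thesis by (simp add: add.commute)
qed

text \<open>
  \<open>T x\<close> is the set of neighbours of \<open>x < n\<close> that precede it in a degenerate order of the graph to be
  embedded, \<open>V x\<close> the part of the host into which \<open>x\<close> is mapped, \<open>E\<close> the host and \<open>G\<close> one colour class.
  Parts may coincide for vertices that are at distance more than two.
\<close>

locale embedding = jumbled_graph E N d p b \<gamma>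
  for E :: "nat \<Rightarrow> nat \<Rightarrow> bool" and N d :: nat and p b \<gamma> :: real +
  fixes G :: "nat \<Rightarrow> nat \<Rightarrow> bool" and n M \<Delta> :: nat and T V :: "nat \<Rightarrow> nat set" and a z \<omega> \<eta> K :: real
  assumes G_E: "G x y \<Longrightarrow> E x y"
    and T_sub: "x < n \<Longrightarrow> T x \<subseteq> {..<x}" and card_T: "x < n \<Longrightarrow> card (T x) \<le> d"
    and degree_le: "u < n \<Longrightarrow> card {x\<in>{..<n}. u \<in> T x} \<le> \<Delta>"
    and V_sub: "x < n \<Longrightarrow> V x \<subseteq> {..<N}"
    and V_disj: "x < n \<Longrightarrow> i \<in> insert x (T x) \<Longrightarrow> j \<in> insert x (T x) \<Longrightarrow> i \<noteq> j \<Longrightarrow> V i \<inter> V j = {}"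
    and N_le: "real N \<le> z * M" and z_ge1: "1 \<le> z" and d_ge1: "1 \<le> d" and \<Delta>_ge1: "1 \<le> \<Delta>" and M_ge1: "1 \<le> M"
    and \<omega>_nonneg: "0 \<le> \<omega>" and b_le: "b \<le> \<omega> * p ^ (2 * d - 1) * M"
    and a_pos: "0 < a"
    and few_bad: "x < n \<Longrightarrow>
      real (card {\<phi>\<in>PiE (T x) V. (\<forall>i\<in>T x. \<forall>j\<in>T i. j \<in> T x \<longrightarrow> E (\<phi> j) (\<phi> i)) \<and>
         (real (card {y\<in>V x. \<forall>i\<in>T x. G (\<phi> i) y}) < a * p ^ card (T x) * M \<or>
          real (card {y\<in>V x. \<forall>i\<in>T x. E (\<phi> i) y}) > 2 * p ^ card (T x) * M)})
      \<le> \<eta> * (\<Prod>i\<in>T x. p ^ card (T i \<inter> T x) * M)"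
    and \<eta>_pos: "0 < \<eta>" and K_ge1: "1 \<le> K" and K\<eta>: "K ^ (d + d * d) * \<eta> < 1"
    and K_ge: "2 ^ (d + 4) * (\<Delta> + \<Delta> * \<Delta>) \<le> K * a"
    and \<omega>_small: "2 * d * \<omega> * (8 * z) ^ d \<le> \<eta>" and \<omega>_le1: "\<omega> \<le> 1"
    and room: "k \<le> d \<Longrightarrow> d * ln (real N + 1) + d * \<Delta> + 64 * z / a * p ^ k * n \<le> a / 2 * p ^ k * M"
begin

text \<open>Too few candidates in the colour class would stop the embedding; too many in the host
  would spoil the averages, which are sums over host candidates.\<close>

definition bad :: "nat \<Rightarrow> (nat \<Rightarrow> nat) \<Rightarrow> bool" where
  "bad x \<phi> \<longleftrightarrow> real (card {y\<in>V x. \<forall>i\<in>T x. G (\<phi> i) y}) < a * p ^ card (T x) * M \<or>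
          real (card {y\<in>V x. \<forall>i\<in>T x. E (\<phi> i) y}) > 2 * p ^ card (T x) * M"

text \<open>
  When the vertices below \<open>u\<close> are embedded by \<open>f\<close>, the set \<open>W x u f\<close> collects the bad ways to complete the
  images of \<open>T x\<close>. Only the host edges \<open>E\<close> are required of the completion, so that \<open>Norm x u\<close> is
  its expected size up to a constant factor. The bound on \<open>W x u f\<close> loses a factor \<open>K\<close> only in the
  \<open>aff x u\<close> steps that embed a vertex of \<open>T x\<close> or an earlier neighbour of one.
\<close>

definition W :: "nat \<Rightarrow> nat \<Rightarrow> (nat \<Rightarrow> nat) \<Rightarrow> (nat \<Rightarrow> nat) set" where
  "W x u f = {\<phi>\<in>PiE (T x) V. (\<forall>i\<in>T x. i < u \<longrightarrow> \<phi> i = f i) \<and>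
     (\<forall>i\<in>T x. \<forall>j\<in>T i. (j \<in> T x \<longrightarrow> E (\<phi> j) (\<phi> i)) \<and> (j < u \<longrightarrow> E (f j) (\<phi> i))) \<and> bad x \<phi>}"

text \<open>The neighbours that constrain the image of \<open>i\<close> at present: those already
  embedded, and those in \<open>T x\<close>, whose images belong to the same completion. Each costs
  a factor \<open>p\<close>.\<close>

definition pend :: "nat \<Rightarrow> nat \<Rightarrow> nat \<Rightarrow> nat set" where
  "pend x u i = {j\<in>T i. j < u \<or> j \<in> T x}"

definition Norm :: "nat \<Rightarrow> nat \<Rightarrow> real" where
  "Norm x u = (\<Prod>i\<in>{i\<in>T x. u \<le> i}. p ^ card (pend x u i) * M)"

definition touched :: "nat \<Rightarrow> nat set" where "touched x = T x \<union> (\<Union>i\<in>T x. T i)"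

definition aff :: "nat \<Rightarrow> nat \<Rightarrow> nat" where "aff x u = card (touched x \<inter> {..<u})"

definition partial :: "nat \<Rightarrow> (nat \<Rightarrow> nat) \<Rightarrow> bool" where
  "partial u f \<longleftrightarrow> (\<forall>i<u. f i \<in> V i) \<and> (\<forall>i<u. \<forall>j\<in>T i. G (f j) (f i))"

lemma finite_T: "x < n \<Longrightarrow> finite (T x)" using T_sub finite_subset by fastforce

lemma T_less: "x < n \<Longrightarrow> i \<in> T x \<Longrightarrow> i < x" using T_sub by auto

lemma finite_V: "x < n \<Longrightarrow> finite (V x)" using V_sub finite_sub by blast

lemma V_mem: "x < n \<Longrightarrow> v \<in> V x \<Longrightarrow> v < N" using V_sub by auto

lemma finite_W: "x < n \<Longrightarrow> finite (W x u f)"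
proof -
  assume x: "x < n"
  have "finite (PiE (T x) V)"
    using finite_T[OF x] finite_V T_less[OF x] x by (intro finite_PiE) (auto intro: less_trans)
  then show ?thesis by (simp add: W_def)
qed

lemma finite_touched: "x < n \<Longrightarrow> finite (touched x)"
  unfolding touched_def using finite_T T_less by (auto intro: less_trans)

lemma Norm_pos: "0 < Norm x u" unfolding Norm_def using p_pos M_ge1 by (intro prod_pos) auto

lemma b_le_pow: "k \<le> 2 * d - 1 \<Longrightarrow> b \<le> \<omega> * (p ^ k * M)"
proof -
  assume "k \<le> 2 * d - 1"
  then have "p ^ (2 * d - 1) \<le> p ^ k" using p_pos p_le1 by (intro power_decreasing) auto
  then have "\<omega> * (p ^ (2 * d - 1) * M) \<le> \<omega> * (p ^ k * M)"
    using \<omega>_nonneg by (intro mult_left_mono mult_right_mono) auto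
  then show ?thesis using b_le by (simp add: mult.assoc)
qed

lemma aff_le: "x < n \<Longrightarrow> aff x u \<le> d + d * d"
proof -
  assume x: "x < n"
  have "aff x u \<le> card (touched x)" unfolding aff_def using finite_touched[OF x] by (intro card_mono) auto
  also have "\<dots> \<le> card (T x) + card (\<Union>i\<in>T x. T i)" unfolding touched_def by (rule card_Un_le)
  also have "card (\<Union>i\<in>T x. T i) \<le> (\<Sum>i\<in>T x. card (T i))" by (rule card_UN_le[OF finite_T[OF x]])
  also have "\<dots> \<le> (\<Sum>i\<in>T x. d)" using card_T T_less[OF x] x by (intro sum_mono) (auto intro: less_trans)
  also have "\<dots> = card (T x) * d" by simp
  also have "\<dots> \<le> d * d" using card_T[OF x] by simp
  finally show ?thesis using card_T[OF x] by linarith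
qed

lemma pend_card: "i < n \<Longrightarrow> card (pend x u i) \<le> d"
proof -
  assume i: "i < n"
  have "card (pend x u i) \<le> card (T i)" unfolding pend_def using finite_T[OF i] by (intro card_mono) auto
  then show ?thesis using card_T[OF i] by simp
qed

lemma untouched:
  assumes "x < n" "u < x" "u \<notin> touched x"
  shows "W x (Suc u) (f(u := v)) = W x u f" "Norm x (Suc u) = Norm x u" "aff x (Suc u) = aff x u"
proof -
  have u: "u \<notin> T x" "\<And>i. i \<in> T x \<Longrightarrow> u \<notin> T i" using assms(3) by (auto simp: touched_def)
  have 1: "i \<in> T x \<Longrightarrow> (i < Suc u) = (i < u)" for i using u(1) by (auto simp: less_Suc_eq)
  have 2: "i \<in> T x \<Longrightarrow> j \<in> T i \<Longrightarrow> (j < Suc u) = (j < u)" for i j using u(2) by (auto simp: less_Suc_eq)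
  have 3: "i \<in> T x \<Longrightarrow> (Suc u \<le> i) = (u \<le> i)" for i using u(1) by (metis Suc_leD le_antisym not_less_eq_eq)
  have eq: "(f(u := v)) i = f i" if "i < u" for i using that by simp
  show "W x (Suc u) (f(u := v)) = W x u f"
    unfolding W_def by (intro Collect_cong conj_cong refl ball_cong) (use 1 2 eq in \<open>auto\<close>)
  have pe: "i \<in> T x \<Longrightarrow> pend x (Suc u) i = pend x u i" for i unfolding pend_def using 2 by blast
  show "Norm x (Suc u) = Norm x u" unfolding Norm_def using 3 pe by (intro prod.cong) auto
  show "aff x (Suc u) = aff x u"
    unfolding aff_def using assms(3) by (intro arg_cong[of _ _ card]) (auto simp: less_Suc_eq)
qed

lemma aff_touched: "x < n \<Longrightarrow> u \<in> touched x \<Longrightarrow> aff x (Suc u) = Suc (aff x u)"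
proof -
  assume "x < n" "u \<in> touched x"
  then have "touched x \<inter> {..<Suc u} = insert u (touched x \<inter> {..<u})" by (auto simp: less_Suc_eq)
  then show ?thesis unfolding aff_def using finite_touched[OF \<open>x < n\<close>] by simp
qed

text \<open>Completions after different choices \<open>v\<close> differ at \<open>u\<close>, so they
  are disjoint parts of the old set of completions. The factor lost by \<open>Norm\<close> is, up to
  a constant, the number of candidates for \<open>u\<close>; hence the average proportion of bad
  completions grows by a constant factor only.\<close>

lemma sum_W_member:
  assumes x: "x < n" and u: "u \<in> T x"
  shows "(\<Sum>v\<in>V u. real (card (W x (Suc u) (f(u := v))))) \<le> card (W x u f)"
    and "Norm x u = Norm x (Suc u) * (p ^ card (T u) * M)"
proof -
  have un: "u < n" using T_less[OF x u] x by simp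
  have sub: "W x (Suc u) (f(u := v)) \<subseteq> {\<phi>\<in>W x u f. \<phi> u = v}" for v
  proof
    fix \<phi> assume \<phi>: "\<phi> \<in> W x (Suc u) (f(u := v))"
    have "\<phi> u = v" using \<phi> u by (auto simp: W_def)
    moreover have "\<phi> i = f i" if "i \<in> T x" "i < u" for i
      using \<phi> that by (auto simp: W_def)
    moreover have "E (f j) (\<phi> i)" if "i \<in> T x" "j \<in> T i" "j < u" for i j
    proof -
      have "j < Suc u \<longrightarrow> E ((f(u := v)) j) (\<phi> i)" using \<phi> that(1,2) unfolding W_def by blast
      then show ?thesis using that(3) by simp
    qed
    ultimately show "\<phi> \<in> {\<phi>\<in>W x u f. \<phi> u = v}" using \<phi> by (auto simp: W_def)
  qed
  have "(\<Sum>v\<in>V u. card (W x (Suc u) (f(u := v)))) \<le> (\<Sum>v\<in>V u. card {\<phi>\<in>W x u f. \<phi> u = v})"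
    using sub finite_W[OF x] by (intro sum_mono card_mono) auto
  also have "\<dots> = card (\<Union>v\<in>V u. {\<phi>\<in>W x u f. \<phi> u = v})"
    using finite_W[OF x] finite_V[OF un] by (subst card_UN_disjoint) auto
  also have "\<dots> \<le> card (W x u f)" using finite_W[OF x] by (intro card_mono) auto
  finally have "real (\<Sum>v\<in>V u. card (W x (Suc u) (f(u := v)))) \<le> card (W x u f)" by (rule of_nat_mono)
  then show "(\<Sum>v\<in>V u. real (card (W x (Suc u) (f(u := v))))) \<le> card (W x u f)" by simp
  have Q: "{i\<in>T x. u \<le> i} = insert u {i\<in>T x. Suc u \<le> i}" using u by auto
  have pe: "pend x u i = pend x (Suc u) i" for i unfolding pend_def using u by (auto simp: less_Suc_eq)
  have pu: "pend x u u = T u" unfolding pend_def using T_less[OF un] by auto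
  show "Norm x u = Norm x (Suc u) * (p ^ card (T u) * M)"
    unfolding Norm_def Q using finite_T[OF x] pu by (subst prod.insert) (auto simp: pe[symmetric] pu)
qed

text \<open>Choosing coordinates in order, the one at \<open>m\<close> has at most \<open>b\<close>
  values by \<open>card_large_nbrs_le\<close>, since \<open>D\<close> depends on earlier coordinates
  only. For a saving, \<open>b\<close> has to be small against the usual
  \<open>p ^ card (pend x u m) * M\<close>, and also against the power of \<open>p\<close> by which
  \<open>Norm\<close> drops when \<open>u\<close> is embedded. The exponents add up to at most
  \<open>d + (d - 1)\<close>, which is the origin of \<open>2 * d - 1\<close> in the assumption on
  \<open>b\<close>.\<close>

lemma card_W_exceptional:
  assumes x: "x < n" and u: "u < x" "u \<notin> T x" and f: "partial u f"
    and D: "\<And>\<phi>. D \<phi> \<subseteq> V u" and m: "m \<in> T x" "u \<in> T m"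
    and dep: "\<And>\<phi> \<psi>. (\<forall>j\<in>T x. j < m \<longrightarrow> \<phi> j = \<psi> j) \<Longrightarrow> D \<phi> = D \<psi>"
  shows "real (card {\<phi>\<in>W x u f. real (card {v\<in>D \<phi>. E (\<phi> m) v}) > 2 * p * max (card (D \<phi>)) b})
     \<le> \<omega> * p ^ card {i\<in>T x. u \<in> T i} * (8 * z) ^ d * Norm x u"
proof -
  let ?S = "{\<phi>\<in>W x u f. real (card {v\<in>D \<phi>. E (\<phi> m) v}) > 2 * p * max (card (D \<phi>)) b}"
  \<comment> \<open>Below \<open>u\<close> there is no choice, as those coordinates are prescribed
    by \<open>f\<close>.\<close>
  define c where "c i = (if i < u then 1 else if i = m then b else 8 * p ^ card (pend x u i) * N)" for i
  have in_n: "i \<in> T x \<Longrightarrow> i < n" for i using T_less[OF x] x by (auto intro: less_trans)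
  have um: "u < m" using T_less[OF in_n[OF m(1)] m(2)] .
  have "real (card ?S) \<le> (\<Prod>i\<in>T x. c i)"
  proof (rule card_PiE_sequential[OF finite_T[OF x]])
    show "?S \<subseteq> PiE (T x) V" by (auto simp: W_def)
    show "i \<in> T x \<Longrightarrow> finite (V i)" for i using in_n finite_V by blast
    show "i \<in> T x \<Longrightarrow> 0 \<le> c i" for i using b_ge1 p_pos by (simp add: c_def)
    fix i \<psi> assume i: "i \<in> T x" and \<psi>: "\<psi> \<in> ?S"
    let ?A = "{\<phi> i |\<phi>. \<phi> \<in> ?S \<and> (\<forall>j\<in>T x. j < i \<longrightarrow> \<phi> j = \<psi> j)}"
    consider "i < u" | "\<not> i < u" "i = m" | "\<not> i < u" "i \<noteq> m" by blast
    then show "real (card ?A) \<le> c i"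
    proof cases
      case 1
      have "?A \<subseteq> {f i}" using i 1 by (auto simp: W_def)
      then have "card ?A \<le> card {f i}" by (intro card_mono) auto
      then show ?thesis using 1 by (simp add: c_def)
    next
      case 2
      have "?A \<subseteq> {w\<in>V m. real (card {v\<in>D \<psi>. E w v}) > 2 * p * max (card (D \<psi>)) b}"
      proof
        fix w assume "w \<in> ?A"
        then obtain \<phi> where \<phi>: "w = \<phi> m" "\<phi> \<in> W x u f" "\<forall>j\<in>T x. j < m \<longrightarrow> \<phi> j = \<psi> j"
          "real (card {v\<in>D \<phi>. E (\<phi> m) v}) > 2 * p * max (card (D \<phi>)) b" using 2 by blast
        have "D \<phi> = D \<psi>" by (rule dep[OF \<phi>(3)])
        moreover have "w \<in> V m" using \<phi>(1,2) m by (auto simp: W_def PiE_def Pi_def)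
        ultimately show "w \<in> {w\<in>V m. real (card {v\<in>D \<psi>. E w v}) > 2 * p * max (card (D \<psi>)) b}" using \<phi> by simp
      qed
      then have "card ?A \<le> card {w\<in>V m. real (card {v\<in>D \<psi>. E w v}) > 2 * p * max (card (D \<psi>)) b}"
        using finite_V[OF in_n[OF m(1)]] by (intro card_mono) auto
      also have "real \<dots> \<le> b"
      proof (rule card_large_nbrs_le)
        show "V m \<subseteq> {..<N}" using V_sub in_n m by blast
        show "D \<psi> \<subseteq> {..<N}" using D V_sub[of u] u x by fastforce
        have "V m \<inter> V u = {}" using V_disj[OF in_n[OF m(1)], of m u] m um by auto
        then show "V m \<inter> D \<psi> = {}" using D by blast
      qed
      finally show ?thesis using 2 by (simp add: c_def)
    next
      case 3
      define g where "g j = (if j < u then f j else \<psi> j)" for j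
      have \<psi>W: "\<psi> \<in> W x u f" using \<psi> by blast
      have gV: "g j \<in> V j" if "j \<in> pend x u i" for j
        using that f \<psi>W by (auto simp: g_def pend_def partial_def W_def PiE_def Pi_def)
      have pT: "pend x u i \<subseteq> T i" by (auto simp: pend_def)
      have inj: "inj_on g (pend x u i)"
      proof (rule inj_onI, rule ccontr)
        fix j k assume jk: "j \<in> pend x u i" "k \<in> pend x u i" "g j = g k" "j \<noteq> k"
        then have "V j \<inter> V k = {}" using V_disj[OF in_n[OF i], of j k] pT by blast
        then show False using gV[OF jk(1)] gV[OF jk(2)] jk(3) by auto
      qed
      have gN: "g ` pend x u i \<subseteq> {..<N}"
      proof (rule image_subsetI)
        fix j assume j: "j \<in> pend x u i"
        then have "j < n" using pT T_less[OF in_n[OF i], of j] in_n[OF i] by auto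
        then show "g j \<in> {..<N}" using gV[OF j] V_sub by blast
      qed
      have "?A \<subseteq> {y\<in>{..<N}. \<forall>t\<in>g ` pend x u i. E t y}"
      proof
        fix w assume "w \<in> ?A"
        then obtain \<phi> where \<phi>: "w = \<phi> i" "\<phi> \<in> W x u f" "\<forall>j\<in>T x. j < i \<longrightarrow> \<phi> j = \<psi> j" by blast
        have "w \<in> V i" using \<phi>(1,2) i by (auto simp: W_def PiE_def Pi_def)
        then have "w < N" using V_mem in_n[OF i] by blast
        moreover have "E (g j) w" if j: "j \<in> pend x u i" for j
        proof (cases "j < u")
          case True
          then show ?thesis using \<phi>(1,2) i j by (auto simp: g_def W_def pend_def)
        next
          case False
          then have jx: "j \<in> T x" "j \<in> T i" using j by (auto simp: pend_def)
          then have "\<phi> j = \<psi> j" using \<phi>(3) T_less[OF in_n[OF i]] by blast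
          moreover have "E (\<phi> j) (\<phi> i)" using \<phi>(2) i jx by (auto simp: W_def)
          ultimately show ?thesis using \<phi>(1) False by (simp add: g_def)
        qed
        ultimately show "w \<in> {y\<in>{..<N}. \<forall>t\<in>g ` pend x u i. E t y}" by auto
      qed
      then have "card ?A \<le> card {y\<in>{..<N}. \<forall>t\<in>g ` pend x u i. E t y}" by (intro card_mono) auto
      also have "real \<dots> \<le> 8 * p ^ card (g ` pend x u i) * N"
        using gN card_image[OF inj] pend_card[OF in_n[OF i], of x u] by (intro common_nbrs) auto
      finally show ?thesis using 3 card_image[OF inj] by (simp add: c_def)
    qed
  qed
  also have "(\<Prod>i\<in>T x. c i) = (\<Prod>i\<in>{i\<in>T x. u \<le> i}. c i)"
    using finite_T[OF x] by (intro prod.mono_neutral_right) (auto simp: c_def)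
  also have "\<dots> = b * (\<Prod>i\<in>{i\<in>T x. u \<le> i} - {m}. 8 * p ^ card (pend x u i) * N)"
  proof -
    have "(\<Prod>i\<in>{i\<in>T x. u \<le> i}. c i) = c m * (\<Prod>i\<in>{i\<in>T x. u \<le> i} - {m}. c i)"
      using finite_T[OF x] m um by (intro prod.remove) auto
    also have "(\<Prod>i\<in>{i\<in>T x. u \<le> i} - {m}. c i) = (\<Prod>i\<in>{i\<in>T x. u \<le> i} - {m}. 8 * p ^ card (pend x u i) * N)"
      by (intro prod.cong refl) (auto simp: c_def)
    finally show ?thesis using um by (simp add: c_def)
  qed
  also have "\<dots> \<le> (\<omega> * p ^ card {i\<in>T x. u \<in> T i} * (p ^ card (pend x u m) * M)) *
      ((8 * z) ^ d * (\<Prod>i\<in>{i\<in>T x. u \<le> i} - {m}. p ^ card (pend x u i) * M))"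
  proof (intro mult_mono)
    \<comment> \<open>\<open>u\<close> lies in \<open>T m\<close> but is not pending, being neither
      below \<open>u\<close> nor in \<open>T x\<close>; hence the bound \<open>d - 1\<close> in
      place of \<open>d\<close>.\<close>
    have "pend x u m \<subseteq> T m - {u}" using u by (auto simp: pend_def)
    then have "card (pend x u m) \<le> card (T m - {u})" using finite_T[OF in_n[OF m(1)]] by (intro card_mono) auto
    also have "\<dots> = card (T m) - 1" using m finite_T[OF in_n[OF m(1)]] by simp
    finally have 1: "card (pend x u m) \<le> d - 1" using card_T[OF in_n[OF m(1)]] by linarith
    have "card {i\<in>T x. u \<in> T i} \<le> card (T x)" using finite_T[OF x] by (intro card_mono) auto
    then have "card {i\<in>T x. u \<in> T i} + card (pend x u m) \<le> 2 * d - 1" using 1 card_T[OF x] d_ge1 by linarith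
    from b_le_pow[OF this] show "b \<le> \<omega> * p ^ card {i\<in>T x. u \<in> T i} * (p ^ card (pend x u m) * M)"
      by (simp add: power_add mult_ac)
    have "(\<Prod>i\<in>{i\<in>T x. u \<le> i} - {m}. 8 * p ^ card (pend x u i) * N)
       \<le> (\<Prod>i\<in>{i\<in>T x. u \<le> i} - {m}. (8 * z) * (p ^ card (pend x u i) * M))"
    proof (intro prod_mono conjI)
      fix i
      have "8 * p ^ card (pend x u i) * N \<le> 8 * p ^ card (pend x u i) * (z * M)"
        using N_le p_pos by (intro mult_left_mono) auto
      then show "8 * p ^ card (pend x u i) * N \<le> (8 * z) * (p ^ card (pend x u i) * M)" by (simp add: mult_ac)
    qed (use p_pos in auto)
    also have "\<dots> = (8 * z) ^ card ({i\<in>T x. u \<le> i} - {m}) * (\<Prod>i\<in>{i\<in>T x. u \<le> i} - {m}. p ^ card (pend x u i) * M)"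
      by (simp add: prod.distrib power_mult_distrib)
    also have "\<dots> \<le> (8 * z) ^ d * (\<Prod>i\<in>{i\<in>T x. u \<le> i} - {m}. p ^ card (pend x u i) * M)"
    proof (intro mult_right_mono power_increasing prod_nonneg)
      have "card ({i\<in>T x. u \<le> i} - {m}) \<le> card (T x)" using finite_T[OF x] by (intro card_mono) auto
      then show "card ({i\<in>T x. u \<le> i} - {m}) \<le> d" using card_T[OF x] by simp
    qed (use z_ge1 p_pos in auto)
    finally show "(\<Prod>i\<in>{i\<in>T x. u \<le> i} - {m}. 8 * p ^ card (pend x u i) * N)
      \<le> (8 * z) ^ d * (\<Prod>i\<in>{i\<in>T x. u \<le> i} - {m}. p ^ card (pend x u i) * M)" .
  qed (use \<omega>_nonneg p_pos in \<open>auto intro!: prod_nonneg\<close>)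
  also have "\<dots> = \<omega> * p ^ card {i\<in>T x. u \<in> T i} * (8 * z) ^ d * Norm x u"
  proof -
    have "Norm x u = (p ^ card (pend x u m) * M) * (\<Prod>i\<in>{i\<in>T x. u \<le> i} - {m}. p ^ card (pend x u i) * M)"
      unfolding Norm_def using finite_T[OF x] m um by (intro prod.remove) auto
    then show ?thesis by (simp only: mult_ac)
  qed
  finally show ?thesis .
qed

end

section \<open>Average loss, invariant and used vertices\<close>

context embedding
begin

text \<open>Double counting: a completion survives the choice \<open>v\<close> only if
  \<open>v\<close> is adjacent to its images of all \<open>i\<close> in \<open>J\<close>. Imposing
  these adjacencies one by one leaves at most a proportion \<open>(2 * p) ^ card J\<close> of the
  bound for the candidates, unless the completion is exceptional at some \<open>m\<close>. The
  exceptional completions are so few that all candidates may be counted for them.\<close>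

lemma sum_W_outside:
  assumes x: "x < n" and u: "u < x" "u \<notin> T x" and f: "partial u f"
    and \<Gamma>: "real (card {y\<in>V u. \<forall>j\<in>T u. E (f j) y}) \<le> 2 * p ^ card (T u) * M"
  shows "(\<Sum>v\<in>{y\<in>V u. \<forall>j\<in>T u. E (f j) y}. real (card (W x (Suc u) (f(u := v)))))
     \<le> (2 ^ (d + 1) * real (card (W x u f)) + \<eta> * Norm x u) * p ^ card {i\<in>T x. u \<in> T i} * (p ^ card (T u) * M)"
    and "Norm x (Suc u) = Norm x u * p ^ card {i\<in>T x. u \<in> T i}"
proof -
  define \<Gamma>0 where "\<Gamma>0 = {y\<in>V u. \<forall>j\<in>T u. E (f j) y}"
  define J where "J = {i\<in>T x. u \<in> T i}"
  define k where "k = card (T u)"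
  have un: "u < n" using u x by simp
  have in_n: "i \<in> T x \<Longrightarrow> i < n" for i using T_less[OF x] x by (auto intro: less_trans)
  have finJ: "finite J" using finite_T[OF x] by (simp add: J_def)
  have cJ: "card J \<le> d"
    using card_mono[OF finite_T[OF x], of J] card_T[OF x] by (auto simp: J_def)
  have k: "k \<le> d" using card_T[OF un] by (simp add: k_def)
  have \<Gamma>V: "\<Gamma>0 \<subseteq> V u" by (auto simp: \<Gamma>0_def)
  have fin\<Gamma>: "finite \<Gamma>0" using \<Gamma>V finite_V[OF un] finite_subset by blast
  have finW: "finite (W x u f)" by (rule finite_W[OF x])
  have uJ: "u < i" if "i \<in> J" for i using that T_less[OF in_n, of i u] by (auto simp: J_def)
  have sub: "W x (Suc u) (f(u := v)) \<subseteq> {\<phi>\<in>W x u f. \<forall>i\<in>J. E (\<phi> i) v}" for v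
  proof
    fix \<phi> assume \<phi>: "\<phi> \<in> W x (Suc u) (f(u := v))"
    have eq: "\<phi> i = f i" if "i \<in> T x" "i < u" for i using \<phi> that by (auto simp: W_def)
    have e: "E ((f(u := v)) j) (\<phi> i)" if "i \<in> T x" "j \<in> T i" "j < Suc u" for i j
      using \<phi> that unfolding W_def by blast
    have "E (f j) (\<phi> i)" if "i \<in> T x" "j \<in> T i" "j < u" for i j
      using e[OF that(1,2)] that(3) by simp
    moreover have "E (\<phi> i) v" if "i \<in> J" for i
    proof (rule E_sym)
      show "E v (\<phi> i)" using e[of i u] that by (simp add: J_def)
    qed
    ultimately show "\<phi> \<in> {\<phi>\<in>W x u f. \<forall>i\<in>J. E (\<phi> i) v}" using \<phi> eq by (auto simp: W_def)
  qed
  define D where "D m \<phi> = {v\<in>\<Gamma>0. \<forall>i\<in>J. i < m \<longrightarrow> E (\<phi> i) v}" for m \<phi>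
  define Ex where "Ex m = {\<phi>\<in>W x u f. real (card {v\<in>D m \<phi>. E (\<phi> m) v}) > 2 * p * max (card (D m \<phi>)) b}" for m
  define \<beta> where "\<beta> = 2 * p ^ k * M"
  define e where "e = \<omega> * p ^ card J * (8 * z) ^ d * Norm x u"
  have \<beta>: "real (card \<Gamma>0) \<le> \<beta>" using \<Gamma> by (simp add: \<Gamma>0_def \<beta>_def k_def)
  have \<beta>0: "0 \<le> \<beta>" using p_pos by (simp add: \<beta>_def)
  have Ex_le: "real (card (Ex m)) \<le> e" if "m \<in> J" for m
    unfolding Ex_def e_def J_def
  proof (rule card_W_exceptional[OF x u f])
    show "D m \<phi> \<subseteq> V u" for \<phi> using \<Gamma>V by (auto simp: D_def)
    show "m \<in> T x" "u \<in> T m" using that by (auto simp: J_def)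
    show "D m \<phi> = D m \<psi>" if "\<forall>j\<in>T x. j < m \<longrightarrow> \<phi> j = \<psi> j" for \<phi> \<psi>
      using that unfolding D_def J_def by (intro Collect_cong conj_cong refl ball_cong) auto
  qed
  have typical: "real (card {v\<in>\<Gamma>0. \<forall>i\<in>J. E (\<phi> i) v}) \<le> (2 * p) ^ card J * \<beta>"
    if \<phi>: "\<phi> \<in> W x u f" "\<And>m. m \<in> J \<Longrightarrow> \<phi> \<notin> Ex m" for \<phi>
  proof (rule card_iterated_shrink[OF finJ fin\<Gamma> \<beta>])
    show "0 \<le> 2 * p" using p_pos by simp
    \<comment> \<open>The cutoff matters only before the last adjacency is imposed, so
      \<open>l \<le> d - 1\<close>; with \<open>k \<le> d\<close> the exponent is again at most
      \<open>2 * d - 1\<close>.\<close>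
    show "b \<le> (2 * p) ^ l * \<beta>" if "l < card J" for l
    proof -
      have "b \<le> \<omega> * (p ^ (l + k) * M)" using that cJ k by (intro b_le_pow) linarith
      also have "\<dots> \<le> (2 ^ l * 2) * (p ^ (l + k) * M)"
      proof (intro mult_right_mono)
        have "(1::real) \<le> 2 ^ l" by simp
        then show "\<omega> \<le> 2 ^ l * 2" using \<omega>_le1 by linarith
      qed (use p_pos in simp)
      also have "\<dots> = (2 * p) ^ l * \<beta>" by (simp add: \<beta>_def power_add power_mult_distrib)
      finally show ?thesis .
    qed
    fix m assume m: "m \<in> J"
    have "{v\<in>D m \<phi>. E (\<phi> m) v} = {v\<in>\<Gamma>0. (\<forall>i\<in>J. i < m \<longrightarrow> E (\<phi> i) v) \<and> E (\<phi> m) v}" by (auto simp: D_def)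
    then show "real (card {v\<in>\<Gamma>0. (\<forall>i\<in>J. i < m \<longrightarrow> E (\<phi> i) v) \<and> E (\<phi> m) v})
       \<le> 2 * p * max (card {v\<in>\<Gamma>0. \<forall>i\<in>J. i < m \<longrightarrow> E (\<phi> i) v}) b"
      using \<phi>(1) \<phi>(2)[OF m] by (simp add: Ex_def D_def not_less)
  qed
  have "(\<Sum>v\<in>\<Gamma>0. real (card (W x (Suc u) (f(u := v))))) \<le> (\<Sum>v\<in>\<Gamma>0. real (card {\<phi>\<in>W x u f. \<forall>i\<in>J. E (\<phi> i) v}))"
    using sub finW by (intro sum_mono of_nat_mono card_mono) auto
  also have "\<dots> = (\<Sum>v\<in>\<Gamma>0. \<Sum>\<phi>\<in>W x u f. of_bool (\<forall>i\<in>J. E (\<phi> i) v))"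
    by (simp only: sum_of_bool_card[OF finW])
  also have "\<dots> = (\<Sum>\<phi>\<in>W x u f. \<Sum>v\<in>\<Gamma>0. of_bool (\<forall>i\<in>J. E (\<phi> i) v))" by (rule sum.swap)
  also have "\<dots> = (\<Sum>\<phi>\<in>W x u f. real (card {v\<in>\<Gamma>0. \<forall>i\<in>J. E (\<phi> i) v}))"
    by (simp only: sum_of_bool_card[OF fin\<Gamma>])
  also have "\<dots> \<le> (\<Sum>\<phi>\<in>W x u f. (2 * p) ^ card J * \<beta> + (\<Sum>m\<in>J. of_bool (\<phi> \<in> Ex m)) * \<beta>)"
  proof (intro sum_mono)
    fix \<phi> assume \<phi>: "\<phi> \<in> W x u f"
    show "real (card {v\<in>\<Gamma>0. \<forall>i\<in>J. E (\<phi> i) v}) \<le> (2 * p) ^ card J * \<beta> + (\<Sum>m\<in>J. of_bool (\<phi> \<in> Ex m)) * \<beta>"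
    proof (cases "\<exists>m\<in>J. \<phi> \<in> Ex m")
      case True
      then obtain m where m: "m \<in> J" "\<phi> \<in> Ex m" by blast
      have "(of_bool (\<phi> \<in> Ex m) :: real) \<le> (\<Sum>m\<in>J. of_bool (\<phi> \<in> Ex m))"
        using m finJ by (intro member_le_sum) auto
      then have "1 * \<beta> \<le> (\<Sum>m\<in>J. of_bool (\<phi> \<in> Ex m)) * \<beta>" using m \<beta>0 by (intro mult_right_mono) auto
      moreover have "card {v\<in>\<Gamma>0. \<forall>i\<in>J. E (\<phi> i) v} \<le> card \<Gamma>0" using fin\<Gamma> by (intro card_mono) auto
      moreover have "0 \<le> (2 * p) ^ card J * \<beta>" using p_pos \<beta>0 by simp
      ultimately show ?thesis using \<beta> by linarith
    next
      case False
      have "0 \<le> (\<Sum>m\<in>J. of_bool (\<phi> \<in> Ex m)) * \<beta>" using \<beta>0 by (intro mult_nonneg_nonneg sum_nonneg) auto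
      then show ?thesis using typical[OF \<phi>] False by fastforce
    qed
  qed
  also have "\<dots> = card (W x u f) * ((2 * p) ^ card J * \<beta>) + (\<Sum>m\<in>J. real (card {\<phi>\<in>W x u f. \<phi> \<in> Ex m})) * \<beta>"
  proof -
    have "(\<Sum>\<phi>\<in>W x u f. \<Sum>m\<in>J. of_bool (\<phi> \<in> Ex m)) = (\<Sum>m\<in>J. \<Sum>\<phi>\<in>W x u f. of_bool (\<phi> \<in> Ex m) :: real)"
      by (rule sum.swap)
    then show ?thesis
      by (simp only: sum.distrib sum_distrib_right[symmetric] sum_constant sum_of_bool_card[OF finW])
  qed
  also have "\<dots> \<le> card (W x u f) * ((2 ^ d * p ^ card J) * \<beta>) + (\<eta> / 2 * p ^ card J * Norm x u) * \<beta>"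
  proof (intro add_mono mult_left_mono mult_right_mono \<beta>0)
    show "(2 * p) ^ card J \<le> 2 ^ d * p ^ card J"
      unfolding power_mult_distrib using cJ p_pos by (intro mult_right_mono power_increasing) auto
    have "(\<Sum>m\<in>J. real (card {\<phi>\<in>W x u f. \<phi> \<in> Ex m})) \<le> (\<Sum>m\<in>J. e)"
    proof (intro sum_mono)
      fix m assume m: "m \<in> J"
      have "{\<phi>\<in>W x u f. \<phi> \<in> Ex m} = Ex m" by (auto simp: Ex_def)
      then show "real (card {\<phi>\<in>W x u f. \<phi> \<in> Ex m}) \<le> e" using Ex_le[OF m] by simp
    qed
    also have "\<dots> = card J * e" by simp
    also have "\<dots> \<le> d * e"
      using cJ \<omega>_nonneg p_pos z_ge1 Norm_pos[of x u] by (intro mult_right_mono) (auto simp: e_def)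
    also have "\<dots> = (2 * d * \<omega> * (8 * z) ^ d) / 2 * p ^ card J * Norm x u" by (simp add: e_def)
    also have "\<dots> \<le> \<eta> / 2 * p ^ card J * Norm x u"
      using \<omega>_small p_pos Norm_pos[of x u] by (intro mult_right_mono divide_right_mono) auto
    finally show "(\<Sum>m\<in>J. real (card {\<phi>\<in>W x u f. \<phi> \<in> Ex m})) \<le> \<eta> / 2 * p ^ card J * Norm x u" .
  qed simp
  also have "\<dots> = (2 ^ (d + 1) * real (card (W x u f)) + \<eta> * Norm x u) * p ^ card J * (p ^ k * M)"
    by (simp add: \<beta>_def algebra_simps)
  finally show "(\<Sum>v\<in>{y\<in>V u. \<forall>j\<in>T u. E (f j) y}. real (card (W x (Suc u) (f(u := v)))))
     \<le> (2 ^ (d + 1) * real (card (W x u f)) + \<eta> * Norm x u) * p ^ card {i\<in>T x. u \<in> T i} * (p ^ card (T u) * M)"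
    by (simp only: \<Gamma>0_def J_def k_def)
  have Q: "{i\<in>T x. Suc u \<le> i} = {i\<in>T x. u \<le> i}" using u(2) by (auto simp: Suc_le_eq le_less)
  have JQ: "J \<subseteq> {i\<in>T x. u \<le> i}" using uJ by (auto simp: J_def less_imp_le)
  have pe: "p ^ card (pend x (Suc u) i) * M = (p ^ card (pend x u i) * M) * (if i \<in> J then p else 1)" if i: "i \<in> T x" for i
  proof (cases "i \<in> J")
    case True
    then have "pend x (Suc u) i = insert u (pend x u i)" "u \<notin> pend x u i" using u(2) by (auto simp: pend_def J_def less_Suc_eq)
    moreover have "finite (pend x u i)" unfolding pend_def using finite_T[OF in_n[OF i]] by simp
    ultimately show ?thesis using True by simp
  next
    case False
    then have "pend x (Suc u) i = pend x u i" using i by (auto simp: pend_def J_def less_Suc_eq)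
    then show ?thesis using False by simp
  qed
  have finQ: "finite {i\<in>T x. u \<le> i}" using finite_T[OF x] by simp
  have "Norm x (Suc u) = (\<Prod>i\<in>{i\<in>T x. u \<le> i}. (p ^ card (pend x u i) * M) * (if i \<in> J then p else 1))"
    unfolding Norm_def Q using pe by (intro prod.cong) auto
  also have "\<dots> = Norm x u * (\<Prod>i\<in>{i\<in>T x. u \<le> i}. if i \<in> J then p else 1)"
    unfolding Norm_def by (rule prod.distrib)
  also have "(\<Prod>i\<in>{i\<in>T x. u \<le> i}. if i \<in> J then p else 1) = (\<Prod>i\<in>J. p)"
    using prod.inter_restrict[OF finQ, of "\<lambda>_. p" J] JQ by (simp add: inf.absorb2)
  finally show "Norm x (Suc u) = Norm x u * p ^ card {i\<in>T x. u \<in> T i}" by (simp add: J_def)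
qed

text \<open>The images of \<open>T i\<close> must avoid \<open>S\<close> because only then does
  lying in the common neighbourhood of \<open>S\<close> amount to \<open>card S\<close> further
  constraints on the image of \<open>i\<close>, each worth a factor \<open>p\<close>.\<close>

definition usage :: "nat \<Rightarrow> (nat \<Rightarrow> nat) \<Rightarrow> nat set \<Rightarrow> real" where
  "usage u f S = real (card {i. i < u \<and> (\<forall>s\<in>S. E s (f i)) \<and> f ` T i \<inter> S = {}})"

text \<open>
  A bound on this sum bounds \<open>usage u f S\<close> by \<open>64 * z / a * p ^ card S * u\<close> plus a logarithm, simultaneously
  for all \<open>S\<close>. The boundedly many vertices with an earlier neighbour mapped into \<open>S\<close> are left out.
\<close>

definition potential :: "nat \<Rightarrow> (nat \<Rightarrow> nat) \<Rightarrow> real" where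
  "potential u f = (\<Sum>S\<in>{S. S \<subseteq> {..<N} \<and> card S \<le> d}. exp (usage u f S - 64 * z / a * p ^ card S * u))"

text \<open>\<open>(real N + 1) ^ d\<close> bounds the number of sets in the potential, which is its
  initial value; from then on the potential never increases.\<close>

definition invariant :: "nat \<Rightarrow> (nat \<Rightarrow> nat) \<Rightarrow> bool" where
  "invariant u f \<longleftrightarrow> partial u f \<and> inj_on f {..<u} \<and> potential u f \<le> (real N + 1) ^ d \<and>
     (\<forall>x. u \<le> x \<and> x < n \<longrightarrow> real (card (W x u f)) \<le> K ^ aff x u * \<eta> * Norm x u)"

lemma finite_small_subsets: "finite {S. S \<subseteq> {..<N} \<and> card S \<le> d}"
  by (rule finite_subset[of _ "Pow {..<N}"]) auto

lemma invariant_0: "invariant 0 f"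
proof -
  have "potential 0 f = real (card {S. S \<subseteq> {..<N} \<and> card S \<le> d})"
    by (simp add: potential_def usage_def)
  then have "potential 0 f \<le> (real N + 1) ^ d" using card_small_subsets_le[of N d] by linarith
  moreover have "real (card (W x 0 f)) \<le> K ^ aff x 0 * \<eta> * Norm x 0" if x: "x < n" for x
  proof -
    have "W x 0 f = {\<phi>\<in>PiE (T x) V. (\<forall>i\<in>T x. \<forall>j\<in>T i. j \<in> T x \<longrightarrow> E (\<phi> j) (\<phi> i)) \<and> bad x \<phi>}"
      by (auto simp: W_def)
    moreover have "Norm x 0 = (\<Prod>i\<in>T x. p ^ card (T i \<inter> T x) * M)"
    proof -
      have "pend x 0 i = T i \<inter> T x" for i by (auto simp: pend_def)
      then show ?thesis by (simp add: Norm_def)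
    qed
    ultimately show ?thesis using few_bad[OF x] by (simp add: aff_def bad_def)
  qed
  ultimately show ?thesis by (simp add: invariant_def partial_def)
qed

text \<open>When \<open>u\<close> is due, all of \<open>T u\<close> is embedded, so the only
  possible member of \<open>W u u f\<close> is the restriction of \<open>f\<close>, and
  \<open>Norm u u = 1\<close>. The invariant bounds the number of members by
  \<open>K ^ (d + d * d) * \<eta>\<close>, which is below 1, so there is none.\<close>

lemma not_bad_at:
  assumes inv: "invariant u f" and u: "u < n"
  shows "a * p ^ card (T u) * M \<le> real (card {y\<in>V u. \<forall>i\<in>T u. G (f i) y})"
    and "real (card {y\<in>V u. \<forall>i\<in>T u. E (f i) y}) \<le> 2 * p ^ card (T u) * M"
proof -
  let ?\<phi> = "restrict f (T u)"
  have f: "partial u f" using inv by (simp add: invariant_def)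
  have "\<not> bad u ?\<phi>"
  proof
    assume b: "bad u ?\<phi>"
    have "?\<phi> \<in> W u u f"
    proof -
      have "f i \<in> V i" if "i \<in> T u" for i using f T_less[OF u that] by (auto simp: partial_def)
      moreover have "E (f j) (f i)" if "i \<in> T u" "j \<in> T i" for i j
        using f T_less[OF u that(1)] that(2) by (auto simp: partial_def intro: G_E)
      ultimately show ?thesis using b by (auto simp: W_def)
    qed
    then have "0 < card (W u u f)" using finite_W[OF u] by (auto simp: card_gt_0_iff)
    then have "1 \<le> real (card (W u u f))" by linarith
    also have "\<dots> \<le> K ^ aff u u * \<eta> * Norm u u" using inv u by (simp add: invariant_def)
    also have "Norm u u = 1"
    proof -
      have "{i\<in>T u. u \<le> i} = {}" using T_less[OF u] by force
      then show ?thesis by (simp only: Norm_def prod.empty)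
    qed
    also have "K ^ aff u u * \<eta> * 1 \<le> K ^ (d + d * d) * \<eta>"
      using aff_le[OF u] K_ge1 \<eta>_pos by (auto intro!: mult_right_mono power_increasing)
    finally show False using K\<eta> by simp
  qed
  then show "a * p ^ card (T u) * M \<le> real (card {y\<in>V u. \<forall>i\<in>T u. G (f i) y})"
    "real (card {y\<in>V u. \<forall>i\<in>T u. E (f i) y}) \<le> 2 * p ^ card (T u) * M"
    by (simp_all add: bad_def not_less cong: ball_cong)
qed

lemma usage_bound:
  assumes "potential u f \<le> (real N + 1) ^ d" "S \<subseteq> {..<N}" "card S \<le> d"
  shows "usage u f S \<le> d * ln (real N + 1) + 64 * z / a * p ^ card S * u"
proof -
  have "exp (usage u f S - 64 * z / a * p ^ card S * u) \<le> potential u f"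
    unfolding potential_def using assms finite_small_subsets by (intro member_le_sum) auto
  also have "\<dots> \<le> (real N + 1) ^ d" by (rule assms)
  also have "\<dots> = exp (d * ln (real N + 1))" by (simp add: exp_of_nat_mult)
  finally show ?thesis by simp
qed

text \<open>A used candidate is the image of some \<open>i < u\<close>. Either \<open>i\<close> is
  counted by \<open>usage\<close> for the image \<open>S\<close> of \<open>T u\<close>, or by
  injectivity \<open>T i\<close> meets \<open>T u\<close>, which happens for at most
  \<open>d * \<Delta>\<close> indices. The assumption \<open>room\<close> is what the resulting
  estimate needs.\<close>

lemma used_candidates_le:
  assumes inv: "invariant u f" and u: "u < n"
  shows "real (card ({y\<in>V u. \<forall>i\<in>T u. G (f i) y} \<inter> f ` {..<u})) \<le> a / 2 * p ^ card (T u) * M"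
proof -
  have f: "partial u f" "inj_on f {..<u}" "potential u f \<le> (real N + 1) ^ d" using inv by (auto simp: invariant_def)
  have Tu: "T u \<subseteq> {..<u}" by (rule T_sub[OF u])
  define S where "S = f ` T u"
  have cS: "card S = card (T u)" unfolding S_def using inj_on_subset[OF f(2) Tu] by (rule card_image)
  have SN: "S \<subseteq> {..<N}"
  proof -
    have "f i < N" if "i \<in> T u" for i
    proof -
      have i: "i < u" using Tu that by auto
      then have "f i \<in> V i" using f(1) by (simp add: partial_def)
      then show ?thesis using V_mem[of i "f i"] i u by simp
    qed
    then show ?thesis by (auto simp: S_def)
  qed
  have finTu: "finite (T u)" by (rule finite_T[OF u])
  let ?U = "{i. i < u \<and> (\<forall>s\<in>S. E s (f i)) \<and> f ` T i \<inter> S = {}}"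
  let ?C = "\<Union>j\<in>T u. {x\<in>{..<n}. j \<in> T x}"
  have "{y\<in>V u. \<forall>i\<in>T u. G (f i) y} \<inter> f ` {..<u} \<subseteq> f ` (?U \<union> ?C)"
  proof
    fix y assume y: "y \<in> {y\<in>V u. \<forall>i\<in>T u. G (f i) y} \<inter> f ` {..<u}"
    then obtain i where i: "i < u" "y = f i" by auto
    have "E s (f i)" if "s \<in> S" for s using y i that G_E by (auto simp: S_def)
    moreover have "i \<in> ?C" if ne: "f ` T i \<inter> S \<noteq> {}"
    proof -
      obtain j j' where j: "j \<in> T i" "j' \<in> T u" "f j = f j'" using ne by (auto simp: S_def)
      have "j < u" "j' < u" using j Tu T_sub[of i] i u by auto
      then have "j = j'" using f(2) j(3) by (auto dest: inj_onD)
      then show ?thesis using j i u by auto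
    qed
    ultimately have "i \<in> ?U \<union> ?C" using i by blast
    then show "y \<in> f ` (?U \<union> ?C)" using i by blast
  qed
  then have "card ({y\<in>V u. \<forall>i\<in>T u. G (f i) y} \<inter> f ` {..<u}) \<le> card (f ` (?U \<union> ?C))"
    using finTu by (intro card_mono) auto
  also have "\<dots> \<le> card (?U \<union> ?C)" using finTu by (intro card_image_le) auto
  also have "\<dots> \<le> card ?U + card ?C" by (rule card_Un_le)
  also have "card ?C \<le> (\<Sum>j\<in>T u. card {x\<in>{..<n}. j \<in> T x})" by (rule card_UN_le[OF finTu])
  also have "\<dots> \<le> (\<Sum>j\<in>T u. \<Delta>)"
  proof (intro sum_mono degree_le)
    show "j < n" if "j \<in> T u" for j using T_less[OF u that] u by simp
  qed
  also have "\<dots> \<le> d * \<Delta>" using card_T[OF u] by simp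
  finally have "card ({y\<in>V u. \<forall>i\<in>T u. G (f i) y} \<inter> f ` {..<u}) \<le> card ?U + d * \<Delta>" by simp
  then have "real (card ({y\<in>V u. \<forall>i\<in>T u. G (f i) y} \<inter> f ` {..<u})) \<le> real (card ?U + d * \<Delta>)" by (rule of_nat_mono)
  also have "\<dots> = usage u f S + d * \<Delta>" by (simp add: usage_def)
  also have "usage u f S \<le> d * ln (real N + 1) + 64 * z / a * p ^ card S * u"
    using cS card_T[OF u] by (intro usage_bound f(3) SN) simp
  also have "64 * z / a * p ^ card S * u \<le> 64 * z / a * p ^ card (T u) * n"
    unfolding cS using u z_ge1 a_pos p_pos by (intro mult_left_mono) auto
  also have "d * ln (real N + 1) + 64 * z / a * p ^ card (T u) * n + real (d * \<Delta>) \<le> a / 2 * p ^ card (T u) * M"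
    using room[OF card_T[OF u]] by simp
  finally show ?thesis by simp
qed

end

section \<open>One step of the embedding\<close>

context embedding
begin

text \<open>The choice at \<open>u\<close> endangers the bounds on \<open>W\<close> only for
  boundedly many \<open>x\<close>, reached from \<open>u\<close> in at most two steps; a union bound
  over them is affordable.\<close>

lemma card_touching_le:
  assumes "u < n" shows "card {x. u < x \<and> x < n \<and> u \<in> touched x} \<le> \<Delta> + \<Delta> * \<Delta>"
proof -
  let ?A = "{x\<in>{..<n}. u \<in> T x}"
  let ?B = "{i\<in>{..<n}. u \<in> T i}"
  let ?C = "\<Union>i\<in>?B. {x\<in>{..<n}. i \<in> T x}"
  have "{x. u < x \<and> x < n \<and> u \<in> touched x} \<subseteq> ?A \<union> ?C"
  proof
    fix x assume "x \<in> {x. u < x \<and> x < n \<and> u \<in> touched x}"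
    then have x: "x < n" "u \<in> touched x" by auto
    show "x \<in> ?A \<union> ?C"
    proof (cases "u \<in> T x")
      case False
      then obtain i where i: "i \<in> T x" "u \<in> T i" using x(2) by (auto simp: touched_def)
      moreover have "i < n" using T_less[OF x(1) i(1)] x(1) by simp
      ultimately show ?thesis using x(1) by auto
    qed (use x in auto)
  qed
  then have "card {x. u < x \<and> x < n \<and> u \<in> touched x} \<le> card (?A \<union> ?C)" by (intro card_mono) auto
  also have "\<dots> \<le> card ?A + card ?C" by (rule card_Un_le)
  also have "card ?C \<le> (\<Sum>i\<in>?B. card {x\<in>{..<n}. i \<in> T x})" by (rule card_UN_le) simp
  also have "\<dots> \<le> (\<Sum>i\<in>?B. \<Delta>)" by (intro sum_mono degree_le) auto
  also have "\<dots> \<le> \<Delta> * \<Delta>" using degree_le[OF assms] by simp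
  finally show ?thesis using degree_le[OF assms] by linarith
qed

text \<open>Markov's inequality: by \<open>sum_W_member\<close> or \<open>sum_W_outside\<close> the
  proportion of bad completions grows by a constant factor on average over the host candidates, so
  few candidates let it grow by more than \<open>K\<close>. The choice is made among the colour
  candidates, possibly a small part of them; a large \<open>K\<close> compensates for this.\<close>

lemma card_overloaded_le:
  assumes inv: "invariant u f" and x: "x < n" "u < x" "u \<in> touched x"
  shows "real (card {v\<in>{y\<in>V u. \<forall>j\<in>T u. E (f j) y}.
      real (card (W x (Suc u) (f(u := v)))) > K ^ aff x (Suc u) * \<eta> * Norm x (Suc u)}) \<le> 2 ^ (d + 2) / K * (p ^ card (T u) * M)"
proof -
  define \<Gamma>0 where "\<Gamma>0 = {y\<in>V u. \<forall>j\<in>T u. E (f j) y}"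
  define k where "k = card (T u)"
  define A where "A = K ^ aff x u * \<eta>"
  define B where "B = Norm x (Suc u)"
  have un: "u < n" using x by simp
  have B0: "0 < B" using Norm_pos by (simp add: B_def)
  have K0: "0 < K" using K_ge1 by simp
  have A0: "0 < A" using K0 \<eta>_pos by (simp add: A_def)
  have \<eta>A: "\<eta> \<le> A" using K_ge1 \<eta>_pos one_le_power[OF K_ge1, of "aff x u"] mult_right_mono[of 1 "K ^ aff x u" \<eta>] by (simp add: A_def)
  have pM0: "0 < p ^ k * M" using p_pos M_ge1 by simp
  have fin: "finite \<Gamma>0" using finite_V[OF un] by (simp add: \<Gamma>0_def)
  have cW: "real (card (W x u f)) \<le> A * Norm x u" using inv x by (simp add: invariant_def A_def)
  have f: "partial u f" using inv by (simp add: invariant_def)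

  have s: "(\<Sum>v\<in>\<Gamma>0. real (card (W x (Suc u) (f(u := v))))) \<le> 2 ^ (d + 2) * A * B * (p ^ k * M)"
  proof (cases "u \<in> T x")
    case True
    have "(\<Sum>v\<in>\<Gamma>0. real (card (W x (Suc u) (f(u := v))))) \<le> (\<Sum>v\<in>V u. real (card (W x (Suc u) (f(u := v)))))"
      using finite_V[OF un] by (intro sum_mono2) (auto simp: \<Gamma>0_def)
    also have "\<dots> \<le> card (W x u f)" by (rule sum_W_member(1)[OF x(1) True])
    also have "\<dots> \<le> A * (B * (p ^ k * M))" using cW sum_W_member(2)[OF x(1) True] by (simp add: B_def k_def)
    also have "\<dots> \<le> 2 ^ (d + 2) * (A * (B * (p ^ k * M)))"
    proof -
      have "0 \<le> A * (B * (p ^ k * M))" using A0 B0 pM0 by simp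
      moreover have "(1::real) \<le> 2 ^ (d + 2)" by (rule one_le_power) simp
      ultimately show ?thesis using mult_right_mono[of 1 "2 ^ (d + 2)" "A * (B * (p ^ k * M))"] by simp
    qed
    finally show ?thesis by (simp only: mult.assoc)
  next
    case False
    have "(\<Sum>v\<in>\<Gamma>0. real (card (W x (Suc u) (f(u := v)))))
       \<le> (2 ^ (d + 1) * real (card (W x u f)) + \<eta> * Norm x u) * p ^ card {i\<in>T x. u \<in> T i} * (p ^ k * M)"
      unfolding \<Gamma>0_def k_def by (rule sum_W_outside(1)[OF x(1,2) False f not_bad_at(2)[OF inv un]])
    also have "\<dots> \<le> (2 ^ (d + 1) * (A * Norm x u) + 2 ^ (d + 1) * (A * Norm x u)) * p ^ card {i\<in>T x. u \<in> T i} * (p ^ k * M)"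
    proof (intro mult_right_mono add_mono mult_left_mono cW)
      have "\<eta> * Norm x u \<le> A * Norm x u" using \<eta>A Norm_pos[of x u] by (intro mult_right_mono) auto
      also have "\<dots> \<le> 2 ^ (d + 1) * (A * Norm x u)"
      proof -
        have "0 \<le> A * Norm x u" using A0 Norm_pos[of x u] by simp
        moreover have "(1::real) \<le> 2 ^ (d + 1)" by (rule one_le_power) simp
        ultimately show ?thesis using mult_right_mono[of 1 "2 ^ (d + 1)" "A * Norm x u"] by simp
      qed
      finally show "\<eta> * Norm x u \<le> 2 ^ (d + 1) * (A * Norm x u)" .
    qed (use p_pos in auto)
    also have "\<dots> = 2 ^ (d + 2) * A * B * (p ^ k * M)"
      unfolding B_def sum_W_outside(2)[OF x(1,2) False f not_bad_at(2)[OF inv un]] by (simp add: algebra_simps)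
    finally show ?thesis .
  qed
  define t where "t = K * A * B"
  have t0: "0 < t" using K0 A0 B0 by (simp add: t_def)
  have "real (card {v\<in>\<Gamma>0. real (card (W x (Suc u) (f(u := v)))) > t}) \<le> 2 ^ (d + 2) * A * B * (p ^ k * M) / t"
    by (rule card_markov[OF fin _ s t0]) simp
  also have "\<dots> = 2 ^ (d + 2) / K * (p ^ k * M)" using K0 A0 B0 by (simp add: t_def field_simps)
  finally show ?thesis
    unfolding aff_touched[OF x(1,3)] by (simp only: t_def A_def B_def \<Gamma>0_def k_def power_Suc mult.assoc)
qed

lemma usage_Suc:
  assumes "u < n"
  shows "usage (Suc u) (f(u := v)) S = usage u f S + of_bool ((\<forall>s\<in>S. E s v) \<and> f ` T u \<inter> S = {})"
proof -
  let ?f = "f(u := v)"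
  let ?U = "{i. i < u \<and> (\<forall>s\<in>S. E s (f i)) \<and> f ` T i \<inter> S = {}}"
  have im: "?f ` T i = f ` T i" if "i \<le> u" for i
    using T_sub[of i] that assms by (intro image_cong) auto
  have "{i. i < Suc u \<and> (\<forall>s\<in>S. E s (?f i)) \<and> ?f ` T i \<inter> S = {}} =
     ?U \<union> (if (\<forall>s\<in>S. E s v) \<and> f ` T u \<inter> S = {} then {u} else {})"
  proof (rule set_eqI)
    fix i
    consider "i < u" | "i = u" | "i > u" by linarith
    then show "i \<in> {i. i < Suc u \<and> (\<forall>s\<in>S. E s (?f i)) \<and> ?f ` T i \<inter> S = {}} \<longleftrightarrow>
       i \<in> ?U \<union> (if (\<forall>s\<in>S. E s v) \<and> f ` T u \<inter> S = {} then {u} else {})"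
    proof cases
      case 1 then show ?thesis using im[of i] by simp
    next
      case 2 then show ?thesis using im[of u] by simp
    next
      case 3 then show ?thesis by simp
    qed
  qed
  then show ?thesis by (simp add: usage_def)
qed

text \<open>The new potential is averaged over \<open>A\<close>. For a fixed \<open>S\<close>, an
  increment of the usage occurs only at candidates adjacent to all of \<open>S\<close> and of the
  images of \<open>T u\<close>; these are disjoint sets with at most \<open>2 * d\<close> elements
  in total, so the codegree bound makes such candidates a proportion of order
  \<open>p ^ card S\<close> of \<open>A\<close>. The drift subtracted in the exponent covers
  this.\<close>

lemma exists_good_candidate:
  assumes inv: "invariant u f" and u: "u < n"
    and A: "A \<subseteq> {y\<in>V u. \<forall>j\<in>T u. E (f j) y}" "a / 4 * p ^ card (T u) * M \<le> card A"
  shows "\<exists>v\<in>A. potential (Suc u) (f(u := v)) \<le> potential u f"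
proof -
  \<comment> \<open>\<open>R * (a / 4) = 2 * 8 * z\<close>: the 2 comes from
    \<open>exp x \<le> 1 + 2 * x\<close> at 0 and 1, \<open>8 * z\<close> from the codegree bound
    and \<open>N \<le> z * M\<close>, and \<open>a / 4\<close> from the lower bound on
    \<open>card A\<close>.\<close>
  define R where "R = 64 * z / a"
  define Fam where "Fam = {S. S \<subseteq> {..<N} \<and> card S \<le> d}"
  define k where "k = card (T u)"
  have f: "partial u f" "inj_on f {..<u}" using inv by (auto simp: invariant_def)
  have R0: "0 < R" using z_ge1 a_pos by (simp add: R_def)
  have finA: "finite A" using A(1) finite_V[OF u] by (auto intro: finite_subset)
  have pM0: "0 < p ^ k * M" using p_pos M_ge1 by simp
  have cA: "0 < real (card A)" using A(2) a_pos pM0 by (intro less_le_trans[OF _ A(2)]) (simp add: k_def mult.assoc)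
  define P where "P v S \<longleftrightarrow> (\<forall>s\<in>S. E s v) \<and> f ` T u \<inter> S = {}" for v S
  have Tu: "T u \<subseteq> {..<u}" by (rule T_sub[OF u])
  have fN: "f ` T u \<subseteq> {..<N}"
  proof (rule image_subsetI)
    fix i assume "i \<in> T u"
    then have i: "i < u" using Tu by auto
    then have "f i \<in> V i" using f(1) by (simp add: partial_def)
    then show "f i \<in> {..<N}" using V_mem[of i "f i"] i u by simp
  qed
  have cT: "card (f ` T u) = k" unfolding k_def using inj_on_subset[OF f(2) Tu] by (rule card_image)
  have step: "(\<Sum>v\<in>A. exp (of_bool (P v S))) \<le> card A * exp (R * p ^ card S)" if S: "S \<in> Fam" for S
  proof (cases "f ` T u \<inter> S = {}")
    case False
    have "(\<Sum>v\<in>A. exp (of_bool (P v S))) = real (card A)" using False by (simp add: P_def)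
    also have "\<dots> \<le> card A * exp (R * p ^ card S)"
      using R0 p_pos mult_left_mono[of 1 "exp (R * p ^ card S)" "real (card A)"] by simp
    finally show ?thesis .
  next
    case True
    have SN: "S \<subseteq> {..<N}" "card S \<le> d" using S by (auto simp: Fam_def)
    have "(\<Sum>v\<in>A. exp (of_bool (P v S))) \<le> (\<Sum>v\<in>A. 1 + 2 * (of_bool (P v S) :: real))"
    proof (intro sum_mono)
      fix v show "exp (of_bool (P v S)) \<le> (1 + 2 * of_bool (P v S) :: real)" using exp_le by (cases "P v S") auto
    qed
    also have "\<dots> = real (card A) + 2 * real (card {v\<in>A. P v S})"
      using finA by (simp only: sum.distrib sum_distrib_left[symmetric] sum_of_bool_card) simp
    also have "real (card {v\<in>A. P v S}) \<le> card {y\<in>{..<N}. \<forall>t\<in>S \<union> f ` T u. E t y}"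
    proof (intro of_nat_mono card_mono)
      show "{v\<in>A. P v S} \<subseteq> {y\<in>{..<N}. \<forall>t\<in>S \<union> f ` T u. E t y}"
        using A(1) V_mem[OF u] by (auto simp: P_def)
    qed simp
    also have "\<dots> \<le> 8 * p ^ card (S \<union> f ` T u) * N"
    proof (rule common_nbrs)
      have "card (S \<union> f ` T u) \<le> card S + card (f ` T u)" by (rule card_Un_le)
      then show "card (S \<union> f ` T u) \<le> 2 * d" using SN(2) cT card_T[OF u] by (simp add: k_def)
    qed (use SN fN in auto)
    also have "card (S \<union> f ` T u) = card S + k"
      using True cT finite_sub[OF SN(1)] finite_T[OF u] by (subst card_Un_disjoint) auto
    also have "8 * p ^ (card S + k) * real N \<le> 8 * p ^ (card S + k) * (z * M)"
      using N_le p_pos by (intro mult_left_mono) auto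
    also have "real (card A) + 2 * (8 * p ^ (card S + k) * (z * M)) = card A + R * p ^ card S * (a / 4 * p ^ k * M)"
      using a_pos by (simp add: R_def power_add field_simps)
    also have "\<dots> \<le> card A + R * p ^ card S * card A"
      using A(2) R0 p_pos by (intro add_left_mono mult_left_mono) (auto simp: k_def)
    also have "\<dots> = card A * (1 + R * p ^ card S)" by (simp add: algebra_simps)
    also have "\<dots> \<le> card A * exp (R * p ^ card S)" by (intro mult_left_mono exp_ge_add_one_self) auto
    finally show ?thesis by simp
  qed
  have "(\<Sum>v\<in>A. potential (Suc u) (f(u := v)))
     = (\<Sum>v\<in>A. \<Sum>S\<in>Fam. exp (usage u f S - R * p ^ card S * u) * exp (- R * p ^ card S) * exp (of_bool (P v S)))"
    unfolding potential_def Fam_def[symmetric] R_def[symmetric]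
  proof (intro sum.cong refl)
    fix v S
    have "usage (Suc u) (f(u := v)) S - R * p ^ card S * Suc u =
       (usage u f S - R * p ^ card S * u) + (- R * p ^ card S) + of_bool (P v S)"
      unfolding usage_Suc[OF u] P_def by (simp add: algebra_simps)
    then show "exp (usage (Suc u) (f(u := v)) S - R * p ^ card S * Suc u) =
      exp (usage u f S - R * p ^ card S * u) * exp (- R * p ^ card S) * exp (of_bool (P v S))"
      by (simp only: exp_add)
  qed
  also have "\<dots> = (\<Sum>S\<in>Fam. exp (usage u f S - R * p ^ card S * u) * exp (- R * p ^ card S) * (\<Sum>v\<in>A. exp (of_bool (P v S))))"
    unfolding sum_distrib_left by (rule sum.swap)
  also have "\<dots> \<le> (\<Sum>S\<in>Fam. exp (usage u f S - R * p ^ card S * u) * exp (- R * p ^ card S) * (card A * exp (R * p ^ card S)))"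
    by (intro sum_mono mult_left_mono step) auto
  also have "\<dots> = (\<Sum>S\<in>Fam. card A * exp (usage u f S - R * p ^ card S * u))"
    by (intro sum.cong refl) (simp add: exp_minus)
  also have "\<dots> = card A * potential u f"
    by (simp only: potential_def Fam_def R_def sum_distrib_left)
  finally have le: "(\<Sum>v\<in>A. potential (Suc u) (f(u := v))) \<le> (\<Sum>v\<in>A. potential u f)" by simp
  show ?thesis
  proof (rule ccontr)
    assume "\<not> ?thesis"
    then have "\<And>v. v \<in> A \<Longrightarrow> potential u f < potential (Suc u) (f(u := v))" by (meson not_le)
    moreover have "A \<noteq> {}" using cA by auto
    ultimately have "(\<Sum>v\<in>A. potential u f) < (\<Sum>v\<in>A. potential (Suc u) (f(u := v)))"
      using finA by (intro sum_strict_mono) auto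
    then show False using le by linarith
  qed
qed

text \<open>Of the at least \<open>a * q\<close> colour candidates at most \<open>a / 2 * q\<close>
  are used, and at most \<open>a / 4 * q\<close> overload some \<open>x\<close> by the choice of
  \<open>K\<close>. The remaining \<open>a / 4 * q\<close> are enough for averaging the
  potential.\<close>

lemma invariant_Suc:
  assumes inv: "invariant u f" and u: "u < n"
  shows "\<exists>v. invariant (Suc u) (f(u := v))"
proof -
  define \<Gamma>0 where "\<Gamma>0 = {y\<in>V u. \<forall>j\<in>T u. E (f j) y}"
  define A0 where "A0 = {y\<in>V u. \<forall>i\<in>T u. G (f i) y}"
  define X where "X = {x. u < x \<and> x < n \<and> u \<in> touched x}"
  define Bx where "Bx x = {v\<in>\<Gamma>0. real (card (W x (Suc u) (f(u := v)))) > K ^ aff x (Suc u) * \<eta> * Norm x (Suc u)}" for x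
  define A where "A = A0 - f ` {..<u} - (\<Union>x\<in>X. Bx x)"
  define q where "q = p ^ card (T u) * M"
  have q0: "0 < q" using p_pos M_ge1 by (simp add: q_def)
  have f: "partial u f" "inj_on f {..<u}" using inv by (auto simp: invariant_def)
  have K0: "0 < K" using K_ge1 by simp
  have A0\<Gamma>: "A0 \<subseteq> \<Gamma>0" using G_E by (auto simp: A0_def \<Gamma>0_def)
  have finA0: "finite A0" "finite \<Gamma>0" using finite_V[OF u] by (auto simp: A0_def \<Gamma>0_def)
  have finX: "finite X" by (rule finite_subset[of _ "{..<n}"]) (auto simp: X_def)
  have cB: "real (card (\<Union>x\<in>X. Bx x)) \<le> a / 4 * q"
  proof -
    have "real (card (\<Union>x\<in>X. Bx x)) \<le> (\<Sum>x\<in>X. real (card (Bx x)))"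
      using of_nat_mono[OF card_UN_le[OF finX, of Bx], where ?'a = real] by simp
    also have "\<dots> \<le> (\<Sum>x\<in>X. 2 ^ (d + 2) / K * q)"
      unfolding Bx_def \<Gamma>0_def q_def by (intro sum_mono card_overloaded_le[OF inv]) (auto simp: X_def)
    also have "\<dots> = card X * (2 ^ (d + 2) / K * q)" by simp
    also have "\<dots> \<le> real (\<Delta> + \<Delta> * \<Delta>) * (2 ^ (d + 2) / K * q)"
      using card_touching_le[OF u] K0 q0 unfolding X_def[symmetric] by (intro mult_right_mono of_nat_mono) auto
    also have "\<dots> = (2 ^ (d + 4) * real (\<Delta> + \<Delta> * \<Delta>)) / (4 * K) * q" by (simp add: power_add)
    also have "\<dots> \<le> (K * a) / (4 * K) * q"
      using K_ge K0 q0 by (intro mult_right_mono divide_right_mono) auto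
    also have "\<dots> = a / 4 * q" using K0 by simp
    finally show ?thesis .
  qed
  have cA: "a / 4 * p ^ card (T u) * M \<le> card A"
  proof -
    have "A0 \<subseteq> A \<union> (A0 \<inter> f ` {..<u}) \<union> (\<Union>x\<in>X. Bx x)" by (auto simp: A_def)
    moreover have "finite (\<Union>x\<in>X. Bx x)" using finX finA0 by (auto simp: Bx_def)
    ultimately have "card A0 \<le> card (A \<union> (A0 \<inter> f ` {..<u}) \<union> (\<Union>x\<in>X. Bx x))"
      using finA0 by (intro card_mono) (auto simp: A_def)
    also have "\<dots> \<le> card A + card (A0 \<inter> f ` {..<u}) + card (\<Union>x\<in>X. Bx x)"
      using card_Un_le[of "A \<union> (A0 \<inter> f ` {..<u})" "\<Union>x\<in>X. Bx x"] card_Un_le[of A "A0 \<inter> f ` {..<u}"] by linarith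
    finally have "real (card A0) \<le> real (card A) + real (card (A0 \<inter> f ` {..<u})) + real (card (\<Union>x\<in>X. Bx x))" by linarith
    moreover have "real (card (A0 \<inter> f ` {..<u})) \<le> a / 2 * q"
      using used_candidates_le[OF inv u] by (simp add: A0_def q_def mult.assoc)
    moreover have "a * q \<le> real (card A0)"
      using not_bad_at(1)[OF inv u] by (simp add: A0_def q_def mult.assoc)
    ultimately have "a / 4 * q \<le> card A" using cB by simp
    then show ?thesis by (simp add: q_def mult.assoc)
  qed
  have "A \<subseteq> {y\<in>V u. \<forall>j\<in>T u. E (f j) y}" using A0\<Gamma> by (auto simp: A_def \<Gamma>0_def)
  from exists_good_candidate[OF inv u this cA] obtain v
    where v: "v \<in> A" "potential (Suc u) (f(u := v)) \<le> potential u f" by blast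
  have vA0: "v \<in> V u" "\<And>i. i \<in> T u \<Longrightarrow> G (f i) v" "v \<notin> f ` {..<u}" using v(1) by (auto simp: A_def A0_def)
  have "partial (Suc u) (f(u := v))"
    unfolding partial_def
  proof (intro conjI allI impI ballI)
    fix i assume i: "i < Suc u"
    show "(f(u := v)) i \<in> V i" using i vA0 f(1) by (cases "i = u") (auto simp: partial_def)
    fix j assume j: "j \<in> T i"
    have ji: "j < i" using T_less[of i j] i j u by simp
    show "G ((f(u := v)) j) ((f(u := v)) i)"
    proof (cases "i = u")
      case True
      then show ?thesis using vA0(2) j ji by simp
    next
      case False
      then show ?thesis using f(1) i j ji by (auto simp: partial_def)
    qed
  qed
  moreover have "inj_on (f(u := v)) {..<Suc u}"
  proof -
    have "{..<Suc u} = insert u {..<u}" by auto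
    moreover have "inj_on (f(u := v)) {..<u}" using f(2) by (auto simp: inj_on_def)
    moreover have "(f(u := v)) ` {..<u} = f ` {..<u}" by (intro image_cong) auto
    ultimately show ?thesis using vA0(3) by (auto simp: inj_on_insert)
  qed
  moreover have "potential (Suc u) (f(u := v)) \<le> (real N + 1) ^ d"
    using v(2) inv by (simp add: invariant_def)
  moreover have "real (card (W x (Suc u) (f(u := v)))) \<le> K ^ aff x (Suc u) * \<eta> * Norm x (Suc u)" if x: "Suc u \<le> x" "x < n" for x
  proof (cases "u \<in> touched x")
    case True
    then have "x \<in> X" using x by (simp add: X_def)
    then have "v \<notin> Bx x" using v(1) by (auto simp: A_def)
    moreover have "v \<in> \<Gamma>0" using v(1) A0\<Gamma> by (auto simp: A_def)
    ultimately show ?thesis by (simp add: Bx_def not_less)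
  next
    case False
    have "real (card (W x u f)) \<le> K ^ aff x u * \<eta> * Norm x u" using inv x by (simp add: invariant_def)
    moreover have "u < x" using x by simp
    ultimately show ?thesis using untouched[OF x(2) _ False] by simp
  qed
  ultimately show ?thesis unfolding invariant_def by blast
qed

theorem embedding_exists:
  "\<exists>f. inj_on f {..<n} \<and> (\<forall>x<n. f x \<in> V x) \<and> (\<forall>x<n. \<forall>j\<in>T x. G (f j) (f x))"
proof -
  have "\<exists>f. invariant u f" if "u \<le> n" for u
    using that
  proof (induction u)
    case 0
    show ?case using invariant_0 by blast
  next
    case (Suc u)
    then obtain f where "invariant u f" by auto
    then show ?case using invariant_Suc[of u f] Suc.prems by auto
  qed
  then obtain f where "invariant n f" by blast
  then show ?thesis by (auto simp: invariant_def partial_def)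
qed

end

section \<open>Regular parts in one colour\<close>

text \<open>Deleting an element of least weight does not lower the average.\<close>

lemma subset_average:
  fixes w :: "'a \<Rightarrow> real"
  assumes "finite A" "k \<le> card A"
  shows "\<exists>A1\<subseteq>A. card A1 = k \<and> k * sum w A \<le> card A * sum w A1"
  using assms
proof (induction "card A" arbitrary: A rule: less_induct)
  case less
  show ?case
  proof (cases "card A = k")
    case True
    then show ?thesis by auto
  next
    case False
    define c where "c = card A - 1"
    have cA: "card A = Suc c" "k \<le> c" using False less.prems by (auto simp: c_def)
    have ne: "A \<noteq> {}" using cA by auto
    obtain a where a: "a \<in> A" "\<And>x. x \<in> A \<Longrightarrow> w a \<le> w x"
      using ex_is_arg_min_if_finite[OF less.prems(1) ne, of w] by (auto simp: is_arg_min_linorder)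
    have le: "card A * w a \<le> sum w A"
      using sum_mono[of A "\<lambda>_. w a" w] a(2) by simp
    have s: "sum w (A - {a}) = sum w A - w a" using a less.prems by (simp add: sum_diff1)
    have 1: "c * sum w A \<le> card A * sum w (A - {a})" using le unfolding s cA by (simp add: algebra_simps)
    have cd: "card (A - {a}) = c" using a cA by simp
    then obtain A1 where A1: "A1 \<subseteq> A - {a}" "card A1 = k" "k * sum w (A - {a}) \<le> c * sum w A1"
      using less.hyps[of "A - {a}"] cA less.prems by auto
    show ?thesis
    proof (cases "c = 0")
      case True
      then have "k = 0" using cA by simp
      then show ?thesis by (intro exI[of _ "{}"]) auto
    next
      case False
      have "c * (k * sum w A) \<le> k * (card A * sum w (A - {a}))"
        using mult_left_mono[OF 1, of "real k"] by (simp add: mult_ac)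
      also have "\<dots> = card A * (k * sum w (A - {a}))" by (simp only: mult_ac)
      also have "\<dots> \<le> card A * (c * sum w A1)" using A1 by (intro mult_left_mono) auto
      finally have "c * (k * sum w A) \<le> c * (card A * sum w A1)" by (simp only: mult_ac)
      then show ?thesis using False A1 by auto
    qed
  qed
qed

text \<open>Averaging on one side and then on the other; both sides get the same size without loss
  of density.\<close>

lemma dense_subpair:
  fixes \<delta> :: real
  assumes "finite A" "finite B" "k \<le> card A" "k \<le> card B" "0 < card A" "0 < card B" and \<delta>: "0 \<le> \<delta>"
    and e: "\<delta> * card A * card B \<le> edge_count R A B"
  shows "\<exists>A1\<subseteq>A. \<exists>B1\<subseteq>B. card A1 = k \<and> card B1 = k \<and> \<delta> * k * k \<le> edge_count R A1 B1"
proof -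
  obtain A1 where A1: "A1 \<subseteq> A" "card A1 = k" "k * edge_count R A B \<le> card A * edge_count R A1 B"
    using subset_average[OF assms(1,3), of "\<lambda>a. \<Sum>b\<in>B. of_bool (R a b)"] unfolding edge_count_def by blast
  have "card A * (\<delta> * k * card B) \<le> card A * edge_count R A1 B"
    using mult_left_mono[OF e, of "real k"] A1(3) by (simp add: mult_ac)
  then have 1: "\<delta> * k * card B \<le> edge_count R A1 B" using assms(5) by simp
  obtain B1 where B1: "B1 \<subseteq> B" "card B1 = k" "k * edge_count (\<lambda>x y. R y x) B A1 \<le> card B * edge_count (\<lambda>x y. R y x) B1 A1"
    using subset_average[OF assms(2,4), of "\<lambda>b. \<Sum>a\<in>A1. of_bool (R a b)"] unfolding edge_count_def by blast
  have "card B * (\<delta> * k * k) \<le> card B * edge_count R A1 B1"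
    using mult_left_mono[OF 1, of "real k"] B1(3) unfolding edge_count_swap[of "\<lambda>x y. R y x"] by (simp add: mult_ac)
  then have "\<delta> * k * k \<le> edge_count R A1 B1" using assms(6) by simp
  then show ?thesis using A1(1,2) B1(1,2) by (intro exI[of _ A1] exI[of _ B1] conjI)
qed

text \<open>Regularity in the cut norm. Since the error refers to the whole pair, it passes to
  subsets with a loss depending on their relative size alone.\<close>

definition cut_regular :: "('a \<Rightarrow> 'b \<Rightarrow> bool) \<Rightarrow> real \<Rightarrow> real \<Rightarrow> 'a set \<Rightarrow> 'b set \<Rightarrow> bool" where
  "cut_regular R p \<epsilon> X Y \<longleftrightarrow> (\<exists>\<alpha>. 0 \<le> \<alpha> \<and> \<alpha> \<le> 2 \<and> (\<forall>A\<subseteq>X. \<forall>B\<subseteq>Y.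
     \<bar>edge_count R A B - \<alpha> * p * card A * card B\<bar> \<le> \<epsilon> * p * card X * card Y))"

context jumbled_graph
begin

lemma edge_count_le:
  assumes "\<And>x y. R x y \<Longrightarrow> E x y" "A \<subseteq> {..<N}" "B \<subseteq> {..<N}" "A \<inter> B = {}"
  shows "edge_count R A B \<le> 2 * p * max (card A) b * max (card B) b"
proof -
  have fin: "finite A" "finite B" using assms finite_sub by auto
  have "edge_count R A B \<le> edge_count E A B" using fin assms(1) by (intro edge_count_mono) auto
  also have "\<dots> \<le> p * card A * card B + \<gamma> * p * max (card A) b * max (card B) b"
    using jumbled[OF assms(2-4)] by linarith
  also have "\<dots> \<le> p * max (card A) b * max (card B) b + 1 * p * max (card A) b * max (card B) b"
    using p_pos \<gamma>_nonneg \<gamma>_le1 b_ge1 by (intro add_mono mult_mono) (auto simp: le_max_iff_disj)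
  finally show ?thesis by simp
qed

text \<open>If an irregular witness \<open>A\<close>, \<open>B\<close> has too few edges, half of
  the defect reappears as an excess on \<open>X - A\<close>, \<open>Y\<close> or on
  \<open>A\<close>, \<open>Y - B\<close>, since these and \<open>A\<close>, \<open>B\<close>
  partition the pair. A subpair with such an excess has at least
  \<open>\<epsilon> / 2 * p * s * s\<close> edges, and because densities are at most
  \<open>2 * p\<close> neither of its sides can be smaller than
  \<open>\<epsilon> / 4 * s\<close>.\<close>

lemma density_increment:
  assumes R: "\<And>x y. R x y \<Longrightarrow> E x y" and \<epsilon>: "0 < \<epsilon>" "\<epsilon> \<le> 1"
    and X: "X \<subseteq> {..<N}" and Y: "Y \<subseteq> {..<N}" and XY: "X \<inter> Y = {}" and card: "card X = s" "card Y = s"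
    and b: "b \<le> \<epsilon> / 8 * s" and irr: "\<not> cut_regular R p \<epsilon> X Y"
    and dens: "\<alpha> * p * s * s \<le> edge_count R X Y" and \<alpha>: "0 \<le> \<alpha>"
  shows "\<exists>A\<subseteq>X. \<exists>B\<subseteq>Y. \<exists>s'. card A = s' \<and> card B = s' \<and> \<epsilon> / 4 * s \<le> s' \<and> (\<alpha> + \<epsilon> / 2) * p * s' * s' \<le> edge_count R A B"
proof -
  have fin: "finite X" "finite Y" using X Y finite_sub by auto
  have s0: "0 < s" using b b_ge1 by (cases "s = 0") auto
  have bs: "b \<le> s"
  proof -
    have "\<epsilon> / 8 * real s \<le> 1 * real s" using \<epsilon> by (intro mult_right_mono) auto
    then show ?thesis using b by simp
  qed
  have e_le2: "edge_count R X Y \<le> 2 * p * s * s" using edge_count_le[OF R X Y XY] bs card by simp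
  \<comment> \<open>The actual density in units of \<open>p\<close>. Irregularity is tested against
    it, while \<open>\<alpha>\<close> is merely a lower bound carried through the iteration.\<close>
  define \<beta> where "\<beta> = edge_count R X Y / (p * s * s)"
  have ps: "0 < p * s * s" using p_pos s0 by simp
  have e\<beta>: "edge_count R X Y = \<beta> * p * s * s" using p_pos s0 by (simp add: \<beta>_def)
  have \<beta>: "0 \<le> \<beta>" "\<beta> \<le> 2" "\<alpha> \<le> \<beta>"
  proof -
    show "0 \<le> \<beta>" using ps by (simp add: \<beta>_def)
    show "\<beta> \<le> 2" using e_le2 ps by (simp add: \<beta>_def divide_le_eq mult_ac)
    show "\<alpha> \<le> \<beta>" using dens ps by (simp add: \<beta>_def le_divide_eq mult_ac)
  qed
  obtain A B where AB: "A \<subseteq> X" "B \<subseteq> Y" "\<bar>edge_count R A B - \<beta> * p * card A * card B\<bar> > \<epsilon> * p * s * s"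
    using irr \<beta> unfolding cut_regular_def card by (meson not_le)
  have "\<exists>A\<subseteq>X. \<exists>B\<subseteq>Y. edge_count R A B \<ge> \<beta> * p * card A * card B + \<epsilon> / 2 * p * s * s"
  proof (rule ccontr)
    assume "\<not> ?thesis"
    then have low: "edge_count R A B < \<beta> * p * card A * card B + \<epsilon> / 2 * p * s * s" if "A \<subseteq> X" "B \<subseteq> Y" for A B
      using that by (meson not_le)
    have cX: "real (card (X - A)) = real s - real (card A)"
      using card_Diff_subset[OF finite_subset[OF AB(1) fin(1)] AB(1)] card_mono[OF fin(1) AB(1)] card(1)
      by (simp add: of_nat_diff)
    have cY: "real (card (Y - B)) = real s - real (card B)"
      using card_Diff_subset[OF finite_subset[OF AB(2) fin(2)] AB(2)] card_mono[OF fin(2) AB(2)] card(2)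
      by (simp add: of_nat_diff)
    have "edge_count R A B < \<beta> * p * card A * card B + \<epsilon> / 2 * p * s * s" by (rule low[OF AB(1,2)])
    moreover have "0 < \<epsilon> / 2 * p * s * s" using \<epsilon> ps by (simp add: mult.assoc)
    moreover have "edge_count R X Y - edge_count R A Y < \<beta> * p * (real s - real (card A)) * s + \<epsilon> / 2 * p * s * s"
      using low[of "X - A" Y] edge_count_Diff_left[OF fin(1) AB(1), of R Y] cX card by simp
    moreover have "edge_count R A Y - edge_count R A B < \<beta> * p * card A * (real s - real (card B)) + \<epsilon> / 2 * p * s * s"
      using low[of A "Y - B"] AB edge_count_Diff_right[OF fin(2) AB(2), of R A] cY by simp
    ultimately have "\<bar>edge_count R A B - \<beta> * p * card A * card B\<bar> \<le> \<epsilon> * p * s * s"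
      unfolding e\<beta> by (simp add: abs_le_iff algebra_simps)
    then show False using AB(3) by linarith
  qed
  then obtain A B where A: "A \<subseteq> X" "B \<subseteq> Y" "edge_count R A B \<ge> \<beta> * p * card A * card B + \<epsilon> / 2 * p * s * s" by blast
  have finAB: "finite A" "finite B" using A fin finite_subset by auto
  have AN: "A \<subseteq> {..<N}" "B \<subseteq> {..<N}" using A X Y by auto
  have low: "\<epsilon> / 2 * p * s * s \<le> edge_count R A B"
  proof -
    have "0 \<le> \<beta> * p * card A * card B" using \<beta> p_pos by simp
    then show ?thesis using A(3) by linarith
  qed
  have big: "\<epsilon> / 4 * s \<le> q" if q: "\<epsilon> / 2 * p * s * s \<le> 2 * p * max q b * s" for q :: real
  proof -
    have "(2 * p * s) * (\<epsilon> / 4 * s) \<le> (2 * p * s) * max q b" using q by (simp add: mult_ac)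
    then have "\<epsilon> / 4 * s \<le> max q b" using p_pos s0 by simp
    moreover have "b < \<epsilon> / 4 * s" using b b_ge1 by linarith
    ultimately show ?thesis by linarith
  qed
  have mY: "max (real (card Y)) b = s" "max (real (card X)) b = s" using card bs by auto
  have cA: "\<epsilon> / 4 * s \<le> card A"
  proof (rule big)
    have "edge_count R A B \<le> edge_count R A Y" using A fin finAB by (intro edge_count_mono) auto
    also have "\<dots> \<le> 2 * p * max (card A) b * max (card Y) b"
      using AN Y XY A by (intro edge_count_le R) auto
    finally show "\<epsilon> / 2 * p * s * s \<le> 2 * p * max (card A) b * s" using low unfolding mY by linarith
  qed
  have cB: "\<epsilon> / 4 * s \<le> card B"
  proof (rule big)
    have "edge_count R A B \<le> edge_count R X B" using A fin finAB by (intro edge_count_mono) auto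
    also have "\<dots> \<le> 2 * p * max (card X) b * max (card B) b"
      using AN X XY A by (intro edge_count_le R) auto
    finally show "\<epsilon> / 2 * p * s * s \<le> 2 * p * max (card B) b * s" using low unfolding mY by (simp add: mult_ac)
  qed
  define k where "k = nat \<lceil>\<epsilon> / 4 * s\<rceil>"
  have k: "\<epsilon> / 4 * s \<le> k" "k \<le> card A" "k \<le> card B"
  proof -
    show "\<epsilon> / 4 * s \<le> k" unfolding k_def by (rule real_nat_ceiling_ge)
    show "k \<le> card A" "k \<le> card B" using cA cB by (simp_all add: k_def nat_le_iff ceiling_le_iff)
  qed
  have "0 < \<epsilon> / 4 * s" using \<epsilon> s0 by simp
  then have c0: "0 < card A" "0 < card B" using cA cB by linarith+
  have "((\<alpha> + \<epsilon> / 2) * p) * card A * card B \<le> edge_count R A B"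
  proof -
    have "\<alpha> * p * card A * card B \<le> \<beta> * p * card A * card B"
      using \<beta> p_pos by (intro mult_right_mono) auto
    moreover have "\<epsilon> / 2 * p * (real (card A) * card B) \<le> \<epsilon> / 2 * p * (real s * s)"
      using card_mono[OF fin(1) A(1)] card_mono[OF fin(2) A(2)] card \<epsilon> p_pos by (intro mult_left_mono mult_mono) auto
    ultimately show ?thesis using A(3) by (simp add: algebra_simps)
  qed
  then obtain A1 B1 where "A1 \<subseteq> A" "B1 \<subseteq> B" "card A1 = k" "card B1 = k" "((\<alpha> + \<epsilon> / 2) * p) * k * k \<le> edge_count R A1 B1"
    using dense_subpair[OF finAB k(2,3) c0, where \<delta> = "(\<alpha> + \<epsilon> / 2) * p" and R = R] \<alpha> \<epsilon> p_pos by auto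
  then show ?thesis using A k(1) by (meson order_trans)
qed

text \<open>\<open>j\<close> counts the remaining increments: each failure raises
  \<open>\<alpha>\<close> by \<open>\<epsilon> / 2\<close>, and at \<open>j = 0\<close> it would be
  at least 3, whereas no density exceeds 2.\<close>

lemma regular_subpair_aux:
  assumes R: "\<And>x y. R x y \<Longrightarrow> E x y" and \<epsilon>: "0 < \<epsilon>" "\<epsilon> \<le> 1"
  shows "X \<subseteq> {..<N} \<Longrightarrow> Y \<subseteq> {..<N} \<Longrightarrow> X \<inter> Y = {} \<Longrightarrow> card X = s \<Longrightarrow> card Y = s \<Longrightarrow>
    b \<le> (\<epsilon> / 4) ^ j * (\<epsilon> / 8) * s \<Longrightarrow> 0 \<le> \<alpha> \<Longrightarrow> 3 - j * (\<epsilon> / 2) \<le> \<alpha> \<Longrightarrow> \<alpha> * p * s * s \<le> edge_count R X Y \<Longrightarrow>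
    \<exists>A\<subseteq>X. \<exists>B\<subseteq>Y. \<exists>s'. card A = s' \<and> card B = s' \<and> (\<epsilon> / 4) ^ j * s \<le> s' \<and> cut_regular R p \<epsilon> A B"
proof (induction j arbitrary: X Y s \<alpha>)
  case 0
  have b: "b \<le> \<epsilon> / 8 * s" using 0 by simp
  also have "\<dots> \<le> 1 * real s" using \<epsilon> by (intro mult_right_mono) auto
  finally have "b \<le> s" by simp
  then have "edge_count R X Y \<le> 2 * (p * s * s)" using edge_count_le[OF R 0(1-3)] 0(4,5) by (simp add: mult_ac)
  moreover have "3 * (p * s * s) \<le> \<alpha> * (p * s * s)" using 0 p_pos by (intro mult_right_mono) auto
  moreover have "0 < p * s * s" using p_pos \<open>b \<le> s\<close> b_ge1 by simp
  ultimately have False using 0(9) by (simp add: mult.assoc)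
  then show ?case ..
next
  case (Suc j)
  have pow: "(\<epsilon> / 4) ^ Suc j \<le> 1" "(\<epsilon> / 4) ^ j \<le> 1" using \<epsilon> by (auto intro!: power_le_one simp del: power_Suc)
  have bs: "b \<le> \<epsilon> / 8 * s"
  proof -
    have "(\<epsilon> / 4) ^ Suc j * (\<epsilon> / 8 * s) \<le> 1 * (\<epsilon> / 8 * s)" using pow \<epsilon> by (intro mult_right_mono) auto
    then show ?thesis using Suc.prems(6) by (simp only: mult.assoc mult_1)
  qed
  show ?case
  proof (cases "cut_regular R p \<epsilon> X Y")
    case True
    have "(\<epsilon> / 4) ^ Suc j * s \<le> 1 * real s" using pow by (intro mult_right_mono) auto
    then show ?thesis using True Suc.prems(4,5) by auto
  next
    case False
    obtain A B s' where A: "A \<subseteq> X" "B \<subseteq> Y" "card A = s'" "card B = s'" "\<epsilon> / 4 * s \<le> s'"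
      "(\<alpha> + \<epsilon> / 2) * p * s' * s' \<le> edge_count R A B"
      using density_increment[OF R \<epsilon> Suc.prems(1-5) bs False Suc.prems(9,7)] by blast
    have le: "(\<epsilon> / 4) ^ Suc j * s \<le> (\<epsilon> / 4) ^ j * s'"
      using mult_left_mono[OF A(5), of "(\<epsilon> / 4) ^ j"] \<epsilon> by (simp add: mult_ac)
    have "\<exists>A'\<subseteq>A. \<exists>B'\<subseteq>B. \<exists>s''. card A' = s'' \<and> card B' = s'' \<and> (\<epsilon> / 4) ^ j * s' \<le> s'' \<and> cut_regular R p \<epsilon> A' B'"
    proof (rule Suc.IH[OF _ _ _ A(3,4) _ _ _ A(6)])
      show "A \<subseteq> {..<N}" "B \<subseteq> {..<N}" "A \<inter> B = {}" using A Suc.prems by auto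
      have "\<epsilon> / 8 * ((\<epsilon> / 4) ^ Suc j * s) \<le> \<epsilon> / 8 * ((\<epsilon> / 4) ^ j * s')" using le \<epsilon> by (intro mult_left_mono) auto
      then show "b \<le> (\<epsilon> / 4) ^ j * (\<epsilon> / 8) * s'" using Suc.prems(6) by (simp only: mult_ac)
      show "0 \<le> \<alpha> + \<epsilon> / 2" using Suc.prems(7) \<epsilon> by simp
      show "3 - real j * (\<epsilon> / 2) \<le> \<alpha> + \<epsilon> / 2" using Suc.prems(8) by (simp add: algebra_simps add_divide_distrib)
    qed
    then obtain A' B' s'' where "A' \<subseteq> A" "B' \<subseteq> B" "card A' = s''" "card B' = s''" "(\<epsilon> / 4) ^ j * s' \<le> s''" "cut_regular R p \<epsilon> A' B'"
      by blast
    then show ?thesis using A le by (meson order_trans)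
  qed
qed

lemma regular_subpair:
  assumes R: "\<And>x y. R x y \<Longrightarrow> E x y" and \<epsilon>: "0 < \<epsilon>" "\<epsilon> \<le> 1" and j: "6 / \<epsilon> \<le> real j"
    and X: "X \<subseteq> {..<N}" "Y \<subseteq> {..<N}" "X \<inter> Y = {}" "card X = s" "card Y = s"
    and b: "b \<le> (\<epsilon> / 4) ^ j * (\<epsilon> / 8) * s"
  shows "\<exists>A\<subseteq>X. \<exists>B\<subseteq>Y. \<exists>s'. card A = s' \<and> card B = s' \<and> (\<epsilon> / 4) ^ j * s \<le> s' \<and> cut_regular R p \<epsilon> A B"
proof (rule regular_subpair_aux[OF R \<epsilon> X b order_refl])
  show "3 - real j * (\<epsilon> / 2) \<le> 0" using j \<epsilon> by (simp add: field_simps)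
qed auto

end

section \<open>All pairs and all colours at once\<close>

lemma cut_regular_subset:
  assumes "cut_regular R p \<epsilon>' X Y" "X' \<subseteq> X" "Y' \<subseteq> Y" "\<epsilon>' * p * card X * card Y \<le> \<epsilon> * p * card X' * card Y'"
  shows "cut_regular R p \<epsilon> X' Y'"
  using assms unfolding cut_regular_def by (meson order_trans)

text \<open>Parts shrink again while later pairs are treated, which weakens the regularity already
  obtained. The head of the list therefore gets the error \<open>\<epsilon> * \<kappa>1^2\<close>,
  where \<open>\<kappa>1\<close> is the shrinking caused by the tail. \<open>\<kappa>\<close>
  depends on \<open>\<epsilon>\<close> and the list only, so it is quantified before the
  graph.\<close>

lemma regular_parts_list:
  fixes \<epsilon> :: real and L :: "(nat \<times> nat \<times> nat) list"
  assumes "0 < \<epsilon>" "\<epsilon> \<le> 1" "\<And>i j c. (i, j, c) \<in> set L \<Longrightarrow> i < m \<and> j < m \<and> i \<noteq> j"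
  shows "\<exists>\<kappa>::real. 0 < \<kappa> \<and> \<kappa> \<le> 1 \<and>
    (\<forall>E N d p b \<gamma> R V s. jumbled_graph E N d p b \<gamma> \<longrightarrow> (\<forall>c x y. R c x y \<longrightarrow> E x y) \<longrightarrow>
       (\<forall>i<m. V i \<subseteq> {..<N} \<and> card (V i) = s) \<longrightarrow> (\<forall>i<m. \<forall>j<m. i \<noteq> j \<longrightarrow> V i \<inter> V j = {}) \<longrightarrow> b \<le> \<kappa> * real s \<longrightarrow>
       (\<exists>V' s'. (\<forall>i<m. V' i \<subseteq> V i \<and> card (V' i) = s') \<and> \<kappa> * real s \<le> real s' \<and>
          (\<forall>(i, j, c)\<in>set L. cut_regular (R c) p \<epsilon> (V' i) (V' j))))"
  using assms(3)
proof (induction L)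
  case Nil
  show ?case
  proof (intro exI[of _ 1] conjI allI impI)
    fix E N d p b \<gamma> and R :: "nat \<Rightarrow> nat \<Rightarrow> nat \<Rightarrow> bool" and V :: "nat \<Rightarrow> nat set" and s :: nat
    assume "\<forall>i<m. V i \<subseteq> {..<N} \<and> card (V i) = s"
    then show "\<exists>V' s'. (\<forall>i<m. V' i \<subseteq> V i \<and> card (V' i) = s') \<and> 1 * real s \<le> real s' \<and>
          (\<forall>(i, j, c)\<in>set []. cut_regular (R c) p \<epsilon> (V' i) (V' j))"
      by (intro exI[of _ V] exI[of _ s]) simp
  qed auto
next
  case (Cons x L)
  obtain i0 j0 c0 where x: "x = (i0, j0, c0)" by (cases x)
  have ij: "i0 < m" "j0 < m" "i0 \<noteq> j0" using Cons.prems[of i0 j0 c0] x by auto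
  have "\<exists>\<kappa>::real. 0 < \<kappa> \<and> \<kappa> \<le> 1 \<and>
    (\<forall>E N d p b \<gamma> R V s. jumbled_graph E N d p b \<gamma> \<longrightarrow> (\<forall>c x y. R c x y \<longrightarrow> E x y) \<longrightarrow>
       (\<forall>i<m. V i \<subseteq> {..<N} \<and> card (V i) = s) \<longrightarrow> (\<forall>i<m. \<forall>j<m. i \<noteq> j \<longrightarrow> V i \<inter> V j = {}) \<longrightarrow> b \<le> \<kappa> * real s \<longrightarrow>
       (\<exists>V' s'. (\<forall>i<m. V' i \<subseteq> V i \<and> card (V' i) = s') \<and> \<kappa> * real s \<le> real s' \<and>
          (\<forall>(i, j, c)\<in>set L. cut_regular (R c) p \<epsilon> (V' i) (V' j))))"
    by (rule Cons.IH) (use Cons.prems in auto)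
  then obtain \<kappa>1 :: real where \<kappa>1: "0 < \<kappa>1" "\<kappa>1 \<le> 1" and IH: "\<And>E N d p b \<gamma> R V s. jumbled_graph E N d p b \<gamma> \<Longrightarrow> (\<forall>c x y. R c x y \<longrightarrow> E x y) \<Longrightarrow>
       (\<forall>i<m. V i \<subseteq> {..<N} \<and> card (V i) = s) \<Longrightarrow> (\<forall>i<m. \<forall>j<m. i \<noteq> j \<longrightarrow> V i \<inter> V j = {}) \<Longrightarrow> b \<le> \<kappa>1 * real s \<Longrightarrow>
       (\<exists>V' s'. (\<forall>i<m. V' i \<subseteq> V i \<and> card (V' i) = s') \<and> \<kappa>1 * real s \<le> real s' \<and>
          (\<forall>(i, j, c)\<in>set L. cut_regular (R c) p \<epsilon> (V' i) (V' j)))"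
    by blast
  define e where "e = \<epsilon> * \<kappa>1\<^sup>2"
  have e: "0 < e" "e \<le> 1"
  proof -
    show "0 < e" using assms(1) \<kappa>1 by (simp add: e_def)
    have "\<kappa>1\<^sup>2 \<le> 1" using \<kappa>1 by (intro power_le_one) auto
    then have "\<epsilon> * \<kappa>1\<^sup>2 \<le> 1 * 1" using assms \<kappa>1 by (intro mult_mono) auto
    then show "e \<le> 1" by (simp add: e_def)
  qed
  obtain k :: nat where k: "6 / e \<le> real k" using real_arch_simple by blast
  define q where "q = (e / 4) ^ k"
  have q: "0 < q" "q \<le> 1" using e by (auto simp: q_def intro!: power_le_one)
  define \<kappa> where "\<kappa> = q * (e / 8) * \<kappa>1"
  have \<kappa>: "0 < \<kappa>" "\<kappa> \<le> \<kappa>1 * q" "\<kappa> \<le> q * (e / 8)" "\<kappa> \<le> 1"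
  proof -
    show "0 < \<kappa>" using q e \<kappa>1 by (simp add: \<kappa>_def)
    have "(q * \<kappa>1) * (e / 8) \<le> (q * \<kappa>1) * 1" using q e \<kappa>1 by (intro mult_left_mono) auto
    then show 1: "\<kappa> \<le> \<kappa>1 * q" by (simp add: \<kappa>_def mult_ac)
    have "(q * (e / 8)) * \<kappa>1 \<le> (q * (e / 8)) * 1" using q e \<kappa>1 by (intro mult_left_mono) auto
    then show "\<kappa> \<le> q * (e / 8)" by (simp add: \<kappa>_def)
    have "\<kappa>1 * q \<le> 1 * 1" using \<kappa>1 q by (intro mult_mono) auto
    then show "\<kappa> \<le> 1" using 1 by simp
  qed
  show ?case
  proof (intro exI[of _ \<kappa>] conjI \<kappa> allI impI)
    fix E N d p b \<gamma> and R :: "nat \<Rightarrow> nat \<Rightarrow> nat \<Rightarrow> bool" and V :: "nat \<Rightarrow> nat set" and s :: nat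
    assume J: "jumbled_graph E N d p b \<gamma>" and R: "\<forall>c x y. R c x y \<longrightarrow> E x y"
      and V: "\<forall>i<m. V i \<subseteq> {..<N} \<and> card (V i) = s" and VV: "\<forall>i<m. \<forall>j<m. i \<noteq> j \<longrightarrow> V i \<inter> V j = {}"
      and b: "b \<le> \<kappa> * real s"
    interpret jumbled_graph E N d p b \<gamma> by (rule J)
    have b': "b \<le> (e / 4) ^ k * (e / 8) * s"
      using b mult_right_mono[OF \<kappa>(3), of "real s"] by (simp add: q_def)
    have "\<exists>A\<subseteq>V i0. \<exists>B\<subseteq>V j0. \<exists>s1. card A = s1 \<and> card B = s1 \<and> (e / 4) ^ k * s \<le> s1 \<and> cut_regular (R c0) p e A B"
    proof (rule regular_subpair[OF _ e k _ _ _ _ _ b'])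
      show "R c0 x y \<Longrightarrow> E x y" for x y using R by blast
      show "V i0 \<subseteq> {..<N}" "V j0 \<subseteq> {..<N}" "card (V i0) = s" "card (V j0) = s" using V ij by auto
      show "V i0 \<inter> V j0 = {}" using VV ij by simp
    qed
    then obtain A B s1 where AB: "A \<subseteq> V i0" "B \<subseteq> V j0" "card A = s1" "card B = s1" "(e / 4) ^ k * s \<le> s1" "cut_regular (R c0) p e A B"
      by blast
    have fV: "finite (V i)" if "i < m" for i using V that finite_sub by blast
    have s1s: "s1 \<le> s" using card_mono[OF fV[OF ij(1)] AB(1)] AB(3) V ij by auto
    \<comment> \<open>The parts not involved are cut to the same size, since equal sizes are part of
      the induction hypothesis.\<close>
    have "\<exists>C. C \<subseteq> V i \<and> card C = s1" if "i < m" for i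
      using obtain_subset_with_card_n[of s1 "V i"] s1s V that by auto
    then obtain C where C: "\<And>i. i < m \<Longrightarrow> C i \<subseteq> V i \<and> card (C i) = s1" by metis
    define V1 where "V1 = C(i0 := A, j0 := B)"
    have V1: "V1 i \<subseteq> V i \<and> card (V1 i) = s1" if "i < m" for i
      using C[OF that] AB ij by (auto simp: V1_def)
    have V1ij: "V1 i0 = A" "V1 j0 = B" using ij by (auto simp: V1_def)
    have s1: "q * s \<le> s1" using AB(5) by (simp add: q_def)
    have \<kappa>s: "\<kappa> * real s \<le> \<kappa>1 * real s1"
    proof -
      have "\<kappa> * real s \<le> (\<kappa>1 * q) * real s" using \<kappa> by (intro mult_right_mono) auto
      also have "\<dots> = \<kappa>1 * (q * real s)" by simp
      also have "\<dots> \<le> \<kappa>1 * real s1" using s1 \<kappa>1 by (intro mult_left_mono) auto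
      finally show ?thesis .
    qed
    have "\<exists>V' s'. (\<forall>i<m. V' i \<subseteq> V1 i \<and> card (V' i) = s') \<and> \<kappa>1 * real s1 \<le> real s' \<and>
          (\<forall>(i, j, c)\<in>set L. cut_regular (R c) p \<epsilon> (V' i) (V' j))"
    proof (rule IH[OF J R])
      show "\<forall>i<m. V1 i \<subseteq> {..<N} \<and> card (V1 i) = s1" using V1 V by blast
      show "\<forall>i<m. \<forall>j<m. i \<noteq> j \<longrightarrow> V1 i \<inter> V1 j = {}" using V1 VV by blast
      show "b \<le> \<kappa>1 * real s1" using b \<kappa>s by simp
    qed
    then obtain V' s' where V': "\<And>i. i < m \<Longrightarrow> V' i \<subseteq> V1 i \<and> card (V' i) = s'" "\<kappa>1 * real s1 \<le> real s'"
      "\<forall>(i, j, c)\<in>set L. cut_regular (R c) p \<epsilon> (V' i) (V' j)" by blast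
    have "cut_regular (R c0) p \<epsilon> (V' i0) (V' j0)"
    proof (rule cut_regular_subset[OF AB(6)])
      show "V' i0 \<subseteq> A" "V' j0 \<subseteq> B" using V'(1)[OF ij(1)] V'(1)[OF ij(2)] V1ij by auto
      have "(\<kappa>1 * real s1) * (\<kappa>1 * real s1) \<le> real s' * real s'" using V'(2) \<kappa>1 by (intro mult_mono) auto
      then have "(\<epsilon> * p) * ((\<kappa>1 * real s1) * (\<kappa>1 * real s1)) \<le> (\<epsilon> * p) * (real s' * real s')"
        using assms p_pos by (intro mult_left_mono) auto
      then show "e * p * card A * card B \<le> \<epsilon> * p * card (V' i0) * card (V' j0)"
        using V'(1)[OF ij(1)] V'(1)[OF ij(2)] AB(3,4) by (simp add: e_def power2_eq_square mult_ac)
    qed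
    then have "\<forall>(i, j, c)\<in>set (x # L). cut_regular (R c) p \<epsilon> (V' i) (V' j)" using V'(3) x by auto
    moreover have "\<forall>i<m. V' i \<subseteq> V i \<and> card (V' i) = s'" using V'(1) V1 by blast
    moreover have "\<kappa> * real s \<le> real s'" using \<kappa>s V'(2) by simp
    ultimately show "\<exists>V' s'. (\<forall>i<m. V' i \<subseteq> V i \<and> card (V' i) = s') \<and> \<kappa> * real s \<le> real s' \<and>
          (\<forall>(i, j, c)\<in>set (x # L). cut_regular (R c) p \<epsilon> (V' i) (V' j))" by blast
  qed
qed

lemma multicolour_ramsey: "\<exists>m0::nat. partn_lst {..<m0} (replicate r m) 2"
  using ramsey_full by blast

text \<open>For \<open>\<gamma> \<le> 1 / 2\<close> every pair of blocks has density at least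
  \<open>p / 2\<close>, so some colour has at least \<open>p / (2 * r)\<close>; a pair of blocks is
  coloured with such a colour. The regularity parameter \<open>\<alpha>\<close> differs from the
  density in units of \<open>p\<close> by at most \<open>\<epsilon> \<le> 1 / (4 * r)\<close>, which
  leaves \<open>1 / (4 * r)\<close>.\<close>

lemma monochromatic_regular_parts:
  fixes \<epsilon> :: real and r m :: nat
  assumes r: "1 \<le> r" and \<epsilon>: "0 < \<epsilon>" "\<epsilon> \<le> 1 / (4 * real r)"
  shows "\<exists>\<kappa>::real. 0 < \<kappa> \<and> \<kappa> \<le> 1 \<and>
    (\<forall>E N d p b \<gamma> R. jumbled_graph E N d p b \<gamma> \<longrightarrow> \<gamma> \<le> 1 / 2 \<longrightarrow> (\<forall>c x y. R c x y \<longrightarrow> E x y) \<longrightarrow>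
       (\<forall>x y. E x y \<longrightarrow> (\<exists>c<r. R c x y)) \<longrightarrow> (\<forall>c x y. R c x y \<longrightarrow> R c y x) \<longrightarrow> b \<le> \<kappa> * real N \<longrightarrow>
       (\<exists>c<r. \<exists>V s. \<kappa> * real N \<le> real s \<and> (\<forall>i<m. V i \<subseteq> {..<N} \<and> card (V i) = s) \<and>
          (\<forall>i<m. \<forall>j<m. i \<noteq> j \<longrightarrow> V i \<inter> V j = {} \<and>
            (\<exists>\<alpha>. 1 / (4 * real r) \<le> \<alpha> \<and> \<alpha> \<le> 2 \<and> (\<forall>A\<subseteq>V i. \<forall>B\<subseteq>V j.
              \<bar>edge_count (R c) A B - \<alpha> * p * card A * card B\<bar> \<le> \<epsilon> * p * real s ^ 2)))))"
proof -
  obtain m1 :: nat where m1: "partn_lst {..<m1} (replicate r m) 2" using multicolour_ramsey by blast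
  \<comment> \<open>The successor makes the number of blocks positive, so that \<open>N\<close> can
    be divided by it.\<close>
  define m0 where "m0 = Suc m1"
  have m0: "partn_lst {..<m0} (replicate r m) 2" using partn_lst_greater_resource[OF m1] by (simp add: m0_def)
  have m0pos: "0 < m0" by (simp add: m0_def)
  have "1 / (4 * real r) \<le> 1" using r by simp
  then have \<epsilon>1: "\<epsilon> \<le> 1" using \<epsilon> by simp
  define L where "L = [(i, j, c). i \<leftarrow> [0..<m0], j \<leftarrow> [0..<m0], c \<leftarrow> [0..<r], i \<noteq> j]"
  have L: "(i, j, c) \<in> set L \<longleftrightarrow> i < m0 \<and> j < m0 \<and> c < r \<and> i \<noteq> j" for i j c
    by (auto simp: L_def)
  have "\<exists>\<kappa>::real. 0 < \<kappa> \<and> \<kappa> \<le> 1 \<and>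
    (\<forall>E N d p b \<gamma> R V s. jumbled_graph E N d p b \<gamma> \<longrightarrow> (\<forall>c x y. R c x y \<longrightarrow> E x y) \<longrightarrow>
       (\<forall>i<m0. V i \<subseteq> {..<N} \<and> card (V i) = s) \<longrightarrow> (\<forall>i<m0. \<forall>j<m0. i \<noteq> j \<longrightarrow> V i \<inter> V j = {}) \<longrightarrow> b \<le> \<kappa> * real s \<longrightarrow>
       (\<exists>V' s'. (\<forall>i<m0. V' i \<subseteq> V i \<and> card (V' i) = s') \<and> \<kappa> * real s \<le> real s' \<and>
          (\<forall>(i, j, c)\<in>set L. cut_regular (R c) p \<epsilon> (V' i) (V' j))))"
    by (rule regular_parts_list[OF \<epsilon>(1) \<epsilon>1]) (use L in auto)
  then obtain \<kappa>0 :: real where \<kappa>0: "0 < \<kappa>0" "\<kappa>0 \<le> 1" and main: "\<And>E N d p b \<gamma> R V s. jumbled_graph E N d p b \<gamma> \<Longrightarrow> (\<forall>c x y. R c x y \<longrightarrow> E x y) \<Longrightarrow>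
       (\<forall>i<m0. V i \<subseteq> {..<N} \<and> card (V i) = s) \<Longrightarrow> (\<forall>i<m0. \<forall>j<m0. i \<noteq> j \<longrightarrow> V i \<inter> V j = {}) \<Longrightarrow> b \<le> \<kappa>0 * real s \<Longrightarrow>
       (\<exists>V' s'. (\<forall>i<m0. V' i \<subseteq> V i \<and> card (V' i) = s') \<and> \<kappa>0 * real s \<le> real s' \<and>
          (\<forall>(i, j, c)\<in>set L. cut_regular (R c) p \<epsilon> (V' i) (V' j)))"
    by blast
  define \<kappa> where "\<kappa> = \<kappa>0 / (2 * real m0)"
  have \<kappa>: "0 < \<kappa>" "\<kappa> \<le> 1"
  proof -
    show "0 < \<kappa>" using \<kappa>0 m0pos by (simp add: \<kappa>_def)
    have "\<kappa>0 \<le> 2 * real m0" using \<kappa>0 m0pos by linarith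
    then show "\<kappa> \<le> 1" using m0pos by (simp add: \<kappa>_def)
  qed
  show ?thesis
  proof (intro exI[of _ \<kappa>] conjI \<kappa> allI impI)
    fix E N d p b \<gamma> and R :: "nat \<Rightarrow> nat \<Rightarrow> nat \<Rightarrow> bool"
    assume J: "jumbled_graph E N d p b \<gamma>" and \<gamma>: "\<gamma> \<le> 1 / 2" and R: "\<forall>c x y. R c x y \<longrightarrow> E x y"
      and cov: "\<forall>x y. E x y \<longrightarrow> (\<exists>c<r. R c x y)" and sym: "\<forall>c x y. R c x y \<longrightarrow> R c y x"
      and b: "b \<le> \<kappa> * real N"
    interpret jumbled_graph E N d p b \<gamma> by (rule J)
    define s0 where "s0 = N div m0"
    have NM: "m0 \<le> N"
    proof -
      have "1 \<le> \<kappa> * real N" using b b_ge1 by simp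
      then have "2 * real m0 \<le> \<kappa>0 * real N" using m0pos by (simp add: \<kappa>_def field_simps)
      also have "\<dots> \<le> 1 * real N" using \<kappa>0 by (intro mult_right_mono) auto
      finally show ?thesis by linarith
    qed
    have s0: "real N \<le> 2 * real m0 * real s0"
    proof -
      have "1 \<le> s0" using NM m0pos by (simp add: s0_def Suc_le_eq div_greater_zero_iff)
      have "N = m0 * s0 + N mod m0" by (simp add: s0_def)
      also have "\<dots> \<le> m0 * s0 + m0" using m0pos by (simp add: less_imp_le)
      also have "\<dots> \<le> m0 * s0 + m0 * s0" using \<open>1 \<le> s0\<close> by simp
      finally have "real N \<le> real (m0 * s0 + m0 * s0)" by (rule of_nat_mono)
      then show ?thesis by simp
    qed
    define V0 where "V0 i = {i * s0..<i * s0 + s0}" for i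
    have V0sub: "V0 i \<subseteq> {..<N}" if "i < m0" for i
    proof -
      have "i * s0 + s0 = (i + 1) * s0" by simp
      also have "\<dots> \<le> m0 * s0" using that by (intro mult_right_mono) auto
      also have "\<dots> \<le> N" by (simp add: s0_def)
      finally show ?thesis by (auto simp: V0_def)
    qed
    have disj: "V0 i \<inter> V0 j = {}" if "i < j" for i j
    proof -
      have "i * s0 + s0 = (i + 1) * s0" by simp
      also have "\<dots> \<le> j * s0" using that by (intro mult_right_mono) auto
      finally show ?thesis by (auto simp: V0_def)
    qed
    have V0disj: "V0 i \<inter> V0 j = {}" if "i \<noteq> j" for i j
      using disj[of i j] disj[of j i] that by (metis inf_commute nat_neq_iff)
    have \<kappa>N: "\<kappa> * real N \<le> \<kappa>0 * real s0"
    proof -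
      have "\<kappa> * real N \<le> \<kappa> * (2 * real m0 * real s0)" using s0 \<kappa> by (intro mult_left_mono) auto
      also have "\<dots> = \<kappa>0 * real s0" using m0pos by (simp add: \<kappa>_def)
      finally show ?thesis .
    qed
    have "\<exists>V' s'. (\<forall>i<m0. V' i \<subseteq> V0 i \<and> card (V' i) = s') \<and> \<kappa>0 * real s0 \<le> real s' \<and>
          (\<forall>(i, j, c)\<in>set L. cut_regular (R c) p \<epsilon> (V' i) (V' j))"
    proof (rule main[OF J R])
      show "\<forall>i<m0. V0 i \<subseteq> {..<N} \<and> card (V0 i) = s0" using V0sub by (auto simp: V0_def)
      show "\<forall>i<m0. \<forall>j<m0. i \<noteq> j \<longrightarrow> V0 i \<inter> V0 j = {}" using V0disj by blast
      show "b \<le> \<kappa>0 * real s0" using b \<kappa>N by simp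
    qed
    then obtain V s where V: "\<And>i. i < m0 \<Longrightarrow> V i \<subseteq> V0 i \<and> card (V i) = s" "\<kappa>0 * real s0 \<le> real s"
      and reg0: "\<forall>(i, j, c)\<in>set L. cut_regular (R c) p \<epsilon> (V i) (V j)" by blast
    have reg: "cut_regular (R c) p \<epsilon> (V i) (V j)" if "i < m0" "j < m0" "c < r" "i \<noteq> j" for i j c
      using reg0 L[of i j c] that by blast
    have Vdisj: "V i \<inter> V j = {}" if "i < m0" "j < m0" "i \<noteq> j" for i j
      using V(1)[OF that(1)] V(1)[OF that(2)] V0disj[OF that(3)] by blast
    have VN: "V i \<subseteq> {..<N}" if "i < m0" for i using V(1)[OF that] V0sub[OF that] by blast
    have sb: "b \<le> s" using b \<kappa>N V(2) by simp
    have s_pos: "0 < real s" using sb b_ge1 by linarith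
    have maj: "\<exists>c<r. p * s * s / (2 * r) \<le> edge_count (R c) (V i) (V j)" if ij: "i < m0" "j < m0" "i \<noteq> j" for i j
    proof (rule ccontr)
      assume "\<not> ?thesis"
      then have lt: "edge_count (R c) (V i) (V j) < p * s * s / (2 * r)" if "c < r" for c
        using that by (meson not_le)
      have fin: "finite (V i)" "finite (V j)" using VN ij finite_sub by blast+
      have "edge_count E (V i) (V j) \<le> (\<Sum>x\<in>V i. \<Sum>y\<in>V j. \<Sum>c<r. of_bool (R c x y))"
        unfolding edge_count_def
      proof (intro sum_mono)
        fix x y
        show "(of_bool (E x y) :: real) \<le> (\<Sum>c<r. of_bool (R c x y))"
        proof (cases "E x y")
          case True
          then obtain c where c: "c < r" "R c x y" using cov by blast
          have "(of_bool (R c x y) :: real) \<le> (\<Sum>c<r. of_bool (R c x y))" using c by (intro member_le_sum) auto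
          then show ?thesis using c True by simp
        qed (simp add: sum_nonneg del: sum_of_bool_eq)
      qed
      also have "\<dots> = (\<Sum>x\<in>V i. \<Sum>c<r. \<Sum>y\<in>V j. of_bool (R c x y))"
        by (rule sum.cong[OF refl], rule sum.swap)
      also have "\<dots> = (\<Sum>c<r. edge_count (R c) (V i) (V j))" unfolding edge_count_def by (rule sum.swap)
      also have "\<dots> < (\<Sum>c<r. p * s * s / (2 * r))" using lt r by (intro sum_strict_mono) (auto simp: lessThan_empty_iff)
      also have "\<dots> = p * s * s / 2" using r by simp
      finally have "edge_count E (V i) (V j) < p * s * s / 2" .
      moreover have "\<bar>edge_count E (V i) (V j) - p * s * s\<bar> \<le> \<gamma> * p * s * s"
        using jumbled[OF VN[OF ij(1)] VN[OF ij(2)] Vdisj[OF ij]] V(1)[OF ij(1)] V(1)[OF ij(2)] sb by (simp add: max_absorb1)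
      moreover have "\<gamma> * (p * s * s) \<le> 1 / 2 * (p * s * s)" using \<gamma> p_pos by (intro mult_right_mono) auto
      ultimately show False by (simp add: mult.assoc)
    qed
    have maj2: "\<exists>\<alpha>. 1 / (4 * real r) \<le> \<alpha> \<and> \<alpha> \<le> 2 \<and> (\<forall>A\<subseteq>V i. \<forall>B\<subseteq>V j.
              \<bar>edge_count (R c) A B - \<alpha> * p * card A * card B\<bar> \<le> \<epsilon> * p * real s ^ 2)"
      if ij: "i < m0" "j < m0" "i \<noteq> j" "c < r" and e: "p * s * s / (2 * r) \<le> edge_count (R c) (V i) (V j)" for i j c
    proof -
      obtain \<alpha> where \<alpha>: "0 \<le> \<alpha>" "\<alpha> \<le> 2" "\<forall>A\<subseteq>V i. \<forall>B\<subseteq>V j.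
        \<bar>edge_count (R c) A B - \<alpha> * p * card A * card B\<bar> \<le> \<epsilon> * p * card (V i) * card (V j)"
        using reg[OF ij(1,2,4,3)] unfolding cut_regular_def by blast
      have c: "card (V i) = s" "card (V j) = s" using V(1) ij by auto
      have "\<bar>edge_count (R c) (V i) (V j) - \<alpha> * p * s * s\<bar> \<le> \<epsilon> * p * s * s" using \<alpha>(3) c by (metis subset_refl)
      then have "p * s * s / (2 * r) \<le> \<alpha> * p * s * s + \<epsilon> * p * s * s" using e by linarith
      then have "(1 / (2 * r)) * (p * s * s) \<le> (\<alpha> + \<epsilon>) * (p * s * s)" by (simp add: algebra_simps)
      moreover have "0 < p * s * s" using p_pos s_pos by simp
      ultimately have "1 / (2 * r) \<le> \<alpha> + \<epsilon>" using mult_right_le_imp_le by blast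
      moreover have "1 / (2 * real r) = 1 / (4 * real r) + 1 / (4 * real r)" using r by (simp add: field_simps)
      ultimately have "1 / (4 * real r) \<le> \<alpha>" using \<epsilon>(2) by linarith
      then show ?thesis using \<alpha> c by (intro exI[of _ \<alpha>]) (simp add: power2_eq_square mult.assoc)
    qed
    \<comment> \<open>\<open>Min\<close> and \<open>Max\<close> orient the pair, because
      \<open>edge_count\<close> has ordered arguments; symmetry of the colour classes gives the
      other order.\<close>
    define col where "col e = (SOME c. c < r \<and> p * s * s / (2 * r) \<le> edge_count (R c) (V (Min e)) (V (Max e)))" for e :: "nat set"
    have col: "col {i, j} < r \<and> p * s * s / (2 * r) \<le> edge_count (R (col {i, j})) (V i) (V j)" if ij: "i < m0" "j < m0" "i < j" for i j
    proof -
      have "Min {i, j} = i" "Max {i, j} = j" using ij by auto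
      moreover have "\<exists>c<r. p * s * s / (2 * r) \<le> edge_count (R c) (V i) (V j)" using maj[of i j] ij by auto
      ultimately show ?thesis unfolding col_def by (simp only:) (rule someI_ex)
    qed
    have "col \<in> nsets {..<m0} 2 \<rightarrow> {..<length (replicate r m)}"
    proof
      fix e assume "e \<in> nsets {..<m0} 2"
      then obtain x y where "e = {x, y}" "x < m0" "y < m0" "x \<noteq> y" by (auto elim!: nsets2_E)
      then show "col e \<in> {..<length (replicate r m)}" using col[of x y] col[of y x]
        by (cases "x < y") (auto simp: insert_commute)
    qed
    then obtain c H where cH: "c < r" "H \<in> nsets {..<m0} m" "\<And>e. e \<in> nsets H 2 \<Longrightarrow> col e = c"
      using m0 unfolding partn_lst_def monochromatic_def by fastforce
    have H: "finite H" "card H = m" "H \<subseteq> {..<m0}" using cH(2) by (auto simp: nsets_def)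
    obtain h where h: "bij_betw h {..<m} H"
      using ex_bij_betw_nat_finite[OF H(1)] H(2) by (auto simp: atLeast0LessThan)
    have hH: "h i < m0" if "i < m" for i using h H(3) that by (auto simp: bij_betw_def)
    have hne: "h i \<noteq> h j" if "i < m" "j < m" "i \<noteq> j" for i j using h that by (auto simp: bij_betw_def inj_on_def)
    have dens: "p * s * s / (2 * r) \<le> edge_count (R c) (V (h i)) (V (h j))" if ij: "i < m" "j < m" "i \<noteq> j" for i j
    proof -
      have "{h i, h j} \<in> nsets H 2" using h ij hne[OF ij] by (auto simp: bij_betw_def)
      then have cc: "col {h i, h j} = c" by (rule cH(3))
      have symc: "edge_count (R c) (V (h j)) (V (h i)) = edge_count (R c) (V (h i)) (V (h j))"
      proof -
        have "R c x y = R c y x" for x y using sym by blast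
        then show ?thesis using edge_count_swap[of "R c" "V (h j)" "V (h i)"] by (simp add: edge_count_def)
      qed
      consider "h i < h j" | "h j < h i" using hne[OF ij] by linarith
      then show ?thesis
      proof cases
        case 1
        then show ?thesis using col[OF hH[OF ij(1)] hH[OF ij(2)] 1] cc by simp
      next
        case 2
        have "{h j, h i} = {h i, h j}" by auto
        then show ?thesis using col[OF hH[OF ij(2)] hH[OF ij(1)] 2] cc symc by simp
      qed
    qed
    show "\<exists>c<r. \<exists>V s. \<kappa> * real N \<le> real s \<and> (\<forall>i<m. V i \<subseteq> {..<N} \<and> card (V i) = s) \<and>
          (\<forall>i<m. \<forall>j<m. i \<noteq> j \<longrightarrow> V i \<inter> V j = {} \<and>
            (\<exists>\<alpha>. 1 / (4 * real r) \<le> \<alpha> \<and> \<alpha> \<le> 2 \<and> (\<forall>A\<subseteq>V i. \<forall>B\<subseteq>V j.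
              \<bar>edge_count (R c) A B - \<alpha> * p * card A * card B\<bar> \<le> \<epsilon> * p * real s ^ 2)))"
    proof (rule exI[of _ c], rule conjI[OF cH(1)], rule exI[of _ "\<lambda>i. V (h i)"], rule exI[of _ s], intro conjI allI impI)
      show "\<kappa> * real N \<le> real s" using \<kappa>N V(2) by simp
      show "V (h i) \<subseteq> {..<N}" "card (V (h i)) = s" if "i < m" for i using VN V(1) hH[OF that] by auto
      show "V (h i) \<inter> V (h j) = {}" if "i < m" "j < m" "i \<noteq> j" for i j
        using Vdisj hH hne that by simp
      show "\<exists>\<alpha>. 1 / (4 * real r) \<le> \<alpha> \<and> \<alpha> \<le> 2 \<and> (\<forall>A\<subseteq>V (h i). \<forall>B\<subseteq>V (h j).
              \<bar>edge_count (R c) A B - \<alpha> * p * card A * card B\<bar> \<le> \<epsilon> * p * real s ^ 2)"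
        if "i < m" "j < m" "i \<noteq> j" for i j
        by (rule maj2[OF hH[OF that(1)] hH[OF that(2)] hne[OF that] cH(1) dens[OF that]])
    qed
  qed
qed

section \<open>Degenerate graphs\<close>

text \<open>\<open>degeneracy\<close> is a \<open>LEAST\<close>, so its defining property needs a
  witness; the number of edges is one.\<close>

lemma degree_induced_le_degeneracy:
  assumes G: "simple_graph H" and U: "U \<subseteq> verts H" "U \<noteq> {}"
  shows "\<exists>v\<in>U. card {e\<in>edges H. e \<subseteq> U \<and> v \<in> e} \<le> degeneracy H"
proof -
  let ?P = "\<lambda>l. \<forall>U. U \<subseteq> verts H \<and> U \<noteq> {} \<longrightarrow> min_degree (induced_subgraph H U) \<le> l"
  have finV: "finite (verts H)" using G by (simp add: simple_graph_def)
  have finE: "finite (edges H)"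
    using G finite_imp_finite_nsets[OF finV, of 2] by (auto simp: simple_graph_def intro: finite_subset)
  have deg: "degree (induced_subgraph H U) v = card {e\<in>edges H. e \<subseteq> U \<and> v \<in> e}" for U v
  proof -
    have "{e \<in> {e \<in> edges H. e \<subseteq> U}. v \<in> e} = {e\<in>edges H. e \<subseteq> U \<and> v \<in> e}" by auto
    then show ?thesis by (simp add: degree_def induced_subgraph_def)
  qed
  have "?P (card (edges H))"
  proof (intro allI impI)
    fix U assume U: "U \<subseteq> verts H \<and> U \<noteq> {}"
    then obtain v where v: "v \<in> U" by blast
    have "finite U" using U finV finite_subset by blast
    then have "min_degree (induced_subgraph H U) \<le> degree (induced_subgraph H U) v"
      unfolding min_degree_def using v by (intro Min_le) (auto simp: induced_subgraph_def)
    also have "\<dots> \<le> card (edges H)" unfolding deg using finE by (intro card_mono) auto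
    finally show "min_degree (induced_subgraph H U) \<le> card (edges H)" .
  qed
  then have "?P (degeneracy H)" unfolding degeneracy_def by (rule LeastI[of ?P])
  then have le: "min_degree (induced_subgraph H U) \<le> degeneracy H" using U by blast
  have finU: "finite U" using U finV finite_subset by blast
  have "min_degree (induced_subgraph H U) \<in> degree (induced_subgraph H U) ` verts (induced_subgraph H U)"
    unfolding min_degree_def using finU U(2) by (intro Min_in) (auto simp: induced_subgraph_def)
  then obtain v where "v \<in> U" "min_degree (induced_subgraph H U) = degree (induced_subgraph H U) v"
    by (auto simp: induced_subgraph_def)
  then show ?thesis using le deg by auto
qed

text \<open>A vertex with at most \<open>degeneracy H\<close> neighbours in \<open>U\<close> is put
  last, so that all its neighbours in \<open>U\<close> precede it.\<close>

lemma degeneracy_ordering: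
  assumes G: "simple_graph H"
  shows "U \<subseteq> verts H \<Longrightarrow> card U = k \<Longrightarrow>
    \<exists>g. bij_betw g {..<k} U \<and> (\<forall>x<k. card {j. j < x \<and> {g j, g x} \<in> edges H} \<le> degeneracy H)"
proof (induction k arbitrary: U)
  case 0
  have "finite U" using 0 G by (auto simp: simple_graph_def intro: finite_subset)
  then have "U = {}" using 0 by simp
  then show ?case by (auto simp: bij_betw_def)
next
  case (Suc k)
  have finV: "finite (verts H)" using G by (simp add: simple_graph_def)
  have finE: "finite (edges H)"
    using G finite_imp_finite_nsets[OF finV, of 2] by (auto simp: simple_graph_def intro: finite_subset)
  have finU: "finite U" using Suc.prems(1) finV finite_subset by blast
  have "U \<noteq> {}" using Suc.prems(2) by auto
  from degree_induced_le_degeneracy[OF G Suc.prems(1) this]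
  obtain v where v: "v \<in> U" "card {e\<in>edges H. e \<subseteq> U \<and> v \<in> e} \<le> degeneracy H" by blast
  have "\<exists>g. bij_betw g {..<k} (U - {v}) \<and> (\<forall>x<k. card {j. j < x \<and> {g j, g x} \<in> edges H} \<le> degeneracy H)"
    using Suc.prems v finU by (intro Suc.IH) auto
  then obtain g where g: "bij_betw g {..<k} (U - {v})" "\<And>x. x < k \<Longrightarrow> card {j. j < x \<and> {g j, g x} \<in> edges H} \<le> degeneracy H"
    by blast
  have gU: "g j \<in> U" "g j \<noteq> v" if "j < k" for j using g(1) that by (auto simp: bij_betw_def)
  have inj: "inj_on g {..<k}" using g(1) by (simp add: bij_betw_def)
  let ?g = "g(k := v)"
  have "bij_betw ?g {..<Suc k} U"
  proof -
    have "bij_betw ?g {..<k} (U - {v})" using g(1) by (subst bij_betw_cong[of _ _ g]) auto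
    then have "bij_betw ?g ({..<k} \<union> {k}) (U - {v} \<union> {?g k})"
      by (intro notIn_Un_bij_betw) auto
    moreover have "{..<k} \<union> {k} = {..<Suc k}" "U - {v} \<union> {?g k} = U" using v(1) by auto
    ultimately show ?thesis by simp
  qed
  moreover have "card {j. j < x \<and> {?g j, ?g x} \<in> edges H} \<le> degeneracy H" if x: "x < Suc k" for x
  proof (cases "x = k")
    case False
    then have "{j. j < x \<and> {?g j, ?g x} \<in> edges H} = {j. j < x \<and> {g j, g x} \<in> edges H}" using x by auto
    then show ?thesis using g(2)[of x] x False by simp
  next
    case True
    let ?J = "{j. j < k \<and> {g j, v} \<in> edges H}"
    have "inj_on (\<lambda>j. {g j, v}) ?J"
      using inj gU by (auto simp: inj_on_def doubleton_eq_iff)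
    then have "card ?J = card ((\<lambda>j. {g j, v}) ` ?J)" by (simp add: card_image)
    also have "\<dots> \<le> card {e\<in>edges H. e \<subseteq> U \<and> v \<in> e}"
      using finE gU v(1) by (intro card_mono) auto
    finally have "card ?J \<le> degeneracy H" using v(2) by simp
    moreover have "{j. j < x \<and> {?g j, ?g x} \<in> edges H} = ?J" using True by auto
    ultimately show ?thesis by simp
  qed
  ultimately show ?case by blast
qed

lemma degenerate_class_ordering:
  assumes H: "H \<in> degenerate_class n d \<Delta>"
  obtains g T where "bij_betw g {..<n} (verts H)"
    and "\<And>x. x < n \<Longrightarrow> T x = {j. j < x \<and> {g j, g x} \<in> edges H}"
    and "\<And>x. x < n \<Longrightarrow> card (T x) \<le> d" and "\<And>u. u < n \<Longrightarrow> card {x\<in>{..<n}. u \<in> T x} \<le> \<Delta>"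
proof -
  have H': "simple_graph H" "card (verts H) = n" "max_degree H \<le> \<Delta>" "degeneracy H \<le> d"
    using H by (auto simp: degenerate_class_def)
  have finV: "finite (verts H)" using H' by (simp add: simple_graph_def)
  have finE: "finite (edges H)"
    using H'(1) finite_imp_finite_nsets[OF finV, of 2] by (auto simp: simple_graph_def intro: finite_subset)
  obtain g where g: "bij_betw g {..<n} (verts H)" "\<And>x. x < n \<Longrightarrow> card {j. j < x \<and> {g j, g x} \<in> edges H} \<le> degeneracy H"
    using degeneracy_ordering[OF H'(1) subset_refl H'(2)] by blast
  define T where "T x = {j. j < x \<and> {g j, g x} \<in> edges H}" for x
  show ?thesis
  proof (rule that[OF g(1)])
    show "T x = {j. j < x \<and> {g j, g x} \<in> edges H}" for x by (simp add: T_def)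
    show "card (T x) \<le> d" if "x < n" for x using g(2)[OF that] H'(4) by (simp add: T_def)
    fix u assume u: "u < n"
    let ?X = "{x\<in>{..<n}. u \<in> T x}"
    have inj: "inj_on g {..<n}" using g(1) by (simp add: bij_betw_def)
    have "inj_on (\<lambda>x. {g u, g x}) ?X"
    proof (rule inj_onI)
      fix x y assume xy: "x \<in> ?X" "y \<in> ?X" "{g u, g x} = {g u, g y}"
      then have "g x = g y" by (auto simp: doubleton_eq_iff)
      then show "x = y" using inj xy by (auto dest: inj_onD)
    qed
    then have "card ?X = card ((\<lambda>x. {g u, g x}) ` ?X)" by (simp add: card_image)
    also have "\<dots> \<le> degree H (g u)" unfolding degree_def using finE by (intro card_mono) (auto simp: T_def)
    also have "\<dots> \<le> max_degree H"
      unfolding max_degree_def using finV g(1) u by (intro Max_ge) (auto simp: bij_betw_def)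
    finally show "card ?X \<le> \<Delta>" using H'(3) by simp
  qed
qed

text \<open>Greedy colouring. An earlier vertex in conflict with \<open>u\<close> lies in
  \<open>T u\<close> or in the closed back-neighbourhood of one of the at most
  \<open>\<Delta>\<close> vertices \<open>z\<close> with \<open>u\<close> in \<open>T z\<close>. No
  other conflicts matter, because disjoint parts are required only within a closed
  back-neighbourhood.\<close>

lemma closed_neighbourhood_colouring:
  fixes T :: "nat \<Rightarrow> nat set"
  assumes T: "\<And>x. x < n \<Longrightarrow> T x \<subseteq> {..<x}" "\<And>x. x < n \<Longrightarrow> card (T x) \<le> d"
    and deg: "\<And>u. u < n \<Longrightarrow> card {x\<in>{..<n}. u \<in> T x} \<le> \<Delta>"
  obtains col :: "nat \<Rightarrow> nat" where "\<And>x. x < n \<Longrightarrow> col x < d + \<Delta> * (d + 1) + 1"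
    and "\<And>x i j. x < n \<Longrightarrow> i \<in> insert x (T x) \<Longrightarrow> j \<in> insert x (T x) \<Longrightarrow> i \<noteq> j \<Longrightarrow> col i \<noteq> col j"
proof -
  define m where "m = d + \<Delta> * (d + 1) + 1"
  define cf where "cf i j \<longleftrightarrow> (\<exists>z<n. i \<in> insert z (T z) \<and> j \<in> insert z (T z))" for i j
  have finT: "finite (T x)" if "x < n" for x using T(1)[OF that] finite_subset by blast
  have "\<exists>col. (\<forall>x<u. col x < m) \<and> (\<forall>i<u. \<forall>j<u. i \<noteq> j \<longrightarrow> cf i j \<longrightarrow> col i \<noteq> col j)" if "u \<le> n" for u
    using that
  proof (induction u)
    case 0
    show ?case by simp
  next
    case (Suc u)
    then obtain col where col: "\<And>x. x < u \<Longrightarrow> col x < m" "\<And>i j. i < u \<Longrightarrow> j < u \<Longrightarrow> i \<noteq> j \<Longrightarrow> cf i j \<Longrightarrow> col i \<noteq> col j" by auto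
    have u: "u < n" using Suc.prems by simp
    let ?Z = "{x\<in>{..<n}. u \<in> T x}"
    let ?F = "{i. i < u \<and> cf i u}"
    have "?F \<subseteq> T u \<union> (\<Union>z\<in>?Z. insert z (T z))" by (auto simp: cf_def)
    moreover have "finite (T u \<union> (\<Union>z\<in>?Z. insert z (T z)))" using finT u by auto
    ultimately have "card ?F \<le> card (T u \<union> (\<Union>z\<in>?Z. insert z (T z)))" by (intro card_mono)
    also have "\<dots> \<le> card (T u) + card (\<Union>z\<in>?Z. insert z (T z))" by (rule card_Un_le)
    also have "card (\<Union>z\<in>?Z. insert z (T z)) \<le> (\<Sum>z\<in>?Z. card (insert z (T z)))" by (rule card_UN_le) simp
    also have "\<dots> \<le> (\<Sum>z\<in>?Z. d + 1)"
    proof (intro sum_mono)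
      fix z assume "z \<in> ?Z"
      then have z: "z < n" by auto
      have "card (insert z (T z)) \<le> Suc (card (T z))" using finT[OF z] by (simp add: card_insert_if)
      then show "card (insert z (T z)) \<le> d + 1" using T(2)[OF z] by simp
    qed
    also have "\<dots> = card ?Z * (d + 1)" by simp
    also have "\<dots> \<le> \<Delta> * (d + 1)" using deg[OF u] by (intro mult_right_mono) auto
    finally have "card ?F < m" using T(2)[OF u] by (simp add: m_def)
    moreover have "card (col ` ?F) \<le> card ?F" by (intro card_image_le) auto
    ultimately have "card (col ` ?F) < card {..<m}" by simp
    then have "\<not> {..<m} \<subseteq> col ` ?F" using card_mono[of "col ` ?F" "{..<m}"] by auto
    then obtain c where c: "c < m" "c \<notin> col ` ?F" by auto
    have sym: "cf i j \<Longrightarrow> cf j i" for i j by (auto simp: cf_def)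
    show ?case
    proof (intro exI[of _ "col(u := c)"] conjI allI impI)
      show "(col(u := c)) x < m" if "x < Suc u" for x using that col(1) c(1) by (auto simp: less_Suc_eq)
      fix i j assume ij: "i < Suc u" "j < Suc u" "i \<noteq> j" "cf i j"
      show "(col(u := c)) i \<noteq> (col(u := c)) j"
      proof (cases "i = u")
        case True
        then have "col j \<in> col ` ?F" using ij sym[OF ij(4)] by auto
        then show ?thesis using True ij c(2) by auto
      next
        case False
        show ?thesis
        proof (cases "j = u")
          case True
          then have "col i \<in> col ` ?F" using ij False by auto
          then show ?thesis using True False c(2) by auto
        next
          case False
          then show ?thesis using \<open>i \<noteq> u\<close> ij col(2)[of i j] by auto
        qed
      qed
    qed
  qed
  from this[of n] obtain col where col: "\<And>x. x < n \<Longrightarrow> col x < m" "\<And>i j. i < n \<Longrightarrow> j < n \<Longrightarrow> i \<noteq> j \<Longrightarrow> cf i j \<Longrightarrow> col i \<noteq> col j"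
    by auto
  show ?thesis
  proof (rule that)
    show "col x < d + \<Delta> * (d + 1) + 1" if "x < n" for x using col(1)[OF that] by (simp add: m_def)
    fix x i j assume x: "x < n" "i \<in> insert x (T x)" "j \<in> insert x (T x)" "i \<noteq> j"
    have "i < n" "j < n" using T(1)[OF x(1)] x by auto
    moreover have "cf i j" using x by (auto simp: cf_def)
    ultimately show "col i \<noteq> col j" using col(2) x(4) by blast
  qed
qed

section \<open>Partition universality of jumbled graphs\<close>

text \<open>For the choice of constants: every requirement on a new small parameter is linear in
  it.\<close>

lemma ex_small_positive:
  fixes xs :: "(real \<times> real) list"
  assumes "\<And>c t. (c, t) \<in> set xs \<Longrightarrow> 0 < t"
  shows "\<exists>w>0. w \<le> 1 \<and> (\<forall>(c, t)\<in>set xs. c * w \<le> t)"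
  using assms
proof (induction xs)
  case Nil
  show ?case by (intro exI[of _ 1]) auto
next
  case (Cons x xs)
  obtain c t where x: "x = (c, t)" by (cases x)
  have t: "0 < t" using Cons.prems[of c t] x by simp
  obtain w where w: "0 < w" "w \<le> 1" "\<forall>(c, t)\<in>set xs. c * w \<le> t" "\<forall>(c, t)\<in>set xs. 0 < t"
    using Cons.IH Cons.prems by (metis (no_types, lifting) case_prodI2 list.set_intros(2))
  define w' where "w' = min w (t / (\<bar>c\<bar> + 1))"
  have w': "0 < w'" "w' \<le> w" "w' \<le> t / (\<bar>c\<bar> + 1)" using w(1) t by (auto simp: w'_def add_nonneg_pos)
  have "c' * w' \<le> t'" if "(c', t') \<in> set xs" for c' t'
  proof (cases "0 \<le> c'")
    case True
    have "c' * w' \<le> c' * w" using w'(2) True by (rule mult_left_mono)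
    then show ?thesis using w(3) that by fastforce
  next
    case False
    then have "c' * w' \<le> 0" using w'(1) by (simp add: mult_nonpos_nonneg)
    then show ?thesis using w(4) that by fastforce
  qed
  moreover have "c * w' \<le> t"
  proof -
    have "c * w' \<le> (\<bar>c\<bar> + 1) * w'" using w'(1) by (intro mult_right_mono) auto
    also have "\<dots> \<le> t" using w'(3) by (simp add: le_divide_eq mult.commute)
    finally show ?thesis .
  qed
  ultimately show ?case using w' w(2) x by (intro exI[of _ w']) auto
qed

lemma ex_small_positive4:
  fixes c1 c2 c3 c4 :: real
  assumes "0 < t1" "0 < t2" "0 < t3" "0 < t4"
  shows "\<exists>w>0. w \<le> 1 \<and> c1 * w \<le> t1 \<and> c2 * w \<le> t2 \<and> c3 * w \<le> t3 \<and> c4 * w \<le> t4"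
  using ex_small_positive[of "[(c1, t1), (c2, t2), (c3, t3), (c4, t4)]"] assms by auto

text \<open>\<open>R\<close> consists of the host edges demanded inside \<open>T x\<close>.
  \<open>P\<close> is any property that forces a deviation of the count, which covers both too few
  neighbours in the colour class and too many in the host.\<close>

lemma few_bad_tuples:
  fixes V T :: "nat \<Rightarrow> nat set" and \<alpha> :: "nat \<Rightarrow> real"
  assumes host: "tuple_host E N d p b \<gamma> G (T x) V (V x) M \<alpha> \<epsilon> z \<omega> \<zeta>"
    and M: "0 < M" and T: "\<And>i. i \<in> T x \<Longrightarrow> T i \<subseteq> {..<i}" and \<theta>: "0 < \<theta>"
    and small: "10 ^ d * (16 * \<epsilon> + 100 * z\<^sup>2 * \<omega> + 4 ^ d * \<zeta> + real (2 * d + 1) * \<omega> * (8 * z) ^ d * (44 * z)) + 5 * (real d)\<^sup>2 * \<gamma> * (32 * z) ^ d \<le> \<eta> * \<theta>\<^sup>2"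
    and P: "\<And>\<phi>. P \<phi> \<Longrightarrow> \<theta> * p ^ card (T x) * M \<le> \<bar>real (card {y\<in>V x. \<forall>i\<in>T x. G (\<phi> i) y}) - (\<Prod>i\<in>T x. \<alpha> i) * p ^ card (T x) * M\<bar>"
  shows "real (card {\<phi>\<in>PiE (T x) V. (\<forall>i\<in>T x. \<forall>j\<in>T i. j \<in> T x \<longrightarrow> E (\<phi> j) (\<phi> i)) \<and> P \<phi>})
    \<le> \<eta> * (\<Prod>i\<in>T x. p ^ card (T i \<inter> T x) * M)"
proof -
  interpret tuple_host E N d p b \<gamma> G "T x" V "V x" M \<alpha> \<epsilon> z \<omega> \<zeta> by (rule host)
  define R where "R = {(j, i). i \<in> T x \<and> j \<in> T i \<inter> T x}"
  have R: "R \<subseteq> {(j, i) \<in> T x \<times> T x. j < i}" using T by (auto simp: R_def)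
  have cnt_eq: "cnt (T x) \<phi> = real (card {y\<in>V x. \<forall>i\<in>T x. G (\<phi> i) y})" for \<phi>
    unfolding cnt_def joint_def using finite_sub[OF Y_sub] by (rule sum_of_bool_card)
  have cR: "card R = (\<Sum>i\<in>T x. card (T i \<inter> T x))"
  proof -
    have "R = (\<lambda>(i, j). (j, i)) ` (SIGMA i:T x. T i \<inter> T x)" by (auto simp: R_def image_iff)
    moreover have "inj_on (\<lambda>(i, j). (j, i)) (SIGMA i:T x. T i \<inter> T x)" by (auto simp: inj_on_def)
    ultimately have "card R = card (SIGMA i:T x. T i \<inter> T x)" by (simp add: card_image)
    then show ?thesis using finite_I by (subst (asm) card_SigmaI) auto
  qed
  have "{\<phi>\<in>PiE (T x) V. (\<forall>i\<in>T x. \<forall>j\<in>T i. j \<in> T x \<longrightarrow> E (\<phi> j) (\<phi> i)) \<and> P \<phi>}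
     \<subseteq> {\<phi>\<in>PiE (T x) V. homs R \<phi> \<and> \<theta> * p ^ card (T x) * M \<le> \<bar>cnt (T x) \<phi> - \<mu> (T x)\<bar>}"
    using P unfolding cnt_eq \<mu>_def homs_def R_def by auto
  moreover have "finite {\<phi>\<in>PiE (T x) V. homs R \<phi> \<and> \<theta> * p ^ card (T x) * M \<le> \<bar>cnt (T x) \<phi> - \<mu> (T x)\<bar>}"
    using finite_PiE[OF finite_I finite_VY(1)] by simp
  ultimately have "real (card {\<phi>\<in>PiE (T x) V. (\<forall>i\<in>T x. \<forall>j\<in>T i. j \<in> T x \<longrightarrow> E (\<phi> j) (\<phi> i)) \<and> P \<phi>})
     \<le> real (card {\<phi>\<in>PiE (T x) V. homs R \<phi> \<and> \<theta> * p ^ card (T x) * M \<le> \<bar>cnt (T x) \<phi> - \<mu> (T x)\<bar>})"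
    by (intro of_nat_mono card_mono)
  also have "\<dots> \<le> \<eta> * p ^ card R * real M ^ card (T x)"
    by (rule card_deviating_homs_le[OF R \<theta> small[folded err_def] M])
  also have "\<dots> = \<eta> * (\<Prod>i\<in>T x. p ^ card (T i \<inter> T x) * M)"
    by (simp add: cR power_sum prod.distrib)
  finally show ?thesis .
qed

text \<open>Order of dependence: \<open>a\<close>, \<open>K\<close>, \<open>\<eta>\<close> come from
  \<open>r\<close>, \<open>d\<close>, \<open>\<Delta>\<close>, then \<open>\<zeta>\<close> and
  \<open>\<epsilon>\<close> from \<open>\<eta>\<close>, then the relative size
  \<open>\<kappa>\<close> of the regular parts from \<open>\<epsilon>\<close>, and at last
  \<open>\<omega>\<close> and \<open>\<gamma>\<close>. There is no circle because in all error terms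
  \<open>\<zeta>\<close> and \<open>\<epsilon>\<close> occur without a factor
  \<open>z = 1 / \<kappa>\<close>; only \<open>\<omega>\<close> and \<open>\<gamma>\<close> are
  multiplied by powers of \<open>z\<close>.\<close>

theorem jumbled_graph_partition_universal:
  fixes r d \<Delta> :: nat
  assumes "1 \<le> r" "1 \<le> d" "1 \<le> \<Delta>"
  shows "\<exists>\<gamma> \<omega> \<rho> :: real. 0 < \<gamma> \<and> \<gamma> \<le> 1 \<and> 0 < \<omega> \<and> 0 < \<rho> \<and>
    (\<forall>N p b n Ed. jumbled_graph (\<lambda>x y. {x, y} \<in> Ed) N d p b \<gamma> \<longrightarrow> Ed \<subseteq> nsets {..<N} 2 \<longrightarrow>
      b \<le> \<omega> * p ^ (2 * d - 1) * real N \<longrightarrow> real d * ln (real N + 1) + real d * real \<Delta> \<le> \<rho> * p ^ d * real N \<longrightarrow>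
      real n \<le> \<rho> * real N \<longrightarrow> partition_universal r (UGraph {..<N} Ed) (degenerate_class n d \<Delta> :: nat ugraph set))"
proof -
  define m where "m = d + \<Delta> * (d + 1) + 1"
  define \<delta> where "\<delta> = 1 / (4 * real r)"
  \<comment> \<open>Half of \<open>\<delta> ^ d\<close>, the least possible product of the densities
    between a vertex and its back-neighbourhood.\<close>
  define a where "a = \<delta> ^ d / 2"
  define K where "K = 2 ^ (d + 4) * real (\<Delta> + \<Delta> * \<Delta>) / a"
  define \<eta> where "\<eta> = 1 / (2 * K ^ (d + d * d))"
  have \<delta>: "0 < \<delta>" "\<delta> \<le> 1" using assms by (auto simp: \<delta>_def)
  have a: "0 < a" "a \<le> 1"
  proof -
    show "0 < a" using \<delta> by (simp add: a_def)
    have "\<delta> ^ d \<le> 1" using \<delta> by (intro power_le_one) auto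
    then show "a \<le> 1" by (simp add: a_def)
  qed
  have K: "1 \<le> K"
  proof -
    have "1 \<le> \<Delta> + \<Delta> * \<Delta>" using assms by simp
    then have "1 \<le> real (\<Delta> + \<Delta> * \<Delta>)" by linarith
    then have "(1::real) * 1 \<le> 2 ^ (d + 4) * real (\<Delta> + \<Delta> * \<Delta>)" by (intro mult_mono one_le_power) auto
    then have "a \<le> 2 ^ (d + 4) * real (\<Delta> + \<Delta> * \<Delta>)" using a by linarith
    then show ?thesis using a by (simp add: K_def le_divide_eq)
  qed
  have Kp: "0 < K ^ (d + d * d)" using K by simp
  have \<eta>: "0 < \<eta>" "K ^ (d + d * d) * \<eta> < 1" using Kp by (auto simp: \<eta>_def)
  \<comment> \<open>Half of \<open>\<eta>\<close> is reserved for each of the two kinds of bad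
    tuples, and a fifth of \<open>\<tau>\<close> for each of the five error terms in
    \<open>small\<close>.\<close>
  define \<tau> where "\<tau> = \<eta> / 2 * a\<^sup>2"
  have \<tau>: "0 < \<tau>" using \<eta> a by (simp add: \<tau>_def)
  have \<tau>5: "0 < \<tau> / 5" using \<tau> by simp
  obtain \<zeta> where \<zeta>: "0 < \<zeta>" "(10 ^ d * 4 ^ d) * \<zeta> \<le> \<tau> / 5"
    using ex_small_positive4[OF \<tau>5 \<tau>5 \<tau>5 \<tau>5] by blast
  have \<zeta>3: "0 < \<zeta>\<^sup>2 / 3" using \<zeta> by simp
  obtain \<epsilon> where \<epsilon>: "0 < \<epsilon>" "(10 ^ d * 16) * \<epsilon> \<le> \<tau> / 5" "192 * \<epsilon> \<le> \<zeta>\<^sup>2 / 3" "1 * \<epsilon> \<le> \<delta>"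
    using ex_small_positive4[OF \<tau>5 \<zeta>3 \<delta>(1) \<delta>(1)] by blast
  have \<epsilon>\<delta>: "\<epsilon> \<le> 1 / (4 * real r)" using \<epsilon>(4) by (simp add: \<delta>_def)
  have "\<exists>\<kappa>::real. 0 < \<kappa> \<and> \<kappa> \<le> 1 \<and>
    (\<forall>E N d p b \<gamma> R. jumbled_graph E N d p b \<gamma> \<longrightarrow> \<gamma> \<le> 1 / 2 \<longrightarrow> (\<forall>c x y. R c x y \<longrightarrow> E x y) \<longrightarrow>
       (\<forall>x y. E x y \<longrightarrow> (\<exists>c<r. R c x y)) \<longrightarrow> (\<forall>c x y. R c x y \<longrightarrow> R c y x) \<longrightarrow> b \<le> \<kappa> * real N \<longrightarrow>
       (\<exists>c<r. \<exists>V s. \<kappa> * real N \<le> real s \<and> (\<forall>i<m. V i \<subseteq> {..<N} \<and> card (V i) = s) \<and>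
          (\<forall>i<m. \<forall>j<m. i \<noteq> j \<longrightarrow> V i \<inter> V j = {} \<and>
            (\<exists>\<alpha>. 1 / (4 * real r) \<le> \<alpha> \<and> \<alpha> \<le> 2 \<and> (\<forall>A\<subseteq>V i. \<forall>B\<subseteq>V j.
              \<bar>edge_count (R c) A B - \<alpha> * p * card A * card B\<bar> \<le> \<epsilon> * p * real s ^ 2)))))"
    (is "\<exists>\<kappa>. ?A \<kappa> \<and> ?B \<kappa> \<and> ?C \<kappa>")
    by (rule monochromatic_regular_parts[OF assms(1) \<epsilon>(1) \<epsilon>\<delta>])
  then obtain \<kappa> :: real where \<kappa>_all: "?A \<kappa> \<and> ?B \<kappa> \<and> ?C \<kappa>" ..
  have \<kappa>: "0 < \<kappa>" "\<kappa> \<le> 1" by (rule conjunct1[OF \<kappa>_all], rule conjunct1[OF conjunct2[OF \<kappa>_all]])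
  note parts = conjunct2[OF conjunct2[OF \<kappa>_all]]
  define z where "z = 1 / \<kappa>"
  have z: "1 \<le> z" using \<kappa> by (simp add: z_def)
  obtain \<omega> where \<omega>: "0 < \<omega>" "\<omega> \<le> 1" "(10 ^ d * 100 * z\<^sup>2) * \<omega> \<le> \<tau> / 5" "(10 ^ d * real (2 * d + 1) * (8 * z) ^ d * (44 * z)) * \<omega> \<le> \<tau> / 5"
      "(1200 * z\<^sup>2) * \<omega> \<le> \<zeta>\<^sup>2 / 3" "(2 * real d * (8 * z) ^ d) * \<omega> \<le> \<eta>"
    using ex_small_positive4[OF \<tau>5 \<tau>5 \<zeta>3 \<eta>(1)] by blast
  obtain \<gamma> where \<gamma>: "0 < \<gamma>" "\<gamma> \<le> 1" "(5 * (real d)\<^sup>2 * (32 * z) ^ d) * \<gamma> \<le> \<tau> / 5" "(704 * z) * \<gamma> \<le> \<zeta>\<^sup>2 / 3"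
      "1 * \<gamma> \<le> 1 / 2" "1 * \<gamma> \<le> \<epsilon>"
    using ex_small_positive4[OF \<tau>5 \<zeta>3 half_gt_zero[OF zero_less_one] \<epsilon>(1)] by blast
  have small: "10 ^ d * (16 * \<epsilon> + 100 * z\<^sup>2 * \<omega> + 4 ^ d * \<zeta> + real (2 * d + 1) * \<omega> * (8 * z) ^ d * (44 * z)) + 5 * (real d)\<^sup>2 * \<gamma> * (32 * z) ^ d \<le> \<eta> / 2 * a\<^sup>2"
  proof -
    have "10 ^ d * (16 * \<epsilon> + 100 * z\<^sup>2 * \<omega> + 4 ^ d * \<zeta> + real (2 * d + 1) * \<omega> * (8 * z) ^ d * (44 * z)) + 5 * (real d)\<^sup>2 * \<gamma> * (32 * z) ^ d
      = (10 ^ d * 16) * \<epsilon> + (10 ^ d * 100 * z\<^sup>2) * \<omega> + (10 ^ d * 4 ^ d) * \<zeta> + (10 ^ d * real (2 * d + 1) * (8 * z) ^ d * (44 * z)) * \<omega>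
        + (5 * (real d)\<^sup>2 * (32 * z) ^ d) * \<gamma>" by (simp add: distrib_left mult_ac)
    also have "\<dots> \<le> \<tau> / 5 + \<tau> / 5 + \<tau> / 5 + \<tau> / 5 + \<tau> / 5"
      by (intro add_mono \<epsilon>(2) \<omega>(3,4) \<zeta>(2) \<gamma>(3))
    finally show ?thesis by (simp add: \<tau>_def)
  qed
  have \<zeta>2: "704 * \<gamma> * z + 192 * \<epsilon> + 1200 * z\<^sup>2 * \<omega> \<le> \<zeta>\<^sup>2"
    using \<gamma>(4) \<epsilon>(3) \<omega>(5) by (simp add: mult_ac)
  \<comment> \<open>Chosen such that \<open>64 * z / a * \<rho> = a * \<kappa> / 4\<close>. The
    logarithmic term is also at most this fraction of \<open>p ^ l * N\<close>, and both together
    are what \<open>room\<close> allows.\<close>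
  define \<rho> where "\<rho> = (a * \<kappa>)\<^sup>2 / 256"
  have a\<kappa>: "0 < a * \<kappa>" "a * \<kappa> \<le> 1" using a \<kappa> by (auto intro: mult_le_one)
  have \<rho>: "0 < \<rho>" "\<rho> \<le> a * \<kappa> / 4"
  proof -
    have "0 < (a * \<kappa>)\<^sup>2" using a\<kappa>(1) by (rule zero_less_power)
    then show "0 < \<rho>" unfolding \<rho>_def by linarith
    have "(a * \<kappa>) * (a * \<kappa>) \<le> (a * \<kappa>) * 1" using a\<kappa> by (intro mult_left_mono) auto
    then show "\<rho> \<le> a * \<kappa> / 4" using a\<kappa> unfolding \<rho>_def power2_eq_square by linarith
  qed
  show ?thesis
  proof (rule exI[of _ \<gamma>], rule exI[of _ "\<omega> * \<kappa>"], rule exI[of _ \<rho>], intro conjI allI impI)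
    show "0 < \<gamma>" "\<gamma> \<le> 1" "0 < \<omega> * \<kappa>" "0 < \<rho>" using \<gamma> \<omega> \<kappa> \<rho> by auto
    fix N p b n and Ed :: "nat set set"
    assume J: "jumbled_graph (\<lambda>x y. {x, y} \<in> Ed) N d p b \<gamma>" and Ed: "Ed \<subseteq> nsets {..<N} 2"
      and b: "b \<le> \<omega> * \<kappa> * p ^ (2 * d - 1) * real N"
      and logN: "real d * ln (real N + 1) + real d * real \<Delta> \<le> \<rho> * p ^ d * real N"
      and nN: "real n \<le> \<rho> * real N"
    define E where "E x y \<longleftrightarrow> {x, y} \<in> Ed" for x y
    have Eeq: "(\<lambda>x y. {x, y} \<in> Ed) = E" by (intro ext) (simp add: E_def)
    interpret jumbled_graph E N d p b \<gamma> using J unfolding Eeq .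
    have JE: "jumbled_graph E N d p b \<gamma>" by unfold_locales
    show "partition_universal r (UGraph {..<N} Ed) (degenerate_class n d \<Delta> :: nat ugraph set)"
      unfolding partition_universal_def ugraph.sel
    proof
      fix c assume c: "c \<in> Ed \<rightarrow> {..<r}"
      define R where "R k x y \<longleftrightarrow> {x, y} \<in> Ed \<and> c {x, y} = k" for k x y
      have RE: "\<forall>k x y. R k x y \<longrightarrow> E x y" by (simp add: R_def E_def)
      have cov: "\<forall>x y. E x y \<longrightarrow> (\<exists>k<r. R k x y)" using c by (auto simp: R_def E_def Pi_def)
      have Rsym: "\<forall>k x y. R k x y \<longrightarrow> R k y x" by (simp add: R_def insert_commute)
      have \<gamma>half: "\<gamma> \<le> 1 / 2" using \<gamma>(5) by simp
      have bN: "b \<le> \<kappa> * real N"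
      proof -
        have "p ^ (2 * d - 1) \<le> 1" using p_pos p_le1 by (intro power_le_one) auto
        then have "\<omega> * p ^ (2 * d - 1) \<le> 1 * 1" using \<omega> p_pos by (intro mult_mono) auto
        then have "(\<omega> * p ^ (2 * d - 1)) * (\<kappa> * N) \<le> 1 * (\<kappa> * N)" using \<kappa> by (intro mult_right_mono) auto
        then show ?thesis using b by (simp add: mult_ac)
      qed
      have "\<exists>k<r. \<exists>V s. \<kappa> * real N \<le> real s \<and> (\<forall>i<m. V i \<subseteq> {..<N} \<and> card (V i) = s) \<and>
          (\<forall>i<m. \<forall>j<m. i \<noteq> j \<longrightarrow> V i \<inter> V j = {} \<and>
            (\<exists>\<alpha>. 1 / (4 * real r) \<le> \<alpha> \<and> \<alpha> \<le> 2 \<and> (\<forall>A\<subseteq>V i. \<forall>B\<subseteq>V j.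
              \<bar>edge_count (R k) A B - \<alpha> * p * card A * card B\<bar> \<le> \<epsilon> * p * real s ^ 2)))"
          (is "\<exists>k. ?L k \<and> (\<exists>V s. ?Ms s \<and> ?Ps V s \<and> ?Qs k V s)")
        by (rule parts[THEN spec, THEN spec, THEN spec, THEN spec, THEN spec, THEN spec, THEN spec, THEN mp, OF JE,
            THEN mp, OF \<gamma>half, THEN mp, OF RE, THEN mp, OF cov, THEN mp, OF Rsym, THEN mp, OF bN])
      then obtain k where k_all: "?L k \<and> (\<exists>V s. ?Ms s \<and> ?Ps V s \<and> ?Qs k V s)" ..
      have k: "k < r" by (rule conjunct1[OF k_all])
      from conjunct2[OF k_all] obtain P where "\<exists>s. ?Ms s \<and> ?Ps P s \<and> ?Qs k P s" ..
      then obtain M where M_all: "?Ms M \<and> ?Ps P M \<and> ?Qs k P M" ..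
      have M: "\<kappa> * real N \<le> real M" by (rule conjunct1[OF M_all])
      have P: "\<forall>i<m. P i \<subseteq> {..<N} \<and> card (P i) = M" by (rule conjunct1[OF conjunct2[OF M_all]])
      define Dense where "Dense i j \<alpha> \<longleftrightarrow> 1 / (4 * real r) \<le> \<alpha> \<and> \<alpha> \<le> 2 \<and> (\<forall>A\<subseteq>P i. \<forall>B\<subseteq>P j.
              \<bar>edge_count (R k) A B - \<alpha> * p * card A * card B\<bar> \<le> \<epsilon> * p * real M ^ 2)" for i j \<alpha>
      have PP: "\<forall>i<m. \<forall>j<m. i \<noteq> j \<longrightarrow> P i \<inter> P j = {} \<and> (\<exists>\<alpha>. Dense i j \<alpha>)"
        unfolding Dense_def by (rule conjunct2[OF conjunct2[OF M_all]])
      have NzM: "real N \<le> z * M" using M \<kappa> by (simp add: z_def field_simps)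
      have b_M: "b \<le> \<omega> * p ^ (2 * d - 1) * M"
      proof -
        have "(\<omega> * p ^ (2 * d - 1)) * (\<kappa> * N) \<le> (\<omega> * p ^ (2 * d - 1)) * M" using M \<omega> p_pos by (intro mult_left_mono) auto
        then show ?thesis using b by (simp add: mult_ac)
      qed
      have bM: "b \<le> M" using bN M by simp
      then have M1: "1 \<le> M" using b_ge1 by simp
      obtain \<alpha> where dense: "\<And>i j. i < m \<Longrightarrow> j < m \<Longrightarrow> i \<noteq> j \<Longrightarrow> Dense i j (\<alpha> i j)"
        using PP by metis
      note \<alpha> = dense[unfolded Dense_def]
      have "contains_copy (UGraph {..<N} {e \<in> Ed. c e = k}) H" if H: "H \<in> degenerate_class n d \<Delta>" for H :: "nat ugraph"
      proof -
        obtain g T where g: "bij_betw g {..<n} (verts H)"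
          and T: "\<And>x. x < n \<Longrightarrow> T x = {j. j < x \<and> {g j, g x} \<in> edges H}"
          and cT: "\<And>x. x < n \<Longrightarrow> card (T x) \<le> d" and deg: "\<And>u. u < n \<Longrightarrow> card {x\<in>{..<n}. u \<in> T x} \<le> \<Delta>"
          using degenerate_class_ordering[OF H] by blast
        have Tsub: "T x \<subseteq> {..<x}" if "x < n" for x using T[OF that] by auto
        obtain col where col: "\<And>x. x < n \<Longrightarrow> col x < d + \<Delta> * (d + 1) + 1"
          and col2: "\<And>x i j. x < n \<Longrightarrow> i \<in> insert x (T x) \<Longrightarrow> j \<in> insert x (T x) \<Longrightarrow> i \<noteq> j \<Longrightarrow> col i \<noteq> col j"
          using closed_neighbourhood_colouring[OF Tsub cT deg] by blast
        define V where "V x = P (col x)" for x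
        have colm: "x < n \<Longrightarrow> col x < m" for x using col by (simp add: m_def)
        have Tn: "x < n \<Longrightarrow> i \<in> insert x (T x) \<Longrightarrow> i < n" for x i using Tsub[of x] by auto
        have V: "x < n \<Longrightarrow> V x \<subseteq> {..<N}" "x < n \<Longrightarrow> card (V x) = M" for x using P colm by (auto simp: V_def)
        have VV: "V i \<inter> V j = {}" if "x < n" "i \<in> insert x (T x)" "j \<in> insert x (T x)" "i \<noteq> j" for x i j
          using PP colm Tn[OF that(1)] that col2[OF that] by (auto simp: V_def)
        have hostG: "tuple_host E N d p b \<gamma> (R k) (T x) V (V x) M (\<lambda>i. \<alpha> (col i) (col x)) \<epsilon> z \<omega> \<zeta>" if x: "x < n" for x
        proof unfold_locales
          show "finite (T x)" using Tsub[OF x] finite_subset by blast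
          show "card (T x) \<le> d" by (rule cT[OF x])
          have ne: "i \<noteq> x" if "i \<in> T x" for i using Tsub[OF x] that by auto
          show "V i \<subseteq> {..<N}" "card (V i) = M" "V i \<inter> V x = {}" if "i \<in> T x" for i
            using V[OF Tn[OF x insertI2[OF that]]] VV[OF x insertI2[OF that] insertI1 ne[OF that]] by auto
          show "V i \<inter> V j = {}" if "i \<in> T x" "j \<in> T x" "i \<noteq> j" for i j using VV[OF x, of i j] that by auto
          show "V x \<subseteq> {..<N}" "card (V x) = M" using V x by auto
          show "R k v y \<Longrightarrow> E v y" for v y using RE by blast
          fix i assume i: "i \<in> T x"
          have ne: "col i \<noteq> col x" using col2[OF x, of i x] i Tsub[OF x] by auto
          note al = \<alpha>[OF colm[OF Tn[OF x insertI2[OF i]]] colm[OF x] ne]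
          show "\<bar>edge_count (R k) A B - \<alpha> (col i) (col x) * p * card A * card B\<bar> \<le> \<epsilon> * p * real M ^ 2"
            if "A \<subseteq> V i" "B \<subseteq> V x" for A B using al that unfolding V_def by blast
          show "\<alpha> (col i) (col x) \<le> 2" using al by blast
          have "0 \<le> 1 / (4 * real r)" by simp
          then show "0 \<le> \<alpha> (col i) (col x)" using al by linarith
        qed (use NzM z assms \<epsilon>(1) \<omega> \<zeta>(1) \<zeta>2 b_M in auto)
        \<comment> \<open>The host itself is regular with \<open>\<alpha> = 1\<close>: its
          jumbledness error satisfies \<open>\<gamma> \<le> \<epsilon>\<close>, and the cutoff does
          no harm because \<open>b \<le> M\<close>.\<close>
        have hostE: "tuple_host E N d p b \<gamma> E (T x) V (V x) M (\<lambda>_. 1) \<epsilon> z \<omega> \<zeta>" if x: "x < n" for x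
        proof unfold_locales
          show "finite (T x)" using Tsub[OF x] finite_subset by blast
          show "card (T x) \<le> d" by (rule cT[OF x])
          have ne: "i \<noteq> x" if "i \<in> T x" for i using Tsub[OF x] that by auto
          show Vi: "V i \<subseteq> {..<N}" "card (V i) = M" "V i \<inter> V x = {}" if "i \<in> T x" for i
            using V[OF Tn[OF x insertI2[OF that]]] VV[OF x insertI2[OF that] insertI1 ne[OF that]] by auto
          show "V i \<inter> V j = {}" if "i \<in> T x" "j \<in> T x" "i \<noteq> j" for i j using VV[OF x, of i j] that by auto
          show "V x \<subseteq> {..<N}" "card (V x) = M" using V x by auto
          fix i A B assume i: "i \<in> T x" and A: "A \<subseteq> V i" "B \<subseteq> V x"
          have fin: "finite (V i)" "finite (V x)" using Vi(1)[OF i] V(1)[OF x] finite_sub by auto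
          have cc: "max (real (card A)) b \<le> M" "max (real (card B)) b \<le> M"
            using card_mono[OF fin(1) A(1)] card_mono[OF fin(2) A(2)] Vi(2)[OF i] V(2)[OF x] bM by auto
          have "\<bar>edge_count E A B - p * card A * card B\<bar> \<le> \<gamma> * p * max (card A) b * max (card B) b"
            using A Vi[OF i] V(1)[OF x] by (intro jumbled) blast+
          also have "\<dots> \<le> \<epsilon> * p * M * M"
            using cc \<gamma> \<epsilon> p_pos b_ge1 by (intro mult_mono) (auto simp: le_max_iff_disj)
          finally show "\<bar>edge_count E A B - 1 * p * card A * card B\<bar> \<le> \<epsilon> * p * real M ^ 2"
            by (simp add: power2_eq_square mult.assoc)
        qed (use NzM z assms \<epsilon>(1) \<omega> \<zeta>(1) \<zeta>2 b_M in auto)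
        have emb: "embedding E N d p b \<gamma> (R k) n M \<Delta> T V a z \<omega> \<eta> K"
        proof unfold_locales
          show "R k x y \<Longrightarrow> E x y" for x y using RE by blast
          show "x < n \<Longrightarrow> T x \<subseteq> {..<x}" for x by (rule Tsub)
          show "x < n \<Longrightarrow> card (T x) \<le> d" for x by (rule cT)
          show "u < n \<Longrightarrow> card {x\<in>{..<n}. u \<in> T x} \<le> \<Delta>" for u by (rule deg)
          show "x < n \<Longrightarrow> V x \<subseteq> {..<N}" for x by (rule V)
          show "x < n \<Longrightarrow> i \<in> insert x (T x) \<Longrightarrow> j \<in> insert x (T x) \<Longrightarrow> i \<noteq> j \<Longrightarrow> V i \<inter> V j = {}" for x i j by (rule VV)
          show "real N \<le> z * M" "1 \<le> z" "1 \<le> d" "1 \<le> \<Delta>" "1 \<le> M" "0 \<le> \<omega>" "0 < a" "0 < \<eta>" "1 \<le> K" "\<omega> \<le> 1"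
            "K ^ (d + d * d) * \<eta> < 1" "b \<le> \<omega> * p ^ (2 * d - 1) * M"
            using NzM z assms M1 \<omega> a \<eta> K b_M by auto
          show "2 ^ (d + 4) * (\<Delta> + \<Delta> * \<Delta>) \<le> K * a" using a by (simp add: K_def)
          show "2 * d * \<omega> * (8 * z) ^ d \<le> \<eta>" using \<omega>(6) by (simp add: mult_ac)
          show "d * ln (real N + 1) + d * \<Delta> + 64 * z / a * p ^ l * n \<le> a / 2 * p ^ l * M" if l: "l \<le> d" for l
          proof -
            have "p ^ d \<le> p ^ l" using l p_pos p_le1 by (intro power_decreasing) auto
            then have "\<rho> * p ^ d * N \<le> (a * \<kappa> / 4) * p ^ l * N"
              using \<rho> p_pos by (intro mult_right_mono mult_mono) auto
            with logN have 1: "real d * ln (real N + 1) + real d * real \<Delta> \<le> (a * \<kappa> / 4) * p ^ l * N"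
              by (rule order_trans)
            have "64 * z / a * p ^ l * n \<le> 64 * z / a * p ^ l * (\<rho> * N)"
              using nN z a p_pos by (intro mult_left_mono) auto
            also have "\<dots> = (a * \<kappa> / 4) * p ^ l * N"
              using a \<kappa> by (simp add: z_def \<rho>_def power2_eq_square field_simps)
            finally have 2: "64 * z / a * p ^ l * n \<le> (a * \<kappa> / 4) * p ^ l * N" .
            have "real d * ln (real N + 1) + real d * real \<Delta> + 64 * z / a * p ^ l * n
              \<le> (a * \<kappa> / 4) * p ^ l * N + (a * \<kappa> / 4) * p ^ l * N" by (rule add_mono[OF 1 2])
            also have "\<dots> = (a / 2 * p ^ l) * (\<kappa> * N)" by (simp add: field_simps)
            also have "\<dots> \<le> a / 2 * p ^ l * M" using M a p_pos by (intro mult_left_mono) auto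
            finally have "real d * ln (real N + 1) + real d * real \<Delta> + 64 * z / a * p ^ l * n \<le> a / 2 * p ^ l * M" .
            then show ?thesis by (simp only: of_nat_mult)
          qed
          fix x assume x: "x < n"
          have Ti: "i \<in> T x \<Longrightarrow> T i \<subseteq> {..<i}" for i using Tsub[of i] Tn[OF x, of i] by auto
          define BG where "BG \<phi> \<longleftrightarrow> real (card {y\<in>V x. \<forall>i\<in>T x. R k (\<phi> i) y}) < a * p ^ card (T x) * M" for \<phi>
          define BE where "BE \<phi> \<longleftrightarrow> real (card {y\<in>V x. \<forall>i\<in>T x. E (\<phi> i) y}) > 2 * p ^ card (T x) * M" for \<phi>
          define Hm where "Hm \<phi> \<longleftrightarrow> (\<forall>i\<in>T x. \<forall>j\<in>T i. j \<in> T x \<longrightarrow> E (\<phi> j) (\<phi> i))" for \<phi>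
          define Q where "Q = (\<Prod>i\<in>T x. p ^ card (T i \<inter> T x) * M)"
          have M0: "0 < M" using M1 by simp
          have pM: "0 \<le> p ^ card (T x) * M" using p_pos by simp
          \<comment> \<open>The predicted count is at least \<open>2 * a\<close> times
            \<open>p ^ card (T x) * M\<close>, so a count below \<open>a\<close> times this deviates
            by more than \<open>a\<close> times it.\<close>
          have 1: "real (card {\<phi>\<in>PiE (T x) V. Hm \<phi> \<and> BG \<phi>}) \<le> \<eta> / 2 * Q"
            unfolding Hm_def Q_def
          proof (rule few_bad_tuples[OF hostG[OF x] M0 Ti a(1) small])
            fix \<phi> assume "BG \<phi>"
            then have lt: "real (card {y\<in>V x. \<forall>i\<in>T x. R k (\<phi> i) y}) < a * (p ^ card (T x) * M)" by (simp add: BG_def mult.assoc)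
            have "\<delta> ^ card (T x) \<le> (\<Prod>i\<in>T x. \<alpha> (col i) (col x))"
            proof -
              have "(\<Prod>i\<in>T x. \<delta>) \<le> (\<Prod>i\<in>T x. \<alpha> (col i) (col x))"
              proof (intro prod_mono conjI)
                fix i assume i: "i \<in> T x"
                have ne: "col i \<noteq> col x" using col2[OF x, of i x] i Tsub[OF x] by auto
                show "\<delta> \<le> \<alpha> (col i) (col x)"
                  using \<alpha>[OF colm[OF Tn[OF x insertI2[OF i]]] colm[OF x] ne] by (simp add: \<delta>_def)
              qed (use \<delta> in auto)
              then show ?thesis by simp
            qed
            moreover have "\<delta> ^ d \<le> \<delta> ^ card (T x)" using cT[OF x] \<delta> by (intro power_decreasing) auto
            ultimately have "2 * a \<le> (\<Prod>i\<in>T x. \<alpha> (col i) (col x))" by (simp add: a_def)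
            then have "(2 * a) * (p ^ card (T x) * M) \<le> (\<Prod>i\<in>T x. \<alpha> (col i) (col x)) * (p ^ card (T x) * M)"
              using pM by (rule mult_right_mono)
            then show "a * p ^ card (T x) * M \<le> \<bar>real (card {y\<in>V x. \<forall>i\<in>T x. R k (\<phi> i) y}) - (\<Prod>i\<in>T x. \<alpha> (col i) (col x)) * p ^ card (T x) * M\<bar>"
              using lt by (simp add: mult.assoc)
          qed
          have 2: "real (card {\<phi>\<in>PiE (T x) V. Hm \<phi> \<and> BE \<phi>}) \<le> \<eta> / 2 * Q"
            unfolding Hm_def Q_def
          proof (rule few_bad_tuples[OF hostE[OF x] M0 Ti a(1) small])
            fix \<phi> assume "BE \<phi>"
            then have "2 * (p ^ card (T x) * M) < real (card {y\<in>V x. \<forall>i\<in>T x. E (\<phi> i) y})" by (simp add: BE_def mult.assoc)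
            moreover have "a * (p ^ card (T x) * M) \<le> 1 * (p ^ card (T x) * M)" using a(2) pM by (rule mult_right_mono)
            ultimately show "a * p ^ card (T x) * M \<le> \<bar>real (card {y\<in>V x. \<forall>i\<in>T x. E (\<phi> i) y}) - (\<Prod>i\<in>T x. 1) * p ^ card (T x) * M\<bar>"
              by (simp add: mult.assoc)
          qed
          have finP: "finite (PiE (T x) V)"
          proof (intro finite_PiE)
            show "finite (T x)" using Tsub[OF x] finite_subset by blast
            show "i \<in> T x \<Longrightarrow> finite (V i)" for i using V(1)[OF Tn[OF x]] finite_sub by blast
          qed
          have "{\<phi>\<in>PiE (T x) V. Hm \<phi> \<and> (BG \<phi> \<or> BE \<phi>)} = {\<phi>\<in>PiE (T x) V. Hm \<phi> \<and> BG \<phi>} \<union> {\<phi>\<in>PiE (T x) V. Hm \<phi> \<and> BE \<phi>}" by auto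
          then have "card {\<phi>\<in>PiE (T x) V. Hm \<phi> \<and> (BG \<phi> \<or> BE \<phi>)} \<le>
             card {\<phi>\<in>PiE (T x) V. Hm \<phi> \<and> BG \<phi>} + card {\<phi>\<in>PiE (T x) V. Hm \<phi> \<and> BE \<phi>}"
            by (simp only: card_Un_le)
          then have "real (card {\<phi>\<in>PiE (T x) V. Hm \<phi> \<and> (BG \<phi> \<or> BE \<phi>)}) \<le>
             real (card {\<phi>\<in>PiE (T x) V. Hm \<phi> \<and> BG \<phi>}) + real (card {\<phi>\<in>PiE (T x) V. Hm \<phi> \<and> BE \<phi>})"
            by linarith
          also have "\<dots> \<le> \<eta> * Q" using 1 2 by simp
          finally show "real (card {\<phi>\<in>PiE (T x) V. (\<forall>i\<in>T x. \<forall>j\<in>T i. j \<in> T x \<longrightarrow> E (\<phi> j) (\<phi> i)) \<and>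
             (real (card {y\<in>V x. \<forall>i\<in>T x. R k (\<phi> i) y}) < a * p ^ card (T x) * M \<or>
              real (card {y\<in>V x. \<forall>i\<in>T x. E (\<phi> i) y}) > 2 * p ^ card (T x) * M)})
            \<le> \<eta> * (\<Prod>i\<in>T x. p ^ card (T i \<inter> T x) * M)"
            by (simp only: Hm_def BG_def BE_def Q_def)
        qed
        obtain f where f: "inj_on f {..<n}" "\<And>x. x < n \<Longrightarrow> f x \<in> V x" "\<And>x j. x < n \<Longrightarrow> j \<in> T x \<Longrightarrow> R k (f j) (f x)"
          using embedding.embedding_exists[OF emb] by blast
        define h where "h v = f (the_inv_into {..<n} g v)" for v
        have ginj: "inj_on g {..<n}" and gim: "g ` {..<n} = verts H" using g by (auto simp: bij_betw_def)
        have hg: "h (g i) = f i" if "i < n" for i using the_inv_into_f_f[OF ginj, of i] that by (simp add: h_def)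
        have "inj_on h (verts H)"
        proof (rule inj_onI)
          fix v w assume vw: "v \<in> verts H" "w \<in> verts H" "h v = h w"
          obtain i j where ij: "v = g i" "w = g j" "i < n" "j < n" using vw gim by (metis imageE lessThan_iff)
          then have "f i = f j" using vw(3) hg by simp
          then show "v = w" using f(1) ij by (auto dest: inj_onD)
        qed
        moreover have "h ` verts H \<subseteq> {..<N}"
        proof (rule image_subsetI)
          fix v assume "v \<in> verts H"
          then obtain i where i: "v = g i" "i < n" using gim by (metis imageE lessThan_iff)
          then show "h v \<in> {..<N}" using f(2)[OF i(2)] V(1)[OF i(2)] hg by auto
        qed
        moreover have "h ` e \<in> {e \<in> Ed. c e = k}" if e: "e \<in> edges H" for e
        proof -
          have "e \<in> nsets (verts H) 2" using e H by (auto simp: degenerate_class_def simple_graph_def)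
          then obtain v w where vw: "e = {v, w}" "v \<in> verts H" "w \<in> verts H" "v \<noteq> w" by (auto elim: nsets2_E)
          obtain i j where ij: "v = g i" "w = g j" "i < n" "j < n" using vw gim by (metis imageE lessThan_iff)
          have "R k (f i) (f j)"
          proof (cases "i < j")
            case True
            then have "i \<in> T j" using T[OF ij(4)] e vw ij by simp
            then show ?thesis by (rule f(3)[OF ij(4)])
          next
            case False
            then have "j < i" using ij vw(4) by (metis linorder_neqE_nat)
            then have "j \<in> T i" using T[OF ij(3)] e vw ij by (simp add: insert_commute)
            then have "R k (f j) (f i)" by (rule f(3)[OF ij(3)])
            then show ?thesis using Rsym by blast
          qed
          then show ?thesis using ij vw(1) hg by (simp add: R_def)
        qed
        ultimately show ?thesis unfolding contains_copy_def ugraph.sel by blast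
      qed
      then show "\<exists>i<r. \<forall>H\<in>degenerate_class n d \<Delta>. contains_copy (UGraph {..<N} {e \<in> Ed. c e = i}) (H :: nat ugraph)"
        using k by blast
    qed
  qed
qed

section \<open>Random graphs\<close>

definition edge_pmf :: "nat \<Rightarrow> real \<Rightarrow> (nat set \<Rightarrow> bool) pmf" where
  "edge_pmf N p = Pi_pmf (nsets {..<N} 2) False (\<lambda>_. bernoulli_pmf p)"

lemma finite_nsets_2: "finite (nsets {..<N::nat} 2)"
  by (rule finite_imp_finite_nsets) simp

lemma prob_all_edges:
  fixes p :: real
  assumes p: "0 \<le> p" "p \<le> 1" and F: "F \<subseteq> nsets {..<N} 2"
  shows "measure_pmf.prob (edge_pmf N p) {\<omega>. \<forall>e\<in>F. \<omega> e} = p ^ card F"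
proof -
  let ?S = "nsets {..<N} 2"
  define B where "B e = (if e \<in> F then {True} else UNIV)" for e
  have "{\<omega>. \<forall>e\<in>F. \<omega> e} = Pi ?S B"
  proof (rule set_eqI)
    fix \<omega> show "\<omega> \<in> {\<omega>. \<forall>e\<in>F. \<omega> e} \<longleftrightarrow> \<omega> \<in> Pi ?S B"
      using F by (auto simp: B_def Pi_def)
  qed
  then have "measure_pmf.prob (edge_pmf N p) {\<omega>. \<forall>e\<in>F. \<omega> e} = (\<Prod>e\<in>?S. measure_pmf.prob (bernoulli_pmf p) (B e))"
    unfolding edge_pmf_def by (simp only: measure_Pi_pmf_Pi[OF finite_nsets_2])
  also have "\<dots> = (\<Prod>e\<in>?S. if e \<in> F then p else 1)"
    using p by (intro prod.cong refl) (auto simp: B_def measure_pmf_single)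
  also have "\<dots> = (\<Prod>e\<in>?S \<inter> F. p)" by (rule prod.inter_restrict[symmetric, OF finite_nsets_2])
  also have "\<dots> = p ^ card F" using F by (simp add: inf.absorb2)
  finally show ?thesis .
qed

definition num_edges :: "nat set set \<Rightarrow> (nat set \<Rightarrow> bool) \<Rightarrow> real" where
  "num_edges F \<omega> = (\<Sum>e\<in>F. of_bool (\<omega> e))"

lemma exp_le_quadratic:
  fixes x :: real assumes "0 \<le> x" "x \<le> 1" shows "exp x \<le> 1 + x + x\<^sup>2" "exp (- x) \<le> 1 - x + x\<^sup>2"
proof -
  show "exp x \<le> 1 + x + x\<^sup>2" by (rule exp_bound[OF assms])
  have "1 \<le> (1 + x) * (1 - x + x\<^sup>2)"
  proof -
    have "(1 + x) * (1 - x + x\<^sup>2) = 1 + x ^ 3" by (simp add: algebra_simps power2_eq_square power3_eq_cube)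
    then show ?thesis using assms by simp
  qed
  also have "\<dots> \<le> exp x * (1 - x + x\<^sup>2)"
  proof (intro mult_right_mono exp_ge_add_one_self)
    have "0 \<le> 1 - x" using assms by simp
    then show "0 \<le> 1 - x + x\<^sup>2" using zero_le_power2[of x] by linarith
  qed
  finally show "exp (- x) \<le> 1 - x + x\<^sup>2" by (simp add: exp_minus field_simps)
qed

text \<open>Exponential moments, with \<open>l = \<gamma> / 2\<close> for the upper tail and
  \<open>l = - \<gamma> / 2\<close> for the lower. The mean may be replaced by any larger
  \<open>m\<close>; this accommodates sets below the cutoff \<open>b\<close>.\<close>

lemma chernoff_tail:
  fixes p \<gamma> m l :: real
  assumes p: "0 \<le> p" "p \<le> 1" and F: "F \<subseteq> nsets {..<N} 2" and l: "exp l \<le> 1 + l + l\<^sup>2"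
    and m: "p * card F \<le> m" and \<gamma>: "l\<^sup>2 = \<gamma>\<^sup>2 / 4"
  shows "measure_pmf.prob (edge_pmf N p) {\<omega>. l * (num_edges F \<omega> - p * card F) \<ge> \<gamma>\<^sup>2 / 2 * m} \<le> exp (- \<gamma>\<^sup>2 * m / 4)"
proof -
  let ?S = "nsets {..<N} 2"
  let ?M = "measure_pmf (edge_pmf N p)"
  define f where "f e v = (if e \<in> F then exp (l * of_bool v) else 1 :: real)" for e :: "nat set" and v
  have fp: "0 \<le> f e v" for e v by (simp add: f_def)
  have int1: "integrable (measure_pmf (bernoulli_pmf p)) (f e)" for e
    by (rule integrable_measure_pmf_finite) (rule finite_subset[OF subset_UNIV], simp)
  have finF: "finite F" using F finite_nsets_2 finite_subset by blast
  have prod_f: "(\<Prod>e\<in>?S. f e (\<omega> e)) = exp (l * num_edges F \<omega>)" for \<omega>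
  proof -
    have "(\<Prod>e\<in>?S. f e (\<omega> e)) = (\<Prod>e\<in>?S \<inter> F. exp (l * of_bool (\<omega> e)))"
      unfolding f_def by (rule prod.inter_restrict[symmetric, OF finite_nsets_2])
    also have "?S \<inter> F = F" using F by auto
    also have "(\<Prod>e\<in>F. exp (l * of_bool (\<omega> e))) = exp (\<Sum>e\<in>F. l * of_bool (\<omega> e))"
      by (rule exp_sum[OF finF, symmetric])
    finally show ?thesis by (simp only: num_edges_def sum_distrib_left)
  qed
  have integ: "integrable ?M (\<lambda>\<omega>. exp (l * num_edges F \<omega>))"
    using integrable_prod_Pi_pmf[OF finite_nsets_2, of N "\<lambda>_. bernoulli_pmf p" f False] int1
    unfolding prod_f edge_pmf_def by blast
  have "measure_pmf.expectation (edge_pmf N p) (\<lambda>\<omega>. exp (l * num_edges F \<omega>)) = (\<Prod>e\<in>?S. measure_pmf.expectation (bernoulli_pmf p) (f e))"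
    using expectation_prod_Pi_pmf[OF finite_nsets_2, of N "\<lambda>_. bernoulli_pmf p" f False] int1 fp
    unfolding prod_f edge_pmf_def by blast
  also have "\<dots> = (\<Prod>e\<in>?S. if e \<in> F then 1 + p * (exp l - 1) else 1)"
    using p by (intro prod.cong refl) (simp add: f_def algebra_simps)
  also have "\<dots> = (\<Prod>e\<in>?S \<inter> F. 1 + p * (exp l - 1))" by (rule prod.inter_restrict[symmetric, OF finite_nsets_2])
  also have "\<dots> = (1 + p * (exp l - 1)) ^ card F" using F by (simp add: inf.absorb2)
  also have "\<dots> \<le> exp (p * (exp l - 1)) ^ card F"
  proof (intro power_mono exp_ge_add_one_self)
    have "1 + p * (exp l - 1) = (1 - p) + p * exp l" by (simp add: algebra_simps)
    moreover have "0 \<le> p * exp l" using p by simp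
    ultimately show "0 \<le> 1 + p * (exp l - 1)" using p(2) by linarith
  qed
  also have "\<dots> = exp (card F * (p * (exp l - 1)))" by (simp add: exp_of_nat_mult)
  also have "\<dots> \<le> exp (p * card F * l + m * l\<^sup>2)"
  proof -
    have "card F * (p * (exp l - 1)) \<le> card F * (p * (l + l\<^sup>2))" using l p by (intro mult_left_mono) auto
    also have "\<dots> = p * card F * l + (p * card F) * l\<^sup>2" by (simp add: algebra_simps)
    also have "\<dots> \<le> p * card F * l + m * l\<^sup>2" using m by (intro add_left_mono mult_right_mono) auto
    finally show ?thesis by simp
  qed
  finally have ex: "measure_pmf.expectation (edge_pmf N p) (\<lambda>\<omega>. exp (l * num_edges F \<omega>)) \<le> exp (p * card F * l + m * l\<^sup>2)" .
  define c where "c = exp (\<gamma>\<^sup>2 / 2 * m + l * (p * card F))"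
  have "{\<omega>. l * (num_edges F \<omega> - p * card F) \<ge> \<gamma>\<^sup>2 / 2 * m} = {\<omega>\<in>space ?M. exp (l * num_edges F \<omega>) \<ge> c}"
    by (auto simp: c_def algebra_simps)
  then have "measure_pmf.prob (edge_pmf N p) {\<omega>. l * (num_edges F \<omega> - p * card F) \<ge> \<gamma>\<^sup>2 / 2 * m}
     \<le> measure_pmf.expectation (edge_pmf N p) (\<lambda>\<omega>. exp (l * num_edges F \<omega>)) / c"
    using integral_Markov_inequality_measure[OF integ, of "{}" c] by (simp add: c_def)
  also have "\<dots> \<le> exp (p * card F * l + m * l\<^sup>2) / c" using ex by (intro divide_right_mono) (auto simp: c_def)
  also have "\<dots> = exp (- \<gamma>\<^sup>2 * m / 4)" unfolding c_def exp_diff[symmetric] \<gamma> by (simp add: algebra_simps)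
  finally show ?thesis .
qed

lemma prob_deviation:
  fixes p \<gamma> m :: real
  assumes p: "0 \<le> p" "p \<le> 1" and F: "F \<subseteq> nsets {..<N} 2" and \<gamma>: "0 < \<gamma>" "\<gamma> \<le> 1" and m: "p * card F \<le> m"
  shows "measure_pmf.prob (edge_pmf N p) {\<omega>. \<bar>num_edges F \<omega> - p * card F\<bar> > \<gamma> * m} \<le> 2 * exp (- \<gamma>\<^sup>2 * m / 4)"
proof -
  let ?P = "measure_pmf.prob (edge_pmf N p)"
  let ?A = "\<lambda>l. {\<omega>. l * (num_edges F \<omega> - p * card F) \<ge> \<gamma>\<^sup>2 / 2 * m}"
  have sq: "(\<gamma> / 2)\<^sup>2 = \<gamma>\<^sup>2 / 4" "(- (\<gamma> / 2))\<^sup>2 = \<gamma>\<^sup>2 / 4" by (simp_all add: power2_eq_square)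
  have 1: "?P (?A (\<gamma> / 2)) \<le> exp (- \<gamma>\<^sup>2 * m / 4)"
    using \<gamma> by (intro chernoff_tail[OF p F _ m sq(1)] exp_le_quadratic) auto
  have 2: "?P (?A (- (\<gamma> / 2))) \<le> exp (- \<gamma>\<^sup>2 * m / 4)"
    using \<gamma> exp_le_quadratic(2)[of "\<gamma> / 2"] by (intro chernoff_tail[OF p F _ m sq(2)]) auto
  have "{\<omega>. \<bar>num_edges F \<omega> - p * card F\<bar> > \<gamma> * m} \<subseteq> ?A (\<gamma> / 2) \<union> ?A (- (\<gamma> / 2))"
  proof
    fix \<omega> assume "\<omega> \<in> {\<omega>. \<bar>num_edges F \<omega> - p * card F\<bar> > \<gamma> * m}"
    then have "\<gamma> / 2 * (\<gamma> * m) \<le> \<gamma> / 2 * \<bar>num_edges F \<omega> - p * card F\<bar>" using \<gamma> by (intro mult_left_mono) auto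
    moreover have "\<gamma> / 2 * (\<gamma> * m) = \<gamma>\<^sup>2 / 2 * m" by (simp add: power2_eq_square)
    ultimately have *: "\<gamma>\<^sup>2 / 2 * m \<le> \<gamma> / 2 * \<bar>num_edges F \<omega> - p * card F\<bar>" by (simp only:)
    show "\<omega> \<in> ?A (\<gamma> / 2) \<union> ?A (- (\<gamma> / 2))"
    proof (cases "0 \<le> num_edges F \<omega> - p * card F")
      case True
      then show ?thesis using * by (simp only: abs_of_nonneg) blast
    next
      case False
      then have "\<bar>num_edges F \<omega> - p * card F\<bar> = - (num_edges F \<omega> - p * card F)" by simp
      then have "\<gamma>\<^sup>2 / 2 * m \<le> - (\<gamma> / 2) * (num_edges F \<omega> - p * card F)" using * by (simp only: mult_minus_left mult_minus_right)
      then show ?thesis by blast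
    qed
  qed
  then have "?P {\<omega>. \<bar>num_edges F \<omega> - p * card F\<bar> > \<gamma> * m} \<le> ?P (?A (\<gamma> / 2) \<union> ?A (- (\<gamma> / 2)))"
    by (intro measure_pmf.finite_measure_mono) auto
  also have "\<dots> \<le> ?P (?A (\<gamma> / 2)) + ?P (?A (- (\<gamma> / 2)))" by (rule measure_Un_le) auto
  finally show ?thesis using 1 2 by linarith
qed

text \<open>The sum over all subsets is \<open>(1 + q) ^ N\<close>. This is the form taken by a
  union bound in which every vertex of \<open>A\<close> contributes a factor
  \<open>q\<close>.\<close>

lemma sum_nonempty_subsets_le:
  fixes q :: real
  assumes "0 \<le> q" "real N * q \<le> 1"
  shows "(\<Sum>A\<in>Pow {..<N} - {{}}. q ^ card A) \<le> 2 * (real N * q)"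
proof -
  have "(1 + q) ^ N = (\<Prod>i<N. q + 1)" by (simp add: add.commute)
  also have "\<dots> = (\<Sum>A\<in>Pow {..<N}. (\<Prod>i\<in>A. q) * (\<Prod>i\<in>{..<N} - A. 1))" by (rule prod_add) simp
  finally have "(\<Sum>A\<in>Pow {..<N}. q ^ card A) = (1 + q) ^ N" by simp
  moreover have "(\<Sum>A\<in>Pow {..<N} - {{}}. q ^ card A) = (\<Sum>A\<in>Pow {..<N}. q ^ card A) - 1"
    by (subst sum_diff) auto
  moreover have "(1 + q) ^ N \<le> exp q ^ N" using assms by (intro power_mono exp_ge_add_one_self) auto
  moreover have "exp q ^ N = exp (real N * q)" by (simp add: exp_of_nat_mult)
  moreover have "exp (real N * q) \<le> 1 + real N * q + (real N * q)\<^sup>2" using assms by (intro exp_bound) auto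
  moreover have "(real N * q)\<^sup>2 \<le> real N * q" unfolding power2_eq_square using assms by (intro mult_left_le) auto
  ultimately show ?thesis by linarith
qed

definition jumbled_event :: "nat \<Rightarrow> real \<Rightarrow> real \<Rightarrow> real \<Rightarrow> nat set \<Rightarrow> nat set \<Rightarrow> (nat set \<Rightarrow> bool) set" where
  "jumbled_event N p b \<gamma> A B = {\<omega>. \<bar>num_edges ((\<lambda>(x, y). {x, y}) ` (A \<times> B)) \<omega> - p * real (card A) * real (card B)\<bar> > \<gamma> * p * max (real (card A)) b * max (real (card B)) b}"

lemma inj_on_doubleton: "A \<inter> B = {} \<Longrightarrow> inj_on (\<lambda>(x, y). {x, y}) (A \<times> B)"
  by (auto simp: inj_on_def doubleton_eq_iff)

text \<open>The product of the two maxima is at least \<open>b / 2\<close> times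
  \<open>card A + card B\<close>. The value of \<open>b\<close> is chosen so that a pair then fails
  with probability at most \<open>2 * q ^ (card A + card B)\<close>, where
  \<open>q = 1 / (N + 1) ^ 3\<close>, and the union bound becomes a product of two sums over
  nonempty sets.\<close>

lemma prob_not_jumbled:
  fixes p \<gamma> b :: real
  assumes p: "0 < p" "p \<le> 1" and \<gamma>: "0 < \<gamma>" "\<gamma> \<le> 1" and N: "0 < N"
    and b: "b = 24 / \<gamma>\<^sup>2 * ln (real N + 1) / p"
  shows "measure_pmf.prob (edge_pmf N p) (\<Union>(A, B)\<in>{(A, B). A \<subseteq> {..<N} \<and> B \<subseteq> {..<N} \<and> A \<inter> B = {} \<and> A \<noteq> {} \<and> B \<noteq> {}}. jumbled_event N p b \<gamma> A B)
     \<le> 8 / (real N + 1)"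
proof -
  let ?I = "{(A, B). A \<subseteq> {..<N} \<and> B \<subseteq> {..<N} \<and> A \<inter> B = {} \<and> A \<noteq> {} \<and> B \<noteq> {}}"
  let ?P = "measure_pmf.prob (edge_pmf N p)"
  define q where "q = 1 / (real N + 1) ^ 3"
  have q0: "0 \<le> q" by (simp add: q_def)
  have Nq: "real N * q \<le> 1 / (real N + 1)"
  proof -
    have "real N * (real N + 1) \<le> (real N + 1) ^ 3"
    proof -
      have "real N * (real N + 1) \<le> (real N + 1) * (real N + 1)" by (intro mult_right_mono) auto
      also have "\<dots> = (real N + 1) ^ 2" by (simp add: power2_eq_square)
      also have "\<dots> \<le> (real N + 1) ^ 3" by (intro power_increasing) auto
      finally show ?thesis .
    qed
    then show ?thesis by (simp add: q_def divide_le_eq le_divide_eq)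
  qed
  also have "\<dots> \<le> 1" by simp
  finally have Nq1: "real N * q \<le> 1" .
  have ln0: "0 < ln (real N + 1)" using N by simp
  have b0: "0 < b" using p \<gamma> ln0 by (simp add: b)
  have fin: "finite ?I" by (rule finite_subset[of _ "Pow {..<N} \<times> Pow {..<N}"]) auto
  have trm: "?P (jumbled_event N p b \<gamma> A B) \<le> 2 * (q ^ card A * q ^ card B)" if AB: "(A, B) \<in> ?I" for A B
  proof -
    let ?F = "(\<lambda>(x, y). {x, y}) ` (A \<times> B)"
    have disj: "A \<inter> B = {}" using AB by auto
    have F: "?F \<subseteq> nsets {..<N} 2" using AB by (auto simp: disjoint_iff)
    have cF: "card ?F = card A * card B"
      using card_image[OF inj_on_doubleton[OF disj]] by (simp add: card_cartesian_product)
    define m where "m = p * max (real (card A)) b * max (real (card B)) b"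
    have m: "p * card ?F \<le> m"
    proof -
      have "real (card A) * real (card B) \<le> max (real (card A)) b * max (real (card B)) b" using b0 by (intro mult_mono) auto
      then have "p * (real (card A) * real (card B)) \<le> p * (max (real (card A)) b * max (real (card B)) b)"
        using p by (intro mult_left_mono) auto
      then show ?thesis unfolding cF m_def by (simp add: mult.assoc)
    qed
    have "jumbled_event N p b \<gamma> A B = {\<omega>. \<bar>num_edges ?F \<omega> - p * card ?F\<bar> > \<gamma> * m}"
      unfolding jumbled_event_def cF m_def by (simp add: mult.assoc)
    then have "?P (jumbled_event N p b \<gamma> A B) \<le> 2 * exp (- \<gamma>\<^sup>2 * m / 4)"
      using prob_deviation[OF _ p(2) F \<gamma> m] p by simp
    also have "exp (- \<gamma>\<^sup>2 * m / 4) \<le> exp (- (3 * ln (real N + 1)) * (card A + card B))"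
    proof -
      have "b * card A \<le> max (real (card A)) b * max (real (card B)) b" "b * card B \<le> max (real (card A)) b * max (real (card B)) b"
        using b0 by (subst mult.commute, intro mult_mono, auto intro: mult_mono)
      then have "b * (card A + card B) \<le> 2 * (max (real (card A)) b * max (real (card B)) b)" by (simp add: distrib_left)
      then have "p * (b * (card A + card B)) \<le> p * (2 * (max (real (card A)) b * max (real (card B)) b))"
        using p by (intro mult_left_mono) auto
      then have "p * b * (card A + card B) \<le> 2 * m" by (simp add: m_def mult_ac)
      moreover have "p * b = 24 / \<gamma>\<^sup>2 * ln (real N + 1)" using p by (simp add: b)
      ultimately have "24 / \<gamma>\<^sup>2 * ln (real N + 1) * (card A + card B) \<le> 2 * m" by simp
      then have mm: "\<gamma>\<^sup>2 / 8 * (24 / \<gamma>\<^sup>2 * ln (real N + 1) * (card A + card B)) \<le> \<gamma>\<^sup>2 / 8 * (2 * m)"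
        by (intro mult_left_mono) auto
      have "\<gamma>\<^sup>2 / 8 * (24 / \<gamma>\<^sup>2 * ln (real N + 1) * (card A + card B)) = 3 * ln (real N + 1) * (card A + card B)"
        using \<gamma> by simp
      then have "3 * ln (real N + 1) * (card A + card B) \<le> \<gamma>\<^sup>2 / 8 * (2 * m)" using mm by (simp only:)
      then have "3 * ln (real N + 1) * (card A + card B) \<le> \<gamma>\<^sup>2 * m / 4" by (simp add: mult.commute)
      then show ?thesis by simp
    qed
    also have "exp (- (3 * ln (real N + 1)) * (card A + card B)) = q ^ card A * q ^ card B"
    proof -
      have "q = exp (- (3 * ln (real N + 1)))"
      proof -
        have "exp (3 * ln (real N + 1)) = exp (ln (real N + 1)) ^ 3" using exp_of_nat_mult[of 3 "ln (real N + 1)"] by simp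
        then show ?thesis by (simp add: q_def exp_minus inverse_eq_divide)
      qed
      then have "q ^ k = exp (k * - (3 * ln (real N + 1)))" for k :: nat by (simp only: exp_of_nat_mult)
      then show ?thesis by (simp only: exp_add[symmetric] of_nat_add distrib_right distrib_left mult.commute)
    qed
    finally show ?thesis by simp
  qed
  have "?P (\<Union>(A, B)\<in>?I. jumbled_event N p b \<gamma> A B) \<le> (\<Sum>(A, B)\<in>?I. ?P (jumbled_event N p b \<gamma> A B))"
    using measure_pmf.finite_measure_subadditive_finite[OF fin, of "\<lambda>(A, B). jumbled_event N p b \<gamma> A B" "edge_pmf N p"]
    by (simp add: split_def)
  also have "\<dots> \<le> (\<Sum>(A, B)\<in>?I. 2 * (q ^ card A * q ^ card B))"
    using trm by (intro sum_mono) auto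
  also have "\<dots> \<le> (\<Sum>(A, B)\<in>(Pow {..<N} - {{}}) \<times> (Pow {..<N} - {{}}). 2 * (q ^ card A * q ^ card B))"
    using q0 by (intro sum_mono2) auto
  also have "\<dots> = 2 * ((\<Sum>A\<in>Pow {..<N} - {{}}. q ^ card A) * (\<Sum>B\<in>Pow {..<N} - {{}}. q ^ card B))"
    unfolding sum_product sum.cartesian_product by (simp only: sum_distrib_left split_def)
  also have "\<dots> \<le> 2 * (2 * (real N * q) * (2 * (real N * q)))"
    using sum_nonempty_subsets_le[OF q0 Nq1] q0
    by (intro mult_left_mono mult_mono) (auto intro!: sum_nonneg)
  also have "\<dots> \<le> 8 * (1 * (1 / (real N + 1)))"
  proof -
    have "(real N * q) * (real N * q) \<le> 1 * (1 / (real N + 1))" using Nq Nq1 q0 by (intro mult_mono) auto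
    then show ?thesis by simp
  qed
  finally show ?thesis by simp
qed

text \<open>Asking for a two-element set \<open>{t, y}\<close> excludes \<open>y\<close> from
  \<open>T\<close>, so that the edges from \<open>T\<close> to the common neighbours are distinct
  and hence independent.\<close>

definition codegree_event :: "nat \<Rightarrow> real \<Rightarrow> nat set \<Rightarrow> (nat set \<Rightarrow> bool) set" where
  "codegree_event N p T = {\<omega>. real (card {y\<in>{..<N}. \<forall>t\<in>T. {t, y} \<in> nsets {..<N} 2 \<and> \<omega> {t, y}}) > 8 * p ^ card T * real N}"

text \<open>By \<open>(1 + 1 / m) ^ m \<le> exp 1\<close>; it stands in for Stirling's
  formula.\<close>

lemma power_div_fact_le_exp: "real m ^ m \<le> fact m * exp (real m)"
proof (induction m)
  case 0
  then show ?case by simp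
next
  case (Suc m)
  show ?case
  proof (cases "m = 0")
    case True
    then show ?thesis using exp_ge_add_one_self[of 1] by simp
  next
    case False
    have "real (Suc m) ^ m \<le> real m ^ m * exp 1"
    proof -
      have "real (Suc m) = real m * (1 + 1 / real m)" using False by (simp add: field_simps)
      then have "real (Suc m) ^ m = real m ^ m * (1 + 1 / real m) ^ m" by (simp only: power_mult_distrib)
      also have "\<dots> \<le> real m ^ m * exp (1 / real m) ^ m"
        by (intro mult_left_mono power_mono exp_ge_add_one_self) auto
      also have "exp (1 / real m) ^ m = exp 1" using False by (simp flip: exp_of_nat_mult)
      finally show ?thesis .
    qed
    then have "real (Suc m) * real (Suc m) ^ m \<le> real (Suc m) * (real m ^ m * exp 1)" by (intro mult_left_mono) auto
    also have "\<dots> \<le> real (Suc m) * (fact m * exp (real m) * exp 1)"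
      using Suc.IH by (intro mult_left_mono mult_right_mono) auto
    also have "\<dots> = fact (Suc m) * exp (real (Suc m))" by (simp add: exp_add mult_ac)
    finally show ?thesis by simp
  qed
qed

text \<open>Union bound over the \<open>m\<close>-sets of common neighbours. Their expected number
  is at most \<open>(N * p ^ k) ^ m / fact m\<close>, hence at most \<open>(exp 1 / 8) ^ m\<close>;
  the constant 8 is large enough for \<open>exp 1 / 8 \<le> exp (- 1 / 2)\<close>.\<close>

lemma prob_codegree_event:
  fixes p :: real
  assumes p: "0 < p" "p \<le> 1" and T: "T \<subseteq> {..<N}" and N: "0 < N"
  shows "measure_pmf.prob (edge_pmf N p) (codegree_event N p T) \<le> exp (- 4 * p ^ card T * N)"
proof -
  let ?P = "measure_pmf.prob (edge_pmf N p)"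
  define k where "k = card T"
  define m where "m = nat \<lceil>8 * p ^ k * N\<rceil>"
  have m: "8 * p ^ k * N \<le> real m" unfolding m_def by (rule real_nat_ceiling_ge)
  have pk: "0 < p ^ k" using p by simp
  have "0 < 8 * p ^ k * N" using pk N by simp
  then have m0: "0 < real m" using m by linarith
  have finT: "finite T" using T finite_subset by blast
  let ?Fam = "{S. S \<subseteq> {..<N} - T \<and> card S = m}"
  have finFam: "finite ?Fam" by (rule finite_subset[of _ "Pow {..<N}"]) auto
  let ?F = "\<lambda>S. (\<lambda>(t, y). {t, y}) ` (T \<times> S)"
  have sub: "codegree_event N p T \<subseteq> (\<Union>S\<in>?Fam. {\<omega>. \<forall>e\<in>?F S. \<omega> e})"
  proof
    fix \<omega> assume \<omega>: "\<omega> \<in> codegree_event N p T"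
    let ?Y = "{y\<in>{..<N}. \<forall>t\<in>T. {t, y} \<in> nsets {..<N} 2 \<and> \<omega> {t, y}}"
    have gt: "8 * p ^ k * N < real (card ?Y)" using \<omega> by (simp add: codegree_event_def k_def)
    have Y: "?Y \<subseteq> {..<N} - T" by auto
    have mY: "m \<le> card ?Y" using gt by (simp add: m_def nat_le_iff ceiling_le_iff)
    obtain S where S: "S \<subseteq> ?Y" "card S = m" using obtain_subset_with_card_n[OF mY] by blast
    then have "S \<in> ?Fam" using Y by blast
    moreover have "\<forall>e\<in>?F S. \<omega> e" using S(1) by auto
    ultimately show "\<omega> \<in> (\<Union>S\<in>?Fam. {\<omega>. \<forall>e\<in>?F S. \<omega> e})" by blast
  qed
  have PS: "?P {\<omega>. \<forall>e\<in>?F S. \<omega> e} = (p ^ k) ^ m" if S: "S \<in> ?Fam" for S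
  proof -
    have disj: "T \<inter> S = {}" using S by auto
    have "?F S \<subseteq> nsets {..<N} 2" using S T by auto
    moreover have "card (?F S) = k * m"
      using card_image[OF inj_on_doubleton[OF disj]] S by (simp add: card_cartesian_product k_def)
    ultimately show ?thesis using prob_all_edges[of p "?F S" N] p by (simp add: power_mult)
  qed
  have "?P (codegree_event N p T) \<le> ?P (\<Union>S\<in>?Fam. {\<omega>. \<forall>e\<in>?F S. \<omega> e})"
    using sub by (intro measure_pmf.finite_measure_mono) auto
  also have "\<dots> \<le> (\<Sum>S\<in>?Fam. ?P {\<omega>. \<forall>e\<in>?F S. \<omega> e})"
    by (intro measure_pmf.finite_measure_subadditive_finite finFam) auto
  also have "\<dots> = (\<Sum>S\<in>?Fam. (p ^ k) ^ m)" using PS by (intro sum.cong refl) auto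
  also have "\<dots> = card ?Fam * (p ^ k) ^ m" by simp
  also have "\<dots> \<le> (real N ^ m / fact m) * (p ^ k) ^ m"
  proof (intro mult_right_mono)
    have "card ?Fam = card ({..<N} - T) choose m" by (rule n_subsets) simp
    also have "\<dots> \<le> N choose m"
    proof -
      have "card ({..<N} - T) \<le> N" using card_mono[of "{..<N}" "{..<N} - T"] by simp
      then show ?thesis by (rule binomial_right_mono)
    qed
    finally have "real (card ?Fam) * fact m \<le> real (N choose m) * fact m" by (intro mult_right_mono of_nat_mono) auto
    also have "real (N choose m) * fact m = real ((N choose m) * fact m)" by simp
    also have "\<dots> \<le> real (N ^ m)" using binomial_fact_pow[of N m] by (rule of_nat_mono)
    finally show "real (card ?Fam) \<le> real N ^ m / fact m" by (simp add: le_divide_eq)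
  qed (use p in auto)
  also have "\<dots> = (real N * p ^ k) ^ m / fact m" by (simp add: power_mult_distrib)
  also have "\<dots> \<le> (real m / 8) ^ m / fact m"
    using m p by (intro divide_right_mono power_mono) (auto simp: mult_ac)
  also have "\<dots> = (real m ^ m / fact m) / 8 ^ m" by (simp add: power_divide)
  also have "\<dots> \<le> exp (real m) / 8 ^ m"
    using power_div_fact_le_exp[of m] by (intro divide_right_mono) (auto simp: divide_le_eq mult.commute)
  also have "\<dots> = (exp 1 / 8) ^ m" by (simp add: power_divide flip: exp_of_nat_mult)
  also have "\<dots> \<le> exp (- (1 / 2)) ^ m"
  proof (intro power_mono)
    have "exp (1 / 2 :: real) \<le> 2" by (rule exp_half_le2)
    then have "1 / 2 \<le> exp (- (1 / 2) :: real)" by (simp add: exp_minus field_simps)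
    moreover have "exp (1::real) \<le> 3" by (rule exp_le)
    ultimately show "exp 1 / 8 \<le> exp (- (1 / 2) :: real)" by linarith
  qed simp
  also have "\<dots> = exp (- (real m / 2))" by (simp flip: exp_of_nat_mult)
  also have "\<dots> \<le> exp (- 4 * p ^ k * N)" using m by simp
  finally show ?thesis by (simp add: k_def)
qed

text \<open>There are at most \<open>(N + 1) ^ (2 * d)\<close> sets, so each may fail with
  probability \<open>1 / (N + 1) ^ (2 * d + 1)\<close>. For the largest of them this requires
  \<open>p ^ (2 * d) * N\<close> to be of the order of \<open>ln N\<close>, in accordance with the
  threshold.\<close>

lemma prob_some_codegree_event:
  fixes p :: real
  assumes p: "0 < p" "p \<le> 1" and N: "0 < N" and big: "real (d + 1) * ln (real N + 1) \<le> p ^ (2 * d) * N"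
  shows "measure_pmf.prob (edge_pmf N p) (\<Union>T\<in>{T. T \<subseteq> {..<N} \<and> card T \<le> 2 * d}. codegree_event N p T) \<le> 1 / (real N + 1)"
proof -
  let ?Fam = "{T. T \<subseteq> {..<N} \<and> card T \<le> 2 * d}"
  let ?P = "measure_pmf.prob (edge_pmf N p)"
  let ?n = "real N + 1"
  have fin: "finite ?Fam" by (rule finite_subset[of _ "Pow {..<N}"]) auto
  have each: "?P (codegree_event N p T) \<le> 1 / ?n ^ (2 * d + 1)" if T: "T \<in> ?Fam" for T
  proof -
    have "p ^ (2 * d) \<le> p ^ card T" using T p by (intro power_decreasing) auto
    then have "p ^ (2 * d) * N \<le> p ^ card T * N" by (intro mult_right_mono) auto
    then have "real (d + 1) * ln ?n \<le> p ^ card T * N" using big by linarith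
    moreover have "0 \<le> ln ?n" by simp
    moreover have "real (2 * d + 1) * ln ?n \<le> 4 * (real (d + 1) * ln ?n)"
      unfolding mult.assoc[symmetric] using \<open>0 \<le> ln ?n\<close> by (intro mult_right_mono) auto
    ultimately have "real (2 * d + 1) * ln ?n \<le> 4 * (p ^ card T * N)" by linarith
    then have "exp (- 4 * p ^ card T * N) \<le> exp (- (real (2 * d + 1) * ln ?n))" by simp
    also have "\<dots> = 1 / exp (real (2 * d + 1) * ln ?n)" by (simp add: exp_minus inverse_eq_divide)
    also have "exp (real (2 * d + 1) * ln ?n) = ?n ^ (2 * d + 1)"
      by (subst exp_of_nat_mult) (simp only: exp_ln[OF add_nonneg_pos[OF of_nat_0_le_iff zero_less_one]])
    finally have "exp (- 4 * p ^ card T * N) \<le> 1 / ?n ^ (2 * d + 1)" .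
    moreover have "T \<subseteq> {..<N}" using T by simp
    ultimately show ?thesis using order_trans[OF prob_codegree_event[OF p _ N]] by blast
  qed
  have "?P (\<Union>T\<in>?Fam. codegree_event N p T) \<le> (\<Sum>T\<in>?Fam. ?P (codegree_event N p T))"
    by (intro measure_pmf.finite_measure_subadditive_finite fin) auto
  also have "\<dots> \<le> (\<Sum>T\<in>?Fam. 1 / ?n ^ (2 * d + 1))" using each by (rule sum_mono)
  also have "\<dots> = card ?Fam * (1 / ?n ^ (2 * d + 1))" by simp
  also have "\<dots> \<le> ?n ^ (2 * d) * (1 / ?n ^ (2 * d + 1))"
    using card_small_subsets_le[of N "2 * d"] by (intro mult_right_mono) auto
  also have "\<dots> = 1 / ?n" by (simp add: power_add)
  finally show ?thesis .
qed

lemma prob_jumbled_graph: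
  fixes p \<gamma> b :: real
  assumes p: "0 < p" "p \<le> 1" and N: "0 < N" and \<gamma>: "0 < \<gamma>" "\<gamma> \<le> 1"
    and b: "b = 24 / \<gamma>\<^sup>2 * ln (real N + 1) / p" "1 \<le> b" and big: "real (d + 1) * ln (real N + 1) \<le> p ^ (2 * d) * N"
  shows "measure_pmf.prob (edge_pmf N p) {\<omega>. jumbled_graph (\<lambda>x y. {x, y} \<in> {e \<in> nsets {..<N} 2. \<omega> e}) N d p b \<gamma>} \<ge> 1 - 9 / (real N + 1)"
proof -
  let ?P = "measure_pmf.prob (edge_pmf N p)"
  let ?I = "{(A, B). A \<subseteq> {..<N} \<and> B \<subseteq> {..<N} \<and> A \<inter> B = {} \<and> A \<noteq> {} \<and> B \<noteq> {}}"
  let ?Fam = "{T. T \<subseteq> {..<N} \<and> card T \<le> 2 * d}"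
  let ?good = "{\<omega>. jumbled_graph (\<lambda>x y. {x, y} \<in> {e \<in> nsets {..<N} 2. \<omega> e}) N d p b \<gamma>}"
  let ?X = "\<Union>(A, B)\<in>?I. jumbled_event N p b \<gamma> A B"
  let ?Y = "\<Union>T\<in>?Fam. codegree_event N p T"
  have "- ?good \<subseteq> ?X \<union> ?Y"
  proof
    fix \<omega> assume ng: "\<omega> \<in> - ?good"
    show "\<omega> \<in> ?X \<union> ?Y"
    proof (rule ccontr)
      assume notin: "\<omega> \<notin> ?X \<union> ?Y"
      define E where "E x y \<longleftrightarrow> {x, y} \<in> {e \<in> nsets {..<N} 2. \<omega> e}" for x y
      have "jumbled_graph E N d p b \<gamma>"
      proof
        show "E x y \<Longrightarrow> E y x" for x y by (simp add: E_def insert_commute)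
        show "0 < p" "p \<le> 1" "0 \<le> \<gamma>" "\<gamma> \<le> 1" "1 \<le> b" using p \<gamma> b by auto
        show "\<bar>edge_count E A B - p * card A * card B\<bar> \<le> \<gamma> * p * max (real (card A)) b * max (real (card B)) b"
          if AB: "A \<subseteq> {..<N}" "B \<subseteq> {..<N}" "A \<inter> B = {}" for A B
        \<comment> \<open>Empty sets were left out of the union bound and satisfy the inequality
          trivially.\<close>
        proof (cases "A = {} \<or> B = {}")
          case True
          have "0 \<le> \<gamma> * p * max (real (card A)) b * max (real (card B)) b"
            using \<gamma> p b(2) by (intro mult_nonneg_nonneg) (auto simp: le_max_iff_disj)
          then show ?thesis using True by (auto simp: edge_count_def)
        next
          case False
          have eq: "edge_count E A B = num_edges ((\<lambda>(x, y). {x, y}) ` (A \<times> B)) \<omega>"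
          proof -
            have "num_edges ((\<lambda>(x, y). {x, y}) ` (A \<times> B)) \<omega> = (\<Sum>(x, y)\<in>A \<times> B. of_bool (\<omega> {x, y}))"
              unfolding num_edges_def by (subst sum.reindex[OF inj_on_doubleton[OF AB(3)]]) (simp add: split_def o_def)
            also have "\<dots> = (\<Sum>(x, y)\<in>A \<times> B. of_bool (E x y))"
              using AB by (intro sum.cong refl) (auto simp: E_def disjoint_iff)
            finally show ?thesis by (simp add: edge_count_def sum.cartesian_product del: sum_of_bool_eq)
          qed
          have "(A, B) \<in> ?I" using AB False by auto
          then have "\<omega> \<notin> jumbled_event N p b \<gamma> A B" using notin by blast
          then show ?thesis unfolding eq jumbled_event_def by (simp add: not_less)
        qed
        show "real (card {y\<in>{..<N}. \<forall>t\<in>T. E t y}) \<le> 8 * p ^ card T * N" if "T \<subseteq> {..<N}" "card T \<le> 2 * d" for T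
        proof -
          have "\<omega> \<notin> codegree_event N p T" using notin that by blast
          then show ?thesis unfolding codegree_event_def E_def by (simp add: not_less)
        qed
      qed
      moreover have "E = (\<lambda>x y. {x, y} \<in> {e \<in> nsets {..<N} 2. \<omega> e})" by (intro ext) (simp only: E_def)
      ultimately show False using ng by (simp only: Compl_iff mem_Collect_eq not_True_eq_False)
    qed
  qed
  then have "?P (- ?good) \<le> ?P (?X \<union> ?Y)" by (intro measure_pmf.finite_measure_mono) auto
  also have "\<dots> \<le> ?P ?X + ?P ?Y" by (rule measure_Un_le) auto
  also have "\<dots> \<le> 8 / (real N + 1) + 1 / (real N + 1)"
    by (intro add_mono prob_not_jumbled[OF p \<gamma> N b(1)] prob_some_codegree_event[OF p N big])
  also have "\<dots> = 9 / (real N + 1)" by (simp add: add_divide_distrib[symmetric])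
  finally have "?P (- ?good) \<le> 9 / (real N + 1)" .
  moreover have "?P (- ?good) = 1 - ?P ?good"
    using measure_pmf.prob_compl[of ?good "edge_pmf N p"] by (simp add: Compl_eq_Diff_UNIV)
  ultimately show ?thesis by linarith
qed

text \<open>Of the factor \<open>c ^ (2 * d)\<close> that arises from raising the threshold to the
  power \<open>2 * d\<close> only \<open>c\<close> is kept, which is enough because the constant may
  be chosen large.\<close>

lemma power_ge_of_threshold:
  fixes p c :: real
  assumes d: "1 \<le> d" and n: "2 \<le> n" and c: "1 \<le> c"
    and p: "c * (log 2 (real n) / real n) powr (1 / (2 * real d)) \<le> p"
  shows "c * log 2 (real n) \<le> p ^ (2 * d) * real n" and "0 < p"
proof -
  define x where "x = log 2 (real n) / real n"
  define y where "y = x powr (1 / (2 * real d))"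
  have n0: "0 < real n" using n by simp
  have x: "0 < x" using n by (simp add: x_def)
  have y: "0 < y" using x by (simp add: y_def)
  have "y ^ (2 * d) = y powr real (2 * d)" using y by (simp only: powr_realpow)
  also have "\<dots> = x powr (1 / (2 * real d) * real (2 * d))" unfolding y_def by (rule powr_powr)
  also have "\<dots> = x" using d x by simp
  finally have yx: "y ^ (2 * d) = x" .
  have cy: "c * y \<le> p" using p by (simp add: y_def x_def)
  moreover have "0 < c * y" using c y by simp
  ultimately show "0 < p" by linarith
  have "c ^ 1 \<le> c ^ (2 * d)" using c d by (intro power_increasing) auto
  then have "c * x \<le> c ^ (2 * d) * x" using x by (intro mult_right_mono) auto
  also have "\<dots> = (c * y) ^ (2 * d)" by (simp only: power_mult_distrib yx)
  also have "\<dots> \<le> p ^ (2 * d)" using cy \<open>0 < c * y\<close> by (intro power_mono) auto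
  finally have "c * x * real n \<le> p ^ (2 * d) * real n" by (intro mult_right_mono) auto
  moreover have "c * x * real n = c * log 2 (real n)" using n0 by (simp add: x_def)
  ultimately show "c * log 2 (real n) \<le> p ^ (2 * d) * real n" by simp
qed

text \<open>What remains is to check that the value of \<open>b\<close> forced by the union bound
  meets the conditions of \<open>universal\<close>. Its division by \<open>p\<close> is the reason
  why the requirement with \<open>p ^ (2 * d - 1)\<close> becomes one with
  \<open>p ^ (2 * d)\<close>.\<close>

lemma prob_partition_universal:
  fixes p \<gamma> \<omega> \<rho> :: real
  assumes universal: "\<And>b Ed. jumbled_graph (\<lambda>x y. {x, y} \<in> Ed) N d p b \<gamma> \<Longrightarrow> Ed \<subseteq> nsets {..<N} 2 \<Longrightarrow>
      b \<le> \<omega> * p ^ (2 * d - 1) * real N \<Longrightarrow> real d * ln (real N + 1) + real d * real \<Delta> \<le> \<rho> * p ^ d * real N \<Longrightarrow>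
      real n \<le> \<rho> * real N \<Longrightarrow> partition_universal r (UGraph {..<N} Ed) (degenerate_class n d \<Delta>)"
    and d: "1 \<le> d" and N: "2 \<le> N" and p: "0 < p" "p \<le> 1" and \<gamma>: "0 < \<gamma>" "\<gamma> \<le> 1" and "0 < \<omega>" "0 < \<rho>"
    and big: "24 / \<gamma>\<^sup>2 * ln (real N + 1) \<le> \<omega> * (p ^ (2 * d) * real N)"
      "(real d + real d * real \<Delta>) * ln (real N + 1) \<le> \<rho> * (p ^ (2 * d) * real N)"
      "real (d + 1) * ln (real N + 1) \<le> p ^ (2 * d) * real N"
    and n: "real n \<le> \<rho> * real N"
  shows "1 - 9 / (real N + 1) \<le> measure_pmf.prob (random_graph N p) {G. partition_universal r G (degenerate_class n d \<Delta>)}"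
proof -
  define b where "b = 24 / \<gamma>\<^sup>2 * ln (real N + 1) / p"
  have ln1: "1 \<le> ln (real N + 1)"
  proof -
    have "exp 1 \<le> real N + 1" using exp_le N by simp
    then show ?thesis by (simp add: ln_ge_iff)
  qed
  have b1: "1 \<le> b"
  proof -
    have "\<gamma>\<^sup>2 \<le> 1" using \<gamma> by (simp add: power_le_one)
    then have "24 * 1 \<le> 24 / \<gamma>\<^sup>2 * ln (real N + 1)" using \<gamma> ln1 by (intro mult_mono) (auto simp: le_divide_eq)
    then have "1 * p \<le> 24 / \<gamma>\<^sup>2 * ln (real N + 1)" using p(2) by linarith
    then show ?thesis unfolding b_def using p(1) by (subst pos_le_divide_eq)
  qed
  have bN: "b \<le> \<omega> * p ^ (2 * d - 1) * real N"
  proof -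
    have "p ^ (2 * d) = p * p ^ (2 * d - 1)" using d by (metis power_eq_if mult_eq_0_iff not_one_le_zero zero_neq_numeral)
    then have "24 / \<gamma>\<^sup>2 * ln (real N + 1) \<le> (\<omega> * p ^ (2 * d - 1) * real N) * p" using big(1) by (simp add: mult_ac)
    then show ?thesis unfolding b_def using p(1) by (subst pos_divide_le_eq)
  qed
  have dN: "real d * ln (real N + 1) + real d * real \<Delta> \<le> \<rho> * p ^ d * real N"
  proof -
    have "real d * real \<Delta> * 1 \<le> real d * real \<Delta> * ln (real N + 1)" using ln1 by (intro mult_left_mono) auto
    then have "real d * ln (real N + 1) + real d * real \<Delta> \<le> \<rho> * (p ^ (2 * d) * real N)"
      using big(2) by (simp only: distrib_right mult_1_right)
    also have "\<dots> \<le> \<rho> * (p ^ d * real N)"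
      using p \<open>0 < \<rho>\<close> by (intro mult_left_mono mult_right_mono power_decreasing) auto
    finally show ?thesis by (simp add: mult.assoc)
  qed
  let ?G = "\<lambda>\<omega>. {e \<in> nsets {..<N} 2. \<omega> e}"
  have "1 - 9 / (real N + 1) \<le> measure_pmf.prob (edge_pmf N p) {\<omega>. jumbled_graph (\<lambda>x y. {x, y} \<in> ?G \<omega>) N d p b \<gamma>}"
    using N by (intro prob_jumbled_graph p \<gamma> b_def b1 big(3)) auto
  also have "\<dots> \<le> measure_pmf.prob (edge_pmf N p) {\<omega>. partition_universal r (UGraph {..<N} (?G \<omega>)) (degenerate_class n d \<Delta>)}"
  proof (intro measure_pmf.finite_measure_mono subsetI)
    fix \<xi> assume "\<xi> \<in> {\<omega>. jumbled_graph (\<lambda>x y. {x, y} \<in> ?G \<omega>) N d p b \<gamma>}"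
    then have "jumbled_graph (\<lambda>x y. {x, y} \<in> ?G \<xi>) N d p b \<gamma>" by (rule CollectD)
    then have "partition_universal r (UGraph {..<N} (?G \<xi>)) (degenerate_class n d \<Delta>)"
      by (rule universal[OF _ _ bN dN n]) (rule Collect_restrict)
    then show "\<xi> \<in> {\<omega>. partition_universal r (UGraph {..<N} (?G \<omega>)) (degenerate_class n d \<Delta>)}" by (simp only: mem_Collect_eq)
  qed simp
  also have "\<dots> = measure_pmf.prob (random_graph N p) {G. partition_universal r G (degenerate_class n d \<Delta>)}"
    unfolding random_graph_def edge_pmf_def measure_map_pmf by (simp only: vimage_def mem_Collect_eq)
  finally show ?thesis .
qed

theorem theorem1p3:
  fixes r d \<Delta> :: nat
  assumes "r \<ge> 1" and "d \<ge> 1" and "\<Delta> \<ge> 1"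
  shows "\<exists>C::nat. \<forall>p :: nat \<Rightarrow> real.
    (\<forall>n. 0 \<le> p n \<and> p n \<le> 1) \<longrightarrow>
    (\<forall>\<^sub>F n in sequentially. p n \<ge> real C * (log 2 (real n) / real n) powr (1 / (2 * real d))) \<longrightarrow>
    (\<lambda>n. measure_pmf.prob (random_graph (C * n) (p n))
            {G. partition_universal r G (degenerate_class n d \<Delta>)}) \<longlonglongrightarrow> 1"
proof -
  obtain \<gamma> \<omega> \<rho> :: real where pos: "0 < \<gamma>" "\<gamma> \<le> 1" "0 < \<omega>" "0 < \<rho>"
    and universal: "\<forall>N p b n Ed. jumbled_graph (\<lambda>x y. {x, y} \<in> Ed) N d p b \<gamma> \<longrightarrow> Ed \<subseteq> nsets {..<N} 2 \<longrightarrow>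
      b \<le> \<omega> * p ^ (2 * d - 1) * real N \<longrightarrow> real d * ln (real N + 1) + real d * real \<Delta> \<le> \<rho> * p ^ d * real N \<longrightarrow>
      real n \<le> \<rho> * real N \<longrightarrow> partition_universal r (UGraph {..<N} Ed) (degenerate_class n d \<Delta> :: nat ugraph set)"
    using jumbled_graph_partition_universal[OF assms] by (elim exE conjE) (rule that)
  define K where "K = real d + real d * real \<Delta>"
  \<comment> \<open>Each entry is the multiple of \<open>ln (N + 1)\<close> that
    \<open>p ^ (2 * d) * N\<close> has to exceed in one of the three conditions of
    \<open>prob_partition_universal\<close>.\<close>
  define Q where "Q = Max {24 / \<gamma>\<^sup>2 / \<omega>, K / \<rho>, real (d + 1)}"
  have Q: "24 / \<gamma>\<^sup>2 / \<omega> \<le> Q" "K / \<rho> \<le> Q" "real (d + 1) \<le> Q" by (simp_all add: Q_def)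
  \<comment> \<open>\<open>C\<close> is both the ratio of \<open>N\<close> to \<open>n\<close> and
    the constant of the threshold. The former needs \<open>1 / \<rho>\<close>, the latter
    \<open>2 * Q\<close>, where 2 allows for \<open>ln (N + 1) \<le> 2 * ln n\<close>.\<close>
  obtain C :: nat where C: "Max {1, 2 * Q, 1 / \<rho>} \<le> real C" using real_arch_simple by blast
  then have C1: "1 \<le> real C" and CQ: "2 * Q \<le> real C" and C\<rho>: "1 / \<rho> \<le> real C" by simp_all
  show ?thesis
  proof (intro exI[of _ C] allI impI)
    fix p :: "nat \<Rightarrow> real"
    assume p01: "\<forall>n. 0 \<le> p n \<and> p n \<le> 1"
      and ev: "\<forall>\<^sub>F n in sequentially. p n \<ge> real C * (log 2 (real n) / real n) powr (1 / (2 * real d))"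
    let ?prob = "\<lambda>n. measure_pmf.prob (random_graph (C * n) (p n)) {G. partition_universal r G (degenerate_class n d \<Delta>)}"
    have lower: "\<forall>\<^sub>F n in sequentially. 1 - 9 / real n \<le> ?prob n"
      using ev eventually_ge_at_top[of "C + 2"]
    proof eventually_elim
      case (elim n)
      define N where "N = C * n"
      have C': "1 \<le> C" using C1 by simp
      have n2: "2 \<le> n" using elim(2) by simp
      have nN: "n \<le> N" using C' by (simp add: N_def)
      have p0: "0 < p n" and pn: "real C * log 2 (real n) \<le> p n ^ (2 * d) * real n"
        using power_ge_of_threshold[OF assms(2) n2 C1 elim(1)] by auto
      define M where "M = p n ^ (2 * d) * real N"
      have "p n ^ (2 * d) * real n \<le> M"
        unfolding M_def using nN p0 by (intro mult_left_mono) auto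
      then have logM: "real C * log 2 (real n) \<le> M" using pn by linarith
      have lnn: "0 \<le> ln (real n)" using n2 by simp
      have "ln (real n) \<le> log 2 (real n)"
        using lnn ln_2_less_1 by (simp add: log_def le_divide_eq mult_left_le)
      then have "real C * ln (real n) \<le> real C * log 2 (real n)" by (intro mult_left_mono) auto
      moreover have "2 * Q * ln (real n) \<le> real C * ln (real n)" using CQ lnn by (rule mult_right_mono)
      ultimately have QM: "Q * (2 * ln (real n)) \<le> M" using logM by (simp add: mult_ac)
      \<comment> \<open>This is the reason for starting at \<open>n \<ge> C + 2\<close>: then
        \<open>(C + 1) * n \<le> n * n\<close>.\<close>
      have lnN: "ln (real N + 1) \<le> 2 * ln (real n)"
      proof -
        have "N + n \<le> n * n" using mult_le_mono1[of "C + 1" n n] elim(2) by (simp add: N_def)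
        then have "N + 1 \<le> n * n" using n2 by linarith
        then have "real N + 1 \<le> real n * real n" by (simp flip: of_nat_mult of_nat_Suc)
        then have "ln (real N + 1) \<le> ln (real n * real n)" by (intro ln_mono) auto
        also have "\<dots> = 2 * ln (real n)" using n2 by (simp add: ln_mult)
        finally show ?thesis .
      qed
      have ln0: "0 \<le> ln (real N + 1)" by simp
      have Q0: "0 \<le> Q" using Q(3) by linarith
      have "Q * ln (real N + 1) \<le> Q * (2 * ln (real n))" using lnN Q0 by (rule mult_left_mono)
      then have QNM: "Q * ln (real N + 1) \<le> M" using QM by linarith
      have le: "x * ln (real N + 1) \<le> y * M" if "x / y \<le> Q" "0 < y" for x y
      proof -
        have "x / y * ln (real N + 1) \<le> M" using mult_right_mono[OF that(1) ln0] QNM by linarith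
        then have "y * (x / y * ln (real N + 1)) \<le> y * M" using that(2) by (intro mult_left_mono) auto
        then show ?thesis using that(2) by simp
      qed
      have \<rho>N: "real n \<le> \<rho> * real N"
      proof -
        have "1 \<le> \<rho> * real C" using C\<rho> pos(4) by (simp add: divide_le_eq mult.commute)
        then have "1 * real n \<le> \<rho> * real C * real n" by (rule mult_right_mono) simp
        then show ?thesis by (simp add: N_def mult.assoc)
      qed
      have "1 - 9 / real n \<le> 1 - 9 / (real N + 1)"
        using n2 nN by (intro diff_left_mono divide_left_mono) auto
      also have "\<dots> \<le> measure_pmf.prob (random_graph N (p n)) {G. partition_universal r G (degenerate_class n d \<Delta>)}"
      proof (rule prob_partition_universal[where \<omega> = \<omega> and \<rho> = \<rho> and \<gamma> = \<gamma>])
        show "partition_universal r (UGraph {..<N} Ed) (degenerate_class n d \<Delta>)"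
          if "jumbled_graph (\<lambda>x y. {x, y} \<in> Ed) N d (p n) b \<gamma>" "Ed \<subseteq> nsets {..<N} 2"
            "b \<le> \<omega> * p n ^ (2 * d - 1) * real N" "real d * ln (real N + 1) + real d * real \<Delta> \<le> \<rho> * p n ^ d * real N"
            "real n \<le> \<rho> * real N" for b Ed
          by (rule universal[rule_format, OF that])
        show "24 / \<gamma>\<^sup>2 * ln (real N + 1) \<le> \<omega> * (p n ^ (2 * d) * real N)"
          using le[OF Q(1) pos(3)] by (simp only: M_def)
        show "(real d + real d * real \<Delta>) * ln (real N + 1) \<le> \<rho> * (p n ^ (2 * d) * real N)"
          using le[OF Q(2) pos(4)] by (simp only: M_def K_def)
        show "real (d + 1) * ln (real N + 1) \<le> p n ^ (2 * d) * real N"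
          using le[of "real (d + 1)" 1] Q(3) by (simp add: M_def)
      qed (use assms p01 p0 pos n2 nN \<rho>N in auto)
      finally show ?case by (simp only: N_def)
    qed
    have upper: "\<forall>\<^sub>F n in sequentially. ?prob n \<le> 1"
      by (rule always_eventually) (rule allI, rule measure_pmf.prob_le_1)
    have "(\<lambda>n. 1 - 9 / real n) \<longlonglongrightarrow> 1"
      using tendsto_diff[OF tendsto_const[of 1] lim_const_over_n[of 9]] by simp
    then show "?prob \<longlonglongrightarrow> 1" by (rule tendsto_sandwich[OF lower upper _ tendsto_const])
  qed
qed

end
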